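(* For each $n$ let $r=r(n)$ be an integer with $1\le r\le n$, let $X_1,\ldots,X_{r+1}$ be i.i.d. points in $\mathbb{R}^n$ chosen according to the Gaussian model, the Beta model (with fixed parameter $\nu>0$) or the spherical model, and let $\mathcal V_{n,r}$ be the $r$-dimensional volume of the simplex with vertices $X_1,\ldots,X_{r+1}$. Let $Z$ be a standard Gaussian random variable. (1) If $r=o(n)$, then there are normalizing sequences $a_{n,r}\in\mathbb{R}$ and $b_{n,r}>0$ such that, as $n\to\infty$, $$\frac{\mathcal V_{n,r}-a_{n,r}}{b_{n,r}}\overset{d}{\longrightarrow}Z.$$ (2) If $r\sim\alpha n$ for some $\alpha\in(0,1)$, then there is a normalizing sequence $b_{n,r}>0$ such that, as $n\to\infty$, $$\frac{\mathcal V_{n,r}}{b_{n,r}}\overset{d}{\longrightarrow}\begin{cases}\exp\Big(\sqrt{\tfrac12\log\tfrac1{1-\alpha}}\;Z\Big)&\text{in the Gaussian model},\\[1mm]\exp\Big(\sqrt{\tfrac12\log\tfrac1{1-\alpha}-\tfrac\alpha2}\;Z\Big)&\text{in the Beta or spherical model}.\end{cases}$$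
   Context: Models for i.i.d. points in $\mathbb{R}^n$. Gaussian model: density $(2\pi)^{-n/2}e^{-|x|^2/2}$. Beta model with parameter $\nu>0$: density $\pi^{-n/2}\frac{\Gamma((n+\nu)/2)}{\Gamma(\nu/2)}(1-|x|^2)^{(\nu-2)/2}$ on $|x|<1$. Spherical model: uniform distribution on the unit sphere of $\mathbb{R}^n$ ($n\ge2$). The model is the same for all $n$. $r\sim\alpha n$ means $r/(\alpha n)\to1$ as $n\to\infty$. *)

theory Defs
  imports "HOL-Probability.Probability" "HOL-Library.Landau_Symbols"
begin

text \<open>
  The dimension \<open>n\<close> varies in the limit theorems, so a point of \<open>n\<close>-dimensional Euclidean
  space is a function \<open>nat \<Rightarrow> real\<close> that is extensional on \<open>{..<n}\<close>.  The measure below is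
  Lebesgue measure on the Borel sets; its space and \<open>\<sigma>\<close>-algebra serve as those of the space
  itself.  The Euclidean norm of \<open>x\<close> is \<open>L2_set x {..<n}\<close>.
\<close>

definition lebesgue_Rn :: "nat \<Rightarrow> (nat \<Rightarrow> real) measure" where
  "lebesgue_Rn n = (\<Pi>\<^sub>M i\<in>{..<n}. lborel)"

subsection \<open>The three models\<close>

datatype point_model = Gaussian_model | Beta_model real | Spherical_model

definition gaussian_law :: "nat \<Rightarrow> (nat \<Rightarrow> real) measure" where
  "gaussian_law n = density (lebesgue_Rn n)
     (\<lambda>x. ennreal ((2 * pi) powr (- real n / 2) * exp (- (L2_set x {..<n})\<^sup>2 / 2)))"

definition beta_law :: "real \<Rightarrow> nat \<Rightarrow> (nat \<Rightarrow> real) measure" where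
  "beta_law \<nu> n = density (lebesgue_Rn n)
     (\<lambda>x. ennreal (if L2_set x {..<n} < 1
        then pi powr (- real n / 2) * (Gamma ((real n + \<nu>) / 2) / Gamma (\<nu> / 2))
               * (1 - (L2_set x {..<n})\<^sup>2) powr ((\<nu> - 2) / 2)
        else 0))"

text \<open>
  Normalized surface measure of the unit sphere, obtained from Lebesgue measure as usual: a Borel
  set \<open>A\<close> of the sphere gets the proportion of the unit ball filled by the cone
  \<open>{t x | x \<in> A, 0 < t < 1}\<close>.  The origin is sent to \<open>0\<close>, but is a null set for \<open>n \<ge> 1\<close>.
\<close>

definition sphere_law :: "nat \<Rightarrow> (nat \<Rightarrow> real) measure" where
  "sphere_law n = distr
     (uniform_measure (lebesgue_Rn n) {x \<in> space (lebesgue_Rn n). L2_set x {..<n} < 1})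
     (lebesgue_Rn n)
     (\<lambda>x. \<lambda>k\<in>{..<n}. x k / L2_set x {..<n})"

fun model_law :: "point_model \<Rightarrow> nat \<Rightarrow> (nat \<Rightarrow> real) measure" where
  "model_law Gaussian_model n = gaussian_law n"
| "model_law (Beta_model \<nu>) n = beta_law \<nu> n"
| "model_law Spherical_model n = sphere_law n"

fun model_parameter_ok :: "point_model \<Rightarrow> bool" where
  "model_parameter_ok (Beta_model \<nu>) \<longleftrightarrow> \<nu> > 0"
| "model_parameter_ok _ \<longleftrightarrow> True"

text \<open>The smallest dimension in which the model is considered.\<close>

fun model_min_dim :: "point_model \<Rightarrow> nat" where
  "model_min_dim Spherical_model = 2"
| "model_min_dim _ = 1"

subsection \<open>Simplices and their volume\<close>

definition simplex_hull :: "nat \<Rightarrow> nat set \<Rightarrow> (nat \<Rightarrow> nat \<Rightarrow> real) \<Rightarrow> (nat \<Rightarrow> real) set" where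
  "simplex_hull n I P =
     {(\<lambda>k\<in>{..<n}. \<Sum>i\<in>I. c i * P i k) | c. (\<forall>i\<in>I. 0 \<le> c i) \<and> (\<Sum>i\<in>I. c i) = 1}"

definition orthonormal_system :: "nat \<Rightarrow> nat \<Rightarrow> (nat \<Rightarrow> nat \<Rightarrow> real) \<Rightarrow> bool" where
  "orthonormal_system n r u \<longleftrightarrow>
     (\<forall>i<r. \<forall>j<r. (\<Sum>k<n. u i k * u j k) = (if i = j then 1 else 0))"

definition flat_chart ::
    "nat \<Rightarrow> nat \<Rightarrow> (nat \<Rightarrow> real) \<Rightarrow> (nat \<Rightarrow> nat \<Rightarrow> real) \<Rightarrow> (nat \<Rightarrow> real) \<Rightarrow> (nat \<Rightarrow> real)" where
  "flat_chart n r p u t = (\<lambda>k\<in>{..<n}. p k + (\<Sum>i<r. t i * u i k))"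

text \<open>
  The \<open>r\<close>-dimensional volume of a set \<open>S\<close> lying in an \<open>r\<close>-dimensional affine subspace of
  \<open>n\<close>-space: the \<open>r\<close>-dimensional Lebesgue measure of \<open>S\<close> in Cartesian coordinates on such a
  subspace (with origin \<open>p\<close> and orthonormal directions \<open>u\<close>).  By invariance of Lebesgue measure
  under isometries the value does not depend on the choice of coordinates; if \<open>S\<close> lies in a flat of
  smaller dimension, it is \<open>0\<close>.  Nothing is specified for sets not contained in an
  \<open>r\<close>-dimensional affine subspace.
\<close>

definition flat_volume :: "nat \<Rightarrow> nat \<Rightarrow> (nat \<Rightarrow> real) set \<Rightarrow> real" where
  "flat_volume n r S = (THE v. \<exists>p u. orthonormal_system n r u \<and>
      S \<subseteq> flat_chart n r p u ` space (lebesgue_Rn r) \<and>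
      v = measure (lebesgue_Rn r) {t \<in> space (lebesgue_Rn r). flat_chart n r p u t \<in> S})"

text \<open>The \<open>r\<close>-volume of the simplex with vertices \<open>P 1, \<dots>, P (r + 1)\<close>.\<close>

definition simplex_volume :: "nat \<Rightarrow> nat \<Rightarrow> (nat \<Rightarrow> nat \<Rightarrow> real) \<Rightarrow> real" where
  "simplex_volume n r P = flat_volume n r (simplex_hull n {1..r + 1} P)"

end

theory Submission
  imports Defs "HOL-Probability.Probability"
begin

text \<open>
  By rotation invariance the squared volume of the simplex on \<open>r + 1\<close> independent points has the law
  of \<open>q * p\<close>, up to the factor \<open>(r!)\<^sup>2\<close>. Here \<open>p\<close> is a product of the independent squared
  distances of the \<open>j\<close>-th point to the span of the previous ones (the squared volume of the
  parallelepiped on all the points), and \<open>q\<close> is the inverse squared distance of the origin to the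
  affine hull of the points. The variable \<open>q\<close> is the end of a scalar Markov chain driven by the
  same independent rows: writing a point as its norm times the direction of a Gaussian vector, the
  \<open>j\<close>-th row enters only through the norms of the vector and of its last \<open>n - j\<close> coordinates and
  through coordinate \<open>j - 1\<close>. Martingale estimates linearise the chain around its deterministic
  path, so \<open>ln (q * p)\<close> is, up to an error that is negligible against its standard deviation, a
  constant plus a sum of independent centred quadratic and linear functions of Gaussian variables.
  Characteristic functions give its central limit theorem, with variance tending to \<open>0\<close> if
  \<open>r = o(n)\<close> and to \<open>2 ln (1 / (1 - \<alpha>))\<close>, respectively \<open>2 ln (1 / (1 - \<alpha>)) - 2 \<alpha>\<close>, if
  \<open>r \<sim> \<alpha> n\<close>. Since the volume is the exponential of half the logarithm, the first case is the
  delta method and the second one continuous mapping.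
\<close>

subsection \<open>Orthonormal systems and Lebesgue measure\<close>

text \<open>The logarithm must be resolved on the scale 1 / sqrt n + r / n, and neither factor is
  negligible there. In the Gaussian model ln p has variance of order r / n, but in the Beta and
  spherical models the norm of a point is almost constant, ln p only has variance of order r^2 /
  n^2, and for r small against sqrt n the fluctuation of q, of order 1 / sqrt n, decides. A limit
  theorem for p alone would not give (1). One computation serves all models: a switch
  \<open>\<gamma>\<close>, 0 in the Gaussian case and 1 otherwise, subtracts the logarithm of the
  Gaussian norm, and the remaining randomness of the length is a perturbation of order 1 / n.
  Inverse moments of chi-square variables are avoided by truncating denominators at 1/2; the rows
  where this matters have total probability O(1 / n). A constant \<open>D\<close> with n \<le> D (n
  - r) keeps n - j comparable with n in all rows; it is 2 in (1) and 2 / (1 - \<alpha>) in (2). The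
  bounds are explicit in n, so the same estimate covers bounded r, r = o(n) and r of order
  n.\<close>

definition ip :: "nat => (nat => real) => (nat => real) => real" where
 "ip n x y = (\<Sum>k<n. x k * y k)"

lemma ip_commute: "ip n x y = ip n y x" by (simp add: ip_def mult.commute)

lemma ip_nonneg [simp]: "0 \<le> ip n x x" by (simp add: ip_def sum_nonneg)

lemma ip_eq_0D: "ip n x x = 0 ==> k < n ==> x k = 0" by (simp add: ip_def sum_nonneg_eq_0_iff)

lemma ip_cong: "(\<And>k. k < n ==> x k = x' k) ==> (\<And>k. k < n ==> y k = y' k) ==> ip n x y = ip n x' y'" by (simp add: ip_def)

lemma L2_set_eq_ip: "L2_set x {..<n} = sqrt (ip n x x)" by (simp add: L2_set_def ip_def power2_eq_square)

lemma ip_add_right: "ip n x (\<lambda>k. y k + z k) = ip n x y + ip n x z" by (simp add: ip_def algebra_simps sum.distrib)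

lemma ip_diff_right: "ip n x (\<lambda>k. y k - z k) = ip n x y - ip n x z" by (simp add: ip_def algebra_simps sum_subtractf)

lemma ip_scale_right: "ip n x (\<lambda>k. c * y k) = c * ip n x y" by (simp add: ip_def sum_distrib_left mult_ac)

lemma ip_sum_right: "ip n x (\<lambda>k. \<Sum>i\<in>I. f i k) = (\<Sum>i\<in>I. ip n x (f i))" unfolding ip_def by (simp add: sum_distrib_left) (rule sum.swap)

lemma ip_add_left: "ip n (\<lambda>k. y k + z k) x = ip n y x + ip n z x" by (simp add: ip_def algebra_simps sum.distrib)

lemma ip_diff_left: "ip n (\<lambda>k. y k - z k) x = ip n y x - ip n z x" by (simp add: ip_def algebra_simps sum_subtractf)

lemma ip_scale_left: "ip n (\<lambda>k. c * y k) x = c * ip n y x" by (simp add: ip_def sum_distrib_left mult_ac)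

lemma ip_sum_left: "ip n (\<lambda>k. \<Sum>i\<in>I. f i k) x = (\<Sum>i\<in>I. ip n (f i) x)" unfolding ip_def by (simp add: sum_distrib_right) (rule sum.swap)

lemmas ip_linear = ip_add_right ip_diff_right ip_scale_right ip_sum_right
 ip_add_left ip_diff_left ip_scale_left ip_sum_left

lemma orthonormal_system_ip:
 "orthonormal_system n r u \<longleftrightarrow> (\<forall>i<r. \<forall>j<r. ip n (u i) (u j) = (if i = j then 1 else 0))" by (simp add: orthonormal_system_def ip_def)

definition orthonormal_on :: "nat => nat set => (nat => nat => real) => bool" where
 "orthonormal_on n J u \<longleftrightarrow> (\<forall>i\<in>J. \<forall>j\<in>J. ip n (u i) (u j) = (if i = j then 1 else 0))"

lemma orthonormal_on_lessThan: "orthonormal_on n {..<r} u \<longleftrightarrow> orthonormal_system n r u"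
 by (auto simp: orthonormal_on_def orthonormal_system_ip)

definition unit_vec :: "nat => nat => real" where
 "unit_vec k = (\<lambda>l. if l = k then 1 else 0)"

lemma ip_unit_vec: "k < n ==> ip n x (unit_vec k) = x k" "k < n ==> ip n (unit_vec k) x = x k"
 by (auto simp: ip_def unit_vec_def if_distrib[of "\<lambda>t. _ * t"] if_distrib[of "\<lambda>t. t * _"] cong: if_cong)

lemma orthonormal_residual:
 assumes "orthonormal_on n J u" "finite J" "j \<in> J"
 shows "ip n (\<lambda>l. x l - (\<Sum>i\<in>J. ip n x (u i) * u i l)) (u j) = 0"
proof -
 have "(\<Sum>i\<in>J. ip n x (u i) * ip n (u i) (u j)) = (\<Sum>i\<in>J. if i = j then ip n x (u i) else 0)"
  using assms by (intro sum.cong) (auto simp: orthonormal_on_def)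
 also have "... = ip n x (u j)" using assms by simp
 finally show ?thesis by (simp add: ip_linear)
qed

lemma orthonormal_residual_norm:
 fixes x :: "nat => real"
 assumes "orthonormal_on n J u" "finite J"
 defines "z \<equiv> \<lambda>l. x l - (\<Sum>i\<in>J. ip n x (u i) * u i l)"
 shows "ip n z z = ip n x x - (\<Sum>i\<in>J. (ip n x (u i))^2)"
proof -
 have "ip n z z = ip n z x - (\<Sum>i\<in>J. ip n x (u i) * ip n z (u i))" by (subst (2) z_def) (simp add: ip_linear)
 also have "(\<Sum>i\<in>J. ip n x (u i) * ip n z (u i)) = 0"
  unfolding z_def using orthonormal_residual[OF assms(1,2)] by (intro sum.neutral) auto
 also have "ip n z x = ip n x x - (\<Sum>i\<in>J. (ip n x (u i))^2)" by (simp add: z_def ip_linear power2_eq_square ip_commute)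
 finally show ?thesis by simp
qed

lemma orthonormal_trace:
 assumes "orthonormal_on n J u" "finite J"
 shows "(\<Sum>k<n. 1 - (\<Sum>i\<in>J. (u i k)^2)) = real n - real (card J)"
proof -
 have "(\<Sum>k<n. \<Sum>i\<in>J. (u i k)^2) = (\<Sum>i\<in>J. ip n (u i) (u i))" by (subst sum.swap) (simp add: ip_def power2_eq_square)
 also have "... = real (card J)" using assms(1) by (simp add: orthonormal_on_def)
 finally show ?thesis by (simp add: sum_subtractf)
qed

text \<open>The residuals of the standard basis vectors have total squared norm \<open>n - card J\<close>, so one
 of them does not vanish.\<close>

lemma orthonormal_on_extend_one:
 assumes "orthonormal_on n J u" "finite J" "card J < n" "i \<notin> J"
 shows "\<exists>v. orthonormal_on n (insert i J) (u(i := v))"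
proof -
 have "\<exists>k<n. 1 - (\<Sum>i\<in>J. (u i k)^2) > 0"
 proof (rule ccontr)
  assume "\<not> ?thesis"
  then have "(\<Sum>k<n. 1 - (\<Sum>i\<in>J. (u i k)^2)) \<le> 0" by (intro sum_nonpos) (metis not_less lessThan_iff)
  with orthonormal_trace[OF assms(1,2)] assms(3) show False by simp
 qed
 then obtain k where k: "k < n" "1 - (\<Sum>i\<in>J. (u i k)^2) > 0" by blast
 define z where "z = (\<lambda>l. unit_vec k l - (\<Sum>i\<in>J. ip n (unit_vec k) (u i) * u i l))"
 have zz: "ip n z z > 0" using orthonormal_residual_norm[OF assms(1,2), of "unit_vec k"] k
  by (simp add: z_def ip_unit_vec) (simp add: unit_vec_def)
 have zu: "ip n z (u j) = 0" "ip n (u j) z = 0" if "j \<in> J" for j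
  using orthonormal_residual[OF assms(1,2) that, of "unit_vec k"] by (simp_all add: z_def ip_commute)
 define v where "v = (\<lambda>l. (1 / sqrt (ip n z z)) * z l)"
 have "ip n v v = 1" using zz by (simp only: v_def ip_scale_left ip_scale_right) (simp add: field_simps)
 moreover have "ip n v (u j) = 0" "ip n (u j) v = 0" if "j \<in> J" for j
  using zu[OF that] by (simp_all only: v_def ip_scale_left ip_scale_right mult_zero_right)
 ultimately have "orthonormal_on n (insert i J) (u(i := v))" using assms(1,4) by (auto simp: orthonormal_on_def)
 then show ?thesis by blast
qed

text \<open>Missing indices are filled one at a time. The vectors already present keep their index,
  so a later rotation can prescribe which coordinate a given direction becomes.\<close>

lemma orthonormal_on_extend:
 assumes "orthonormal_on n J u" "J \<subseteq> {..<n}"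
 shows "\<exists>v. orthonormal_system n n v \<and> (\<forall>j\<in>J. v j = u j)" using assms
proof (induction "card ({..<n} - J)" arbitrary: J u)
 case 0
 then have "J = {..<n}" by auto
 then show ?case using 0 orthonormal_on_lessThan by blast
next
 case (Suc m)
 then obtain i where i: "i < n" "i \<notin> J" by (metis DiffE all_not_in_conv card.empty lessThan_iff nat.distinct(1))
 have fin: "finite J" using Suc.prems(2) finite_subset by blast
 have "card J < n" using i Suc.prems(2) by (metis card_lessThan finite_lessThan lessThan_iff psubsetI psubset_card_mono)
 then obtain v where v: "orthonormal_on n (insert i J) (u(i := v))"
  using orthonormal_on_extend_one[OF Suc.prems(1) fin _ i(2)] by blast
 have "m = card ({..<n} - insert i J)" using Suc.hyps(2) i by (simp add: card_Diff_insert)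
 from Suc.hyps(1)[OF this v] i Suc.prems(2) obtain w where
  "orthonormal_system n n w" "\<forall>j\<in>insert i J. w j = (u(i := v)) j" by auto
 with i show ?case by (intro exI[of _ w]) auto
qed

text \<open>The residuals of the standard basis vectors have squared norms summing to n - n = 0, so
  each residual vanishes; read coordinatewise, this is orthogonality of the columns.\<close>

lemma orthonormal_complete:
 assumes "orthonormal_system n n b" "k < n" "l < n"
 shows "(\<Sum>i<n. b i k * b i l) = (if k = l then 1 else 0)"
proof -
 have on: "orthonormal_on n {..<n} b" using assms by (simp add: orthonormal_on_lessThan)
 define res where "res k = (\<lambda>l. unit_vec k l - (\<Sum>i<n. ip n (unit_vec k) (b i) * b i l))" for k
 have nr: "ip n (res k) (res k) = 1 - (\<Sum>i<n. (b i k)^2)" if "k < n" for k using orthonormal_residual_norm[OF on, of "unit_vec k"] that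
  by (simp add: res_def ip_unit_vec) (simp add: unit_vec_def)
 have "(\<Sum>k<n. ip n (res k) (res k)) = 0" using orthonormal_trace[OF on] nr by simp
 then have "ip n (res k) (res k) = 0" using assms(2) by (subst (asm) sum_nonneg_eq_0_iff) auto
 from ip_eq_0D[OF this assms(3)] assms(2) show ?thesis by (simp add: res_def ip_unit_vec(2)) (auto simp: unit_vec_def)
qed

lemma sum_rev_if: "(\<Sum>l<n. if (k::nat) = l then f l else (0::real)) = (if k < n then f k else 0)" by (simp add: sum.delta')

lemma parseval:
 assumes "orthonormal_system n n b"
 shows "(\<Sum>i<n. ip n (b i) x * ip n (b i) y) = ip n x y"
proof -
 have "(\<Sum>i<n. ip n (b i) x * ip n (b i) y)
   = (\<Sum>i<n. \<Sum>k<n. \<Sum>l<n. b i k * x k * (b i l * y l))" by (simp add: ip_def sum_product)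
 also have "... = (\<Sum>k<n. \<Sum>l<n. \<Sum>i<n. b i k * x k * (b i l * y l))" by (subst sum.swap, rule sum.cong[OF refl], rule sum.swap)
 also have "... = (\<Sum>k<n. \<Sum>l<n. x k * y l * (\<Sum>i<n. b i k * b i l))" by (simp add: sum_distrib_left mult_ac)
 also have "... = (\<Sum>k<n. \<Sum>l<n. if k = l then x k * y l else 0)" by (intro sum.cong) (auto simp: orthonormal_complete[OF assms])
 also have "... = ip n x y" by (simp add: sum_rev_if ip_def)
 finally show ?thesis .
qed

lemma expansion:
 assumes "orthonormal_system n n b" "l < n"
 shows "(\<Sum>i<n. ip n (b i) x * b i l) = x l" using parseval[OF assms(1), of x "unit_vec l"] assms(2) by (simp add: ip_unit_vec)

section \<open>Lebesgue measure, translations and uniqueness\<close>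

lemma sets_lebesgue_Rn [measurable_cong]: "sets (lebesgue_Rn n) = sets (\<Pi>\<^sub>M i\<in>{..<n}. borel)"
 unfolding lebesgue_Rn_def by (rule sets_PiM_cong) simp_all

lemma space_lebesgue_Rn: "space (lebesgue_Rn n) = {..<n} \<rightarrow>\<^sub>E UNIV" by (simp add: lebesgue_Rn_def space_PiM)

lemma measurable_ip [measurable]:
 assumes [measurable]: "\<And>k. k < n ==> (\<lambda>w. f w k) \<in> borel_measurable M"
  "\<And>k. k < n ==> (\<lambda>w. g w k) \<in> borel_measurable M"
 shows "(\<lambda>w. ip n (f w) (g w)) \<in> borel_measurable M" unfolding ip_def by (intro borel_measurable_sum borel_measurable_times) auto

lemma measurable_lebesgue_Rn_component:
 "k < n ==> (\<lambda>x. x k) \<in> borel_measurable (lebesgue_Rn n)" by measurable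

interpretation lborel_product: product_sigma_finite "\<lambda>_::nat. lborel :: real measure" by standard

lemma sigma_finite_lebesgue_Rn: "sigma_finite_measure (lebesgue_Rn n)"
 unfolding lebesgue_Rn_def by (rule lborel_product.sigma_finite) simp

lemma measurable_component_lebesgue_Rn [measurable (raw)]:
 assumes "f \<in> M \<rightarrow>\<^sub>M lebesgue_Rn n" "k < n"
 shows "(\<lambda>w. f w k) \<in> borel_measurable M" using measurable_compose[OF assms(1) measurable_lebesgue_Rn_component[OF assms(2)]] .

lemma measurable_lebesgue_RnI:
 assumes "\<And>k. k < n ==> (\<lambda>w. f w k) \<in> borel_measurable M"
 shows "(\<lambda>w. \<lambda>k\<in>{..<n}. f w k) \<in> M \<rightarrow>\<^sub>M lebesgue_Rn n" unfolding lebesgue_Rn_def using assms by (intro measurable_restrict) auto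

text \<open>The restriction keeps sums extensional, hence inside the space of
  \<open>lebesgue_Rn\<close>.\<close>

definition vadd :: "nat => (nat => real) => (nat => real) => (nat => real)" where
 "vadd n x y = (\<lambda>k\<in>{..<n}. x k + y k)"

lemma measurable_vadd [measurable]:
 assumes [measurable]: "f \<in> M \<rightarrow>\<^sub>M lebesgue_Rn n" "g \<in> M \<rightarrow>\<^sub>M lebesgue_Rn n"
 shows "(\<lambda>w. vadd n (f w) (g w)) \<in> M \<rightarrow>\<^sub>M lebesgue_Rn n"
 unfolding vadd_def by (intro measurable_lebesgue_RnI borel_measurable_add) measurable

lemma lebesgue_Rn_translate:
 assumes "y \<in> space (lebesgue_Rn n)"
 shows "distr (lebesgue_Rn n) (lebesgue_Rn n) (\<lambda>x. vadd n x y) = lebesgue_Rn n"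
proof -
 have [measurable]: "(\<lambda>x. vadd n x y) \<in> lebesgue_Rn n \<rightarrow>\<^sub>M lebesgue_Rn n" using assms by measurable
 have "distr (lebesgue_Rn n) (lebesgue_Rn n) (\<lambda>x. vadd n x y) = PiM {..<n} (\<lambda>_. lborel)"
 proof (rule lborel_product.PiM_eqI)
  fix A :: "nat => real set" assume A: "\<And>i. i \<in> {..<n} ==> A i \<in> sets lborel"
  have "Pi\<^sub>E {..<n} A \<in> sets (lebesgue_Rn n)" unfolding lebesgue_Rn_def using A by (intro sets_PiM_I_finite) auto
  then have "emeasure (distr (lebesgue_Rn n) (lebesgue_Rn n) (\<lambda>x. vadd n x y)) (Pi\<^sub>E {..<n} A)
    = emeasure (lebesgue_Rn n) ((\<lambda>x. vadd n x y) -` Pi\<^sub>E {..<n} A \<inter> space (lebesgue_Rn n))" by (subst emeasure_distr) auto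
  also have "(\<lambda>x. vadd n x y) -` Pi\<^sub>E {..<n} A \<inter> space (lebesgue_Rn n)
    = Pi\<^sub>E {..<n} (\<lambda>i. (\<lambda>t. y i + t) -` A i)" by (auto simp: vadd_def space_lebesgue_Rn PiE_iff add.commute)
  also have "emeasure (lebesgue_Rn n) ... = (\<Prod>i<n. emeasure lborel ((\<lambda>t. y i + t) -` A i))" unfolding lebesgue_Rn_def using A
   by (intro lborel_product.emeasure_PiM) (auto intro!: measurable_sets_borel[of _ lborel, simplified])
  also have "... = (\<Prod>i<n. emeasure (distr lborel borel ((+) (y i))) (A i))"
   using A by (intro prod.cong refl) (subst emeasure_distr, auto)
  finally show "emeasure (distr (lebesgue_Rn n) (lebesgue_Rn n) (\<lambda>x. vadd n x y)) (Pi\<^sub>E {..<n} A)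
    = (\<Prod>i<n. emeasure lborel (A i))" by (simp add: lborel_distr_plus)
 qed (simp_all add: lebesgue_Rn_def)
 then show ?thesis by (simp add: lebesgue_Rn_def)
qed

text \<open>Uniqueness of translation invariant measures: evaluate the double integral of
 \<open>f x * g (x + y)\<close> in both orders.\<close>

lemma translation_invariant_unique:
 fixes n :: nat
 defines "L \<equiv> lebesgue_Rn n"
 assumes sets: "sets \<nu> = sets L" and "sigma_finite_measure \<nu>"
  and trans: "\<And>y. y \<in> space L ==> distr \<nu> L (\<lambda>x. vadd n x y) = \<nu>"
  and f [measurable]: "f \<in> borel_measurable L" and g [measurable]: "g \<in> borel_measurable L"
  and sym: "\<And>x. x \<in> space L ==> f (\<lambda>k\<in>{..<n}. - x k) = f x"
 shows "(\<integral>\<^sup>+x. g x \<partial>\<nu>) * (\<integral>\<^sup>+x. f x \<partial>L) = (\<integral>\<^sup>+x. g x \<partial>L) * (\<integral>\<^sup>+x. f x \<partial>\<nu>)"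
proof -
 interpret \<nu>: sigma_finite_measure \<nu> by fact
 interpret L: sigma_finite_measure L unfolding L_def by (rule sigma_finite_lebesgue_Rn)
 interpret LP: pair_sigma_finite L \<nu> by standard
 note sets [measurable_cong]
 have [measurable_cong]: "sets L = sets (\<Pi>\<^sub>M i\<in>{..<n}. borel)" by (simp add: L_def sets_lebesgue_Rn)
 have sp: "space \<nu> = space L" by (rule sets_eq_imp_space_eq[OF sets])
 have va [measurable]: "(\<lambda>w. vadd n (a w) (b w)) \<in> N \<rightarrow>\<^sub>M L"
  if "a \<in> N \<rightarrow>\<^sub>M L" "b \<in> N \<rightarrow>\<^sub>M L" for a b and N :: "'z measure" using that measurable_vadd[of a N n b] by (simp add: L_def)
 have neg [measurable]: "(\<lambda>w. \<lambda>k\<in>{..<n}. - a w k) \<in> N \<rightarrow>\<^sub>M L"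
  if "a \<in> N \<rightarrow>\<^sub>M L" for a and N :: "'z measure" using that unfolding L_def
  by (intro measurable_lebesgue_RnI borel_measurable_uminus measurable_component_lebesgue_Rn)
 have inL: "(\<lambda>k\<in>{..<n}. h k) \<in> space L" for h by (simp add: L_def space_lebesgue_Rn)
 have va_in: "vadd n y z \<in> space L" for y z unfolding vadd_def by (rule inL)
 have tr\<nu>: "(\<integral>\<^sup>+x. h (vadd n x y) \<partial>\<nu>) = (\<integral>\<^sup>+x. h x \<partial>\<nu>)"
  if [measurable]: "h \<in> borel_measurable L" and y: "y \<in> space L" for h y
  by (subst (2) trans[OF y, symmetric], subst nn_integral_distr) (use y in auto)
 have trL: "(\<integral>\<^sup>+x. h (vadd n x y) \<partial>L) = (\<integral>\<^sup>+x. h x \<partial>L)"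
  if [measurable]: "h \<in> borel_measurable L" and y: "y \<in> space L" for h y using y unfolding L_def
  by (subst (2) lebesgue_Rn_translate[symmetric, of y], simp, subst nn_integral_distr)
    (use y that in \<open>auto simp: L_def\<close>)
 have "(\<integral>\<^sup>+x. g x \<partial>L) * (\<integral>\<^sup>+x. f x \<partial>\<nu>) = (\<integral>\<^sup>+x. f x * (\<integral>\<^sup>+y. g y \<partial>L) \<partial>\<nu>)" by (subst nn_integral_multc) (auto simp: mult.commute)
 also have "... = (\<integral>\<^sup>+x. (\<integral>\<^sup>+y. f x * g (vadd n y x) \<partial>L) \<partial>\<nu>)"
 proof (rule nn_integral_cong)
  fix x assume x: "x \<in> space \<nu>"
  then have [simp]: "x \<in> space L" by (simp add: sp)
  show "f x * (\<integral>\<^sup>+y. g y \<partial>L) = (\<integral>\<^sup>+y. f x * g (vadd n y x) \<partial>L)" by (subst nn_integral_cmult) (auto simp: trL)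
 qed
 also have "... = (\<integral>\<^sup>+y. (\<integral>\<^sup>+x. f x * g (vadd n y x) \<partial>\<nu>) \<partial>L)" by (rule LP.Fubini') measurable
 also have "... = (\<integral>\<^sup>+y. (\<integral>\<^sup>+x. f (vadd n x (\<lambda>k\<in>{..<n}. - y k)) * g x \<partial>\<nu>) \<partial>L)"
 proof (rule nn_integral_cong)
  fix y assume y: "y \<in> space L"
  have "(\<integral>\<^sup>+x. f x * g (vadd n y x) \<partial>\<nu>)
    = (\<integral>\<^sup>+x. f (vadd n (vadd n x y) (\<lambda>k\<in>{..<n}. - y k)) * g (vadd n x y) \<partial>\<nu>)"
  proof (intro nn_integral_cong arg_cong2[where f="(*)"] arg_cong[where f=f] arg_cong[where f=g])
   fix x assume "x \<in> space \<nu>"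
   then show "x = vadd n (vadd n x y) (\<lambda>k\<in>{..<n}. - y k)"
    by (auto simp: sp L_def space_lebesgue_Rn vadd_def PiE_iff extensional_def fun_eq_iff)
   show "vadd n y x = vadd n x y" by (auto simp: vadd_def add.commute)
  qed
  also have "... = (\<integral>\<^sup>+x. f (vadd n x (\<lambda>k\<in>{..<n}. - y k)) * g x \<partial>\<nu>)"
   using y by (subst tr\<nu>[of "\<lambda>x. f (vadd n x (\<lambda>k\<in>{..<n}. - y k)) * g x" y]) (auto simp: inL)
  finally show "(\<integral>\<^sup>+x. f x * g (vadd n y x) \<partial>\<nu>)
    = (\<integral>\<^sup>+x. f (vadd n x (\<lambda>k\<in>{..<n}. - y k)) * g x \<partial>\<nu>)" .
 qed
 also have "... = (\<integral>\<^sup>+x. (\<integral>\<^sup>+y. f (vadd n x (\<lambda>k\<in>{..<n}. - y k)) * g x \<partial>L) \<partial>\<nu>)" by (rule LP.Fubini'[symmetric]) measurable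
 also have "... = (\<integral>\<^sup>+x. (\<integral>\<^sup>+y. f y \<partial>L) * g x \<partial>\<nu>)"
 proof (rule nn_integral_cong)
  fix x assume "x \<in> space \<nu>"
  have "(\<integral>\<^sup>+y. f (vadd n x (\<lambda>k\<in>{..<n}. - y k)) * g x \<partial>L)
    = (\<integral>\<^sup>+y. f (vadd n y (\<lambda>k\<in>{..<n}. - x k)) * g x \<partial>L)"
  proof (intro nn_integral_cong arg_cong2[where f="(*)"] refl)
   fix y assume "y \<in> space L"
   \<comment> \<open>By the symmetry of \<open>f\<close>, f (x - y) = f (y - x); as a function of y
     this is a translate of \<open>f\<close>.\<close>
   have "(\<lambda>k\<in>{..<n}. - vadd n y (\<lambda>k\<in>{..<n}. - x k) k) = vadd n x (\<lambda>k\<in>{..<n}. - y k)" by (auto simp: vadd_def)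
   then show "f (vadd n x (\<lambda>k\<in>{..<n}. - y k)) = f (vadd n y (\<lambda>k\<in>{..<n}. - x k))"
    using sym[OF va_in[of y "\<lambda>k\<in>{..<n}. - x k"]] by (simp only:)
  qed
  also have "... = (\<integral>\<^sup>+y. f (vadd n y (\<lambda>k\<in>{..<n}. - x k)) \<partial>L) * g x"
   by (rule nn_integral_multc, intro measurable_compose[OF _ f] va measurable_ident_sets
     measurable_const inL) auto
  also have "(\<integral>\<^sup>+y. f (vadd n y (\<lambda>k\<in>{..<n}. - x k)) \<partial>L) = (\<integral>\<^sup>+y. f y \<partial>L)" by (rule trL[OF f inL])
  finally show "(\<integral>\<^sup>+y. f (vadd n x (\<lambda>k\<in>{..<n}. - y k)) * g x \<partial>L) = (\<integral>\<^sup>+y. f y \<partial>L) * g x" .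
 qed
 also have "... = (\<integral>\<^sup>+x. g x \<partial>\<nu>) * (\<integral>\<^sup>+x. f x \<partial>L)" by (subst nn_integral_cmult) (auto simp: mult.commute)
 finally show ?thesis ..
qed

lemma ennreal_mult_right_cancel:
 fixes a b c :: ennreal
 assumes "c \<noteq> 0" "c \<noteq> top"
 shows "a * c = b * c \<longleftrightarrow> a = b" using ennreal_mult_divide_eq[OF assms] by metis

lemma emeasure_cube:
 assumes "a \<ge> 0"
 shows "emeasure (lebesgue_Rn n) (Pi\<^sub>E {..<n} (\<lambda>_. {-a..a})) = ennreal ((2 * a) ^ n)"
proof -
 have "emeasure (lebesgue_Rn n) (Pi\<^sub>E {..<n} (\<lambda>_. {-a..a})) = (\<Prod>i<n. emeasure lborel {-a..a})"
  unfolding lebesgue_Rn_def by (intro lborel_product.emeasure_PiM) auto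
 also have "... = ennreal ((2 * a) ^ n)" using assms by (simp add: ennreal_power)
 finally show ?thesis .
qed

lemma cube_in_sets [measurable]: "Pi\<^sub>E {..<n} (\<lambda>_. {-a..a::real}) \<in> sets (lebesgue_Rn n)"
 unfolding lebesgue_Rn_def by (intro sets_PiM_I_finite) auto

definition ball_Rn :: "nat => real => (nat => real) set" where
 "ball_Rn n t = {x \<in> space (lebesgue_Rn n). ip n x x \<le> t}"

lemma ball_Rn_sets [measurable]: "ball_Rn n t \<in> sets (lebesgue_Rn n)" unfolding ball_Rn_def by measurable

lemma ip_self_ge: "k < n ==> (x k)^2 \<le> ip n x x" unfolding ip_def power2_eq_square by (rule member_le_sum) auto

lemma emeasure_ball_Rn_finite: "emeasure (lebesgue_Rn n) (ball_Rn n t) < \<infinity>"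
proof -
 have "ball_Rn n t \<subseteq> Pi\<^sub>E {..<n} (\<lambda>_. {-(\<bar>t\<bar>+1)..\<bar>t\<bar>+1})"
 proof
  fix x assume x: "x \<in> ball_Rn n t"
  have "\<bar>x k\<bar> \<le> \<bar>t\<bar> + 1" if "k < n" for k
  proof -
   have "(x k)^2 \<le> t" using ip_self_ge[OF that, of x] x by (simp add: ball_Rn_def)
   also have "t \<le> (\<bar>t\<bar> + 1)^2" using self_le_power[of "\<bar>t\<bar> + 1" 2] abs_ge_self[of t] by linarith
   finally show ?thesis using abs_le_square_iff[of "x k" "\<bar>t\<bar>+1"] by simp
  qed
  then have "x k \<in> {-(\<bar>t\<bar>+1)..\<bar>t\<bar>+1}" if "k < n" for k using that unfolding abs_le_iff atLeastAtMost_iff by force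
  then show "x \<in> Pi\<^sub>E {..<n} (\<lambda>_. {-(\<bar>t\<bar>+1)..\<bar>t\<bar>+1})" using x unfolding ball_Rn_def space_lebesgue_Rn PiE_iff by blast
 qed
 from emeasure_mono[OF this cube_in_sets]
 have "emeasure (lebesgue_Rn n) (ball_Rn n t) \<le> ennreal ((2 * (\<bar>t\<bar> + 1)) ^ n)" by (subst (asm) emeasure_cube) auto
 also have "... < \<infinity>" by simp
 finally show ?thesis .
qed

lemma emeasure_unit_ball_pos: "emeasure (lebesgue_Rn n) (ball_Rn n 1) > 0"
proof -
 \<comment> \<open>A cube of half side a lies in the unit ball, since its points have squared norm
   at most n a^2 \<le> n a \<le> 1.\<close>
 define a where "a = 1 / (real n + 1)"
 have a: "a > 0" "a \<le> 1" "real n * a \<le> 1" by (auto simp: a_def field_simps)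
 have "Pi\<^sub>E {..<n} (\<lambda>_. {-a..a}) \<subseteq> ball_Rn n 1"
 proof
  fix x assume x: "x \<in> Pi\<^sub>E {..<n} (\<lambda>_. {-a..a})"
  have "ip n x x \<le> (\<Sum>k<n. a * 1)" unfolding ip_def
  proof (intro sum_mono)
   fix k assume "k \<in> {..<n}"
   with x have "x k \<in> {-a..a}" by (meson PiE_mem)
   then have "\<bar>x k\<bar> \<le> a" by auto
   then have "\<bar>x k\<bar> * \<bar>x k\<bar> \<le> a * 1" using a by (intro mult_mono) auto
   then show "x k * x k \<le> a * 1" by (simp add: abs_mult[symmetric] del: abs_mult_self_eq)
  qed
  with a x show "x \<in> ball_Rn n 1" by (auto simp: ball_Rn_def space_lebesgue_Rn PiE_iff)
 qed
 from emeasure_mono[OF this ball_Rn_sets]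
 have "ennreal ((2 * a) ^ n) \<le> emeasure (lebesgue_Rn n) (ball_Rn n 1)" using a by (subst (asm) emeasure_cube) auto
 moreover have "0 < ennreal ((2 * a) ^ n)" using a by simp
 ultimately show ?thesis by (rule less_le_trans[rotated])
qed

text \<open>The form in which uniqueness is applied: one symmetric set \<open>F\<close> of known
  measure determines the factor between \<open>\<nu>\<close> and Lebesgue measure. Finiteness on
  balls of integer squared radius makes \<open>\<nu>\<close> \<sigma>-finite.\<close>

lemma translation_invariant_measure_eq:
 assumes sets: "sets \<nu> = sets (lebesgue_Rn n)"
  and fin: "\<And>N::nat. emeasure \<nu> (ball_Rn n N) < \<infinity>"
  and trans: "\<And>y. y \<in> space (lebesgue_Rn n) ==> distr \<nu> (lebesgue_Rn n) (\<lambda>x. vadd n x y) = \<nu>"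
  and A: "A \<in> sets (lebesgue_Rn n)" and F: "F \<in> sets (lebesgue_Rn n)"
  and sym: "\<And>x. x \<in> space (lebesgue_Rn n) ==> (\<lambda>k\<in>{..<n}. - x k) \<in> F \<longleftrightarrow> x \<in> F"
 shows "emeasure \<nu> A * emeasure (lebesgue_Rn n) F = emeasure (lebesgue_Rn n) A * emeasure \<nu> F"
proof -
 have sp: "space \<nu> = space (lebesgue_Rn n)" by (rule sets_eq_imp_space_eq[OF sets])
 have "sigma_finite_measure \<nu>"
 proof
  show "\<exists>C. countable C \<and> C \<subseteq> sets \<nu> \<and> \<Union> C = space \<nu> \<and> (\<forall>a\<in>C. emeasure \<nu> a \<noteq> \<infinity>)"
  proof (intro exI[of _ "range (\<lambda>N::nat. ball_Rn n N)"] conjI)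
   show "\<Union> (range (\<lambda>N::nat. ball_Rn n (real N))) = space \<nu>"
   proof (intro set_eqI iffI)
    fix x assume "x \<in> space \<nu>"
    moreover obtain N :: nat where "ip n x x \<le> real N" using real_arch_simple by blast
    ultimately show "x \<in> \<Union> (range (\<lambda>N::nat. ball_Rn n (real N)))" by (auto simp: sp ball_Rn_def)
   qed (auto simp: sp ball_Rn_def)
  qed (use fin in \<open>auto simp: sets less_top[symmetric]\<close>)
 qed
 from translation_invariant_unique[OF sets this trans, of "indicator F" "indicator A"] A F sym sets
 have "(\<integral>\<^sup>+x. indicator A x \<partial>\<nu>) * (\<integral>\<^sup>+x. indicator F x \<partial>lebesgue_Rn n)
   = (\<integral>\<^sup>+x. indicator A x \<partial>lebesgue_Rn n) * (\<integral>\<^sup>+x. indicator F x \<partial>\<nu>)" by (auto simp: indicator_def)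
 with A F sets show ?thesis by simp
qed

section \<open>Rotations and dilations\<close>

definition rot :: "nat => (nat => nat => real) => (nat => real) => (nat => real)" where
 "rot n b x = (\<lambda>i\<in>{..<n}. ip n (b i) x)"

lemma measurable_rot [measurable]: "rot n b \<in> lebesgue_Rn n \<rightarrow>\<^sub>M lebesgue_Rn n"
 unfolding rot_def by (intro measurable_lebesgue_RnI measurable_ip) measurable

lemma ip_rot: "orthonormal_system n n b ==> ip n (rot n b x) (rot n b y) = ip n x y"
 using parseval[of n b x y] by (simp add: ip_def[of n "rot n b x" "rot n b y"]) (simp add: rot_def)

text \<open>The image measure is again translation invariant because a rotation is linear and onto,
  and it gives every centred ball its old measure. The unit ball therefore forces the
  proportionality factor 1.\<close>

lemma lebesgue_Rn_rot:
 assumes b: "orthonormal_system n n b"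
 shows "distr (lebesgue_Rn n) (lebesgue_Rn n) (rot n b) = lebesgue_Rn n"
proof (rule measure_eqI)
 let ?L = "lebesgue_Rn n"
 let ?\<nu> = "distr ?L ?L (rot n b)"
 have ball: "emeasure ?\<nu> (ball_Rn n t) = emeasure ?L (ball_Rn n t)" for t
 proof -
  have "rot n b -` ball_Rn n t \<inter> space ?L = ball_Rn n t"
   by (auto simp: ball_Rn_def ip_rot[OF b]) (auto simp: rot_def space_lebesgue_Rn)
  then show ?thesis by (simp add: emeasure_distr)
 qed
 have trans: "distr ?\<nu> ?L (\<lambda>x. vadd n x y) = ?\<nu>" if y: "y \<in> space ?L" for y
 proof -
  \<comment> \<open>The preimage of y under the rotation, obtained from the transposed
    matrix.\<close>
  define y' where "y' = (\<lambda>k\<in>{..<n}. \<Sum>j<n. y j * b j k)"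
  have y': "y' \<in> space ?L" by (simp add: y'_def space_lebesgue_Rn)
  have iy: "ip n (b i) y' = y i" if "i < n" for i
  proof -
   have "ip n (b i) y' = ip n (b i) (\<lambda>k. \<Sum>j<n. y j * b j k)" by (rule ip_cong) (auto simp: y'_def)
   also have "... = (\<Sum>j<n. if i = j then y j else 0)"
    using b that by (simp add: ip_linear orthonormal_system_ip if_distrib[of "(*) _"] cong: if_cong)
   finally show ?thesis using that by (simp add: sum_rev_if)
  qed
  have eq: "vadd n (rot n b x) y = rot n b (vadd n x y')" for x
  proof -
   have "ip n (b i) (vadd n x y') = ip n (b i) (\<lambda>k. x k + y' k)" for i by (rule ip_cong) (auto simp: vadd_def)
   then show ?thesis by (auto simp: vadd_def rot_def ip_linear iy)
  qed
  have [measurable]: "(\<lambda>x. vadd n x z) \<in> ?L \<rightarrow>\<^sub>M ?L" if "z \<in> space ?L" for z using that by measurable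
  have "distr ?\<nu> ?L (\<lambda>x. vadd n x y) = distr (distr ?L ?L (\<lambda>x. vadd n x y')) ?L (rot n b)"
   using y y' by (simp add: distr_distr comp_def eq)
  then show ?thesis by (simp add: lebesgue_Rn_translate[OF y'])
 qed
 fix A assume "A \<in> sets ?\<nu>"
 then have A: "A \<in> sets ?L" by simp
 have "(\<lambda>k\<in>{..<n}. - x k) \<in> ball_Rn n 1 \<longleftrightarrow> x \<in> ball_Rn n 1" if "x \<in> space ?L" for x
  using that by (auto simp: ball_Rn_def ip_def space_lebesgue_Rn)
 from translation_invariant_measure_eq[OF _ _ trans A ball_Rn_sets this] ball emeasure_ball_Rn_finite
 have "emeasure ?\<nu> A * emeasure ?L (ball_Rn n 1) = emeasure ?L A * emeasure ?L (ball_Rn n 1)" by simp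
 then show "emeasure ?\<nu> A = emeasure ?L A" using emeasure_unit_ball_pos[of n] emeasure_ball_Rn_finite[of n 1]
  by (simp add: ennreal_mult_right_cancel)
qed simp

definition vscale :: "nat => real => (nat => real) => (nat => real)" where
 "vscale n t x = (\<lambda>k\<in>{..<n}. t * x k)"

lemma measurable_vscale [measurable]:
 assumes [measurable]: "f \<in> M \<rightarrow>\<^sub>M lebesgue_Rn n" "t \<in> borel_measurable M"
 shows "(\<lambda>w. vscale n (t w) (f w)) \<in> M \<rightarrow>\<^sub>M lebesgue_Rn n"
 unfolding vscale_def by (intro measurable_lebesgue_RnI borel_measurable_times) measurable

lemma ip_vscale: "ip n (vscale n t x) (vscale n t x) = t^2 * ip n x x"
 by (simp add: ip_def vscale_def sum_distrib_left power2_eq_square mult_ac)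

text \<open>The same uniqueness argument as for rotations; the factor is read off from the cube of
  half side t, whose preimage is the cube of half side 1.\<close>

lemma emeasure_lebesgue_Rn_vscale:
 assumes t: "t > 0" and A: "A \<in> sets (lebesgue_Rn n)"
 shows "emeasure (lebesgue_Rn n) A = ennreal (t ^ n) * emeasure (lebesgue_Rn n) (vscale n t -` A \<inter> space (lebesgue_Rn n))"
proof -
 let ?L = "lebesgue_Rn n"
 have [measurable]: "vscale n t \<in> ?L \<rightarrow>\<^sub>M ?L" by measurable
 let ?\<nu> = "distr ?L ?L (vscale n t)"
 have trans: "distr ?\<nu> ?L (\<lambda>x. vadd n x y) = ?\<nu>" if y: "y \<in> space ?L" for y
 proof -
  have eq: "vadd n (vscale n t x) y = vscale n t (vadd n x (vscale n (1/t) y))" for x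
   using t by (auto simp: vadd_def vscale_def field_simps)
  have y': "vscale n (1/t) y \<in> space ?L" by (simp add: vscale_def space_lebesgue_Rn)
  have [measurable]: "(\<lambda>x. vadd n x z) \<in> ?L \<rightarrow>\<^sub>M ?L" if "z \<in> space ?L" for z using that by measurable
  have "distr ?\<nu> ?L (\<lambda>x. vadd n x y) = distr (distr ?L ?L (\<lambda>x. vadd n x (vscale n (1/t) y))) ?L (vscale n t)"
   using y y' by (simp add: distr_distr comp_def eq)
  then show ?thesis by (simp add: lebesgue_Rn_translate[OF y'])
 qed
 have fin: "emeasure ?\<nu> (ball_Rn n N) < \<infinity>" for N
 proof -
  have "vscale n t -` ball_Rn n N \<inter> space ?L = ball_Rn n (N / t^2)"
   using t by (auto simp: ball_Rn_def ip_vscale field_simps) (auto simp: vscale_def space_lebesgue_Rn)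
  then show ?thesis using emeasure_ball_Rn_finite by (simp add: emeasure_distr)
 qed
 let ?F = "Pi\<^sub>E {..<n} (\<lambda>_. {-t..t})"
 have F: "(\<lambda>k\<in>{..<n}. - x k) \<in> ?F \<longleftrightarrow> x \<in> ?F" if "x \<in> space ?L" for x
 proof -
  have "(\<lambda>k\<in>{..<n}. - x k) \<in> ?F \<longleftrightarrow> (\<forall>k\<in>{..<n}. - x k \<in> {-t..t})" unfolding PiE_iff by (auto simp del: atLeastAtMost_iff)
  moreover have "x \<in> ?F \<longleftrightarrow> (\<forall>k\<in>{..<n}. x k \<in> {-t..t})" using that unfolding PiE_iff space_lebesgue_Rn by blast
  moreover have "- u \<in> {-t..t} \<longleftrightarrow> u \<in> {-t..t}" for u by auto
  ultimately show ?thesis by (simp only:)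
 qed
 have "vscale n t -` ?F \<inter> space ?L = Pi\<^sub>E {..<n} (\<lambda>_. {-1..1})"
 proof (intro set_eqI)
  fix x
  have "t * u \<in> {-t..t} \<longleftrightarrow> u \<in> {-1..1}" for u using t mult_le_cancel_left_pos[of t "-1" u] mult_le_cancel_left_pos[of t u 1] by simp
  then show "x \<in> vscale n t -` ?F \<inter> space ?L \<longleftrightarrow> x \<in> Pi\<^sub>E {..<n} (\<lambda>_. {-1..1})"
   by (simp add: vscale_def space_lebesgue_Rn PiE_iff del: atLeastAtMost_iff)
 qed
 then have "emeasure ?\<nu> ?F = ennreal (2 ^ n)" by (simp add: emeasure_distr emeasure_cube[of 1, simplified])
 with translation_invariant_measure_eq[OF _ fin trans A cube_in_sets F] t
 have "emeasure ?\<nu> A * ennreal ((2 * t) ^ n) = emeasure ?L A * ennreal (2 ^ n)" by (simp add: emeasure_cube del: ennreal_power)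
 also have "ennreal ((2 * t) ^ n) = ennreal (t ^ n) * ennreal (2 ^ n)"
  using t by (simp add: power_mult_distrib ennreal_mult[symmetric] mult.commute)
 finally have "(emeasure ?\<nu> A * ennreal (t ^ n)) * ennreal (2 ^ n) = emeasure ?L A * ennreal (2 ^ n)" by (simp only: mult.assoc)
 then have "emeasure ?\<nu> A * ennreal (t ^ n) = emeasure ?L A" by (subst (asm) ennreal_mult_right_cancel) auto
 with A show ?thesis by (simp add: emeasure_distr mult.commute)
qed

subsection \<open>The volume of a simplex\<close>

text \<open>Gram-Schmidt without normalisation. A vanishing earlier vector gets the coefficient x /
  0 = 0, so the recursion also makes sense for linearly dependent families.\<close>

fun gs :: "nat => (nat => nat => real) => nat => (nat => real)" where
 "gs n v j = (\<lambda>k. v j k - (\<Sum>i<j. (ip n (v j) (gs n v i) / ip n (gs n v i) (gs n v i)) * gs n v i k))"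

declare gs.simps [simp del]

lemma ip_null_right: "ip n w w = 0 ==> ip n x w = 0" unfolding ip_def[of n x w] by (rule sum.neutral) (use ip_eq_0D[of n w] in auto)

lemma gs_orth: "i < j ==> ip n (gs n v j) (gs n v i) = 0"
proof (induction j arbitrary: i rule: less_induct)
 case (less j)
 have orth: "ip n (gs n v l) (gs n v i) = 0" if "l < j" "l \<noteq> i" for l
 proof (cases "i < l")
  case True
  then show ?thesis using less.IH that by blast
 next
  case False
  then have "ip n (gs n v i) (gs n v l) = 0" using less.IH[of i l] less.prems that by simp
  then show ?thesis by (simp add: ip_commute[of n "gs n v l"])
 qed
 have "ip n (gs n v j) (gs n v i)
   = ip n (v j) (gs n v i) - (\<Sum>l<j. ip n (v j) (gs n v l) / ip n (gs n v l) (gs n v l) * ip n (gs n v l) (gs n v i))"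
  by (subst gs.simps) (simp add: ip_linear del: times_divide_eq_left)
 also have "(\<Sum>l<j. ip n (v j) (gs n v l) / ip n (gs n v l) (gs n v l) * ip n (gs n v l) (gs n v i))
   = (\<Sum>l<j. if l = i then ip n (v j) (gs n v i) else 0)" using orth ip_null_right[of n "gs n v i" "v j"] by (intro sum.cong) auto
 also have "... = ip n (v j) (gs n v i)" using less.prems by simp
 finally show ?case by simp
qed

lemma gs_orth': "i \<noteq> j ==> ip n (gs n v j) (gs n v i) = 0"
 using gs_orth[of i j n v] gs_orth[of j i n v] ip_commute[of n "gs n v j" "gs n v i"] by (cases "i < j") auto

lemma gs_expansion: "\<exists>c. v j = (\<lambda>k. gs n v j k + (\<Sum>i<j. c i * gs n v i k))"
 by (rule exI[of _ "\<lambda>i. ip n (v j) (gs n v i) / ip n (gs n v i) (gs n v i)"])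
   (simp add: gs.simps[of n v j])

lemma gs_orth_source: "i < j ==> ip n (gs n v j) (v i) = 0"
proof -
 assume "i < j"
 obtain c where c: "v i = (\<lambda>k. gs n v i k + (\<Sum>l<i. c l * gs n v l k))" using gs_expansion by blast
 show ?thesis by (subst c) (use \<open>i < j\<close> in \<open>simp add: ip_linear gs_orth\<close>)
qed

lemma span_combine:
 fixes f :: "nat => nat => real"
 assumes "\<And>i. i < j ==> \<exists>c. \<forall>k. f i k = (\<Sum>l<j. c l * v l k)"
 shows "\<exists>c. \<forall>k. (\<Sum>i<j. d i * f i k) = (\<Sum>l<j. c l * v l k)"
proof -
 from assms obtain c where c: "\<And>i k. i < j ==> f i k = (\<Sum>l<j. c i l * v l k)" by metis
 have "(\<Sum>i<j. d i * f i k) = (\<Sum>l<j. (\<Sum>i<j. d i * c i l) * v l k)" for k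
 proof -
  have "(\<Sum>i<j. d i * f i k) = (\<Sum>i<j. \<Sum>l<j. d i * c i l * v l k)" by (intro sum.cong) (auto simp: c sum_distrib_left mult.assoc)
  also have "... = (\<Sum>l<j. (\<Sum>i<j. d i * c i l) * v l k)" by (subst sum.swap) (simp add: sum_distrib_right)
  finally show ?thesis .
 qed
 then show ?thesis by (intro exI[of _ "\<lambda>l. \<Sum>i<j. d i * c i l"] allI)
qed

lemma gs_span: "\<exists>c. \<forall>k. gs n v j k = v j k - (\<Sum>i<j. c i * v i k)"
proof (induction j rule: less_induct)
 case (less j)
 have "\<exists>c. \<forall>k. gs n v i k = (\<Sum>l<j. c l * v l k)" if i: "i < j" for i
 proof -
  from less[OF i] obtain c where c: "\<And>k. gs n v i k = v i k - (\<Sum>l<i. c l * v l k)" by blast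
  let ?c = "\<lambda>l. if l < i then - c l else if l = i then 1 else 0"
  have "gs n v i k = (\<Sum>l<j. ?c l * v l k)" for k
  proof -
   have "{..<j} = {..<i} \<union> {i} \<union> {i<..<j}" using i by auto
   then have "(\<Sum>l<j. ?c l * v l k) = (\<Sum>l\<in>{..<i} \<union> {i} \<union> {i<..<j}. ?c l * v l k)" by simp
   also have "... = (\<Sum>l<i. ?c l * v l k) + (\<Sum>l\<in>{i}. ?c l * v l k) + (\<Sum>l\<in>{i<..<j}. ?c l * v l k)"
    by (subst sum.union_disjoint, simp, simp, force, subst sum.union_disjoint) auto
   also have "(\<Sum>l\<in>{i}. ?c l * v l k) = v i k" by simp
   also have "(\<Sum>l\<in>{i<..<j}. ?c l * v l k) = 0" by (rule sum.neutral) auto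
   also have "(\<Sum>l<i. ?c l * v l k) = - (\<Sum>l<i. c l * v l k)" by (simp add: sum_negf)
   finally show ?thesis by (simp add: c)
  qed
  then show ?thesis by (intro exI[of _ ?c]) blast
 qed
 from span_combine[where f="gs n v" and d="\<lambda>i. ip n (v j) (gs n v i) / ip n (gs n v i) (gs n v i)", OF this]
 obtain c where "\<forall>k. (\<Sum>i<j. ip n (v j) (gs n v i) / ip n (gs n v i) (gs n v i) * gs n v i k) = (\<Sum>l<j. c l * v l k)" by blast
 then show ?case by (subst gs.simps) (auto intro!: exI[of _ c])
qed

text \<open>The difference of two such vectors lies in the span of the earlier vectors and is
  orthogonal to it.\<close>

lemma gs_unique:
 assumes u: "\<And>k. k < n ==> u k = v j k - (\<Sum>i<j. c i * v i k)"
  and orth: "\<And>i. i < j ==> ip n u (v i) = 0" and k: "k < n"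
 shows "u k = gs n v j k"
proof -
 obtain e where e: "\<And>k. gs n v j k = v j k - (\<Sum>i<j. e i * v i k)" using gs_span by blast
 define d where "d = (\<lambda>k. u k - gs n v j k)"
 have d: "d k = (\<Sum>i<j. (e i - c i) * v i k)" if "k < n" for k using that by (simp add: d_def u e algebra_simps sum_subtractf)
 have "ip n d d = ip n d (\<lambda>k. \<Sum>i<j. (e i - c i) * v i k)" by (rule ip_cong) (auto simp: d)
 also have "... = 0" by (simp add: ip_linear) (auto intro!: sum.neutral simp: d_def ip_linear orth gs_orth_source)
 finally have "d k = 0" using ip_eq_0D k by blast
 then show ?thesis by (simp add: d_def)
qed

lemma ip_isometry:
 assumes "orthonormal_system n r u"
 shows "ip n (\<lambda>k. \<Sum>l<r. a l * u l k) (\<lambda>k. \<Sum>l<r. b l * u l k) = ip r a b"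
proof -
 have "ip n (\<lambda>k. \<Sum>l<r. a l * u l k) (\<lambda>k. \<Sum>l<r. b l * u l k)
   = (\<Sum>l<r. b l * (\<Sum>i<r. a i * ip n (u i) (u l)))" by (simp only: ip_linear)
 also have "... = (\<Sum>l<r. b l * (\<Sum>i<r. if l = i then a i else 0))"
  using assms by (intro sum.cong arg_cong2[where f="(*)"] refl) (auto simp: orthonormal_system_ip)
 also have "... = ip r a b" by (simp add: sum_rev_if ip_def mult.commute)
 finally show ?thesis .
qed

text \<open>Gram-Schmidt is built from inner products and linear combinations, and the embedding of
  r-space by the orthonormal system \<open>u\<close> preserves both.\<close>

lemma gs_isometry:
 assumes u: "orthonormal_system n r u"
  and v: "\<And>i k. k < n ==> v i k = (\<Sum>l<r. w i l * u l k)" and "k < n"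
 shows "gs n v j k = (\<Sum>l<r. gs r w j l * u l k)" using \<open>k < n\<close>
proof (induction j arbitrary: k rule: less_induct)
 case (less j)
 have 1: "ip n (gs n v i) (gs n v i) = ip r (gs r w i) (gs r w i)" if "i < j" for i
 proof -
  have "ip n (gs n v i) (gs n v i) = ip n (\<lambda>k. \<Sum>l<r. gs r w i l * u l k) (\<lambda>k. \<Sum>l<r. gs r w i l * u l k)"
   using less.IH[OF that] by (intro ip_cong) auto
  then show ?thesis by (simp add: ip_isometry[OF u])
 qed
 have 2: "ip n (v j) (gs n v i) = ip r (w j) (gs r w i)" if "i < j" for i
 proof -
  have "ip n (v j) (gs n v i) = ip n (\<lambda>k. \<Sum>l<r. w j l * u l k) (\<lambda>k. \<Sum>l<r. gs r w i l * u l k)"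
   using less.IH[OF that] v by (intro ip_cong) auto
  then show ?thesis by (simp add: ip_isometry[OF u])
 qed
 have "gs n v j k = v j k - (\<Sum>i<j. ip r (w j) (gs r w i) / ip r (gs r w i) (gs r w i) * (\<Sum>l<r. gs r w i l * u l k))"
  by (subst gs.simps) (auto intro!: sum.cong simp: 1 2 less)
 also have "... = (\<Sum>l<r. gs r w j l * u l k)"
  apply (simp add: gs.simps[of r w j] v[OF less.prems] left_diff_distrib sum_subtractf sum_distrib_right sum_distrib_left mult.assoc)
  apply (rule sum.swap)
  done
 finally show ?case .
qed

lemma gs_isometry_norm:
 assumes u: "orthonormal_system n r u"
  and v: "\<And>i k. k < n ==> v i k = (\<Sum>l<r. w i l * u l k)"
 shows "ip n (gs n v j) (gs n v j) = ip r (gs r w j) (gs r w j)"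
proof -
 have "ip n (gs n v j) (gs n v j) = ip n (\<lambda>k. \<Sum>l<r. gs r w j l * u l k) (\<lambda>k. \<Sum>l<r. gs r w j l * u l k)"
  using gs_isometry[OF u v] by (intro ip_cong) auto
 then show ?thesis by (simp add: ip_isometry[OF u])
qed

definition gs_norm :: "nat => (nat => nat => real) => nat => real" where
 "gs_norm n v j = sqrt (ip n (gs n v j) (gs n v j))"

lemma gs_norm_nonneg [simp]: "gs_norm n v j \<ge> 0" by (simp add: gs_norm_def)

text \<open>Normalise the nonzero Gram-Schmidt vectors, at their own indices, and extend. At an
  index with a zero vector the factor \<open>gs_norm\<close> is 0, so any basis vector is allowed
  there.\<close>

lemma gs_adapted_basis:
 assumes "r \<le> n"
 obtains b where "orthonormal_system n n b"
  "\<forall>j<r. \<forall>k<n. gs n v j k = gs_norm n v j * b j k"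
proof -
 define J where "J = {j. j < r \<and> gs_norm n v j \<noteq> 0}"
 define u where "u j = (\<lambda>k. (1 / gs_norm n v j) * gs n v j k)" for j
 have "orthonormal_on n J u" unfolding orthonormal_on_def
 proof (intro ballI)
  fix i j assume ij: "i \<in> J" "j \<in> J"
  have "ip n (u i) (u j) = (1 / gs_norm n v i) * ((1 / gs_norm n v j) * ip n (gs n v i) (gs n v j))"
   unfolding u_def by (simp only: ip_scale_left ip_scale_right)
  with ij show "ip n (u i) (u j) = (if i = j then 1 else 0)" by (auto simp: gs_orth' J_def gs_norm_def)
 qed
 moreover have "J \<subseteq> {..<n}" using assms by (auto simp: J_def)
 ultimately obtain b where b: "orthonormal_system n n b" "\<forall>j\<in>J. b j = u j" using orthonormal_on_extend by blast
 show thesis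
 proof (rule that[OF b(1)], intro allI impI)
  fix j k assume jk: "j < r" "k < n"
  show "gs n v j k = gs_norm n v j * b j k"
  proof (cases "gs_norm n v j = 0")
   case True
   with ip_eq_0D[of n "gs n v j" k] jk show ?thesis by (simp add: gs_norm_def)
  next
   case False
   with b(2) jk show ?thesis by (simp add: J_def u_def)
  qed
 qed
qed

text \<open>Each \<open>v j\<close> is a combination of the vectors \<open>gs n v i\<close> with i
  \<le> j, and these are multiples of \<open>b i\<close>. So in the adapted basis the family is a
  triangular matrix with the Gram-Schmidt norms on the diagonal, and a zero on the diagonal empties
  its whole column.\<close>

lemma gs_adapted_coord:
 assumes b: "orthonormal_system n n b"
  and g: "\<forall>j<r. \<forall>k<n. gs n v j k = gs_norm n v j * b j k"
  and "r \<le> n" "j < r" "k < n"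
 shows "k > j ==> ip n (b k) (v j) = 0" "k = j ==> ip n (b k) (v j) = gs_norm n v j"
  "gs_norm n v k = 0 ==> k < r ==> ip n (b k) (v j) = 0"
proof -
 obtain c where c: "v j = (\<lambda>k. gs n v j k + (\<Sum>i<j. c i * gs n v i k))" using gs_expansion by blast
 have bg: "ip n (b k) (gs n v i) = (if k = i then gs_norm n v i else 0)" if "i < r" for i
 proof -
  have "ip n (b k) (gs n v i) = ip n (b k) (\<lambda>k. gs_norm n v i * b i k)" using that g by (intro ip_cong) auto
  then show ?thesis using b that assms by (simp add: ip_scale_right orthonormal_system_ip)
 qed
 have *: "ip n (b k) (v j) = (if k = j then gs_norm n v j else 0) + (\<Sum>i<j. c i * (if k = i then gs_norm n v i else 0))"
  by (subst c) (use assms in \<open>auto simp: ip_linear bg intro!: sum.cong\<close>)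
 show "k > j ==> ip n (b k) (v j) = 0" "k = j ==> ip n (b k) (v j) = gs_norm n v j" unfolding * by (auto intro!: sum.neutral)
 show "gs_norm n v k = 0 ==> k < r ==> ip n (b k) (v j) = 0" unfolding * by (auto intro!: sum.neutral)
qed

text \<open>Membership in the image of \<open>{c. c \<ge> 0, sum c \<le> s}\<close> under a triangular matrix, by back
 substitution.\<close>

fun tri_simplex :: "(nat => nat => real) => nat => real => (nat => real) => bool" where
 "tri_simplex a 0 s x \<longleftrightarrow> 0 \<le> s"
| "tri_simplex a (Suc m) s x \<longleftrightarrow> 0 \<le> x m \<and> tri_simplex a m (s - x m / a m m) (\<lambda>k. x k - x m / a m m * a m k)"

lemma tri_simplex_cong: "(\<And>k. k < m ==> x k = y k) ==> tri_simplex a m s x = tri_simplex a m s y"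
proof (induction m arbitrary: s x y)
 case (Suc m)
 have m: "x m = y m" by (rule Suc.prems) simp
 have "tri_simplex a m (s - y m / a m m) (\<lambda>k. x k - y m / a m m * a m k)
   = tri_simplex a m (s - y m / a m m) (\<lambda>k. y k - y m / a m m * a m k)" by (rule Suc.IH) (simp add: Suc.prems)
 then show ?case unfolding tri_simplex.simps m by (rule arg_cong)
qed simp

lemma tri_simplex_iff:
 assumes "\<And>j k. j < m ==> k < m ==> j < k ==> a j k = 0" "\<And>j. j < m ==> a j j > 0"
 shows "tri_simplex a m s x \<longleftrightarrow>
  (\<exists>c. (\<forall>j<m. 0 \<le> c j) \<and> (\<Sum>j<m. c j) \<le> s \<and> (\<forall>k<m. x k = (\<Sum>j<m. c j * a j k)))" using assms
proof (induction m arbitrary: s x)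
 case (Suc m)
 have am: "a m m > 0" using Suc.prems by simp
 have IH: "tri_simplex a m s x \<longleftrightarrow>
  (\<exists>c. (\<forall>j<m. 0 \<le> c j) \<and> (\<Sum>j<m. c j) \<le> s \<and> (\<forall>k<m. x k = (\<Sum>j<m. c j * a j k)))" for s x using Suc.prems by (rule Suc.IH) auto
 show ?case
 proof
  assume L: "tri_simplex a (Suc m) s x"
  then obtain c where c: "\<forall>j<m. 0 \<le> c j" "(\<Sum>j<m. c j) \<le> s - x m / a m m"
   "\<forall>k<m. x k - x m / a m m * a m k = (\<Sum>j<m. c j * a j k)" by (auto simp: IH)
  let ?c = "c(m := x m / a m m)"
  have "x k = (\<Sum>j<Suc m. ?c j * a j k)" if "k < Suc m" for k
  proof (cases "k = m")
   case True
   have "(\<Sum>j<m. ?c j * a j k) = 0" using Suc.prems(1) True by (intro sum.neutral) auto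
   then show ?thesis using True am by simp
  next
   case False
   then have "k < m" using that by simp
   with c(3) have "x k - x m / a m m * a m k = (\<Sum>j<m. c j * a j k)" by blast
   also have "... = (\<Sum>j<m. ?c j * a j k)" by (intro sum.cong) auto
   finally show ?thesis by simp
  qed
  moreover have "(\<Sum>j<m. ?c j) = (\<Sum>j<m. c j)" by (intro sum.cong) auto
  then have "(\<Sum>j<Suc m. ?c j) \<le> s" using c(2) by simp
  moreover have "0 \<le> x m" using L by simp
  then have "0 \<le> ?c j" if "j < Suc m" for j using that c(1) am by (cases "j = m") auto
  ultimately show "\<exists>c. (\<forall>j<Suc m. 0 \<le> c j) \<and> (\<Sum>j<Suc m. c j) \<le> s \<and> (\<forall>k<Suc m. x k = (\<Sum>j<Suc m. c j * a j k))"
   by (intro exI[of _ ?c] conjI allI impI) blast+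
 next
  assume "\<exists>c. (\<forall>j<Suc m. 0 \<le> c j) \<and> (\<Sum>j<Suc m. c j) \<le> s \<and> (\<forall>k<Suc m. x k = (\<Sum>j<Suc m. c j * a j k))"
  then obtain c where c: "\<forall>j<Suc m. 0 \<le> c j" "(\<Sum>j<Suc m. c j) \<le> s"
   "\<And>k. k < Suc m ==> x k = (\<Sum>j<Suc m. c j * a j k)" by blast
  \<comment> \<open>Triangularity: the last coordinate determines \<open>c m\<close> alone, which
    starts the back substitution.\<close>
  have "(\<Sum>j<m. c j * a j m) = 0" using Suc.prems(1) by (intro sum.neutral) auto
  with c(3)[of m] have xm: "x m = c m * a m m" by simp
  then have q: "x m / a m m = c m" using am by simp
  have "0 \<le> x m" using xm c(1) am by simp
  moreover have "tri_simplex a m (s - x m / a m m) (\<lambda>k. x k - x m / a m m * a m k)" unfolding IH q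
  proof (intro exI[of _ c] conjI allI impI)
   show "0 \<le> c j" if "j < m" for j using c(1) that by simp
   show "(\<Sum>j<m. c j) \<le> s - c m" using c(2) by simp
   show "x k - c m * a m k = (\<Sum>j<m. c j * a j k)" if "k < m" for k using c(3)[of k] that by simp
  qed
  ultimately show "tri_simplex a (Suc m) s x" by simp
 qed
qed simp

lemma measurable_tri_simplex [measurable]:
 assumes "\<And>k. k < m ==> (\<lambda>w. x w k) \<in> borel_measurable M" "s \<in> borel_measurable M"
 shows "Measurable.pred M (\<lambda>w. tri_simplex a m (s w) (x w))" using assms
proof (induction m arbitrary: s x)
 case 0
 note 0(2)[measurable]
 show ?case by simp
next
 case (Suc m)
 note Suc.prems(2)[measurable]
 have [measurable]: "(\<lambda>w. x w k) \<in> borel_measurable M" if "k < Suc m" for k using Suc.prems(1) that .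
 have "Measurable.pred M (\<lambda>w. tri_simplex a m (s w - x w m / a m m) (\<lambda>k. x w k - x w m / a m m * a m k))" by (rule Suc.IH) measurable
 then show ?case by simp
qed

text \<open>Fubini in the last coordinate: the slice at y is a translate of the lower-dimensional
  set with s reduced by y / a m m, and integrating its volume over y raises the power and the
  factorial by one.\<close>

lemma emeasure_tri_simplex:
 assumes "\<And>j. j < m ==> a j j > 0"
 shows "emeasure (lebesgue_Rn m) {x \<in> space (lebesgue_Rn m). tri_simplex a m s x}
  = ennreal (if s \<ge> 0 then s ^ m * (\<Prod>j<m. a j j) / fact m else 0)" using assms
proof (induction m arbitrary: s)
 case 0
 have "emeasure (lebesgue_Rn 0) {\<lambda>_. undefined} = 1" by (simp add: lebesgue_Rn_def)
 then show ?case by (auto simp: space_lebesgue_Rn)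
next
 case (Suc m)
 let ?L = "lebesgue_Rn m"
 define p where "p = (\<Prod>j<m. a j j)"
 have p: "p > 0" unfolding p_def using Suc.prems by (intro prod_pos) auto
 have am: "a m m > 0" using Suc.prems by simp
 have meas [measurable]: "{x \<in> space (lebesgue_Rn i). tri_simplex a i s x} \<in> sets (lebesgue_Rn i)" for i s by measurable
 have "emeasure (lebesgue_Rn (Suc m)) {x \<in> space (lebesgue_Rn (Suc m)). tri_simplex a (Suc m) s x}
   = (\<integral>\<^sup>+x. indicator {x \<in> space (lebesgue_Rn (Suc m)). tri_simplex a (Suc m) s x} x \<partial>lebesgue_Rn (Suc m))"
  by (subst nn_integral_indicator) (use meas[of "Suc m" s] in auto)
 also have "... = (\<integral>\<^sup>+y. (\<integral>\<^sup>+x. indicator {x \<in> space (lebesgue_Rn (Suc m)). tri_simplex a (Suc m) s x} (x(m := y)) \<partial>?L) \<partial>lborel)"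
  unfolding lebesgue_Rn_def lessThan_Suc by (rule lborel_product.product_nn_integral_insert_rev)
    (use meas[of "Suc m" s] in \<open>auto simp: lebesgue_Rn_def lessThan_Suc intro!: borel_measurable_indicator\<close>)
 also have "... = (\<integral>\<^sup>+y. ennreal ((s - y / a m m) ^ m * p / fact m) * indicator {0..s * a m m} y \<partial>lborel)"
 proof (rule nn_integral_cong)
  fix y :: real
  \<comment> \<open>The shift caused by the multiple y / a m m of row m, to be removed by
    translation invariance.\<close>
  define z where "z = (\<lambda>k\<in>{..<m}. - (y / a m m * a m k))"
  have z: "z \<in> space ?L" by (simp add: z_def space_lebesgue_Rn)
  have "(\<integral>\<^sup>+x. indicator {x \<in> space (lebesgue_Rn (Suc m)). tri_simplex a (Suc m) s x} (x(m := y)) \<partial>?L)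
    = (\<integral>\<^sup>+x. indicator {0..} y * indicator {x \<in> space ?L. tri_simplex a m (s - y / a m m) x} (vadd m x z) \<partial>?L)"
  proof (rule nn_integral_cong)
   fix x assume "x \<in> space ?L"
   have "tri_simplex a m (s - y / a m m) (\<lambda>k. (x(m := y)) k - y / a m m * a m k)
     \<longleftrightarrow> tri_simplex a m (s - y / a m m) (vadd m x z)" by (rule tri_simplex_cong) (auto simp: vadd_def z_def)
   then show "indicator {x \<in> space (lebesgue_Rn (Suc m)). tri_simplex a (Suc m) s x} (x(m := y))
    = (indicator {0..} y * indicator {x \<in> space ?L. tri_simplex a m (s - y / a m m) x} (vadd m x z) :: ennreal)"
    using \<open>x \<in> space ?L\<close> by (auto simp: indicator_def space_lebesgue_Rn vadd_def PiE_iff extensional_def)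
  qed
  also have "... = indicator {0..} y * (\<integral>\<^sup>+x. indicator {x \<in> space ?L. tri_simplex a m (s - y / a m m) x} (vadd m x z) \<partial>?L)"
   using z by (intro nn_integral_cmult) measurable
  also have "(\<integral>\<^sup>+x. indicator {x \<in> space ?L. tri_simplex a m (s - y / a m m) x} (vadd m x z) \<partial>?L)
    = (\<integral>\<^sup>+x. indicator {x \<in> space ?L. tri_simplex a m (s - y / a m m) x} x \<partial>distr ?L ?L (\<lambda>x. vadd m x z))"
   using z by (subst nn_integral_distr) auto
  also have "... = emeasure ?L {x \<in> space ?L. tri_simplex a m (s - y / a m m) x}" by (simp add: lebesgue_Rn_translate[OF z])
  also have "... = ennreal (if s - y / a m m \<ge> 0 then (s - y / a m m) ^ m * p / fact m else 0)"
   unfolding p_def using Suc.prems by (rule Suc.IH) auto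
  also have "indicator {0..} y * ennreal (if s - y / a m m \<ge> 0 then (s - y / a m m) ^ m * p / fact m else 0)
    = ennreal ((s - y / a m m) ^ m * p / fact m) * indicator {0..s * a m m} y" using am by (auto simp: indicator_def field_simps)
  finally show "(\<integral>\<^sup>+x. indicator {x \<in> space (lebesgue_Rn (Suc m)). tri_simplex a (Suc m) s x} (x(m := y)) \<partial>?L)
    = ennreal ((s - y / a m m) ^ m * p / fact m) * indicator {0..s * a m m} y" .
 qed
 also have "... = ennreal (if s \<ge> 0 then s ^ Suc m * (\<Prod>j<Suc m. a j j) / fact (Suc m) else 0)"
 proof (cases "s \<ge> 0")
  case True
  \<comment> \<open>An antiderivative in y of the slice volume; it vanishes at the upper end s * a m
    m.\<close>
  define F where "F = (\<lambda>y. - (a m m * p / fact (Suc m)) * (s - y / a m m) ^ Suc m)"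
  have "(\<integral>\<^sup>+y. ennreal ((s - y / a m m) ^ m * p / fact m) * indicator {0..s * a m m} y \<partial>lborel)
    = ennreal (F (s * a m m) - F 0)"
  proof (rule nn_integral_FTC_Icc)
   fix y assume y': "y \<in> {0..s * a m m}"
   then have y: "0 \<le> y" "y \<le> s * a m m" by auto
   show "(F has_real_derivative (s - y / a m m) ^ m * p / fact m) (at y)"
   proof -
    have 1: "((\<lambda>y. s - y / a m m) has_real_derivative - (1 / a m m)) (at y)" using am by (auto intro!: derivative_eq_intros)
    have "((\<lambda>y. (s - y / a m m) ^ Suc m) has_real_derivative (1 + real m) * (- (1 / a m m) * (s - y / a m m) ^ m)) (at y)"
     using DERIV_power[OF 1, of "Suc m"] by simp
    from DERIV_cmult[OF this, of "- (a m m * p / fact (Suc m))"]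
    have "(F has_real_derivative - (a m m * p / fact (Suc m)) * ((1 + real m) * (- (1 / a m m) * (s - y / a m m) ^ m))) (at y)"
     unfolding F_def .
    also have "- (a m m * p / fact (Suc m)) * ((1 + real m) * (- (1 / a m m) * (s - y / a m m) ^ m))
      = (s - y / a m m) ^ m * p / fact m" using am by (simp add: fact_Suc divide_simps)
    finally show ?thesis .
   qed
   show "0 \<le> (s - y / a m m) ^ m * p / fact m" using y am p by (auto simp: field_simps)
  qed (use True am in auto)
  also have "F (s * a m m) - F 0 = s ^ Suc m * (\<Prod>j<Suc m. a j j) / fact (Suc m)" using am by (simp add: F_def p_def)
  finally show ?thesis using True by simp
 next
  case False
  then have "s * a m m < 0" using am by (simp add: mult_neg_pos)
  then show ?thesis using False by simp
 qed
 finally show ?case .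
qed

text \<open>The vertices are numbered from 1 and the edges from 0, so edge j joins
  \<open>P 1\<close> to \<open>P (j + 2)\<close>.\<close>

definition edge :: "(nat => nat => real) => nat => nat => real" where
 "edge P j = (\<lambda>k. P (j + 2) k - P 1 k)"

lemma sum_vertices:
 fixes f :: "nat => real"
 shows "(\<Sum>i\<in>{1..r+1}. f i) = f 1 + (\<Sum>j<r. f (j + 2))" by (induction r) auto

text \<open>Eliminating the barycentric coefficient of \<open>P 1\<close> turns the equation for the
  sum of the coefficients into an inequality.\<close>

lemma simplex_hull_edges:
 "simplex_hull n {1..r+1} P =
  {x. \<exists>c. (\<forall>j<r. 0 \<le> c j) \<and> (\<Sum>j<r. c j) \<le> 1 \<and> x = (\<lambda>k\<in>{..<n}. P 1 k + (\<Sum>j<r. c j * edge P j k))}"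
 (is "?A = ?B")
proof (intro set_eqI iffI)
 fix x assume "x \<in> ?A"
 then obtain c where c: "\<forall>i\<in>{1..r+1}. 0 \<le> c i" "(\<Sum>i\<in>{1..r+1}. c i) = 1"
  and x: "x = (\<lambda>k\<in>{..<n}. \<Sum>i\<in>{1..r+1}. c i * P i k)" unfolding simplex_hull_def by blast
 from c(2) have c1: "c 1 = 1 - (\<Sum>j<r. c (j + 2))" unfolding sum_vertices by simp
 have "(\<Sum>i\<in>{1..r+1}. c i * P i k) = P 1 k + (\<Sum>j<r. c (j+2) * edge P j k)" for k unfolding sum_vertices c1
  by (simp add: edge_def algebra_simps sum_subtractf sum_distrib_left sum_distrib_right)
 moreover have "(\<Sum>j<r. c (j + 2)) \<le> 1" using c1 c(1) by force
 ultimately show "x \<in> ?B" using c(1) by (intro CollectI exI[of _ "\<lambda>j. c (j + 2)"]) (auto simp: x)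
next
 fix x assume "x \<in> ?B"
 then obtain c where c: "\<forall>j<r. 0 \<le> c j" "(\<Sum>j<r. c j) \<le> 1"
  and x: "x = (\<lambda>k\<in>{..<n}. P 1 k + (\<Sum>j<r. c j * edge P j k))" by blast
 define d where "d i = (if i = 1 then 1 - (\<Sum>j<r. c j) else c (i - 2))" for i
 have d: "d 1 = 1 - (\<Sum>j<r. c j)" "d (j + 2) = c j" for j by (auto simp: d_def)
 have "(\<Sum>i\<in>{1..r+1}. d i * P i k) = P 1 k + (\<Sum>j<r. c j * edge P j k)" for k unfolding sum_vertices d
  by (simp add: edge_def algebra_simps sum_subtractf sum_distrib_left sum_distrib_right)
 moreover have "(\<Sum>i\<in>{1..r+1}. d i) = 1" unfolding sum_vertices d by simp
 moreover have "0 \<le> d i" if "i \<in> {1..r+1}" for i using that c by (cases "i = 1") (auto simp: d_def)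
 ultimately show "x \<in> ?A" unfolding simplex_hull_def by (intro CollectI exI[of _ d]) (simp add: x)
qed

text \<open>If \<open>A\<close> is not measurable, \<open>measure\<close> returns 0 by convention.
  This covers degenerate simplices through the hyperplane containing them.\<close>

lemma measure_subset_null_eq_0:
 assumes "A \<subseteq> N" "N \<in> sets M" "emeasure M N = 0"
 shows "measure M A = 0"
proof (cases "A \<in> sets M")
 case True
 then show ?thesis using emeasure_mono[OF assms(1,2)] assms(3) by (simp add: measure_def)
qed (rule measure_notin_sets)

text \<open>The volume of the parallelepiped spanned by \<open>v 0, ..., v (r - 1)\<close>, as
  iterated base times height.\<close>

definition gs_volume :: "nat => nat => (nat => nat => real) => real" where
 "gs_volume n r v = (\<Prod>j<r. gs_norm n v j)"

lemma emeasure_hyperplane: "j < r ==> emeasure (lebesgue_Rn r) {x \<in> space (lebesgue_Rn r). x j = 0} = 0"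
proof -
 assume j: "j < r"
 have "{x \<in> space (lebesgue_Rn r). x j = 0} = Pi\<^sub>E {..<r} (\<lambda>k. if k = j then {0} else (UNIV :: real set))"
 proof (intro set_eqI iffI)
  fix x assume "x \<in> {x \<in> space (lebesgue_Rn r). x j = 0}"
  then show "x \<in> Pi\<^sub>E {..<r} (\<lambda>k. if k = j then {0} else (UNIV :: real set))" unfolding space_lebesgue_Rn by (intro PiE_I) auto
 next
  fix x assume x: "x \<in> Pi\<^sub>E {..<r} (\<lambda>k. if k = j then {0} else (UNIV :: real set))"
  have "x j \<in> {0}" using PiE_mem[OF x, of j] j by simp
  moreover have "x \<in> space (lebesgue_Rn r)" unfolding space_lebesgue_Rn using x by (intro PiE_I) auto
  ultimately show "x \<in> {x \<in> space (lebesgue_Rn r). x j = 0}" by simp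
 qed
 also have "emeasure (lebesgue_Rn r) ... = (\<Prod>k<r. emeasure lborel (if k = j then {0} else UNIV :: real set))"
  unfolding lebesgue_Rn_def by (intro lborel_product.emeasure_PiM) auto
 also have "... = 0" using j by (intro prod_zero) auto
 finally show ?thesis .
qed

text \<open>Moving \<open>P 1\<close> to the origin and rotating into the adapted basis maps the
  hull to a \<open>tri_simplex\<close> set with the Gram-Schmidt norms on the diagonal, or into a
  coordinate hyperplane if one of these norms is 0. Both motions preserve Lebesgue measure.\<close>

lemma measure_full_simplex:
 "measure (lebesgue_Rn r) (simplex_hull r {1..r+1} P) = gs_volume r r (edge P) / fact r"
proof -
 let ?L = "lebesgue_Rn r"
 let ?v = "edge P"
 obtain b where b: "orthonormal_system r r b"
  and g: "\<forall>j<r. \<forall>k<r. gs r ?v j k = gs_norm r ?v j * b j k" using gs_adapted_basis[of r r ?v] by auto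
 note coord = gs_adapted_coord[OF b g order.refl]
 define a where "a j k = ip r (b k) (?v j)" for j k
 define z where "z = (\<lambda>k\<in>{..<r}. - P 1 k)"
 have z: "z \<in> space ?L" by (simp add: z_def space_lebesgue_Rn)
 define \<phi> where "\<phi> x = rot r b (vadd r x z)" for x
 have \<phi>_meas [measurable]: "\<phi> \<in> ?L \<rightarrow>\<^sub>M ?L" unfolding \<phi>_def using z by (intro measurable_compose[OF _ measurable_rot]) measurable
 have \<phi>_distr: "distr ?L ?L \<phi> = ?L"
 proof -
  have "distr ?L ?L \<phi> = distr (distr ?L ?L (\<lambda>x. vadd r x z)) ?L (rot r b)"
   using z by (subst distr_distr) (auto simp: \<phi>_def[abs_def] comp_def)
  then show ?thesis by (simp add: lebesgue_Rn_translate[OF z] lebesgue_Rn_rot[OF b])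
 qed
 have \<phi>_emeasure: "emeasure ?L (\<phi> -` E \<inter> space ?L) = emeasure ?L E" if "E \<in> sets ?L" for E
  using that by (subst (2) \<phi>_distr[symmetric], subst emeasure_distr) auto
 have \<phi>_coord: "\<phi> x k = ip r (b k) (\<lambda>l. x l - P 1 l)" if "k < r" for x k
  using that by (simp add: \<phi>_def rot_def) (rule ip_cong, auto simp: vadd_def z_def)
 have \<phi>_hull: "\<phi> x k = (\<Sum>j<r. c j * a j k)"
  if "x = (\<lambda>k\<in>{..<r}. P 1 k + (\<Sum>j<r. c j * ?v j k))" "k < r" for x k c
 proof -
  have "\<phi> x k = ip r (b k) (\<lambda>l. \<Sum>j<r. c j * ?v j l)" unfolding \<phi>_coord[OF that(2)] that(1) by (rule ip_cong) auto
  then show ?thesis by (simp add: ip_linear a_def)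
 qed
 show ?thesis
 proof (cases "\<exists>j<r. gs_norm r ?v j = 0")
  case True
  then obtain j where j: "j < r" "gs_norm r ?v j = 0" by blast
  have aj: "a i j = 0" if "i < r" for i unfolding a_def using coord(3)[OF that j(1) j(2) j(1)] .
  let ?H = "{x \<in> space ?L. x j = 0}"
  have H: "?H \<in> sets ?L" using j by measurable
  have "simplex_hull r {1..r+1} P \<subseteq> \<phi> -` ?H \<inter> space ?L"
  proof
   fix x assume "x \<in> simplex_hull r {1..r+1} P"
   then obtain c where x: "x = (\<lambda>k\<in>{..<r}. P 1 k + (\<Sum>j<r. c j * ?v j k))" unfolding simplex_hull_edges by blast
   have "\<phi> x j = 0" unfolding \<phi>_hull[OF x j(1)] by (rule sum.neutral) (use aj in auto)
   moreover have "x \<in> space ?L" by (simp add: x space_lebesgue_Rn)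
   ultimately show "x \<in> \<phi> -` ?H \<inter> space ?L" using measurable_space[OF \<phi>_meas] by auto
  qed
  then have "measure ?L (simplex_hull r {1..r+1} P) = 0" by (rule measure_subset_null_eq_0)
     (use \<phi>_emeasure[OF H] measurable_sets[OF \<phi>_meas H] emeasure_hyperplane[OF j(1)] in auto)
  moreover have "gs_volume r r ?v = 0" unfolding gs_volume_def using j by (intro prod_zero) auto
  ultimately show ?thesis by simp
 next
  case False
  then have pos: "a j j > 0" if "j < r" for j using coord(2)[OF that that refl] that gs_norm_nonneg[of r ?v j]
   by (auto simp: a_def less_le)
  have tri: "a j k = 0" if "j < r" "k < r" "j < k" for j k unfolding a_def using coord(1)[OF that(1,2,3)] .
  let ?E = "{x \<in> space ?L. tri_simplex a r 1 x}"
  have E: "?E \<in> sets ?L" by measurable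
  have "simplex_hull r {1..r+1} P = \<phi> -` ?E \<inter> space ?L"
  proof (intro set_eqI iffI)
   fix x assume "x \<in> simplex_hull r {1..r+1} P"
   then obtain c where c: "\<forall>j<r. 0 \<le> c j" "(\<Sum>j<r. c j) \<le> 1"
    and x: "x = (\<lambda>k\<in>{..<r}. P 1 k + (\<Sum>j<r. c j * ?v j k))" unfolding simplex_hull_edges by blast
   have "tri_simplex a r 1 (\<phi> x)" using c \<phi>_hull[OF x] by (subst tri_simplex_iff[OF tri pos]) (auto intro!: exI[of _ c])
   moreover have "x \<in> space ?L" by (simp add: x space_lebesgue_Rn)
   ultimately show "x \<in> \<phi> -` ?E \<inter> space ?L" using measurable_space[OF \<phi>_meas] by auto
  next
   fix x assume x: "x \<in> \<phi> -` ?E \<inter> space ?L"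
   then obtain c where c: "\<forall>j<r. 0 \<le> c j" "(\<Sum>j<r. c j) \<le> 1"
    "\<forall>k<r. \<phi> x k = (\<Sum>j<r. c j * a j k)" by (auto simp: tri_simplex_iff[OF tri pos])
   define y where "y = (\<lambda>l. (x l - P 1 l) - (\<Sum>j<r. c j * ?v j l))"
   have y0: "ip r (b k) y = 0" if "k < r" for k using c(3) that by (simp add: y_def ip_linear \<phi>_coord a_def)
   have "y l = 0" if "l < r" for l using expansion[OF b that, of y] y0 by simp
   then have "x = (\<lambda>k\<in>{..<r}. P 1 k + (\<Sum>j<r. c j * ?v j k))"
    using x by (auto simp: space_lebesgue_Rn PiE_iff extensional_def y_def fun_eq_iff algebra_simps)
   then show "x \<in> simplex_hull r {1..r+1} P" unfolding simplex_hull_edges using c by blast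
  qed
  then have "measure ?L (simplex_hull r {1..r+1} P) = measure ?L ?E" using \<phi>_emeasure[OF E] by (simp add: measure_def)
  also have "... = (\<Prod>j<r. a j j) / fact r"
  proof -
   have "emeasure ?L ?E = ennreal (if 0 \<le> (1::real) then 1 ^ r * (\<Prod>j<r. a j j) / fact r else 0)"
    by (rule emeasure_tri_simplex) (rule pos)
   moreover have "0 \<le> (\<Prod>j<r. a j j)" by (rule prod_nonneg) (auto intro: less_imp_le pos)
   ultimately show ?thesis by (simp add: measure_def)
  qed
  also have "(\<Prod>j<r. a j j) = gs_volume r r ?v" unfolding gs_volume_def a_def using coord(2) by (intro prod.cong) auto
  finally show ?thesis .
 qed
qed

lemma flat_chart_inj:
 assumes "orthonormal_system n r u" "t \<in> space (lebesgue_Rn r)" "t' \<in> space (lebesgue_Rn r)"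
  "flat_chart n r p u t = flat_chart n r p u t'"
 shows "t = t'"
proof -
 define d where "d i = t i - t' i" for i
 have "ip n (\<lambda>k. \<Sum>i<r. d i * u i k) (\<lambda>k. \<Sum>i<r. d i * u i k) = 0"
 proof -
  have "(\<Sum>i<r. d i * u i k) = 0" if "k < n" for k using fun_cong[OF assms(4), of k] that
   by (simp add: flat_chart_def d_def left_diff_distrib sum_subtractf)
  then show ?thesis by (simp add: ip_def)
 qed
 then have "ip r d d = 0" by (simp add: ip_isometry[OF assms(1)])
 then have "t k = t' k" if "k < r" for k using ip_eq_0D[of r d k] that by (simp add: d_def)
 then show ?thesis using assms(2,3) unfolding space_lebesgue_Rn by (intro PiE_ext) auto
qed

lemma simplex_vertex_in_hull:
 assumes "i \<in> {1..r+1}"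
 shows "(\<lambda>k\<in>{..<n}. P i k) \<in> simplex_hull n {1..r+1} P" unfolding simplex_hull_def using assms
 by (intro CollectI exI[of _ "\<lambda>j. if j = i then 1 else 0"])
   (auto simp: if_distrib[of "\<lambda>t. t * _"] cong: if_cong)

text \<open>The description behind \<open>THE\<close> has one value: a chart pulls the hull back to
  the hull of the coordinate vectors of the vertices, and these have the same Gram-Schmidt norms for
  every chart. The adapted basis provides a chart, so a value exists.\<close>

theorem simplex_volume_eq:
 assumes "r \<le> n"
 shows "simplex_volume n r P = gs_volume n r (edge P) / fact r"
proof -
 let ?S = "simplex_hull n {1..r+1} P"
 have unique: "measure (lebesgue_Rn r) {t \<in> space (lebesgue_Rn r). flat_chart n r p u t \<in> ?S}
   = gs_volume n r (edge P) / fact r"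
  if u: "orthonormal_system n r u" and sub: "?S \<subseteq> flat_chart n r p u ` space (lebesgue_Rn r)" for p u
 proof -
  have "\<forall>i\<in>{1..r+1}. \<exists>t\<in>space (lebesgue_Rn r). (\<lambda>k\<in>{..<n}. P i k) = flat_chart n r p u t"
   using simplex_vertex_in_hull[where n=n and P=P and r=r] sub by blast
  then obtain \<tau> where \<tau>: "\<And>i. i \<in> {1..r+1} ==> \<tau> i \<in> space (lebesgue_Rn r)"
   "\<And>i. i \<in> {1..r+1} ==> (\<lambda>k\<in>{..<n}. P i k) = flat_chart n r p u (\<tau> i)" by metis
  have Pk: "P i k = p k + (\<Sum>l<r. \<tau> i l * u l k)" if "i \<in> {1..r+1}" "k < n" for i k
   using fun_cong[OF \<tau>(2)[OF that(1)], of k] that(2) by (simp add: flat_chart_def)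
  \<comment> \<open>\<open>gs_isometry_norm\<close> wants coordinates for the vectors at all
    indices, while the chart only supplies them for the given vertices; beyond index r both families
    are set to 0.\<close>
  define w where "w j = (if j < r then edge \<tau> j else (\<lambda>_. 0))" for j
  define v where "v j = (if j < r then edge P j else (\<lambda>_. 0))" for j
  have vw: "v j k = (\<Sum>l<r. w j l * u l k)" if "k < n" for j k using that Pk[of "j+2" k] Pk[of 1 k]
   by (auto simp: v_def w_def edge_def left_diff_distrib sum_subtractf)
  have gcong: "gs_norm m f j = gs_norm m (\<lambda>j. if j < r then f j else (\<lambda>_. 0)) j" if "j < r" for m f j
  proof -
   have "gs m f j = gs m (\<lambda>j. if j < r then f j else (\<lambda>_. 0)) j" if "j < r" for j using that
   proof (induction j rule: less_induct)
    case (less j)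
    then show ?case by (subst (1 2) gs.simps) (auto intro!: sum.cong)
   qed
   with that show ?thesis by (simp add: gs_norm_def)
  qed
  have "gs_volume n r (edge P) = (\<Prod>j<r. gs_norm n v j)" unfolding gs_volume_def v_def by (intro prod.cong gcong) auto
  also have "... = (\<Prod>j<r. gs_norm r w j)" by (simp add: gs_norm_def gs_isometry_norm[OF u vw])
  also have "... = gs_volume r r (edge \<tau>)" unfolding gs_volume_def w_def by (intro prod.cong gcong[symmetric]) auto
  finally have vol: "gs_volume n r (edge P) = gs_volume r r (edge \<tau>)" .
  have chart: "flat_chart n r p u (\<lambda>l\<in>{..<r}. \<tau> 1 l + (\<Sum>j<r. c j * edge \<tau> j l))
    = (\<lambda>k\<in>{..<n}. P 1 k + (\<Sum>j<r. c j * edge P j k))" for c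
  proof
   fix k
   show "flat_chart n r p u (\<lambda>l\<in>{..<r}. \<tau> 1 l + (\<Sum>j<r. c j * edge \<tau> j l)) k
    = (\<lambda>k\<in>{..<n}. P 1 k + (\<Sum>j<r. c j * edge P j k)) k"
   proof (cases "k < n")
    case True
    have "(\<Sum>j<r. c j * edge P j k) = (\<Sum>j<r. c j * (\<Sum>l<r. edge \<tau> j l * u l k))"
    proof (intro sum.cong refl arg_cong2[where f="(*)"])
     fix j assume "j \<in> {..<r}"
     then show "edge P j k = (\<Sum>l<r. edge \<tau> j l * u l k)" using vw[OF True, of j] by (simp add: v_def w_def)
    qed
    also have "... = (\<Sum>l<r. (\<Sum>j<r. c j * edge \<tau> j l) * u l k)"
     by (simp add: sum_distrib_left sum_distrib_right mult.assoc) (rule sum.swap)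
    finally show ?thesis using True by (simp add: flat_chart_def Pk distrib_right sum.distrib)
   qed (simp add: flat_chart_def)
  qed
  have "{t \<in> space (lebesgue_Rn r). flat_chart n r p u t \<in> ?S} = simplex_hull r {1..r+1} \<tau>"
  proof (intro set_eqI iffI)
   fix t assume t: "t \<in> {t \<in> space (lebesgue_Rn r). flat_chart n r p u t \<in> ?S}"
   then obtain c where c: "\<forall>j<r. 0 \<le> c j" "(\<Sum>j<r. c j) \<le> 1"
    "flat_chart n r p u t = (\<lambda>k\<in>{..<n}. P 1 k + (\<Sum>j<r. c j * edge P j k))" unfolding simplex_hull_edges by blast
   have "t = (\<lambda>l\<in>{..<r}. \<tau> 1 l + (\<Sum>j<r. c j * edge \<tau> j l))"
   proof (rule flat_chart_inj[OF u])
    show "t \<in> space (lebesgue_Rn r)" using t by simp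
    show "flat_chart n r p u t = flat_chart n r p u (\<lambda>l\<in>{..<r}. \<tau> 1 l + (\<Sum>j<r. c j * edge \<tau> j l))" unfolding chart c(3) ..
   qed (simp add: space_lebesgue_Rn)
   with c show "t \<in> simplex_hull r {1..r+1} \<tau>" unfolding simplex_hull_edges by blast
  next
   fix t assume "t \<in> simplex_hull r {1..r+1} \<tau>"
   then obtain c where c: "\<forall>j<r. 0 \<le> c j" "(\<Sum>j<r. c j) \<le> 1"
    "t = (\<lambda>l\<in>{..<r}. \<tau> 1 l + (\<Sum>j<r. c j * edge \<tau> j l))" unfolding simplex_hull_edges by blast
   have "flat_chart n r p u t \<in> ?S" unfolding c(3) chart simplex_hull_edges using c by blast
   moreover have "t \<in> space (lebesgue_Rn r)" by (simp add: c(3) space_lebesgue_Rn)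
   ultimately show "t \<in> {t \<in> space (lebesgue_Rn r). flat_chart n r p u t \<in> ?S}" by simp
  qed
  then show ?thesis by (simp only: measure_full_simplex vol)
 qed
 obtain b where b: "orthonormal_system n n b"
  and g: "\<forall>j<r. \<forall>k<n. gs n (edge P) j k = gs_norm n (edge P) j * b j k" using gs_adapted_basis[OF assms] by metis
 \<comment> \<open>The first r vectors of the adapted basis span a space containing all edges, so
   they serve as directions of a chart at \<open>P 1\<close>.\<close>
 have br: "orthonormal_system n r b" using b assms by (simp add: orthonormal_system_ip)
 have sub: "?S \<subseteq> flat_chart n r (P 1) b ` space (lebesgue_Rn r)"
 proof
  fix x assume "x \<in> ?S"
  then obtain c where x: "x = (\<lambda>k\<in>{..<n}. P 1 k + (\<Sum>j<r. c j * edge P j k))" unfolding simplex_hull_edges by blast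
  define y where "y = (\<lambda>k. \<Sum>j<r. c j * edge P j k)"
  have "ip n (b l) y = 0" if "l < n" "r \<le> l" for l unfolding y_def ip_linear
   by (rule sum.neutral) (use gs_adapted_coord(1)[OF b g assms _ that(1)] that in auto)
  then have "(\<Sum>i<n. ip n (b i) y * b i k) = (\<Sum>i<r. ip n (b i) y * b i k)" for k using assms by (intro sum.mono_neutral_right) auto
  then have y: "y k = (\<Sum>i<r. ip n (b i) y * b i k)" if "k < n" for k using expansion[OF b that, of y] by simp
  have "x = flat_chart n r (P 1) b (\<lambda>i\<in>{..<r}. ip n (b i) y)"
   unfolding x flat_chart_def by (rule restrict_ext) (use y in \<open>simp add: y_def\<close>)
  moreover have "(\<lambda>i\<in>{..<r}. ip n (b i) y) \<in> space (lebesgue_Rn r)" by (simp add: space_lebesgue_Rn)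
  ultimately show "x \<in> flat_chart n r (P 1) b ` space (lebesgue_Rn r)" by blast
 qed
 show ?thesis unfolding simplex_volume_def flat_volume_def
 proof (rule the_equality)
  show "\<exists>p u. orthonormal_system n r u \<and> ?S \<subseteq> flat_chart n r p u ` space (lebesgue_Rn r) \<and>
   gs_volume n r (edge P) / fact r = measure (lebesgue_Rn r) {t \<in> space (lebesgue_Rn r). flat_chart n r p u t \<in> ?S}"
   using br sub unique[OF br sub] by (intro exI[of _ "P 1"] exI[of _ b]) auto
 qed (use unique in auto)
qed

subsection \<open>The volume as the end of a Markov chain\<close>

lemma ip_div: "ip n (\<lambda>k. y k / d) x = ip n y x / d" "ip n x (\<lambda>k. y k / d) = ip n x y / d" by (simp_all add: ip_def sum_divide_distrib)

definition gs_sq :: "nat => (nat => nat => real) => nat => real" where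
 "gs_sq n v j = ip n (gs n v j) (gs n v j)"

lemma gs_sq_nonneg [simp]: "0 \<le> gs_sq n v j" by (simp add: gs_sq_def)

text \<open>The vector in the span of \<open>v 0, ..., v (j - 1)\<close> having inner product \<open>1\<close> with each of them; its
 squared norm is the inverse squared distance of the origin from their affine hull.\<close>

primrec dual_vec :: "nat => (nat => nat => real) => nat => nat => real" where
 "dual_vec n v 0 = (\<lambda>k. 0)"
| "dual_vec n v (Suc j) = (\<lambda>k. dual_vec n v j k + (1 - ip n (dual_vec n v j) (v j)) / gs_sq n v j * gs n v j k)"

definition dual_sq :: "nat => (nat => nat => real) => nat => real" where
 "dual_sq n v j = ip n (dual_vec n v j) (dual_vec n v j)"

lemma dual_sq_nonneg [simp]: "0 \<le> dual_sq n v j" by (simp add: dual_sq_def)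

lemma dual_vec_span: "\<exists>c. \<forall>k. dual_vec n v j k = (\<Sum>i<j. c i * v i k)"
proof (induction j)
 case (Suc j)
 then obtain c where c: "\<And>k. dual_vec n v j k = (\<Sum>i<j. c i * v i k)" by blast
 obtain e where e: "\<And>k. gs n v j k = v j k - (\<Sum>i<j. e i * v i k)" using gs_span by blast
 define a where "a = (1 - ip n (dual_vec n v j) (v j)) / gs_sq n v j"
 have "dual_vec n v (Suc j) k = (\<Sum>i<Suc j. (if i = j then a else c i - a * e i) * v i k)" for k
 proof -
  have "(\<Sum>i<Suc j. (if i = j then a else c i - a * e i) * v i k) = (\<Sum>i<j. (c i - a * e i) * v i k) + a * v j k" by simp
  also have "... = dual_vec n v (Suc j) k" by (simp add: a_def[symmetric] c e algebra_simps sum_subtractf sum_distrib_left)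
  finally show ?thesis ..
 qed
 then show ?case by (intro exI[of _ "\<lambda>i. if i = j then a else c i - a * e i"] allI)
qed simp

lemma dual_vec_gs: "i \<le> j ==> ip n (dual_vec n v i) (gs n v j) = 0"
proof -
 assume "i \<le> j"
 obtain c where c: "\<And>k. dual_vec n v i k = (\<Sum>l<i. c l * v l k)" using dual_vec_span by blast
 have "ip n (dual_vec n v i) (gs n v j) = (\<Sum>l<i. c l * ip n (v l) (gs n v j))" unfolding c[abs_def] by (simp add: ip_linear)
 also have "... = 0" using \<open>i \<le> j\<close> by (intro sum.neutral) (auto simp: ip_commute[of n _ "gs n v j"] gs_orth_source)
 finally show ?thesis .
qed

lemma gs_dual_vec: "i \<le> j ==> ip n (gs n v j) (dual_vec n v i) = 0" using dual_vec_gs by (simp add: ip_commute[of n "gs n v j"])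

lemma gs_source_self: "ip n (gs n v j) (v j) = gs_sq n v j"
proof -
 obtain c where c: "v j = (\<lambda>k. gs n v j k + (\<Sum>i<j. c i * gs n v i k))" using gs_expansion by blast
 show ?thesis by (subst c) (simp add: ip_linear gs_orth gs_sq_def)
qed

lemma dual_vec_source:
 assumes "\<And>i. i < j ==> gs_sq n v i \<noteq> 0" "i < j"
 shows "ip n (dual_vec n v j) (v i) = 1" using assms
proof (induction j)
 case (Suc j)
 show ?case
 proof (cases "i = j")
  case True
  then show ?thesis using Suc.prems(1)[of j] by (simp add: ip_linear ip_div gs_source_self)
 next
  case False
  then show ?thesis using Suc by (simp add: ip_linear ip_div gs_orth_source)
 qed
qed simp

text \<open>Pythagoras: the increment of the dual vector is a multiple of \<open>gs n v j\<close>,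
  which is orthogonal to \<open>dual_vec n v j\<close>.\<close>

lemma dual_sq_Suc:
 "dual_sq n v (Suc j) = dual_sq n v j + (1 - ip n (dual_vec n v j) (v j))^2 / gs_sq n v j"
proof -
 define a where "a = (1 - ip n (dual_vec n v j) (v j)) / gs_sq n v j"
 have "dual_sq n v (Suc j) = dual_sq n v j + a * (a * gs_sq n v j)" unfolding dual_sq_def dual_vec.simps a_def[symmetric]
  by (simp add: ip_linear ip_div dual_vec_gs gs_dual_vec gs_sq_def algebra_simps)
 also have "a * (a * gs_sq n v j) = (1 - ip n (dual_vec n v j) (v j))^2 / gs_sq n v j" by (simp add: a_def power2_eq_square)
 finally show ?thesis .
qed

lemma dual_sq_pos:
 assumes "\<And>i. i < j ==> gs_sq n v i \<noteq> 0" "0 < j"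
 shows "dual_sq n v j > 0"
proof (rule ccontr)
 assume "\<not> ?thesis"
 then have "ip n (dual_vec n v j) (dual_vec n v j) = 0" using dual_sq_nonneg[of n v j] unfolding dual_sq_def by linarith
 from ip_null_right[OF this, of "v 0"] dual_vec_source[OF assms(1) assms(2)] show False by (simp add: ip_commute)
qed

text \<open>The height of edge j over the earlier edges is the distance of \<open>v (Suc j)\<close>
  from the affine hull of \<open>v 0, ..., v j\<close>. It exceeds the distance from their linear
  span by a component along the dual vector, orthogonal to the linear residual.\<close>

lemma gs_sq_edges:
 fixes v :: "nat => nat => real" and n j :: nat
 defines "e \<equiv> \<lambda>j k. v (Suc j) k - v 0 k"
 assumes nd: "\<And>i. i \<le> Suc j ==> gs_sq n v i \<noteq> 0"
 shows "gs_sq n e j = gs_sq n v (Suc j) * dual_sq n v (Suc (Suc j)) / dual_sq n v (Suc j)"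
proof -
 define J where "J = Suc j"
 let ?z = "dual_vec n v J"
 define q where "q = dual_sq n v J"
 define s where "s = ip n ?z (v J)"
 have q: "q > 0" unfolding q_def J_def using nd by (intro dual_sq_pos) auto
 have z1: "ip n ?z (v i) = 1" if "i < J" for i using that nd by (intro dual_vec_source) (auto simp: J_def)
 obtain c where c: "\<And>k. gs n v J k = v J k - (\<Sum>i<J. c i * v i k)" using gs_span by blast
 obtain d where d: "\<And>k. ?z k = (\<Sum>i<J. d i * v i k)" using dual_vec_span by blast
 have dsum: "(\<Sum>i<J. d i) = q"
 proof -
  have "q = ip n ?z (\<lambda>k. \<Sum>i<J. d i * v i k)" unfolding q_def dual_sq_def by (subst (2) d[abs_def]) simp
  then show ?thesis by (simp add: ip_linear z1)
 qed
 have csum: "(\<Sum>i<J. c i) = s"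
 proof -
  have "0 = ip n ?z (gs n v J)" by (simp add: dual_vec_gs)
  also have "... = s - (\<Sum>i<J. c i)" unfolding c[abs_def] by (simp add: ip_linear z1 s_def)
  finally show ?thesis by simp
 qed
 \<comment> \<open>The multiple of the dual vector is chosen so that the subtracted combination has
   coefficient sum 1, that is, lies in the affine hull: the linear part has sum \<open>s\<close>,
   and the dual vector itself has sum \<open>q\<close>.\<close>
 define u where "u = (\<lambda>k. gs n v J k - (1 - s) / q * ?z k)"
 define f where "f i = c i + (1 - s) / q * d i" for i
 have fsum: "(\<Sum>i<J. f i) = 1"
 proof -
  have "(\<Sum>i<J. f i) = (\<Sum>i<J. c i) + (1 - s) / q * (\<Sum>i<J. d i)" unfolding f_def by (simp only: sum.distrib sum_distrib_left)
  then show ?thesis using q by (simp add: csum dsum)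
 qed
 have uf: "u k = v J k - (\<Sum>i<J. f i * v i k)" for k by (simp add: u_def c d f_def algebra_simps sum.distrib sum_distrib_left)
 have u: "u k = e j k - (\<Sum>i<j. f (Suc i) * e i k)" for k
 proof -
  have "(\<Sum>i<J. f i * v i k) = (\<Sum>i<J. f i * (v i k - v 0 k)) + (\<Sum>i<J. f i) * v 0 k"
   by (simp add: right_diff_distrib sum_subtractf sum_distrib_right)
  also have "(\<Sum>i<J. f i * (v i k - v 0 k)) = (\<Sum>i<j. f (Suc i) * e i k)" unfolding J_def e_def by (subst sum.lessThan_Suc_shift) simp
  finally show ?thesis unfolding uf fsum by (simp add: e_def J_def)
 qed
 have orth: "ip n u (e i) = 0" if "i < j" for i
 proof -
  have "Suc i < J" "0 < J" using that by (auto simp: J_def)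
  then show ?thesis unfolding u_def e_def by (simp add: ip_linear ip_div z1 gs_orth_source)
 qed
 have "gs n e j k = u k" if "k < n" for k using gs_unique[of n u e j "\<lambda>i. f (Suc i)", OF u orth that] by simp
 then have "gs_sq n e j = ip n u u" unfolding gs_sq_def by (intro ip_cong) auto
 also have "... = gs_sq n v J + ((1 - s) / q) * ((1 - s) / q * q)" unfolding u_def
  by (simp add: ip_linear ip_div dual_vec_gs gs_dual_vec gs_sq_def q_def dual_sq_def)
 also have "... = gs_sq n v J * dual_sq n v (Suc J) / q" unfolding dual_sq_Suc[of n v J] q_def[symmetric] s_def[symmetric]
  using q nd[of J] by (simp add: J_def field_simps power2_eq_square)
 finally show ?thesis by (simp add: J_def q_def)
qed

text \<open>The ratios of \<open>dual_sq\<close> in \<open>gs_sq_edges\<close> telescope, starting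
  from \<open>dual_sq n v 1 = 1 / gs_sq n v 0\<close>.\<close>

lemma gs_volume_edges:
 assumes nd: "\<And>i. i \<le> r ==> gs_sq n v i \<noteq> 0"
 shows "(gs_volume n r (\<lambda>j k. v (Suc j) k - v 0 k))^2 = dual_sq n v (Suc r) * (\<Prod>i<Suc r. gs_sq n v i)" using assms
proof (induction r)
 case 0
 have "dual_sq n v (Suc 0) = 1 / gs_sq n v 0" by (simp add: dual_sq_Suc) (simp add: dual_sq_def ip_def)
 with 0 show ?case by (simp add: gs_volume_def)
next
 case (Suc r)
 let ?e = "\<lambda>j k. v (Suc j) k - v 0 k"
 have q: "dual_sq n v (Suc r) > 0" using Suc.prems by (intro dual_sq_pos) auto
 have "(gs_volume n (Suc r) ?e)^2 = (gs_volume n r ?e)^2 * gs_sq n ?e r"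
  by (simp add: gs_volume_def power_mult_distrib gs_norm_def gs_sq_def)
 also have "... = dual_sq n v (Suc (Suc r)) * (\<Prod>i<Suc (Suc r). gs_sq n v i)" using q Suc.prems by (simp add: Suc.IH gs_sq_edges)
 finally show ?case .
qed

lemma gs_volume_nonneg [simp]: "gs_volume n r v \<ge> 0" unfolding gs_volume_def by (intro prod_nonneg) auto

lemma gs_cong: "(\<And>i. i \<le> j ==> v i = v' i) ==> gs n v j = gs n v' j"
proof (induction j rule: less_induct)
 case (less j)
 have "gs n v i = gs n v' i" if "i < j" for i by (rule less.IH[OF that]) (use that less.prems in simp)
 then show ?case unfolding gs.simps[of n v j] gs.simps[of n v' j] less.prems[OF order.refl]
  by (intro ext arg_cong2[where f="(-)"] refl sum.cong) auto
qed

lemma dual_vec_cong: "(\<And>i. i < j ==> v i = v' i) ==> dual_vec n v j = dual_vec n v' j"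
proof (induction j)
 case (Suc j)
 have "gs n v j = gs n v' j" by (rule gs_cong) (simp add: Suc.prems)
 moreover have "dual_vec n v j = dual_vec n v' j" by (rule Suc.IH) (simp add: Suc.prems)
 ultimately show ?case using Suc.prems[of j] by (simp add: gs_sq_def)
qed simp

lemma measurable_gs:
 assumes "\<And>i k. i \<le> j ==> k < n ==> (\<lambda>w. v w i k) \<in> borel_measurable M" "k < n"
 shows "(\<lambda>w. gs n (v w) j k) \<in> borel_measurable M" using assms
proof (induction j arbitrary: k rule: less_induct)
 case (less j)
 have [measurable]: "(\<lambda>w. gs n (v w) i k) \<in> borel_measurable M" if "i < j" "k < n" for i k
  by (rule less.IH[OF that(1)]) (use that less.prems in auto)
 have [measurable]: "(\<lambda>w. v w j k) \<in> borel_measurable M" if "k < n" for k using less.prems(1)[of j] that by simp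
 show ?case unfolding gs.simps[of n _ j] by (intro borel_measurable_diff borel_measurable_sum borel_measurable_times
    borel_measurable_divide measurable_ip) (use less.prems in measurable)
qed

lemma measurable_gs_sq:
 assumes "\<And>i k. i \<le> j ==> k < n ==> (\<lambda>w. v w i k) \<in> borel_measurable M"
 shows "(\<lambda>w. gs_sq n (v w) j) \<in> borel_measurable M" unfolding gs_sq_def using assms by (intro measurable_ip measurable_gs) auto

lemma measurable_dual_vec:
 assumes "\<And>i k. i < j ==> k < n ==> (\<lambda>w. v w i k) \<in> borel_measurable M" "k < n"
 shows "(\<lambda>w. dual_vec n (v w) j k) \<in> borel_measurable M" using assms
proof (induction j arbitrary: k)
 case (Suc j)
 have IH: "(\<lambda>w. dual_vec n (v w) j k) \<in> borel_measurable M" if "k < n" for k by (rule Suc.IH) (use Suc.prems that in auto)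
 show ?case unfolding dual_vec.simps by (intro borel_measurable_add IH borel_measurable_times borel_measurable_divide
    borel_measurable_diff measurable_ip measurable_gs measurable_gs_sq borel_measurable_const)
    (use Suc.prems in auto)
qed simp

lemma measurable_dual_sq:
 assumes "\<And>i k. i < j ==> k < n ==> (\<lambda>w. v w i k) \<in> borel_measurable M"
 shows "(\<lambda>w. dual_sq n (v w) j) \<in> borel_measurable M"
 unfolding dual_sq_def using assms by (intro measurable_ip measurable_dual_vec) auto

lemma measurable_gs_volume:
 assumes "\<And>i k. i < r ==> k < n ==> (\<lambda>w. v w i k) \<in> borel_measurable M"
 shows "(\<lambda>w. gs_volume n r (v w)) \<in> borel_measurable M" unfolding gs_volume_def gs_norm_def using assms
 by (intro borel_measurable_prod borel_measurable_sqrt[THEN measurable_compose[rotated]] measurable_ip measurable_gs) auto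

section \<open>The scalar chain and its law\<close>

definition tail_sq :: "nat => nat => (nat => real) => real" where
 "tail_sq n j x = (\<Sum>k\<in>{j..<n}. (x k)^2)"

lemma measurable_tail_sq [measurable]:
 "f \<in> M \<rightarrow>\<^sub>M lebesgue_Rn n ==> (\<lambda>w. tail_sq n j (f w)) \<in> borel_measurable M" unfolding tail_sq_def
 by (intro borel_measurable_sum borel_measurable_power measurable_component_lebesgue_Rn) auto

primrec chain_prod :: "nat => (nat => nat => real) => nat => real" where
 "chain_prod n v 0 = 1"
| "chain_prod n v (Suc j) = chain_prod n v j * tail_sq n j (v j)"

text \<open>The recursion \<open>dual_sq_Suc\<close> as it looks when the dual vector points along
  coordinate j - 1 and the span of the earlier points fills the first j coordinates. At j = 0 the
  index j - 1 is 0, but its factor sqrt 0 removes the term.\<close>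

primrec chain_dual :: "nat => (nat => nat => real) => nat => real" where
 "chain_dual n v 0 = 0"
| "chain_dual n v (Suc j) = chain_dual n v j + (1 - sqrt (chain_dual n v j) * v j (j - 1))^2 / tail_sq n j (v j)"

lemma chain_prod_cong: "(\<And>i. i < j ==> v i = v' i) ==> chain_prod n v j = chain_prod n v' j" by (induction j) auto

lemma chain_dual_cong: "(\<And>i. i < j ==> v i = v' i) ==> chain_dual n v j = chain_dual n v' j" by (induction j) auto

lemma measurable_chain_prod:
 "(\<And>i. i < j ==> (\<lambda>w. v w i) \<in> M \<rightarrow>\<^sub>M lebesgue_Rn n) ==> (\<lambda>w. chain_prod n (v w) j) \<in> borel_measurable M"
 by (induction j) (auto intro!: borel_measurable_times measurable_tail_sq)

lemma measurable_chain_dual: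
 assumes "\<And>i. i < j ==> (\<lambda>w. v w i) \<in> M \<rightarrow>\<^sub>M lebesgue_Rn n" "j \<le> n"
 shows "(\<lambda>w. chain_dual n (v w) j) \<in> borel_measurable M" using assms
proof (induction j)
 case (Suc j)
 have [measurable]: "(\<lambda>w. v w j) \<in> M \<rightarrow>\<^sub>M lebesgue_Rn n" using Suc.prems by simp
 have [measurable]: "(\<lambda>w. v w j (j - 1)) \<in> borel_measurable M" using Suc.prems by (intro measurable_component_lebesgue_Rn) auto
 have [measurable]: "(\<lambda>w. chain_dual n (v w) j) \<in> borel_measurable M" using Suc by auto
 show ?case unfolding chain_dual.simps by measurable
qed simp

locale rotation_invariant_law = prob_space \<mu> for \<mu> :: "(nat => real) measure" and n :: nat +
 assumes sets_\<mu> [measurable_cong]: "sets \<mu> = sets (lebesgue_Rn n)"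
  and rot_invariant: "\<And>b. orthonormal_system n n b ==> distr \<mu> (lebesgue_Rn n) (rot n b) = \<mu>"
begin

lemma nn_integral_rot:
 assumes "orthonormal_system n n b" and [measurable]: "g \<in> borel_measurable (lebesgue_Rn n)"
 shows "(\<integral>\<^sup>+y. g (rot n b y) \<partial>\<mu>) = (\<integral>\<^sup>+y. g y \<partial>\<mu>)" by (subst (2) rot_invariant[OF assms(1), symmetric], subst nn_integral_distr) auto

text \<open>For fixed \<open>x 0, ..., x (j - 1)\<close> rotate their span onto the first \<open>j\<close> coordinates so that the
 dual vector becomes a multiple of the last one of these.\<close>

lemma nn_integral_new_vertex:
 fixes x :: "nat => nat => real"
 assumes j: "j < n" and nd: "\<And>i. i < j ==> gs_sq n x i \<noteq> 0"
  and f [measurable]: "f \<in> borel_measurable (borel \<Otimes>\<^sub>M borel)"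
 shows "(\<integral>\<^sup>+y. f (gs_sq n (x(j := y)) j, ip n (dual_vec n x j) y) \<partial>\<mu>)
    = (\<integral>\<^sup>+y. f (tail_sq n j y, sqrt (dual_sq n x j) * y (j - 1)) \<partial>\<mu>)"
proof -
 define z where "z = dual_vec n x j"
 define q where "q = dual_sq n x j"
 obtain b where b: "orthonormal_system n n b"
  and g: "\<forall>i<j. \<forall>k<n. gs n x i k = gs_norm n x i * b i k" using gs_adapted_basis[of j n x] j by auto
 have gnz: "gs_norm n x i \<noteq> 0" if "i < j" for i using nd[OF that] by (simp add: gs_norm_def gs_sq_def)
 have bz: "ip n (b k) z = 0" if "j \<le> k" "k < n" for k
 proof -
  obtain c where c: "\<And>k. z k = (\<Sum>i<j. c i * x i k)" unfolding z_def using dual_vec_span by blast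
  have "ip n (b k) (x i) = 0" if "i < j" for i using gs_adapted_coord(1)[OF b g _ that \<open>k < n\<close>] that \<open>j \<le> k\<close> j by auto
  then show ?thesis unfolding c[abs_def] by (simp add: ip_linear)
 qed
 define J where "J = {j..<n} \<union> (if j = 0 then {} else {j - 1})"
 define c where "c k = (if j \<le> k then b k else (\<lambda>l. (1 / sqrt q) * z l))" for k
 have q: "q > 0" if "j \<noteq> 0" unfolding q_def using nd that by (intro dual_sq_pos) auto
 have "orthonormal_on n J c" unfolding orthonormal_on_def
 proof (intro ballI)
  fix i k assume ik: "i \<in> J" "k \<in> J"
  have zz: "ip n (\<lambda>l. (1 / sqrt q) * z l) (\<lambda>l. (1 / sqrt q) * z l) = 1" if "j \<noteq> 0"
   using q[OF that] unfolding ip_scale_left ip_scale_right by (simp add: z_def q_def[unfolded dual_sq_def, symmetric])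
  have zb: "ip n (\<lambda>l. (1 / sqrt q) * z l) (b k) = 0" "ip n (b k) (\<lambda>l. (1 / sqrt q) * z l) = 0"
   if "j \<le> k" "k < n" for k using bz[OF that] unfolding ip_scale_left ip_scale_right by (simp_all add: ip_commute)
  show "ip n (c i) (c k) = (if i = k then 1 else 0)" using ik b zz zb unfolding J_def c_def orthonormal_system_ip
   by (auto split: if_splits)
 qed
 moreover have "J \<subseteq> {..<n}" using j by (auto simp: J_def)
 ultimately obtain w where w: "orthonormal_system n n w" "\<forall>k\<in>J. w k = c k" using orthonormal_on_extend by blast
 have jn: "j - 1 < n" using j by simp
 have [measurable]: "(\<lambda>y. y (j - 1)) \<in> borel_measurable (lebesgue_Rn n)" by (rule measurable_lebesgue_Rn_component[OF jn])
 have "(\<integral>\<^sup>+y. f (tail_sq n j y, sqrt q * y (j - 1)) \<partial>\<mu>)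
   = (\<integral>\<^sup>+y. f (tail_sq n j (rot n w y), sqrt q * rot n w y (j - 1)) \<partial>\<mu>)" by (rule nn_integral_rot[OF w(1), symmetric]) measurable
 also have "... = (\<integral>\<^sup>+y. f (gs_sq n (x(j := y)) j, ip n z y) \<partial>\<mu>)"
 proof (rule nn_integral_cong, rule arg_cong[where f=f], rule arg_cong2[where f=Pair])
  fix y assume "y \<in> space \<mu>"
  let ?v = "x(j := y)"
  obtain d where d: "?v j = (\<lambda>k. gs n ?v j k + (\<Sum>i<j. d i * gs n ?v i k))" using gs_expansion by blast
  have gi: "gs n ?v i = gs n x i" if "i < j" for i using that by (intro gs_cong) auto
  have bi: "ip n (b k) (gs n x i) = (if k = i then gs_norm n x i else 0)" if "i < j" "k < n" for i k
  proof -
   have "ip n (b k) (gs n x i) = ip n (b k) (\<lambda>l. gs_norm n x i * b i l)" using g that by (intro ip_cong) auto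
   then show ?thesis using b that j by (simp add: ip_scale_right orthonormal_system_ip)
  qed
  have b1: "ip n (b k) (gs n ?v j) = ip n (b k) y" if "j \<le> k" "k < n" for k
  proof -
   have "ip n (b k) (?v j) = ip n (b k) (gs n ?v j)" by (subst d) (use that in \<open>auto simp: ip_linear gi bi intro!: sum.neutral\<close>)
   then show ?thesis by simp
  qed
  have b2: "ip n (b k) (gs n ?v j) = 0" if "k < j" for k
  proof -
   have "0 = ip n (gs n x k) (gs n ?v j)" using gs_orth[OF that, of n ?v] by (simp add: gi that ip_commute)
   also have "... = ip n (\<lambda>l. gs_norm n x k * b k l) (gs n ?v j)" using g that by (intro ip_cong) auto
   also have "... = gs_norm n x k * ip n (b k) (gs n ?v j)" by (simp add: ip_scale_left)
   finally show ?thesis using gnz[OF that] by simp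
  qed
  have "gs_sq n ?v j = (\<Sum>k<n. (ip n (b k) (gs n ?v j))^2)"
   using parseval[OF b, of "gs n ?v j" "gs n ?v j"] by (simp add: gs_sq_def power2_eq_square)
  also have "... = (\<Sum>k\<in>{j..<n}. (ip n (b k) (gs n ?v j))^2)" using b2 by (intro sum.mono_neutral_right) (auto simp: not_le)
  also have "... = (\<Sum>k\<in>{j..<n}. (ip n (b k) y)^2)" using b1 by (intro sum.cong) auto
  also have "... = tail_sq n j (rot n w y)" unfolding tail_sq_def using w(2) by (intro sum.cong) (auto simp: rot_def J_def c_def)
  finally show "tail_sq n j (rot n w y) = gs_sq n ?v j" ..
  show "sqrt q * rot n w y (j - 1) = ip n z y"
  proof (cases "j = 0")
   case True
   then show ?thesis by (simp add: q_def z_def dual_sq_def ip_def)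
  next
   case False
   then have "rot n w y (j - 1) = ip n (\<lambda>l. (1 / sqrt q) * z l) y" using w(2) jn by (auto simp: rot_def J_def c_def)
   then show ?thesis using q[OF False] unfolding ip_scale_left by simp
  qed
 qed
 finally show ?thesis by (simp add: q_def z_def)
qed

lemma chain_law:
 assumes "j \<le> n" and f: "f \<in> borel_measurable (borel \<Otimes>\<^sub>M borel)" and f0: "\<And>q. f (0, q) = (0::ennreal)"
 shows "(\<integral>\<^sup>+x. f (\<Prod>i<j. gs_sq n x i, dual_sq n x j) \<partial>(\<Pi>\<^sub>M i\<in>{..<j}. \<mu>))
    = (\<integral>\<^sup>+x. f (chain_prod n x j, chain_dual n x j) \<partial>(\<Pi>\<^sub>M i\<in>{..<j}. \<mu>))" using assms
proof (induction j arbitrary: f)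
 case 0
 then show ?case by (simp add: dual_sq_def ip_def)
next
 case (Suc j)
 note Suc.prems(2)[measurable]
 have j: "j < n" using Suc.prems by simp
 interpret P: product_sigma_finite "\<lambda>_::nat. \<mu>" by standard
 \<comment> \<open>One step of the chain from the state (d, q): t is the squared height of the new
   point over the span, s its inner product with the dual vector.\<close>
 define F where "F = (\<lambda>(d, q, t, s). f (d * t, q + (1 - s)^2 / t))"
 have Fm [measurable]: "F \<in> borel_measurable (borel \<Otimes>\<^sub>M borel \<Otimes>\<^sub>M borel \<Otimes>\<^sub>M borel)" unfolding F_def by measurable
 have jn: "j - 1 < n" using j by simp
 have c1 [measurable]: "(\<lambda>y. y (j - 1)) \<in> borel_measurable (lebesgue_Rn n)" by (rule measurable_lebesgue_Rn_component[OF jn])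
 define G where "G = (\<lambda>(d, q). \<integral>\<^sup>+y. F (d, q, tail_sq n j y, sqrt q * y (j - 1)) \<partial>\<mu>)"
 have Gm: "G \<in> borel_measurable (borel \<Otimes>\<^sub>M borel)" unfolding G_def by measurable
 have G0: "G (0, q) = 0" for q by (simp add: G_def F_def Suc.prems(3))
 have comp': "(\<lambda>w. w i) \<in> (\<Pi>\<^sub>M i\<in>{..<m}. \<mu>) \<rightarrow>\<^sub>M lebesgue_Rn n" if "i < m" for i m
 proof -
  have "(\<lambda>w. w i) \<in> (\<Pi>\<^sub>M i\<in>{..<m}. \<mu>) \<rightarrow>\<^sub>M \<mu>" using that by (intro measurable_component_singleton) auto
  then show ?thesis by (simp add: measurable_def sets_\<mu> sets_eq_imp_space_eq[OF sets_\<mu>])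
 qed
 have comp: "(\<lambda>w. w i k) \<in> borel_measurable (\<Pi>\<^sub>M i\<in>{..<m}. \<mu>)" if "i < m" "k < n" for i m k
  by (rule measurable_component_lebesgue_Rn[OF comp'[OF that(1)] that(2)])
 have m1: "(\<lambda>x. f (\<Prod>i<m. gs_sq n x i, dual_sq n x m)) \<in> borel_measurable (\<Pi>\<^sub>M i\<in>{..<m}. \<mu>)" for m
  by (rule measurable_compose[OF _ Suc.prems(2)])
    (intro measurable_Pair borel_measurable_prod measurable_gs_sq measurable_dual_sq comp; simp)
 have m2: "(\<lambda>x. f (chain_prod n x m, chain_dual n x m)) \<in> borel_measurable (\<Pi>\<^sub>M i\<in>{..<m}. \<mu>)" if "m \<le> n" for m
  by (rule measurable_compose[OF _ Suc.prems(2)])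
    (intro measurable_Pair measurable_chain_prod measurable_chain_dual comp' that; simp)
 have "(\<integral>\<^sup>+x. f (\<Prod>i<Suc j. gs_sq n x i, dual_sq n x (Suc j)) \<partial>(\<Pi>\<^sub>M i\<in>{..<Suc j}. \<mu>))
   = (\<integral>\<^sup>+x. (\<integral>\<^sup>+y. f (\<Prod>i<Suc j. gs_sq n (x(j := y)) i, dual_sq n (x(j := y)) (Suc j)) \<partial>\<mu>) \<partial>(\<Pi>\<^sub>M i\<in>{..<j}. \<mu>))"
  using m1[of "Suc j"] unfolding lessThan_Suc by (intro P.product_nn_integral_insert) auto
 also have "... = (\<integral>\<^sup>+x. G (\<Prod>i<j. gs_sq n x i, dual_sq n x j) \<partial>(\<Pi>\<^sub>M i\<in>{..<j}. \<mu>))"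
 proof (rule nn_integral_cong)
  fix x :: "nat => nat => real"
  have eq: "f (\<Prod>i<Suc j. gs_sq n (x(j := y)) i, dual_sq n (x(j := y)) (Suc j))
    = F (\<Prod>i<j. gs_sq n x i, dual_sq n x j, gs_sq n (x(j := y)) j, ip n (dual_vec n x j) y)" for y
  proof -
   have "gs_sq n (x(j := y)) i = gs_sq n x i" if "i < j" for i
    unfolding gs_sq_def using that by (simp add: gs_cong[of i "x(j := y)" x])
   moreover have "dual_vec n (x(j := y)) j = dual_vec n x j" by (rule dual_vec_cong) simp
   moreover have "dual_sq n (x(j := y)) j = dual_sq n x j" unfolding dual_sq_def using dual_vec_cong[of j "x(j := y)" x] by simp
   ultimately show ?thesis by (simp add: dual_sq_Suc F_def)
  qed
  show "(\<integral>\<^sup>+y. f (\<Prod>i<Suc j. gs_sq n (x(j := y)) i, dual_sq n (x(j := y)) (Suc j)) \<partial>\<mu>)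
    = G (\<Prod>i<j. gs_sq n x i, dual_sq n x j)"
  proof (cases "(\<Prod>i<j. gs_sq n x i) = 0")
   case True
   \<comment> \<open>A dependent family keeps the product at 0, and both sides vanish.\<close>
   show ?thesis unfolding eq True by (simp add: F_def Suc.prems(3) G0)
  next
   case False
   then have nd: "gs_sq n x i \<noteq> 0" if "i < j" for i using that by auto
   let ?f = "\<lambda>(t, s). F (\<Prod>i<j. gs_sq n x i, dual_sq n x j, t, s)"
   have "(\<integral>\<^sup>+y. ?f (gs_sq n (x(j := y)) j, ip n (dual_vec n x j) y) \<partial>\<mu>)
    = (\<integral>\<^sup>+y. ?f (tail_sq n j y, sqrt (dual_sq n x j) * y (j - 1)) \<partial>\<mu>)" by (rule nn_integral_new_vertex[OF j nd]) measurable
   then show ?thesis unfolding eq by (simp add: G_def)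
  qed
 qed
 also have "... = (\<integral>\<^sup>+x. G (chain_prod n x j, chain_dual n x j) \<partial>(\<Pi>\<^sub>M i\<in>{..<j}. \<mu>))" using Suc.prems(1) by (intro Suc.IH Gm G0) auto
 also have "... = (\<integral>\<^sup>+x. (\<integral>\<^sup>+y. f (chain_prod n (x(j := y)) (Suc j), chain_dual n (x(j := y)) (Suc j)) \<partial>\<mu>) \<partial>(\<Pi>\<^sub>M i\<in>{..<j}. \<mu>))"
 proof (rule nn_integral_cong)
  fix x :: "nat => nat => real"
  have "chain_prod n (x(j := y)) j = chain_prod n x j" "chain_dual n (x(j := y)) j = chain_dual n x j" for y
   by (intro chain_prod_cong chain_dual_cong; simp)+
  then show "G (chain_prod n x j, chain_dual n x j)
   = (\<integral>\<^sup>+y. f (chain_prod n (x(j := y)) (Suc j), chain_dual n (x(j := y)) (Suc j)) \<partial>\<mu>)" by (simp add: G_def F_def)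
 qed
 also have "... = (\<integral>\<^sup>+x. f (chain_prod n x (Suc j), chain_dual n x (Suc j)) \<partial>(\<Pi>\<^sub>M i\<in>{..<Suc j}. \<mu>))"
  using m2[of "Suc j"] Suc.prems(1) unfolding lessThan_Suc by (intro P.product_nn_integral_insert[symmetric]) auto
 finally show ?case .
qed

lemma PiM_row_measurable:
 assumes "i \<in> I" shows "(\<lambda>w. w i) \<in> (\<Pi>\<^sub>M i\<in>I. \<mu>) \<rightarrow>\<^sub>M lebesgue_Rn n"
proof -
 have "(\<lambda>w. w i) \<in> (\<Pi>\<^sub>M i\<in>I. \<mu>) \<rightarrow>\<^sub>M \<mu>" using assms by (rule measurable_component_singleton)
 then show ?thesis by (simp add: measurable_def sets_\<mu> sets_eq_imp_space_eq[OF sets_\<mu>])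
qed

end

lemma measurable_simplex_volume:
 assumes "r \<le> n" "\<And>i. i \<in> {1..r+1} ==> X i \<in> M \<rightarrow>\<^sub>M lebesgue_Rn n"
 shows "(\<lambda>w. simplex_volume n r (\<lambda>i. X i w)) \<in> borel_measurable M"
proof -
 have "(\<lambda>w. X i w k) \<in> borel_measurable M" if "i \<in> {1..r+1}" "k < n" for i k
  using measurable_component_lebesgue_Rn[OF assms(2)[OF that(1)] that(2)] .
 then show ?thesis unfolding simplex_volume_eq[OF assms(1)] edge_def
  by (intro borel_measurable_divide measurable_gs_volume borel_measurable_diff borel_measurable_const) auto
qed

text \<open>Independence makes the joint law of the points a product, and \<open>chain_law\<close>
  is applied to the indicator of the event. Both events exclude product 0; taking
  \<open>B = UNIV\<close> later gives the probability of that exclusion.\<close>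

theorem (in rotation_invariant_law) simplex_volume_law:
 assumes "prob_space M" "r < n"
  and ind: "prob_space.indep_vars M (\<lambda>_. lebesgue_Rn n) X {1..r+1}"
  and law: "\<And>i. i \<in> {1..r+1} ==> distr M (lebesgue_Rn n) (X i) = \<mu>"
  and B [measurable]: "B \<in> sets borel"
 defines "D \<equiv> \<lambda>w. (\<Prod>i<Suc r. gs_sq n (\<lambda>i. X (Suc i) w) i)"
 shows "measure M {w \<in> space M. D w \<noteq> 0 \<and> simplex_volume n r (\<lambda>i. X i w) \<in> B}
    = measure (\<Pi>\<^sub>M i\<in>{..<Suc r}. \<mu>) {x \<in> space (\<Pi>\<^sub>M i\<in>{..<Suc r}. \<mu>). chain_prod n x (Suc r) \<noteq> 0 \<and>
      sqrt (chain_dual n x (Suc r) * chain_prod n x (Suc r)) / fact r \<in> B}" (is "?lhs = ?rhs")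
  and "D \<in> borel_measurable M"
proof -
 interpret M: prob_space M by fact
 let ?I = "{1..r+1}"
 let ?P = "\<Pi>\<^sub>M i\<in>{..<Suc r}. \<mu>"
 have X: "X i \<in> M \<rightarrow>\<^sub>M lebesgue_Rn n" if "i \<in> ?I" for i using ind that by (simp add: M.indep_vars_def2)
 have X' [measurable]: "(\<lambda>w. X (Suc i) w k) \<in> borel_measurable M" if "i < Suc r" "k < n" for i k
  by (rule measurable_component_lebesgue_Rn[OF X that(2)]) (use that in auto)
 \<comment> \<open>Points are numbered from 1 to r + 1, rows from 0 to r.\<close>
 define Y where "Y w = (\<lambda>i\<in>{..<Suc r}. X (Suc i) w)" for w
 have Y_law: "distr M ?P Y = ?P"
 proof -
  have 1: "distr M (\<Pi>\<^sub>M i\<in>?I. \<mu>) (\<lambda>w. \<lambda>i\<in>?I. X i w) = (\<Pi>\<^sub>M i\<in>?I. \<mu>)"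
  proof -
   have "distr M (\<Pi>\<^sub>M i\<in>?I. lebesgue_Rn n) (\<lambda>w. \<lambda>i\<in>?I. X i w) = (\<Pi>\<^sub>M i\<in>?I. distr M (lebesgue_Rn n) (X i))"
    using ind by (subst M.indep_vars_iff_distr_eq_PiM'[symmetric]) (auto intro: X)
   also have "... = (\<Pi>\<^sub>M i\<in>?I. \<mu>)" by (rule PiM_cong) (auto simp: law)
   finally show ?thesis by (subst distr_cong[OF refl _ refl, of _ "\<Pi>\<^sub>M i\<in>?I. lebesgue_Rn n"])
      (auto intro!: sets_PiM_cong simp: sets_\<mu>)
  qed
  have Xm: "(\<lambda>w. \<lambda>i\<in>?I. X i w) \<in> M \<rightarrow>\<^sub>M (\<Pi>\<^sub>M i\<in>?I. \<mu>)"
   by (intro measurable_restrict) (use X in \<open>auto simp: measurable_def sets_\<mu> sets_eq_imp_space_eq[OF sets_\<mu>]\<close>)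
  have "?P = distr (\<Pi>\<^sub>M i\<in>?I. \<mu>) ?P (\<lambda>x. \<lambda>i\<in>{..<Suc r}. x (Suc i))" using prob_space_axioms
   by (intro distr_PiM_reindex[of ?I "\<lambda>_. \<mu>" Suc "{..<Suc r}", symmetric]) auto
  also have "... = distr (distr M (\<Pi>\<^sub>M i\<in>?I. \<mu>) (\<lambda>w. \<lambda>i\<in>?I. X i w)) ?P (\<lambda>x. \<lambda>i\<in>{..<Suc r}. x (Suc i))" by (simp only: 1)
  also have "... = distr M ?P Y" by (subst distr_distr[OF _ Xm])
     (auto intro!: measurable_restrict measurable_component_singleton arg_cong[where f="distr M ?P"]
      simp: comp_def Y_def fun_eq_iff)
  finally show ?thesis ..
 qed
 have Ym: "Y \<in> M \<rightarrow>\<^sub>M ?P" unfolding Y_def by (intro measurable_restrict)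
   (use X in \<open>auto simp: measurable_def sets_\<mu> sets_eq_imp_space_eq[OF sets_\<mu>]\<close>)
 show Dm: "D \<in> borel_measurable M" unfolding D_def by (intro borel_measurable_prod measurable_gs_sq X') auto
 note Dm[measurable]
 have [measurable]: "(\<lambda>w. simplex_volume n r (\<lambda>i. X i w)) \<in> borel_measurable M"
  using X assms(2) by (intro measurable_simplex_volume) auto
 define f :: "real \<times> real => ennreal" where
  "f = (\<lambda>(d, q). indicator {p. fst p \<noteq> 0 \<and> sqrt (snd p * fst p) / fact r \<in> B} (d, q))"
 have fm [measurable]: "f \<in> borel_measurable (borel \<Otimes>\<^sub>M borel)" unfolding f_def by measurable
 have f0: "f (0, q) = 0" for q by (simp add: f_def)
 have comp: "(\<lambda>x. x i k) \<in> borel_measurable ?P" if "i < Suc r" "k < n" for i k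
  by (rule measurable_component_lebesgue_Rn[OF PiM_row_measurable that(2)]) (use that in auto)
 have g1: "(\<lambda>x. f (\<Prod>i<Suc r. gs_sq n x i, dual_sq n x (Suc r))) \<in> borel_measurable ?P" by (rule measurable_compose[OF _ fm])
    (intro measurable_Pair borel_measurable_prod measurable_gs_sq measurable_dual_sq comp; simp)
 have [measurable]: "(\<lambda>x. chain_prod n x (Suc r)) \<in> borel_measurable ?P"
  "(\<lambda>x. chain_dual n x (Suc r)) \<in> borel_measurable ?P"
  using assms(2) by (intro measurable_chain_prod measurable_chain_dual PiM_row_measurable; simp)+
 have "emeasure M {w \<in> space M. D w \<noteq> 0 \<and> simplex_volume n r (\<lambda>i. X i w) \<in> B}
   = (\<integral>\<^sup>+w. indicator {w \<in> space M. D w \<noteq> 0 \<and> simplex_volume n r (\<lambda>i. X i w) \<in> B} w \<partial>M)"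
  by (rule nn_integral_indicator[symmetric]) measurable
 also have "... = (\<integral>\<^sup>+w. f (\<Prod>i<Suc r. gs_sq n (Y w) i, dual_sq n (Y w) (Suc r)) \<partial>M)"
 proof (rule nn_integral_cong)
  fix w assume w: "w \<in> space M"
  let ?v = "\<lambda>i. X (Suc i) w"
  have gY: "gs_sq n (Y w) i = gs_sq n ?v i" if "i < Suc r" for i
  proof -
   have "gs n (Y w) i = gs n ?v i" using that by (intro gs_cong) (simp add: Y_def)
   then show ?thesis by (simp only: gs_sq_def)
  qed
  have qY: "dual_sq n (Y w) (Suc r) = dual_sq n ?v (Suc r)"
  proof -
   have "dual_vec n (Y w) (Suc r) = dual_vec n ?v (Suc r)" by (rule dual_vec_cong) (simp add: Y_def)
   then show ?thesis by (simp only: dual_sq_def)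
  qed
  have dY: "(\<Prod>i<Suc r. gs_sq n (Y w) i) = D w" unfolding D_def by (rule prod.cong) (auto simp: gY)
  have vol: "simplex_volume n r (\<lambda>i. X i w) = sqrt (dual_sq n ?v (Suc r) * D w) / fact r" if "D w \<noteq> 0"
  proof -
   have nd: "gs_sq n ?v i \<noteq> 0" if "i \<le> r" for i using \<open>D w \<noteq> 0\<close> that unfolding D_def
    by (metis finite_lessThan lessThan_iff less_Suc_eq_le prod_zero)
   have "edge (\<lambda>i. X i w) = (\<lambda>j k. ?v (Suc j) k - ?v 0 k)" by (simp add: edge_def fun_eq_iff)
   then have "(gs_volume n r (edge (\<lambda>i. X i w)))^2 = dual_sq n ?v (Suc r) * D w"
    using gs_volume_edges[of r n ?v, OF nd] by (simp add: D_def)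
   then have "gs_volume n r (edge (\<lambda>i. X i w)) = sqrt (dual_sq n ?v (Suc r) * D w)" by (metis gs_volume_nonneg real_sqrt_unique)
   then show ?thesis using assms(2) by (simp add: simplex_volume_eq)
  qed
  show "indicator {w \<in> space M. D w \<noteq> 0 \<and> simplex_volume n r (\<lambda>i. X i w) \<in> B} w
    = f (\<Prod>i<Suc r. gs_sq n (Y w) i, dual_sq n (Y w) (Suc r))" unfolding dY qY f_def using w vol by (auto simp: indicator_def)
 qed
 also have "... = (\<integral>\<^sup>+x. f (\<Prod>i<Suc r. gs_sq n x i, dual_sq n x (Suc r)) \<partial>?P)"
 proof -
  have "(\<integral>\<^sup>+x. f (\<Prod>i<Suc r. gs_sq n x i, dual_sq n x (Suc r)) \<partial>distr M ?P Y)
    = (\<integral>\<^sup>+w. f (\<Prod>i<Suc r. gs_sq n (Y w) i, dual_sq n (Y w) (Suc r)) \<partial>M)" by (rule nn_integral_distr[OF Ym]) (simp only: Y_law g1)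
  then show ?thesis by (simp only: Y_law)
 qed
 also have "... = (\<integral>\<^sup>+x. f (chain_prod n x (Suc r), chain_dual n x (Suc r)) \<partial>?P)" using assms(2) by (intro chain_law fm f0) auto
 also have "... = (\<integral>\<^sup>+x. indicator {x \<in> space ?P. chain_prod n x (Suc r) \<noteq> 0 \<and>
      sqrt (chain_dual n x (Suc r) * chain_prod n x (Suc r)) / fact r \<in> B} x \<partial>?P)"
  by (rule nn_integral_cong) (auto simp: f_def indicator_def)
 also have "... = emeasure ?P {x \<in> space ?P. chain_prod n x (Suc r) \<noteq> 0 \<and>
      sqrt (chain_dual n x (Suc r) * chain_prod n x (Suc r)) / fact r \<in> B}" by (rule nn_integral_indicator) measurable
 finally show "?lhs = ?rhs" by (simp add: measure_def)
qed

subsection \<open>Direction and length of the model laws\<close>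

abbreviation nrm :: "nat => (nat => real) => real" where "nrm n x \<equiv> L2_set x {..<n}"

lemma nrm_sq: "(nrm n x)^2 = ip n x x" by (simp add: L2_set_eq_ip)

lemma measurable_nrm [measurable]:
 assumes "f \<in> M \<rightarrow>\<^sub>M lebesgue_Rn n"
 shows "(\<lambda>w. nrm n (f w)) \<in> borel_measurable M" unfolding L2_set_eq_ip
 by (intro borel_measurable_sqrt[THEN measurable_compose[rotated]] measurable_ip measurable_component_lebesgue_Rn[OF assms]) auto

definition direction :: "nat => (nat => real) => (nat => real)" where
 "direction n x = (\<lambda>k\<in>{..<n}. x k / nrm n x)"

lemma measurable_direction [measurable]:
 assumes [measurable]: "f \<in> M \<rightarrow>\<^sub>M lebesgue_Rn n"
 shows "(\<lambda>w. direction n (f w)) \<in> M \<rightarrow>\<^sub>M lebesgue_Rn n"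
 unfolding direction_def by (intro measurable_lebesgue_RnI borel_measurable_divide) measurable

lemma nrm_vscale: "t \<ge> 0 ==> nrm n (vscale n t x) = t * nrm n x" by (simp add: L2_set_eq_ip ip_vscale real_sqrt_mult)

lemma direction_vscale: "t > 0 ==> direction n (vscale n t x) = direction n x"
 by (auto simp: direction_def nrm_vscale) (auto simp: vscale_def)

lemma vscale_in_space [simp]: "vscale n t x \<in> space (lebesgue_Rn n)" by (simp add: vscale_def space_lebesgue_Rn)

lemma direction_in_space [simp]: "direction n x \<in> space (lebesgue_Rn n)" by (simp add: direction_def space_lebesgue_Rn)

lemma vscale_nrm_direction:
 assumes "x \<in> space (lebesgue_Rn n)"
 shows "vscale n (nrm n x) (direction n x) = x"
proof
 fix k
 show "vscale n (nrm n x) (direction n x) k = x k"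
 proof (cases "k < n")
  case True
  show ?thesis
  proof (cases "nrm n x = 0")
   case True2: True
   then have "ip n x x = 0" by (simp add: L2_set_eq_ip)
   from ip_eq_0D[OF this True] show ?thesis using True by (simp add: vscale_def direction_def)
  qed (use True in \<open>simp add: vscale_def direction_def\<close>)
 next
  case False
  then show ?thesis using assms by (simp add: vscale_def space_lebesgue_Rn PiE_iff extensional_def)
 qed
qed

definition open_unit_ball :: "nat => (nat => real) set" where
 "open_unit_ball n = {x \<in> space (lebesgue_Rn n). nrm n x < 1}"

lemma open_unit_ball_sets [measurable]: "open_unit_ball n \<in> sets (lebesgue_Rn n)" unfolding open_unit_ball_def by measurable

lemma cone_sets:
 assumes [measurable]: "B \<in> sets (lebesgue_Rn n)" "I \<in> sets borel"
 shows "{x \<in> space (lebesgue_Rn n). nrm n x \<in> I \<and> direction n x \<in> B} \<in> sets (lebesgue_Rn n)" by measurable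

lemma emeasure_cone:
 assumes t: "t > 0" and B: "B \<in> sets (lebesgue_Rn n)"
 shows "emeasure (lebesgue_Rn n) {x \<in> space (lebesgue_Rn n). nrm n x \<in> {..<t} \<and> direction n x \<in> B}
  = ennreal (t ^ n) * emeasure (lebesgue_Rn n) {x \<in> open_unit_ball n. direction n x \<in> B}"
proof -
 have "vscale n t -` {x \<in> space (lebesgue_Rn n). nrm n x \<in> {..<t} \<and> direction n x \<in> B} \<inter> space (lebesgue_Rn n)
   = {x \<in> open_unit_ball n. direction n x \<in> B}" using t by (auto simp: nrm_vscale direction_vscale open_unit_ball_def)
 with emeasure_lebesgue_Rn_vscale[OF t cone_sets[OF B, of "{..<t}"]] show ?thesis by simp
qed

lemma emeasure_open_unit_ball: "0 < emeasure (lebesgue_Rn n) (open_unit_ball n)" "emeasure (lebesgue_Rn n) (open_unit_ball n) < \<infinity>"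
proof -
 have "vscale n 2 -` ball_Rn n 1 \<inter> space (lebesgue_Rn n) \<subseteq> open_unit_ball n"
  by (auto simp: ball_Rn_def ip_vscale open_unit_ball_def L2_set_eq_ip)
 then have "emeasure (lebesgue_Rn n) (ball_Rn n 1) \<le> ennreal (2 ^ n) * emeasure (lebesgue_Rn n) (open_unit_ball n)"
  using emeasure_lebesgue_Rn_vscale[of 2 "ball_Rn n 1" n] by (auto intro!: mult_left_mono emeasure_mono)
 then show "0 < emeasure (lebesgue_Rn n) (open_unit_ball n)"
  using emeasure_unit_ball_pos[of n] by (metis mult_zero_right not_gr_zero not_le)
 have "open_unit_ball n \<subseteq> ball_Rn n 1"
 proof
  fix x assume "x \<in> open_unit_ball n"
  then show "x \<in> ball_Rn n 1" by (auto simp: open_unit_ball_def ball_Rn_def L2_set_eq_ip)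
 qed
 from emeasure_mono[OF this ball_Rn_sets] show "emeasure (lebesgue_Rn n) (open_unit_ball n) < \<infinity>"
  using emeasure_ball_Rn_finite[of n 1] by (rule le_less_trans)
qed

lemma sphere_law_eq: "sphere_law n = distr (uniform_measure (lebesgue_Rn n) (open_unit_ball n)) (lebesgue_Rn n) (direction n)"
 unfolding sphere_law_def open_unit_ball_def direction_def[abs_def] ..

lemma sets_sphere_law [measurable_cong, simp]: "sets (sphere_law n) = sets (lebesgue_Rn n)" by (simp add: sphere_law_def)

lemma emeasure_sphere_law:
 assumes [measurable]: "B \<in> sets (lebesgue_Rn n)"
 shows "emeasure (sphere_law n) B = emeasure (lebesgue_Rn n) {x \<in> open_unit_ball n. direction n x \<in> B} / emeasure (lebesgue_Rn n) (open_unit_ball n)"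
proof -
 have "emeasure (sphere_law n) B = emeasure (uniform_measure (lebesgue_Rn n) (open_unit_ball n)) (direction n -` B \<inter> space (lebesgue_Rn n))"
  unfolding sphere_law_eq by (subst emeasure_distr) auto
 also have "... = emeasure (lebesgue_Rn n) (open_unit_ball n \<inter> (direction n -` B \<inter> space (lebesgue_Rn n))) / emeasure (lebesgue_Rn n) (open_unit_ball n)"
  by (rule emeasure_uniform_measure) auto
 also have "open_unit_ball n \<inter> (direction n -` B \<inter> space (lebesgue_Rn n)) = {x \<in> open_unit_ball n. direction n x \<in> B}"
  by (auto simp: open_unit_ball_def)
 finally show ?thesis .
qed

lemma prob_space_sphere_law: "prob_space (sphere_law n)"
proof -
 have "prob_space (uniform_measure (lebesgue_Rn n) (open_unit_ball n))"
  using emeasure_open_unit_ball[of n] by (intro prob_space_uniform_measure) auto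
 then show ?thesis unfolding sphere_law_eq by (intro prob_space.prob_space_distr) auto
qed

text \<open>As measures in the set of radii, both sides scale like t^n on the half lines {..<t}, by
  \<open>emeasure_cone\<close>, and half lines form a generator closed under intersection. The
  factors \<open>U\<close> and \<open>W\<close> clear the denominator of the sphere law, so that two
  finite quantities are compared.\<close>

lemma polar_lebesgue:
 assumes B [measurable]: "B \<in> sets (lebesgue_Rn n)" and I [measurable]: "I \<in> sets borel"
 shows "emeasure (lebesgue_Rn n) {x \<in> space (lebesgue_Rn n). nrm n x \<in> I \<and> direction n x \<in> B}
  = emeasure (lebesgue_Rn n) {x \<in> space (lebesgue_Rn n). nrm n x \<in> I} * emeasure (sphere_law n) B"
proof -
 let ?L = "lebesgue_Rn n"
 let ?S = "\<lambda>B. {x \<in> space ?L. direction n x \<in> B}"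
 define U where "U = emeasure ?L (open_unit_ball n)"
 define W where "W = emeasure ?L {x \<in> open_unit_ball n. direction n x \<in> B}"
 define N1 where "N1 = scale_measure U (distr (density ?L (indicator (?S B))) borel (nrm n))"
 define N2 where "N2 = scale_measure W (distr ?L borel (nrm n))"
 have e1: "emeasure N1 A = U * emeasure ?L {x \<in> space ?L. nrm n x \<in> A \<and> direction n x \<in> B}" if [measurable]: "A \<in> sets borel" for A
 proof -
  have "emeasure (distr (density ?L (indicator (?S B))) borel (nrm n)) A
    = emeasure ?L (?S B \<inter> (nrm n -` A \<inter> space ?L))" by (subst emeasure_distr) (auto intro!: emeasure_restricted)
  also have "?S B \<inter> (nrm n -` A \<inter> space ?L) = {x \<in> space ?L. nrm n x \<in> A \<and> direction n x \<in> B}" by auto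
  finally show ?thesis by (simp add: N1_def)
 qed
 have e2: "emeasure N2 A = W * emeasure ?L {x \<in> space ?L. nrm n x \<in> A}" if [measurable]: "A \<in> sets borel" for A
 proof -
  have "nrm n -` A \<inter> space ?L = {x \<in> space ?L. nrm n x \<in> A}" by auto
  then show ?thesis by (simp add: N2_def emeasure_distr)
 qed
 have all: "{x \<in> open_unit_ball n. direction n x \<in> space ?L} = open_unit_ball n" by (auto simp: open_unit_ball_def)
 have half: "emeasure ?L {x \<in> space ?L. nrm n x \<in> {..<t}} = ennreal (t ^ n) * U" if "t > 0" for t
  using emeasure_cone[OF that, of "space ?L" n] unfolding all U_def by simp
 have "N1 = N2"
 proof (rule measure_eqI_generator_eq[where E="range lessThan" and A="\<lambda>i::nat. {..<real i}" and \<Omega>=UNIV])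
  show "Int_stable (range lessThan :: real set set)" unfolding Int_stable_def
  proof (intro ballI)
   fix a b :: "real set" assume "a \<in> range lessThan" "b \<in> range lessThan"
   then obtain s t where "a = {..<s}" "b = {..<t}" by blast
   then have "a \<inter> b = {..<min s t}" by auto
   then show "a \<inter> b \<in> range lessThan" by blast
  qed
  show "emeasure N1 X = emeasure N2 X" if X_range: "X \<in> range lessThan" for X
  proof -
   obtain t where X: "X = {..<t}" using X_range by blast
   show ?thesis
   proof (cases "t > 0")
    case True
    have "emeasure N1 X = U * (ennreal (t ^ n) * W)"
     unfolding X e1[OF lessThan_borel] W_def by (simp only: emeasure_cone[OF True B])
    moreover have "emeasure N2 X = W * (ennreal (t ^ n) * U)" unfolding X e2[OF lessThan_borel] by (simp only: half[OF True])
    ultimately show ?thesis by (simp add: mult_ac)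
   next
    case False
    then have "\<not> nrm n x < t" for x using L2_set_nonneg[of x "{..<n}"] by linarith
    then have "{x \<in> space ?L. nrm n x \<in> {..<t} \<and> direction n x \<in> B} = {}" "{x \<in> space ?L. nrm n x \<in> {..<t}} = {}" by auto
    then show ?thesis unfolding X e1[OF lessThan_borel] e2[OF lessThan_borel] by (simp only: emeasure_empty mult_zero_right)
   qed
  qed
  have "sets (borel :: real measure) = sigma_sets UNIV (range lessThan)" by (subst borel_Iio) simp
  then show "sets N1 = sigma_sets UNIV (range lessThan)" "sets N2 = sigma_sets UNIV (range lessThan)"
   by (simp_all add: N1_def N2_def)
  show "(\<Union>i. {..<real i}) = UNIV" by (auto intro: reals_Archimedean2)
  show "emeasure N1 {..<real i} \<noteq> \<infinity>" for i
  proof -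
   have "emeasure ?L {x \<in> space ?L. nrm n x \<in> {..<real i} \<and> direction n x \<in> B} \<le> emeasure ?L {x \<in> space ?L. nrm n x \<in> {..<real i + 1}}"
    by (intro emeasure_mono) auto
   also have "... = ennreal ((real i + 1) ^ n) * U" by (rule half) simp
   also have "... < \<infinity>" using emeasure_open_unit_ball(2)[of n] by (simp add: U_def ennreal_mult_less_top)
   finally show ?thesis using emeasure_open_unit_ball(2)[of n] unfolding e1[OF lessThan_borel]
    by (simp add: U_def ennreal_mult_eq_top_iff less_top)
  qed
 qed auto
 then have "U * emeasure ?L {x \<in> space ?L. nrm n x \<in> I \<and> direction n x \<in> B} = W * emeasure ?L {x \<in> space ?L. nrm n x \<in> I}"
  using e1[OF I] e2[OF I] by simp
 moreover have "emeasure ?L {x \<in> space ?L. nrm n x \<in> I \<and> direction n x \<in> B}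
   = emeasure ?L {x \<in> space ?L. nrm n x \<in> I \<and> direction n x \<in> B} * U / U"
  using emeasure_open_unit_ball[of n] by (intro ennreal_mult_divide_eq[symmetric]) (auto simp: U_def)
 ultimately have "emeasure ?L {x \<in> space ?L. nrm n x \<in> I \<and> direction n x \<in> B} = (emeasure ?L {x \<in> space ?L. nrm n x \<in> I} * W) / U"
  by (simp only: mult.commute)
 then show ?thesis unfolding emeasure_sphere_law[OF B] W_def U_def by (simp add: ennreal_times_divide)
qed

locale radial_law = prob_space \<mu> for \<mu> :: "(nat => real) measure" and n :: nat and \<phi> :: "real => ennreal" +
 assumes \<phi> [measurable]: "\<phi> \<in> borel_measurable borel"
  and density: "\<mu> = density (lebesgue_Rn n) (\<lambda>x. \<phi> (nrm n x))"
begin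

lemma sets_radial [measurable_cong]: "sets \<mu> = sets (lebesgue_Rn n)" by (simp add: density)

lemma nn_integral_radial:
 assumes [measurable]: "g \<in> borel_measurable (lebesgue_Rn n)"
 shows "(\<integral>\<^sup>+x. g x \<partial>\<mu>) = (\<integral>\<^sup>+x. \<phi> (nrm n x) * g x \<partial>lebesgue_Rn n)" unfolding density by (rule nn_integral_density) auto

text \<open>The density only involves the norm, so the factorisation in
  \<open>polar_lebesgue\<close> carries over: integrating the radial density against both sides
  shows that length and direction are independent and that the direction is uniform.\<close>

lemma polar: "distr \<mu> borel (nrm n) \<Otimes>\<^sub>M sphere_law n = distr \<mu> (borel \<Otimes>\<^sub>M lebesgue_Rn n) (\<lambda>x. (nrm n x, direction n x))"
proof -
 let ?L = "lebesgue_Rn n"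
 interpret L: sigma_finite_measure ?L by (rule sigma_finite_lebesgue_Rn)
 interpret S: prob_space "sphere_law n" by (rule prob_space_sphere_law)
 define N where "N B = distr (density ?L (indicator {x \<in> space ?L. direction n x \<in> B})) borel (nrm n)" for B
 show ?thesis
 proof (rule pair_measure_eqI)
  interpret D: prob_space "distr \<mu> borel (nrm n)" by (rule prob_space_distr) measurable
  show "sigma_finite_measure (distr \<mu> borel (nrm n))" by unfold_locales
  show "sigma_finite_measure (sphere_law n)" by unfold_locales
  fix A B assume "A \<in> sets (distr \<mu> borel (nrm n))" "B \<in> sets (sphere_law n)"
  then have [measurable]: "A \<in> sets borel" "B \<in> sets ?L" by simp_all
  have NB: "N B = scale_measure (emeasure (sphere_law n) B) (distr ?L borel (nrm n))"
  proof (rule measure_eqI)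
   fix I assume "I \<in> sets (N B)"
   then have [measurable]: "I \<in> sets borel" by (simp add: N_def)
   have "emeasure (N B) I = emeasure ?L {x \<in> space ?L. nrm n x \<in> I \<and> direction n x \<in> B}"
   proof -
    have "emeasure (N B) I = emeasure ?L ({x \<in> space ?L. direction n x \<in> B} \<inter> (nrm n -` I \<inter> space ?L))"
     unfolding N_def by (subst emeasure_distr) (auto intro!: emeasure_restricted)
    also have "{x \<in> space ?L. direction n x \<in> B} \<inter> (nrm n -` I \<inter> space ?L) = {x \<in> space ?L. nrm n x \<in> I \<and> direction n x \<in> B}" by auto
    finally show ?thesis .
   qed
   also have "... = emeasure ?L {x \<in> space ?L. nrm n x \<in> I} * emeasure (sphere_law n) B" by (rule polar_lebesgue) auto
   also have "{x \<in> space ?L. nrm n x \<in> I} = nrm n -` I \<inter> space ?L" by auto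
   finally show "emeasure (N B) I = emeasure (scale_measure (emeasure (sphere_law n) B) (distr ?L borel (nrm n))) I"
    by (simp add: emeasure_distr mult.commute)
  qed (simp add: N_def)
  have "emeasure (distr \<mu> borel (nrm n)) A = (\<integral>\<^sup>+x. \<phi> (nrm n x) * indicator A (nrm n x) \<partial>?L)"
  proof -
   have "emeasure (distr \<mu> borel (nrm n)) A = (\<integral>\<^sup>+x. indicator A x \<partial>distr \<mu> borel (nrm n))" by simp
   also have "... = (\<integral>\<^sup>+x. indicator A (nrm n x) \<partial>\<mu>)" by (rule nn_integral_distr) auto
   also have "... = (\<integral>\<^sup>+x. \<phi> (nrm n x) * indicator A (nrm n x) \<partial>?L)" by (rule nn_integral_radial) measurable
   finally show ?thesis .
  qed
  also have "... = (\<integral>\<^sup>+t. \<phi> t * indicator A t \<partial>distr ?L borel (nrm n))" by (subst nn_integral_distr) auto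
  finally have 1: "emeasure (distr \<mu> borel (nrm n)) A * emeasure (sphere_law n) B
    = (\<integral>\<^sup>+t. \<phi> t * indicator A t \<partial>N B)" unfolding NB by (subst nn_integral_scale_measure) (auto simp: mult.commute)
  have "emeasure (distr \<mu> (borel \<Otimes>\<^sub>M ?L) (\<lambda>x. (nrm n x, direction n x))) (A \<times> B)
    = (\<integral>\<^sup>+p. indicator (A \<times> B) p \<partial>distr \<mu> (borel \<Otimes>\<^sub>M ?L) (\<lambda>x. (nrm n x, direction n x)))" by simp
  also have "... = (\<integral>\<^sup>+x. indicator (A \<times> B) (nrm n x, direction n x) \<partial>\<mu>)" by (rule nn_integral_distr) auto
  also have "... = (\<integral>\<^sup>+x. \<phi> (nrm n x) * indicator (A \<times> B) (nrm n x, direction n x) \<partial>?L)" by (rule nn_integral_radial) measurable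
  also have "... = (\<integral>\<^sup>+x. indicator {x \<in> space ?L. direction n x \<in> B} x * (\<phi> (nrm n x) * indicator A (nrm n x)) \<partial>?L)"
   by (rule nn_integral_cong) (auto simp: indicator_def)
  also have "... = (\<integral>\<^sup>+t. \<phi> t * indicator A t \<partial>N B)" unfolding N_def by (subst nn_integral_distr) (auto simp: nn_integral_density)
  finally show "emeasure (distr \<mu> borel (nrm n)) A * emeasure (sphere_law n) B
    = emeasure (distr \<mu> (borel \<Otimes>\<^sub>M ?L) (\<lambda>x. (nrm n x, direction n x))) (A \<times> B)" using 1 by simp
 qed (auto intro!: sets_pair_measure_cong)
qed

lemma direction_law: "distr \<mu> (lebesgue_Rn n) (direction n) = sphere_law n"
proof (rule measure_eqI)
 interpret D: prob_space "distr \<mu> borel (nrm n)" by (rule prob_space_distr) measurable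
 interpret S: prob_space "sphere_law n" by (rule prob_space_sphere_law)
 fix B assume "B \<in> sets (distr \<mu> (lebesgue_Rn n) (direction n))"
 then have [measurable]: "B \<in> sets (lebesgue_Rn n)" by simp
 have "emeasure (distr \<mu> (lebesgue_Rn n) (direction n)) B
   = emeasure (distr \<mu> (borel \<Otimes>\<^sub>M lebesgue_Rn n) (\<lambda>x. (nrm n x, direction n x))) (UNIV \<times> B)"
  by (auto simp: emeasure_distr intro!: arg_cong[where f="emeasure \<mu>"])
 also have "... = emeasure (distr \<mu> borel (nrm n)) UNIV * emeasure (sphere_law n) B"
  unfolding polar[symmetric] by (rule S.emeasure_pair_measure_Times) auto
 also have "emeasure (distr \<mu> borel (nrm n)) UNIV = 1" using D.emeasure_space_1 by simp
 finally show "emeasure (distr \<mu> (lebesgue_Rn n) (direction n)) B = emeasure (sphere_law n) B" by simp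
qed simp

lemma radial_rot: "orthonormal_system n n b ==> distr \<mu> (lebesgue_Rn n) (rot n b) = \<mu>"
proof (rule measure_eqI)
 assume b: "orthonormal_system n n b"
 fix A assume "A \<in> sets (distr \<mu> (lebesgue_Rn n) (rot n b))"
 then have [measurable]: "A \<in> sets (lebesgue_Rn n)" by simp
 have "emeasure (distr \<mu> (lebesgue_Rn n) (rot n b)) A = (\<integral>\<^sup>+x. indicator A x \<partial>distr \<mu> (lebesgue_Rn n) (rot n b))" by simp
 also have "... = (\<integral>\<^sup>+x. indicator A (rot n b x) \<partial>\<mu>)" by (rule nn_integral_distr) auto
 also have "... = (\<integral>\<^sup>+x. \<phi> (nrm n x) * indicator A (rot n b x) \<partial>lebesgue_Rn n)" by (rule nn_integral_radial) measurable
 also have "... = (\<integral>\<^sup>+x. \<phi> (nrm n (rot n b x)) * indicator A (rot n b x) \<partial>lebesgue_Rn n)" by (simp add: L2_set_eq_ip ip_rot[OF b])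
 also have "... = (\<integral>\<^sup>+x. \<phi> (nrm n x) * indicator A x \<partial>distr (lebesgue_Rn n) (lebesgue_Rn n) (rot n b))"
  by (rule nn_integral_distr[symmetric]) auto
 also have "... = (\<integral>\<^sup>+x. indicator A x \<partial>\<mu>)" unfolding lebesgue_Rn_rot[OF b] by (rule nn_integral_radial[symmetric]) measurable
 finally show "emeasure (distr \<mu> (lebesgue_Rn n) (rot n b)) A = emeasure \<mu> A" by simp
qed (simp add: sets_radial)

lemma rotation_invariant: "rotation_invariant_law \<mu> n" by unfold_locales (auto simp: sets_radial radial_rot)

end

text \<open>The length of the second point in the direction of the first. With an independent
  Gaussian first point this represents a model point through independent normal coordinates.\<close>

definition redirect :: "nat => (nat => real) \<times> (nat => real) => (nat => real)" where
 "redirect n = (\<lambda>(g, x). vscale n (nrm n x) (direction n g))"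

lemma measurable_redirect [measurable]:
 assumes [measurable]: "f \<in> M \<rightarrow>\<^sub>M lebesgue_Rn n" "g \<in> M \<rightarrow>\<^sub>M lebesgue_Rn n"
 shows "(\<lambda>w. redirect n (f w, g w)) \<in> M \<rightarrow>\<^sub>M lebesgue_Rn n" unfolding redirect_def by simp

text \<open>Under \<open>\<mu>\<close> the direction is uniform and independent of the length, and
  the direction of a Gaussian vector is uniform too. Exchanging one for an independent copy of the
  other leaves the law unchanged.\<close>

lemma redirect_law:
 assumes "prob_space \<mu>" and sets: "sets \<mu> = sets (lebesgue_Rn n)"
  and \<gamma>: "radial_law \<gamma> n \<phi>"
  and polar: "distr \<mu> borel (nrm n) \<Otimes>\<^sub>M sphere_law n = distr \<mu> (borel \<Otimes>\<^sub>M lebesgue_Rn n) (\<lambda>x. (nrm n x, direction n x))"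
 shows "distr (\<gamma> \<Otimes>\<^sub>M \<mu>) (lebesgue_Rn n) (redirect n) = \<mu>"
proof (rule measure_eqI)
 let ?L = "lebesgue_Rn n"
 note sets[measurable_cong]
 interpret \<mu>: prob_space \<mu> by fact
 interpret \<gamma>: radial_law \<gamma> n \<phi> by fact
 interpret K: prob_space "distr \<mu> borel (nrm n)" by (rule \<mu>.prob_space_distr) measurable
 interpret S: prob_space "sphere_law n" by (rule prob_space_sphere_law)
 interpret KS: pair_sigma_finite "distr \<mu> borel (nrm n)" "sphere_law n" by unfold_locales
 have [measurable]: "redirect n \<in> \<gamma> \<Otimes>\<^sub>M \<mu> \<rightarrow>\<^sub>M ?L" unfolding redirect_def by measurable
 fix A assume "A \<in> sets (distr (\<gamma> \<Otimes>\<^sub>M \<mu>) ?L (redirect n))"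
 then have [measurable]: "A \<in> sets ?L" by simp
 have "emeasure (distr (\<gamma> \<Otimes>\<^sub>M \<mu>) ?L (redirect n)) A = (\<integral>\<^sup>+p. indicator A p \<partial>distr (\<gamma> \<Otimes>\<^sub>M \<mu>) ?L (redirect n))" by simp
 also have "... = (\<integral>\<^sup>+p. indicator A (redirect n p) \<partial>(\<gamma> \<Otimes>\<^sub>M \<mu>))" by (rule nn_integral_distr) auto
 also have "... = (\<integral>\<^sup>+g. \<integral>\<^sup>+x. indicator A (redirect n (g, x)) \<partial>\<mu> \<partial>\<gamma>)" by (rule \<mu>.nn_integral_fst[symmetric]) measurable
 also have "... = (\<integral>\<^sup>+u. \<integral>\<^sup>+x. indicator A (vscale n (nrm n x) u) \<partial>\<mu> \<partial>sphere_law n)"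
  unfolding \<gamma>.direction_law[symmetric] redirect_def by (subst nn_integral_distr) auto
 also have "... = (\<integral>\<^sup>+u. \<integral>\<^sup>+t. indicator A (vscale n t u) \<partial>distr \<mu> borel (nrm n) \<partial>sphere_law n)"
 proof (rule nn_integral_cong)
  fix u assume "u \<in> space (sphere_law n)"
  then have [measurable]: "u \<in> space ?L" by (simp add: sphere_law_def)
  show "(\<integral>\<^sup>+x. indicator A (vscale n (nrm n x) u) \<partial>\<mu>) = (\<integral>\<^sup>+t. indicator A (vscale n t u) \<partial>distr \<mu> borel (nrm n))"
   by (subst nn_integral_distr) auto
 qed
 also have "... = (\<integral>\<^sup>+p. indicator A (vscale n (fst p) (snd p)) \<partial>(distr \<mu> borel (nrm n) \<Otimes>\<^sub>M sphere_law n))"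
  by (subst KS.nn_integral_snd[symmetric]) auto
 also have "... = (\<integral>\<^sup>+x. indicator A (vscale n (nrm n x) (direction n x)) \<partial>\<mu>)" unfolding polar by (subst nn_integral_distr) auto
 also have "... = (\<integral>\<^sup>+x. indicator A x \<partial>\<mu>)" by (rule nn_integral_cong) (simp add: vscale_nrm_direction sets_eq_imp_space_eq[OF sets])
 finally show "emeasure (distr (\<gamma> \<Otimes>\<^sub>M \<mu>) ?L (redirect n)) A = emeasure \<mu> A" by simp
qed (simp add: sets)

section \<open>The Gaussian and the uniform law\<close>

lemma gaussian_law_eq_PiM: "gaussian_law n = (\<Pi>\<^sub>M k\<in>{..<n}. std_normal_distribution)"
proof -
 interpret N: product_sigma_finite "\<lambda>_::nat. std_normal_distribution"
  by (intro product_sigma_finite.intro prob_space_imp_sigma_finite prob_space_normal_density) simp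
 show ?thesis
 proof (rule N.PiM_eqI)
  show "sets (gaussian_law n) = sets (\<Pi>\<^sub>M k\<in>{..<n}. std_normal_distribution)"
   by (simp add: gaussian_law_def lebesgue_Rn_def cong: sets_PiM_cong)
  fix A :: "nat => real set" assume A: "\<And>i. i \<in> {..<n} ==> A i \<in> sets std_normal_distribution"
  have [measurable]: "A i \<in> sets borel" if "i < n" for i using A[of i] that by simp
  have PA [measurable]: "Pi\<^sub>E {..<n} A \<in> sets (lebesgue_Rn n)" unfolding lebesgue_Rn_def using A by (intro sets_PiM_I_finite) auto
  have dens: "(2 * pi) powr (- real n / 2) * exp (- (nrm n x)\<^sup>2 / 2) = (\<Prod>k<n. std_normal_density (x k))" for x
  proof -
   have "(\<Prod>k<n. std_normal_density (x k)) = (1 / sqrt (2 * pi)) ^ n * exp (\<Sum>k<n. - (x k)\<^sup>2 / 2)"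
    by (simp add: std_normal_density_def prod.distrib exp_sum power_divide prod_dividef)
   also have "(\<Sum>k<n. - (x k)\<^sup>2 / 2) = - (nrm n x)\<^sup>2 / 2"
    unfolding nrm_sq ip_def by (simp add: power2_eq_square sum_negf sum_divide_distrib)
   also have "(1 / sqrt (2 * pi)) ^ n = (2 * pi) powr (- real n / 2)"
   proof -
    have "(2 * pi) powr (- real n / 2) = ((2 * pi) powr (- 1 / 2)) powr real n" by (simp add: powr_powr)
    also have "(2 * pi) powr (- 1 / 2) = 1 / sqrt (2 * pi)" by (simp add: powr_minus_divide powr_half_sqrt[symmetric])
    finally show ?thesis by (simp add: powr_realpow)
   qed
   finally show ?thesis by simp
  qed
  have "emeasure (gaussian_law n) (Pi\<^sub>E {..<n} A)
    = (\<integral>\<^sup>+x. ennreal (\<Prod>k<n. std_normal_density (x k)) * indicator (Pi\<^sub>E {..<n} A) x \<partial>lebesgue_Rn n)"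
   unfolding gaussian_law_def dens by (subst emeasure_density) auto
  also have "... = (\<integral>\<^sup>+x. (\<Prod>k<n. ennreal (std_normal_density (x k)) * indicator (A k) (x k)) \<partial>lebesgue_Rn n)"
  proof (rule nn_integral_cong)
   fix x assume x: "x \<in> space (lebesgue_Rn n)"
   have "indicator (Pi\<^sub>E {..<n} A) x = (\<Prod>k<n. indicator (A k) (x k) :: ennreal)"
   proof (cases "x \<in> Pi\<^sub>E {..<n} A")
    case True
    then have "indicator (A k) (x k) = (1::ennreal)" if "k < n" for k using that by (auto simp: PiE_iff)
    then show ?thesis using True by simp
   next
    case False
    then obtain k where "k < n" "x k \<notin> A k" using x by (auto simp: PiE_iff space_lebesgue_Rn)
    then have "(\<Prod>k<n. indicator (A k) (x k) :: ennreal) = 0" by (intro prod_zero) (auto intro!: bexI[of _ k])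
    then show ?thesis using False by simp
   qed
   then show "ennreal (\<Prod>k<n. std_normal_density (x k)) * indicator (Pi\<^sub>E {..<n} A) x
     = (\<Prod>k<n. ennreal (std_normal_density (x k)) * indicator (A k) (x k))" by (simp add: prod.distrib prod_ennreal)
  qed
  also have "... = (\<Prod>k<n. \<integral>\<^sup>+t. ennreal (std_normal_density t) * indicator (A k) t \<partial>lborel)"
   unfolding lebesgue_Rn_def by (rule lborel_product.product_nn_integral_prod) auto
  also have "... = (\<Prod>k<n. emeasure std_normal_distribution (A k))" using A by (intro prod.cong refl) (subst emeasure_density, auto)
  finally show "emeasure (gaussian_law n) (Pi\<^sub>E {..<n} A) = (\<Prod>k<n. emeasure std_normal_distribution (A k))" .
 qed simp
qed

lemma prob_space_gaussian_law: "prob_space (gaussian_law n)"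
 unfolding gaussian_law_eq_PiM by (intro prob_space_PiM prob_space_normal_density) simp

lemma radial_gaussian_law:
 "radial_law (gaussian_law n) n (\<lambda>t. ennreal ((2 * pi) powr (- real n / 2) * exp (- t\<^sup>2 / 2)))"
 using prob_space_gaussian_law[of n] unfolding radial_law_def radial_law_axioms_def gaussian_law_def by simp

lemma sets_gaussian_law [measurable_cong, simp]: "sets (gaussian_law n) = sets (lebesgue_Rn n)" by (simp add: gaussian_law_def)

text \<open>The sphere law is singular, so invariance is inherited from the Gaussian law, whose
  direction it is; rotations commute with \<open>direction\<close>.\<close>

lemma rotation_invariant_sphere_law: "rotation_invariant_law (sphere_law n) n"
proof -
 let ?L = "lebesgue_Rn n"
 interpret S: prob_space "sphere_law n" by (rule prob_space_sphere_law)
 interpret G: radial_law "gaussian_law n" n "\<lambda>t. ennreal ((2 * pi) powr (- real n / 2) * exp (- t\<^sup>2 / 2))"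
  by (rule radial_gaussian_law)
 show ?thesis
 proof
  fix b assume b: "orthonormal_system n n b"
  have comm: "rot n b (direction n x) = direction n (rot n b x)" for x
  proof -
   have "ip n (b i) (direction n x) = ip n (b i) x / nrm n x" for i
   proof -
    have "ip n (b i) (direction n x) = ip n (b i) (\<lambda>k. x k / nrm n x)" by (rule ip_cong) (auto simp: direction_def)
    then show ?thesis by (simp add: ip_div)
   qed
   moreover have "nrm n (rot n b x) = nrm n x" by (simp add: L2_set_eq_ip ip_rot[OF b])
   ultimately show ?thesis by (auto simp: rot_def direction_def)
  qed
  have "distr (sphere_law n) ?L (rot n b) = distr (gaussian_law n) ?L (\<lambda>x. rot n b (direction n x))"
   unfolding G.direction_law[symmetric] by (subst distr_distr) (auto simp: comp_def)
  also have "... = distr (distr (gaussian_law n) ?L (rot n b)) ?L (direction n)"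
   unfolding comm by (subst distr_distr) (auto simp: comp_def)
  also have "... = sphere_law n" by (simp add: G.radial_rot[OF b] G.direction_law)
  finally show "distr (sphere_law n) ?L (rot n b) = sphere_law n" .
 qed simp
qed

lemma AE_sphere_law:
 assumes "n \<ge> 1" shows "AE x in sphere_law n. nrm n x = 1"
proof -
 let ?L = "lebesgue_Rn n"
 have "AE x in ?L. x 0 \<noteq> 0" using emeasure_hyperplane[of 0 n] assms by (intro AE_I[of _ _ "{x \<in> space ?L. x 0 = 0}"]) auto
 moreover have "nrm n (direction n x) = 1" if "x 0 \<noteq> 0" for x
 proof -
  have "ip n x x \<noteq> 0" using ip_eq_0D[of n x 0] that assms by auto
  then have p: "nrm n x > 0" by (simp add: L2_set_eq_ip less_le)
  have "direction n x = vscale n (1 / nrm n x) x" by (auto simp: direction_def vscale_def)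
  then show ?thesis using p by (simp add: nrm_vscale)
 qed
 ultimately have "AE x in ?L. nrm n (direction n x) = 1" by auto
 then have "AE x in uniform_measure ?L (open_unit_ball n). nrm n (direction n x) = 1" by (intro AE_uniform_measureI) auto
 then show ?thesis unfolding sphere_law_eq by (subst AE_distr_iff) auto
qed

text \<open>The length is 1 almost everywhere, so \<open>redirect\<close> returns the direction of
  the Gaussian argument.\<close>

lemma redirect_sphere_law:
 assumes "n \<ge> 1"
 shows "distr (gaussian_law n \<Otimes>\<^sub>M sphere_law n) (lebesgue_Rn n) (redirect n) = sphere_law n"
proof (rule measure_eqI)
 let ?L = "lebesgue_Rn n"
 interpret S: prob_space "sphere_law n" by (rule prob_space_sphere_law)
 interpret G: radial_law "gaussian_law n" n "\<lambda>t. ennreal ((2 * pi) powr (- real n / 2) * exp (- t\<^sup>2 / 2))"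
  by (rule radial_gaussian_law)
 have [measurable]: "redirect n \<in> gaussian_law n \<Otimes>\<^sub>M sphere_law n \<rightarrow>\<^sub>M ?L" unfolding redirect_def by measurable
 fix A assume "A \<in> sets (distr (gaussian_law n \<Otimes>\<^sub>M sphere_law n) ?L (redirect n))"
 then have [measurable]: "A \<in> sets ?L" by simp
 have "emeasure (distr (gaussian_law n \<Otimes>\<^sub>M sphere_law n) ?L (redirect n)) A
   = (\<integral>\<^sup>+p. indicator A p \<partial>distr (gaussian_law n \<Otimes>\<^sub>M sphere_law n) ?L (redirect n))" by simp
 also have "... = (\<integral>\<^sup>+p. indicator A (redirect n p) \<partial>(gaussian_law n \<Otimes>\<^sub>M sphere_law n))" by (rule nn_integral_distr) auto
 also have "... = (\<integral>\<^sup>+g. \<integral>\<^sup>+x. indicator A (redirect n (g, x)) \<partial>sphere_law n \<partial>gaussian_law n)"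
  by (rule S.nn_integral_fst[symmetric]) measurable
 also have "... = (\<integral>\<^sup>+g. indicator A (direction n g) \<partial>gaussian_law n)"
 proof (rule nn_integral_cong)
  fix g
  have "(\<integral>\<^sup>+x. indicator A (redirect n (g, x)) \<partial>sphere_law n) = (\<integral>\<^sup>+x. indicator A (direction n g) \<partial>sphere_law n)"
  proof (rule nn_integral_cong_AE)
   have "redirect n (g, x) = direction n g" if "nrm n x = 1" for x using that by (auto simp: redirect_def vscale_def direction_def)
   then show "AE x in sphere_law n. indicator A (redirect n (g, x)) = indicator A (direction n g)"
    using AE_sphere_law[OF assms] by auto
  qed
  then show "(\<integral>\<^sup>+x. indicator A (redirect n (g, x)) \<partial>sphere_law n) = indicator A (direction n g)" by (simp add: S.emeasure_space_1)
 qed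
 also have "... = (\<integral>\<^sup>+u. indicator A u \<partial>sphere_law n)" unfolding G.direction_law[symmetric] by (subst nn_integral_distr) auto
 finally show "emeasure (distr (gaussian_law n \<Otimes>\<^sub>M sphere_law n) ?L (redirect n)) A = emeasure (sphere_law n) A" by simp
qed simp

section \<open>Moments of the Beta law\<close>

lemma nn_integral_vscale:
 assumes t: "t > 0" and [measurable]: "f \<in> borel_measurable (lebesgue_Rn n)"
 shows "(\<integral>\<^sup>+x. f x \<partial>lebesgue_Rn n) = ennreal (t ^ n) * (\<integral>\<^sup>+x. f (vscale n t x) \<partial>lebesgue_Rn n)"
proof -
 let ?L = "lebesgue_Rn n"
 have [measurable]: "vscale n t \<in> ?L \<rightarrow>\<^sub>M ?L" by measurable
 have "?L = scale_measure (ennreal (t ^ n)) (distr ?L ?L (vscale n t))"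
 proof (rule measure_eqI)
  fix A assume A: "A \<in> sets ?L"
  show "emeasure ?L A = emeasure (scale_measure (ennreal (t ^ n)) (distr ?L ?L (vscale n t))) A"
   using A by (subst emeasure_lebesgue_Rn_vscale[OF t A]) (simp add: emeasure_distr)
 qed simp
 then have "(\<integral>\<^sup>+x. f x \<partial>?L) = (\<integral>\<^sup>+x. f x \<partial>scale_measure (ennreal (t ^ n)) (distr ?L ?L (vscale n t)))"
  by (rule arg_cong[where f="\<lambda>M. integral\<^sup>N M f"])
 also have "... = ennreal (t ^ n) * (\<integral>\<^sup>+x. f (vscale n t x) \<partial>?L)" by (subst nn_integral_scale_measure) (auto simp: nn_integral_distr)
 finally show ?thesis .
qed

text \<open>For t = 1 and up to the normalising constant these are moments of 1 - |x|^2 under Beta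
  laws: a = \<nu> / 2 - 1 is the total mass, and each further unit in \<open>a\<close> adds a power.
  The parameter t, a squared radius, allows a scaling argument.\<close>

definition ball_moment :: "nat => real => real => ennreal" where
 "ball_moment n a t = (\<integral>\<^sup>+x. (if ip n x x < t then ennreal ((t - ip n x x) powr a) else 0) \<partial>lebesgue_Rn n)"

lemma measurable_ip_self [measurable]: "(\<lambda>x. ip n x x) \<in> borel_measurable (lebesgue_Rn n)"
 by (intro measurable_ip measurable_lebesgue_Rn_component)

lemma ball_moment_scale:
 assumes t: "t > 0"
 shows "ball_moment n a t = ennreal (t powr (real n / 2 + a)) * ball_moment n a 1"
proof -
 let ?L = "lebesgue_Rn n"
 have s: "sqrt t > 0" using t by simp
 have "ball_moment n a t = ennreal (sqrt t ^ n) * (\<integral>\<^sup>+x. (if ip n (vscale n (sqrt t) x) (vscale n (sqrt t) x) < t then ennreal ((t - ip n (vscale n (sqrt t) x) (vscale n (sqrt t) x)) powr a) else 0) \<partial>?L)"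
  unfolding ball_moment_def by (rule nn_integral_vscale[OF s]) measurable
 also have "(\<integral>\<^sup>+x. (if ip n (vscale n (sqrt t) x) (vscale n (sqrt t) x) < t then ennreal ((t - ip n (vscale n (sqrt t) x) (vscale n (sqrt t) x)) powr a) else 0) \<partial>?L)
   = (\<integral>\<^sup>+x. ennreal (t powr a) * (if ip n x x < 1 then ennreal ((1 - ip n x x) powr a) else 0) \<partial>?L)"
 proof (rule nn_integral_cong)
  fix x
  have "t - t * ip n x x = t * (1 - ip n x x)" by (simp add: algebra_simps)
  then show "(if ip n (vscale n (sqrt t) x) (vscale n (sqrt t) x) < t then ennreal ((t - ip n (vscale n (sqrt t) x) (vscale n (sqrt t) x)) powr a) else 0)
   = ennreal (t powr a) * (if ip n x x < 1 then ennreal ((1 - ip n x x) powr a) else 0)"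
   using t by (auto simp: ip_vscale powr_mult ennreal_mult[symmetric])
 qed
 also have "... = ennreal (t powr a) * ball_moment n a 1" unfolding ball_moment_def by (rule nn_integral_cmult) measurable
 also have "ennreal (sqrt t ^ n) * (ennreal (t powr a) * ball_moment n a 1) = ennreal (t powr (real n / 2 + a)) * ball_moment n a 1"
 proof -
  have "sqrt t ^ n = t powr (real n / 2)" using t by (simp add: powr_half_sqrt[symmetric] powr_realpow[symmetric] powr_powr)
  then have "sqrt t ^ n * t powr a = t powr (real n / 2 + a)" by (simp add: powr_add)
  moreover have "ennreal (sqrt t ^ n) * ennreal (t powr a) = ennreal (sqrt t ^ n * t powr a)"
   using t by (intro ennreal_mult[symmetric]) auto
  ultimately show ?thesis by (simp add: mult.assoc[symmetric])
 qed
 finally show ?thesis .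
qed

lemma nn_integral_powr_interval:
 fixes a u :: real
 assumes a: "a > -1"
 shows "(\<integral>\<^sup>+t. (if u < t \<and> t \<le> 1 then ennreal ((t - u) powr a) else 0) \<partial>lborel)
  = (if u < 1 then ennreal ((1 - u) powr (a + 1) / (a + 1)) else 0)"
proof (cases "u < 1")
 case True
 have "(\<integral>\<^sup>+t. (if u < t \<and> t \<le> 1 then ennreal ((t - u) powr a) else 0) \<partial>lborel)
   = (\<integral>\<^sup>+s. (if u < u + 1 * s \<and> u + 1 * s \<le> 1 then ennreal ((u + 1 * s - u) powr a) else 0) \<partial>lborel)"
  by (subst nn_integral_real_affine[of _ 1 u]) auto
 also have "... = (\<integral>\<^sup>+s. ennreal (indicator {0..1 - u} s * s powr a) \<partial>lborel)" by (rule nn_integral_cong) (auto simp: indicator_def)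
 also have "... = ennreal ((1 - u) powr (a + 1) / (a + 1))"
  using True a by (intro nn_integral_has_integral_lebesgue has_integral_powr_from_0) auto
 finally show ?thesis using True by simp
next
 case False
 then have "(\<lambda>t. if u < t \<and> t \<le> 1 then ennreal ((t - u) powr a) else 0) = (\<lambda>t. 0)" by auto
 then show ?thesis using False by simp
qed

text \<open>Write (1 - u)^(a+1) as a + 1 times the integral of (t - u)^a over t in (u, 1] with u =
  |x|^2, exchange the integrals, and use scaling in t; what remains is the integral of t^(n/2 + a)
  over (0, 1].\<close>

lemma ball_moment_Suc:
 assumes a: "a > -1"
 shows "ball_moment n (a + 1) 1 = ennreal ((a + 1) / (real n / 2 + a + 1)) * ball_moment n a 1"
proof -
 let ?L = "lebesgue_Rn n"
 interpret L: sigma_finite_measure ?L by (rule sigma_finite_lebesgue_Rn)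
 interpret LP: pair_sigma_finite "lborel :: real measure" ?L by unfold_locales
 have "ball_moment n (a + 1) 1 = (\<integral>\<^sup>+x. ennreal (a + 1) * (\<integral>\<^sup>+t. (if ip n x x < t \<and> t \<le> 1 then ennreal ((t - ip n x x) powr a) else 0) \<partial>lborel) \<partial>?L)"
  unfolding ball_moment_def
 proof (rule nn_integral_cong)
  fix x
  show "(if ip n x x < 1 then ennreal ((1 - ip n x x) powr (a + 1)) else 0)
   = ennreal (a + 1) * (\<integral>\<^sup>+t. (if ip n x x < t \<and> t \<le> 1 then ennreal ((t - ip n x x) powr a) else 0) \<partial>lborel)"
   unfolding nn_integral_powr_interval[OF a] using a by (auto simp: ennreal_mult[symmetric])
 qed
 also have "... = ennreal (a + 1) * (\<integral>\<^sup>+x. (\<integral>\<^sup>+t. (if ip n x x < t \<and> t \<le> 1 then ennreal ((t - ip n x x) powr a) else 0) \<partial>lborel) \<partial>?L)"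
  by (rule nn_integral_cmult) measurable
 also have "(\<integral>\<^sup>+x. (\<integral>\<^sup>+t. (if ip n x x < t \<and> t \<le> 1 then ennreal ((t - ip n x x) powr a) else 0) \<partial>lborel) \<partial>?L)
   = (\<integral>\<^sup>+t. (\<integral>\<^sup>+x. (if ip n x x < t \<and> t \<le> 1 then ennreal ((t - ip n x x) powr a) else 0) \<partial>?L) \<partial>lborel)"
  by (rule LP.Fubini') measurable
 also have "... = (\<integral>\<^sup>+t. (if 0 < t \<and> t \<le> 1 then ennreal ((t - 0) powr (real n / 2 + a)) else 0) * ball_moment n a 1 \<partial>lborel)"
 proof (rule nn_integral_cong)
  fix t :: real
  show "(\<integral>\<^sup>+x. (if ip n x x < t \<and> t \<le> 1 then ennreal ((t - ip n x x) powr a) else 0) \<partial>?L)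
   = (if 0 < t \<and> t \<le> 1 then ennreal ((t - 0) powr (real n / 2 + a)) else 0) * ball_moment n a 1"
  proof (cases "0 < t \<and> t \<le> 1")
   case True
   then have "(\<integral>\<^sup>+x. (if ip n x x < t \<and> t \<le> 1 then ennreal ((t - ip n x x) powr a) else 0) \<partial>?L) = ball_moment n a t"
    by (simp add: ball_moment_def)
   with True show ?thesis using ball_moment_scale[of t n a] by simp
  next
   case False
   have "(if ip n x x < t \<and> t \<le> 1 then ennreal ((t - ip n x x) powr a) else 0) = 0" for x
   proof -
    have "\<not> (ip n x x < t \<and> t \<le> 1)" using False ip_nonneg[of n x] by linarith
    then show ?thesis by simp
   qed
   with False show ?thesis by (simp only: nn_integral_const) simp
  qed
 qed
 also have "... = ennreal (1 / (real n / 2 + a + 1)) * ball_moment n a 1"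
  using nn_integral_powr_interval[of "real n / 2 + a" 0] a by (subst nn_integral_multc) auto
 also have "ennreal (a + 1) * (ennreal (1 / (real n / 2 + a + 1)) * ball_moment n a 1)
   = ennreal ((a + 1) / (real n / 2 + a + 1)) * ball_moment n a 1"
  using a by (simp add: mult.assoc[symmetric] ennreal_mult[symmetric])
 finally show ?thesis .
qed

lemma beta_law_eq:
 "beta_law \<nu> n = density (lebesgue_Rn n) (\<lambda>x. (\<lambda>t. ennreal (if t < 1
    then pi powr (- real n / 2) * (Gamma ((real n + \<nu>) / 2) / Gamma (\<nu> / 2)) * (1 - t\<^sup>2) powr ((\<nu> - 2) / 2)
    else 0)) (nrm n x))" by (simp add: beta_law_def)

text \<open>Total mass 1 reads \<open>c * ball_moment n a 1 = 1\<close>, so two applications of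
  \<open>ball_moment_Suc\<close> give the second moment of 1 - |x|^2 as a product of two ratios,
  without evaluating the Gamma quotient.\<close>

lemma beta_law_moment:
 assumes \<nu>: "\<nu> > 0" and n: "n \<ge> 1" and prob: "prob_space (beta_law \<nu> n)"
 shows "(\<integral>\<^sup>+x. ennreal ((1 - (nrm n x)\<^sup>2)^2) \<partial>beta_law \<nu> n) \<le> ennreal (\<nu> * (\<nu> + 2) / (real n)^2)"
  and "AE x in beta_law \<nu> n. nrm n x \<le> 1"
proof -
 let ?L = "lebesgue_Rn n"
 interpret B: prob_space "beta_law \<nu> n" by fact
 define c where "c = pi powr (- real n / 2) * (Gamma ((real n + \<nu>) / 2) / Gamma (\<nu> / 2))"
 have c: "c \<ge> 0" unfolding c_def using \<nu> by (intro mult_nonneg_nonneg divide_nonneg_nonneg) (auto intro: less_imp_le Gamma_real_pos)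
 define a where "a = \<nu> / 2 - 1"
 have a: "a > -1" using \<nu> by (simp add: a_def)
 have lt: "nrm n x < 1 \<longleftrightarrow> ip n x x < 1" for x by (simp add: L2_set_eq_ip)
 have dens: "ennreal (if nrm n x < 1 then pi powr (- real n / 2) * (Gamma ((real n + \<nu>) / 2) / Gamma (\<nu> / 2)) * (1 - (nrm n x)\<^sup>2) powr ((\<nu> - 2) / 2) else 0)
   = ennreal c * (if ip n x x < 1 then ennreal ((1 - ip n x x) powr a) else 0)" for x
  unfolding lt nrm_sq c_def[symmetric] using c by (auto simp: a_def ennreal_mult[symmetric] diff_divide_distrib)
 have beta: "beta_law \<nu> n = density ?L (\<lambda>x. ennreal c * (if ip n x x < 1 then ennreal ((1 - ip n x x) powr a) else 0))"
  unfolding beta_law_def dens ..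
 have int: "(\<integral>\<^sup>+x. g x \<partial>beta_law \<nu> n) = (\<integral>\<^sup>+x. (ennreal c * (if ip n x x < 1 then ennreal ((1 - ip n x x) powr a) else 0)) * g x \<partial>?L)"
  if [measurable]: "g \<in> borel_measurable ?L" for g unfolding beta by (rule nn_integral_density) measurable
 have "1 = (\<integral>\<^sup>+x. 1 \<partial>beta_law \<nu> n)" by (simp add: B.emeasure_space_1)
 also have "... = ennreal c * ball_moment n a 1" by (subst int) (auto simp: ball_moment_def nn_integral_cmult)
 finally have one: "ennreal c * ball_moment n a 1 = 1" ..
 have "(\<integral>\<^sup>+x. ennreal ((1 - (nrm n x)\<^sup>2)^2) \<partial>beta_law \<nu> n)
   = (\<integral>\<^sup>+x. ennreal c * (if ip n x x < 1 then ennreal ((1 - ip n x x) powr (a + 1 + 1)) else 0) \<partial>?L)"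
 proof (subst int)
  show "(\<integral>\<^sup>+x. (ennreal c * (if ip n x x < 1 then ennreal ((1 - ip n x x) powr a) else 0)) * ennreal ((1 - (nrm n x)\<^sup>2)^2) \<partial>?L)
    = (\<integral>\<^sup>+x. ennreal c * (if ip n x x < 1 then ennreal ((1 - ip n x x) powr (a + 1 + 1)) else 0) \<partial>?L)"
  proof (rule nn_integral_cong)
   fix x
   have "(1 - ip n x x) powr a * (1 - ip n x x)^2 = (1 - ip n x x) powr (a + 1 + 1)" if "ip n x x < 1"
    using that powr_add[of "1 - ip n x x" a 2] by (simp add: add.assoc)
   then show "(ennreal c * (if ip n x x < 1 then ennreal ((1 - ip n x x) powr a) else 0)) * ennreal ((1 - (nrm n x)\<^sup>2)^2)
    = ennreal c * (if ip n x x < 1 then ennreal ((1 - ip n x x) powr (a + 1 + 1)) else 0)"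
    by (auto simp: nrm_sq mult.assoc ennreal_mult[symmetric])
  qed
 qed measurable
 also have "... = ennreal c * ball_moment n (a + 1 + 1) 1" unfolding ball_moment_def by (rule nn_integral_cmult) measurable
 also have "... = ennreal ((a + 1 + 1) / (real n / 2 + (a + 1) + 1)) * (ennreal ((a + 1) / (real n / 2 + a + 1)) * (ennreal c * ball_moment n a 1))"
  using a by (subst ball_moment_Suc, simp, subst ball_moment_Suc) (simp_all add: mult_ac)
 also have "... = ennreal ((a + 1 + 1) / (real n / 2 + (a + 1) + 1) * ((a + 1) / (real n / 2 + a + 1)))"
  using a by (simp add: one ennreal_mult[symmetric])
 also have "... \<le> ennreal (\<nu> * (\<nu> + 2) / (real n)^2)"
 proof (rule ennreal_leI)
  have n0: "real n > 0" using n by simp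
  have "(a + 1 + 1) / (real n / 2 + (a + 1) + 1) \<le> (\<nu> + 2) / real n"
   using \<nu> n0 by (simp add: a_def divide_simps) (simp add: algebra_simps)
  moreover have "(a + 1) / (real n / 2 + a + 1) \<le> \<nu> / real n" using \<nu> n0 by (simp add: a_def divide_simps)
  ultimately have "(a + 1 + 1) / (real n / 2 + (a + 1) + 1) * ((a + 1) / (real n / 2 + a + 1)) \<le> (\<nu> + 2) / real n * (\<nu> / real n)"
   using a \<nu> n0 by (intro mult_mono) auto
  then show "(a + 1 + 1) / (real n / 2 + (a + 1) + 1) * ((a + 1) / (real n / 2 + a + 1)) \<le> \<nu> * (\<nu> + 2) / (real n)^2"
   by (simp add: power2_eq_square mult_ac)
 qed
 finally show "(\<integral>\<^sup>+x. ennreal ((1 - (nrm n x)\<^sup>2)^2) \<partial>beta_law \<nu> n) \<le> ennreal (\<nu> * (\<nu> + 2) / (real n)^2)" .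
 show "AE x in beta_law \<nu> n. nrm n x \<le> 1" unfolding beta by (subst AE_density) (auto simp: lt[symmetric] split: if_splits)
qed

lemma radial_beta_law:
 assumes "prob_space (beta_law \<nu> n)"
 shows "radial_law (beta_law \<nu> n) n (\<lambda>t. ennreal (if t < 1
    then pi powr (- real n / 2) * (Gamma ((real n + \<nu>) / 2) / Gamma (\<nu> / 2)) * (1 - t\<^sup>2) powr ((\<nu> - 2) / 2)
    else 0))" using assms unfolding radial_law_def radial_law_axioms_def beta_law_eq by simp

text \<open>The laws of the form \<open>redirect\<close>: length and direction are independent, the direction is
 uniform, and the squared length is \<open>1 + O(1 / n)\<close> in mean square.\<close>

locale near_sphere_law = rotation_invariant_law \<mu> n for \<mu> n +
 fixes K :: real
 assumes redirect_eq: "distr (gaussian_law n \<Otimes>\<^sub>M \<mu>) (lebesgue_Rn n) (redirect n) = \<mu>"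
  and nrm_le_1: "AE x in \<mu>. nrm n x \<le> 1"
  and nrm_moment: "(\<integral>\<^sup>+x. ennreal ((1 - (nrm n x)\<^sup>2)^2) \<partial>\<mu>) \<le> ennreal (K / (real n)^2)"

lemma near_sphere_beta_law:
 assumes "\<nu> > 0" "n \<ge> 1" and prob: "prob_space (beta_law \<nu> n)"
 shows "near_sphere_law (beta_law \<nu> n) n (\<nu> * (\<nu> + 2))"
proof -
 interpret B: radial_law "beta_law \<nu> n" n "\<lambda>t. ennreal (if t < 1
    then pi powr (- real n / 2) * (Gamma ((real n + \<nu>) / 2) / Gamma (\<nu> / 2)) * (1 - t\<^sup>2) powr ((\<nu> - 2) / 2)
    else 0)" by (rule radial_beta_law[OF prob])
 show ?thesis using redirect_law[OF prob B.sets_radial radial_gaussian_law B.polar] B.rotation_invariant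
   beta_law_moment[OF assms] by (simp add: near_sphere_law_def near_sphere_law_axioms_def)
qed

lemma near_sphere_sphere_law:
 assumes "n \<ge> 1" shows "near_sphere_law (sphere_law n) n 0"
proof -
 have "(\<integral>\<^sup>+x. ennreal ((1 - (nrm n x)\<^sup>2)^2) \<partial>sphere_law n) = (\<integral>\<^sup>+x. 0 \<partial>sphere_law n)"
  using AE_sphere_law[OF assms] by (intro nn_integral_cong_AE) auto
 then show ?thesis using AE_sphere_law[OF assms] redirect_sphere_law[OF assms] rotation_invariant_sphere_law
  by (auto simp: near_sphere_law_def near_sphere_law_axioms_def)
qed

subsection \<open>Moment bounds on products of i.i.d. rows\<close>

definition L1_le :: "'a measure => ('a => real) => real => bool" where
 "L1_le M f c \<longleftrightarrow> f \<in> borel_measurable M \<and> 0 \<le> c \<and> (\<integral>\<^sup>+x. ennreal \<bar>f x\<bar> \<partial>M) \<le> ennreal c"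

text \<open>\<open>c\<close> bounds the second moment itself, not its square root. Measurability and
  the sign of \<open>c\<close> are carried along so that such bounds compose without side
  conditions.\<close>

definition L2_le :: "'a measure => ('a => real) => real => bool" where
 "L2_le M f c \<longleftrightarrow> f \<in> borel_measurable M \<and> 0 \<le> c \<and> (\<integral>\<^sup>+x. ennreal ((f x)^2) \<partial>M) \<le> ennreal c"

lemma L1_leD: "L1_le M f c ==> f \<in> borel_measurable M" "L1_le M f c ==> 0 \<le> c" by (auto simp: L1_le_def)

lemma L2_leD: "L2_le M f c ==> f \<in> borel_measurable M" "L2_le M f c ==> 0 \<le> c" by (auto simp: L2_le_def)

lemma L2_le_iff_L1: "f \<in> borel_measurable M ==> L2_le M f c \<longleftrightarrow> L1_le M (\<lambda>x. (f x)^2) c" by (simp add: L1_le_def L2_le_def)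

lemma L1_le_mono:
 assumes "L1_le M g c" "f \<in> borel_measurable M" "AE x in M. \<bar>f x\<bar> \<le> \<bar>g x\<bar>" "c \<le> d"
 shows "L1_le M f d"
proof -
 have "(\<integral>\<^sup>+x. ennreal \<bar>f x\<bar> \<partial>M) \<le> (\<integral>\<^sup>+x. ennreal \<bar>g x\<bar> \<partial>M)" using assms(3) by (intro nn_integral_mono_AE) (auto intro: ennreal_leI)
 also have "... \<le> ennreal d" using assms(1,4) by (auto simp: L1_le_def intro: order_trans ennreal_leI)
 finally show ?thesis using assms by (auto simp: L1_le_def)
qed

lemma L2_le_mono:
 assumes "L2_le M g c" "f \<in> borel_measurable M" "AE x in M. \<bar>f x\<bar> \<le> \<bar>g x\<bar>" "c \<le> d"
 shows "L2_le M f d"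
proof -
 have AE: "AE x in M. \<bar>(f x)\<^sup>2\<bar> \<le> \<bar>(g x)\<^sup>2\<bar>" using assms(3) by (auto simp: abs_le_square_iff)
 have g: "L1_le M (\<lambda>x. (g x)^2) c" using assms(1) L2_leD(1) L2_le_iff_L1 by blast
 have "(\<lambda>x. (f x)^2) \<in> borel_measurable M" using assms(2) by measurable
 from L1_le_mono[OF g this AE assms(4)] show ?thesis by (simp add: L2_le_iff_L1[OF assms(2)])
qed

lemma L1_le_weaken: "L1_le M f c ==> c \<le> d ==> L1_le M f d" by (auto simp: L1_le_def intro: order_trans ennreal_leI)

lemma L2_le_weaken: "L2_le M f c ==> c \<le> d ==> L2_le M f d" by (auto simp: L2_le_def intro: order_trans ennreal_leI)

lemma L1_le_0 [simp]: "L1_le M (\<lambda>x. 0) 0" by (simp add: L1_le_def)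

lemma L2_le_0 [simp]: "L2_le M (\<lambda>x. 0) 0" by (simp add: L2_le_def)

lemma L1_le_add:
 assumes "L1_le M f a" "L1_le M g b" shows "L1_le M (\<lambda>x. f x + g x) (a + b)"
proof -
 have [measurable]: "f \<in> borel_measurable M" "g \<in> borel_measurable M" using assms by (auto simp: L1_le_def)
 have "(\<integral>\<^sup>+x. ennreal \<bar>f x + g x\<bar> \<partial>M) \<le> (\<integral>\<^sup>+x. ennreal \<bar>f x\<bar> + ennreal \<bar>g x\<bar> \<partial>M)"
  by (intro nn_integral_mono) (auto simp: ennreal_plus[symmetric] simp del: ennreal_plus intro!: ennreal_leI)
 also have "... \<le> ennreal a + ennreal b" using assms by (subst nn_integral_add) (auto simp: L1_le_def intro!: add_mono)
 finally show ?thesis using assms by (auto simp: L1_le_def)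
qed

lemma L1_le_cmult:
 assumes "L1_le M f a" shows "L1_le M (\<lambda>x. c * f x) (\<bar>c\<bar> * a)"
proof -
 have [measurable]: "f \<in> borel_measurable M" using assms by (auto simp: L1_le_def)
 have "(\<integral>\<^sup>+x. ennreal \<bar>c * f x\<bar> \<partial>M) = ennreal \<bar>c\<bar> * (\<integral>\<^sup>+x. ennreal \<bar>f x\<bar> \<partial>M)"
  by (subst nn_integral_cmult[symmetric]) (auto simp: abs_mult ennreal_mult)
 also have "... \<le> ennreal \<bar>c\<bar> * ennreal a" using assms by (intro mult_left_mono) (auto simp: L1_le_def)
 finally show ?thesis using assms by (auto simp: L1_le_def ennreal_mult)
qed

lemma L2_le_cmult:
 assumes "L2_le M f a" shows "L2_le M (\<lambda>x. c * f x) (c^2 * a)"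
proof -
 have m: "f \<in> borel_measurable M" using assms by (auto simp: L2_le_def)
 have "L1_le M (\<lambda>x. c^2 * (f x)^2) (\<bar>c^2\<bar> * a)" using assms m by (intro L1_le_cmult) (simp add: L2_le_iff_L1)
 then show ?thesis using m by (simp add: L2_le_iff_L1 power_mult_distrib)
qed

lemma L2_le_add:
 assumes "L2_le M f a" "L2_le M g b" shows "L2_le M (\<lambda>x. f x + g x) (2 * a + 2 * b)"
proof -
 have m [measurable]: "f \<in> borel_measurable M" "g \<in> borel_measurable M" using assms by (auto simp: L2_le_def)
 have "L1_le M (\<lambda>x. 2 * (f x)^2 + 2 * (g x)^2) (\<bar>2\<bar> * a + \<bar>2\<bar> * b)"
  using assms m by (intro L1_le_add L1_le_cmult) (simp_all add: L2_le_iff_L1)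
 then have "L1_le M (\<lambda>x. (f x + g x)^2) (2 * a + 2 * b)"
 proof (rule L1_le_mono)
  have "(f x + g x)^2 \<le> 2 * (f x)^2 + 2 * (g x)^2" for x
   using zero_le_power2[of "f x - g x"] by (simp add: power2_eq_square algebra_simps)
  then show "AE x in M. \<bar>(f x + g x)\<^sup>2\<bar> \<le> \<bar>2 * (f x)^2 + 2 * (g x)^2\<bar>" by auto
 qed auto
 then show ?thesis by (simp add: L2_le_iff_L1)
qed

lemma L1_le_sum:
 assumes "finite I" "\<And>i. i \<in> I ==> L1_le M (f i) (a i)"
 shows "L1_le M (\<lambda>x. \<Sum>i\<in>I. f i x) (\<Sum>i\<in>I. a i)" using assms by (induction I rule: finite_induct) (auto intro: L1_le_add)

lemma L1_le_mult:
 assumes "L2_le M f a" "L2_le M g b" shows "L1_le M (\<lambda>x. f x * g x) (sqrt (a * b))"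
proof -
 have [measurable]: "f \<in> borel_measurable M" "g \<in> borel_measurable M" using assms by (auto simp: L2_le_def)
 have ab: "0 \<le> a" "0 \<le> b" using assms by (auto simp: L2_le_def)
 have "(\<integral>\<^sup>+x. ennreal \<bar>f x\<bar> * ennreal \<bar>g x\<bar> \<partial>M)^2
   \<le> (\<integral>\<^sup>+x. (ennreal \<bar>f x\<bar>)^2 \<partial>M) * (\<integral>\<^sup>+x. (ennreal \<bar>g x\<bar>)^2 \<partial>M)" by (rule Cauchy_Schwarz_nn_integral) auto
 also have "... \<le> ennreal a * ennreal b" using assms by (intro mult_mono) (auto simp: L2_le_def ennreal_power)
 also have "... = (ennreal (sqrt (a * b)))^2" using ab by (simp add: ennreal_power ennreal_mult[symmetric])
 finally have sq: "(\<integral>\<^sup>+x. ennreal \<bar>f x\<bar> * ennreal \<bar>g x\<bar> \<partial>M)^2 \<le> (ennreal (sqrt (a * b)))^2" .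
 have sq_le: "X \<le> ennreal y" if "X^2 \<le> (ennreal y)^2" "0 \<le> y" for X y
 proof (cases X rule: ennreal_cases)
  case (real u)
  with that have "u^2 \<le> y^2" by (simp add: ennreal_power ennreal_le_iff)
  then have "u \<le> y" using that(2) by (rule power2_le_imp_le)
  with real show ?thesis by (simp add: ennreal_leI)
 next
  case top
  with that show ?thesis by (simp add: power2_eq_square ennreal_mult[symmetric] top_unique)
 qed
 have "(\<integral>\<^sup>+x. ennreal \<bar>f x\<bar> * ennreal \<bar>g x\<bar> \<partial>M) \<le> ennreal (sqrt (a * b))" by (rule sq_le[OF sq]) (use ab in simp)
 then show ?thesis using ab by (simp add: L1_le_def abs_mult ennreal_mult)
qed

lemma L1_le_square: "L2_le M f a ==> L1_le M (\<lambda>x. (f x)^2) a" using L2_leD(1) L2_le_iff_L1 by blast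

lemma L1_le_integrable: "L1_le M f c ==> integrable M f" by (auto simp: L1_le_def integrable_iff_bounded intro: le_less_trans)

lemma L1_le_integral: "L1_le M f c ==> \<bar>integral\<^sup>L M f\<bar> \<le> c"
proof -
 assume f: "L1_le M f c"
 have "ennreal \<bar>integral\<^sup>L M f\<bar> \<le> (\<integral>\<^sup>+x. ennreal \<bar>f x\<bar> \<partial>M)" using integral_norm_bound_ennreal[OF L1_le_integrable[OF f]] by simp
 also have "... \<le> ennreal c" using f by (simp add: L1_le_def)
 finally show ?thesis using f by (simp add: L1_le_def ennreal_le_iff)
qed

lemma L1_leI_integral:
 assumes "integrable M f" "(\<integral>x. \<bar>f x\<bar> \<partial>M) \<le> c" shows "L1_le M f c"
proof -
 have "(\<integral>\<^sup>+x. ennreal \<bar>f x\<bar> \<partial>M) = ennreal (\<integral>x. \<bar>f x\<bar> \<partial>M)" using assms by (intro nn_integral_eq_integral) auto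
 moreover have "0 \<le> (\<integral>x. \<bar>f x\<bar> \<partial>M)" by (rule integral_nonneg_AE) auto
 then have "0 \<le> c" using assms(2) by (rule order_trans)
 ultimately show ?thesis using assms unfolding L1_le_def by (auto intro: ennreal_leI)
qed

lemma L2_leI_integral:
 assumes "f \<in> borel_measurable M" "integrable M (\<lambda>x. (f x)^2)" "(\<integral>x. (f x)^2 \<partial>M) \<le> c" shows "L2_le M f c"
 using assms by (auto simp: L2_le_iff_L1 intro!: L1_leI_integral)

context prob_space
begin

lemma L1_le_const: "L1_le M (\<lambda>x. c) \<bar>c\<bar>" by (simp add: L1_le_def emeasure_space_1)

lemma L2_le_const: "L2_le M (\<lambda>x. c) (c^2)" by (simp add: L2_le_def emeasure_space_1)

lemma L2_le_imp_L1_le: "L2_le M f a ==> L1_le M f (sqrt a)" using L1_le_mult[of M f a "\<lambda>_. 1" 1] L2_le_const[of 1] by simp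

lemma L1_le_Markov:
 assumes f: "L1_le M f c" and t: "t > 0"
 shows "prob {x \<in> space M. t \<le> \<bar>f x\<bar>} \<le> c / t"
proof -
 have [measurable]: "f \<in> borel_measurable M" using f by (simp add: L1_le_def)
 have "emeasure M {x \<in> space M. 1 \<le> ennreal (1 / t) * ennreal \<bar>f x\<bar>} \<le> ennreal (1 / t) * (\<integral>\<^sup>+x. ennreal \<bar>f x\<bar> * indicator (space M) x \<partial>M)"
  by (rule nn_integral_Markov_inequality) auto
 also have "(\<integral>\<^sup>+x. ennreal \<bar>f x\<bar> * indicator (space M) x \<partial>M) = (\<integral>\<^sup>+x. ennreal \<bar>f x\<bar> \<partial>M)" by (intro nn_integral_cong) auto
 also have "ennreal (1 / t) * ... \<le> ennreal (1 / t) * ennreal c" using f by (intro mult_left_mono) (auto simp: L1_le_def)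
 also have "... = ennreal (c / t)" using t L1_leD(2)[OF f] by (simp add: ennreal_mult[symmetric])
 also have "{x \<in> space M. 1 \<le> ennreal (1 / t) * ennreal \<bar>f x\<bar>} = {x \<in> space M. t \<le> \<bar>f x\<bar>}"
  using t by (auto simp: ennreal_mult[symmetric] field_simps)
 finally show ?thesis using t L1_leD(2)[OF f] by (simp add: emeasure_eq_measure ennreal_le_iff)
qed

end

section \<open>Independent rows, resampling and martingale sums\<close>

lemma sum_bound_const: "(\<And>j. j < k ==> f j \<le> (c::real)) ==> (\<Sum>j<k. f j) \<le> real k * c" using sum_bounded_above[of "{..<k}" f c] by simp

text \<open>\<open>F\<close> depends only on the entries below j. Stating this as invariance under
  updates replaces a filtration and conditional expectations.\<close>

definition past :: "nat => ((nat => 'a) => 'b) => bool" where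
 "past j F \<longleftrightarrow> (\<forall>i\<ge>j. \<forall>x y. F (x(i := y)) = F x)"

lemma pastD: "past j F ==> j \<le> i ==> F (x(i := y)) = F x" by (auto simp: past_def)

locale row_product = Q: prob_space Q for Q :: "'a measure" +
 fixes N :: nat
begin

abbreviation rows :: "(nat => 'a) measure" where "rows \<equiv> \<Pi>\<^sub>M i\<in>{..<N}. Q"

sublocale P: prob_space rows by (intro prob_space_PiM Q.prob_space_axioms)

sublocale PQ: pair_sigma_finite rows Q by unfold_locales

text \<open>Overwriting row j by an independent copy does not change the product law. This plays the
  role of conditioning on the other rows.\<close>

lemma resample:
 assumes j: "j < N"
 shows "distr (rows \<Otimes>\<^sub>M Q) rows (\<lambda>(x, y). x(j := y)) = rows"
proof -
 interpret PP: product_sigma_finite "\<lambda>_::nat. Q" by standard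
 interpret FP: finite_product_sigma_finite "\<lambda>_::nat. Q" "{..<N}" by standard simp
 have ins: "insert j {..<N} = {..<N}" using j by auto
 have upd: "(\<lambda>(x, y). x(j := y)) \<in> rows \<Otimes>\<^sub>M Q \<rightarrow>\<^sub>M rows" using measurable_add_dim[of j "{..<N}" "\<lambda>_. Q"] unfolding ins by simp
 show ?thesis
 proof (rule PP.PiM_eqI)
  fix A assume A: "\<And>i. i \<in> {..<N} ==> A i \<in> sets Q"
  have PA: "Pi\<^sub>E {..<N} A \<in> sets rows" using A by (intro sets_PiM_I_finite) auto
  have "emeasure (distr (rows \<Otimes>\<^sub>M Q) rows (\<lambda>(x, y). x(j := y))) (Pi\<^sub>E {..<N} A)
    = emeasure (rows \<Otimes>\<^sub>M Q) ((\<lambda>(x, y). x(j := y)) -` Pi\<^sub>E {..<N} A \<inter> space (rows \<Otimes>\<^sub>M Q))" by (rule emeasure_distr[OF upd PA])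
  also have "(\<lambda>(x, y). x(j := y)) -` Pi\<^sub>E {..<N} A \<inter> space (rows \<Otimes>\<^sub>M Q) = Pi\<^sub>E {..<N} (A(j := space Q)) \<times> A j"
  proof (intro set_eqI iffI)
   fix p assume p: "p \<in> (\<lambda>(x, y). x(j := y)) -` Pi\<^sub>E {..<N} A \<inter> space (rows \<Otimes>\<^sub>M Q)"
   obtain x y where xy: "p = (x, y)" by (cases p)
   with p have x: "x \<in> space rows" and u: "x(j := y) \<in> Pi\<^sub>E {..<N} A" by (auto simp: space_pair_measure)
   have "y \<in> A j" using PiE_mem[OF u, of j] j by simp
   moreover have "x \<in> Pi\<^sub>E {..<N} (A(j := space Q))"
   proof (rule PiE_I)
    fix i assume "i \<in> {..<N}"
    then show "x i \<in> (A(j := space Q)) i" using PiE_mem[OF u, of i] x by (auto simp: space_PiM PiE_iff)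
   qed (use x in \<open>auto simp: space_PiM PiE_iff extensional_def\<close>)
   ultimately show "p \<in> Pi\<^sub>E {..<N} (A(j := space Q)) \<times> A j" by (simp add: xy)
  next
   fix p assume p: "p \<in> Pi\<^sub>E {..<N} (A(j := space Q)) \<times> A j"
   obtain x y where xy: "p = (x, y)" by (cases p)
   with p have x: "x \<in> Pi\<^sub>E {..<N} (A(j := space Q))" and y: "y \<in> A j" by auto
   have xi: "x i \<in> A i" if "i < N" "i \<noteq> j" for i using PiE_mem[OF x, of i] that by simp
   have xj: "x j \<in> space Q" using PiE_mem[OF x, of j] j by simp
   have ext: "x \<in> extensional {..<N}" using x by (simp add: PiE_iff)
   have sub: "A i \<subseteq> space Q" if "i < N" for i using A[of i] that sets.sets_into_space by auto
   have "x i \<in> space Q" if "i < N" for i using xi[OF that] xj sub[OF that] by (cases "i = j") auto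
   then have "x \<in> space rows" using ext by (simp add: space_PiM PiE_iff)
   moreover have "x(j := y) \<in> Pi\<^sub>E {..<N} A" using xi y ext j by (intro PiE_I) (auto simp: extensional_def)
   moreover have "y \<in> space Q" using sub[OF j] y by blast
   ultimately show "p \<in> (\<lambda>(x, y). x(j := y)) -` Pi\<^sub>E {..<N} A \<inter> space (rows \<Otimes>\<^sub>M Q)" by (simp add: xy space_pair_measure)
  qed
  also have "emeasure (rows \<Otimes>\<^sub>M Q) (Pi\<^sub>E {..<N} (A(j := space Q)) \<times> A j)
    = emeasure rows (Pi\<^sub>E {..<N} (A(j := space Q))) * emeasure Q (A j)"
   using A j by (intro Q.emeasure_pair_measure_Times sets_PiM_I_finite) auto
  also have "emeasure rows (Pi\<^sub>E {..<N} (A(j := space Q))) = (\<Prod>i<N. emeasure Q ((A(j := space Q)) i))"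
   using A by (intro FP.measure_times) auto
  also have "... = (\<Prod>i\<in>{..<N}-{j}. emeasure Q (A i))"
   using j by (subst prod.remove[of _ j]) (auto simp: Q.emeasure_space_1 intro!: prod.cong)
  also have "... * emeasure Q (A j) = (\<Prod>i<N. emeasure Q (A i))" using j by (subst (2) prod.remove[of _ j]) (auto simp: mult.commute)
  finally show "emeasure (distr (rows \<Otimes>\<^sub>M Q) rows (\<lambda>(x, y). x(j := y))) (Pi\<^sub>E {..<N} A) = (\<Prod>i<N. emeasure Q (A i))" .
 qed simp_all
qed

lemma measurable_row: "j < N ==> (\<lambda>x. x j) \<in> rows \<rightarrow>\<^sub>M Q" by (rule measurable_component_singleton) simp

lemma measurable_row_fun:
 "j < N ==> \<xi> \<in> borel_measurable Q ==> (\<lambda>x. \<xi> (x j)) \<in> borel_measurable rows" by (rule measurable_compose[OF measurable_row])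

text \<open>After resampling row j, \<open>F\<close> and \<xi> sit on different factors of a product
  space, and Fubini splits moment and mean. Both are asserted together because the second needs the
  integrability given by the first.\<close>

lemma L1_le_indep_mult:
 assumes j: "j < N" and F: "L1_le rows F a" and indep: "\<And>x y. F (x(j := y)) = F x" and \<xi>: "L1_le Q \<xi> b"
 shows "L1_le rows (\<lambda>x. F x * \<xi> (x j)) (a * b)"
  and "(\<integral>x. F x * \<xi> (x j) \<partial>rows) = (\<integral>x. F x \<partial>rows) * (\<integral>y. \<xi> y \<partial>Q)"
proof -
 have ins: "insert j {..<N} = {..<N}" using j by auto
 have upd [measurable]: "(\<lambda>(x, y). x(j := y)) \<in> rows \<Otimes>\<^sub>M Q \<rightarrow>\<^sub>M rows"
  using measurable_add_dim[of j "{..<N}" "\<lambda>_. Q"] unfolding ins by simp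
 have Fm [measurable]: "F \<in> borel_measurable rows" and xm [measurable]: "\<xi> \<in> borel_measurable Q" using F \<xi> by (auto simp: L1_le_def)
 have \<xi>m [measurable]: "(\<lambda>x. \<xi> (x j)) \<in> borel_measurable rows" by (rule measurable_row_fun[OF j xm])
 have ab: "0 \<le> a" "0 \<le> b" using F \<xi> by (auto simp: L1_le_def)
 have "(\<integral>\<^sup>+x. ennreal \<bar>F x * \<xi> (x j)\<bar> \<partial>rows) = (\<integral>\<^sup>+x. ennreal \<bar>F x * \<xi> (x j)\<bar> \<partial>distr (rows \<Otimes>\<^sub>M Q) rows (\<lambda>(x, y). x(j := y)))"
  by (simp add: resample[OF j])
 also have "... = (\<integral>\<^sup>+p. ennreal \<bar>F (fst p) * \<xi> (snd p)\<bar> \<partial>(rows \<Otimes>\<^sub>M Q))"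
  using indep by (subst nn_integral_distr) (auto simp: split_beta)
 also have "... = (\<integral>\<^sup>+x. \<integral>\<^sup>+y. ennreal \<bar>F x\<bar> * ennreal \<bar>\<xi> y\<bar> \<partial>Q \<partial>rows)"
  by (subst Q.nn_integral_fst[symmetric]) (auto simp: abs_mult ennreal_mult)
 also have "... = (\<integral>\<^sup>+x. ennreal \<bar>F x\<bar> \<partial>rows) * (\<integral>\<^sup>+y. ennreal \<bar>\<xi> y\<bar> \<partial>Q)" by (simp add: nn_integral_cmult nn_integral_multc)
 also have "... \<le> ennreal a * ennreal b" using F \<xi> by (intro mult_mono) (auto simp: L1_le_def)
 finally show L1: "L1_le rows (\<lambda>x. F x * \<xi> (x j)) (a * b)" using ab by (simp add: L1_le_def ennreal_mult)
 have "(\<integral>\<^sup>+p. ennreal \<bar>F (fst p) * \<xi> (snd p)\<bar> \<partial>(rows \<Otimes>\<^sub>M Q)) < \<infinity>"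
 proof -
  have "(\<integral>\<^sup>+p. ennreal \<bar>F (fst p) * \<xi> (snd p)\<bar> \<partial>(rows \<Otimes>\<^sub>M Q)) = (\<integral>\<^sup>+x. \<integral>\<^sup>+y. ennreal \<bar>F x\<bar> * ennreal \<bar>\<xi> y\<bar> \<partial>Q \<partial>rows)"
   by (subst Q.nn_integral_fst[symmetric]) (auto simp: abs_mult ennreal_mult)
  also have "... = (\<integral>\<^sup>+x. ennreal \<bar>F x\<bar> \<partial>rows) * (\<integral>\<^sup>+y. ennreal \<bar>\<xi> y\<bar> \<partial>Q)" by (simp add: nn_integral_cmult nn_integral_multc)
  also have "... \<le> ennreal a * ennreal b" using F \<xi> by (intro mult_mono) (auto simp: L1_le_def)
  also have "... < \<infinity>" by (simp add: ennreal_mult_less_top)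
  finally show ?thesis .
 qed
 then have int: "integrable (rows \<Otimes>\<^sub>M Q) (\<lambda>p. F (fst p) * \<xi> (snd p))" by (intro integrableI_bounded) auto
 have "(\<integral>x. F x * \<xi> (x j) \<partial>rows) = (\<integral>x. F x * \<xi> (x j) \<partial>distr (rows \<Otimes>\<^sub>M Q) rows (\<lambda>(x, y). x(j := y)))" by (simp add: resample[OF j])
 also have "... = (\<integral>p. F (fst p) * \<xi> (snd p) \<partial>(rows \<Otimes>\<^sub>M Q))" using indep by (subst integral_distr) (auto simp: split_beta)
 also have "... = (\<integral>x. \<integral>y. F x * \<xi> y \<partial>Q \<partial>rows)" using PQ.integral_fst'[OF int] by simp
 finally show "(\<integral>x. F x * \<xi> (x j) \<partial>rows) = (\<integral>x. F x \<partial>rows) * (\<integral>y. \<xi> y \<partial>Q)" by simp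
qed

lemma L1_le_past_mult:
 assumes j: "j < N" and F: "L1_le rows F a" "past j F" and \<xi>: "L1_le Q \<xi> b"
 shows "L1_le rows (\<lambda>x. F x * \<xi> (x j)) (a * b)"
  and "(\<integral>x. F x * \<xi> (x j) \<partial>rows) = (\<integral>x. F x \<partial>rows) * (\<integral>y. \<xi> y \<partial>Q)" using L1_le_indep_mult[OF j F(1) _ \<xi>] pastD[OF F(2)] by auto

lemma L2_le_past_mult:
 assumes j: "j < N" and F: "L2_le rows F a" "past j F" and \<xi>: "L2_le Q \<xi> b"
 shows "L2_le rows (\<lambda>x. F x * \<xi> (x j)) (a * b)"
proof -
 have m: "F \<in> borel_measurable rows" "\<xi> \<in> borel_measurable Q" using F \<xi> by (auto simp: L2_le_def)
 have "L1_le rows (\<lambda>x. (F x)^2 * (\<xi> (x j))^2) (a * b)"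
  using F \<xi> by (intro L1_le_past_mult(1)[OF j] L1_le_square) (auto simp: past_def)
 then show ?thesis using m measurable_row_fun[OF j m(2)] by (simp add: L2_le_iff_L1 power_mult_distrib)
qed

lemma L1_le_row: "j < N ==> L1_le Q \<xi> b ==> L1_le rows (\<lambda>x. \<xi> (x j)) b"
 using L1_le_past_mult(1)[of j "\<lambda>_. 1" 1 \<xi> b] P.L1_le_const[of 1] by (simp add: past_def)

lemma L2_le_row: "j < N ==> L2_le Q \<xi> b ==> L2_le rows (\<lambda>x. \<xi> (x j)) b"
 using L2_le_past_mult[of j "\<lambda>_. 1" 1 \<xi> b] P.L2_le_const[of 1] by (simp add: past_def)

text \<open>The cross term of row k with the earlier sum has mean 0, since \<xi> k is centred and
  independent of the past; second moments add.\<close>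

lemma martingale_L2_le:
 assumes "k \<le> N"
  and h: "\<And>j. j < k ==> L2_le rows (h j) (a j)" "\<And>j. j < k ==> past j (h j)"
  and \<xi>: "\<And>j. j < k ==> L2_le Q (\<xi> j) (b j)" "\<And>j. j < k ==> (\<integral>y. \<xi> j y \<partial>Q) = 0"
 shows "L2_le rows (\<lambda>x. \<Sum>j<k. h j x * \<xi> j (x j)) (\<Sum>j<k. a j * b j)" using assms
proof (induction k)
 case (Suc k)
 let ?S = "\<lambda>x. \<Sum>j<k. h j x * \<xi> j (x j)"
 have k: "k < N" using Suc.prems by simp
 have IH: "L2_le rows ?S (\<Sum>j<k. a j * b j)" using Suc by simp
 have hk: "L2_le rows (h k) (a k)" "past k (h k)" and xk: "L2_le Q (\<xi> k) (b k)" "(\<integral>y. \<xi> k y \<partial>Q) = 0" using Suc.prems by auto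
 have pS: "past k ?S" unfolding past_def
 proof (intro allI impI sum.cong refl)
  fix i j :: nat and x :: "nat => 'a" and y assume "k \<le> i" "j \<in> {..<k}"
  then have "h j (x(i := y)) = h j x" using Suc.prems(3)[of j] by (intro pastD[of j]) auto
  then show "h j (x(i := y)) * \<xi> j ((x(i := y)) j) = h j x * \<xi> j (x j)" using \<open>k \<le> i\<close> \<open>j \<in> {..<k}\<close> by simp
 qed
 have X1: "L1_le rows (\<lambda>x. ?S x * h k x) (sqrt ((\<Sum>j<k. a j * b j) * a k))" by (rule L1_le_mult[OF IH hk(1)])
 have pX: "past k (\<lambda>x. ?S x * h k x)" using pS hk(2) by (simp add: past_def)
 note cross = L1_le_past_mult[OF k X1 pX Q.L2_le_imp_L1_le[OF xk(1)]]
 have zero: "(\<integral>x. ?S x * h k x * \<xi> k (x k) \<partial>rows) = 0" unfolding cross(2) xk(2) by simp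
 note sq = L2_le_past_mult[OF k hk xk(1)]
 have i1: "integrable rows (\<lambda>x. (?S x)^2)" by (rule L1_le_integrable[OF L1_le_square[OF IH]])
 have i2: "integrable rows (\<lambda>x. (h k x * \<xi> k (x k))^2)" by (rule L1_le_integrable[OF L1_le_square[OF sq]])
 have i3: "integrable rows (\<lambda>x. ?S x * h k x * \<xi> k (x k))" by (rule L1_le_integrable[OF cross(1)])
 have eq: "(\<Sum>j<Suc k. h j x * \<xi> j (x j))^2 = (?S x)^2 + 2 * (?S x * h k x * \<xi> k (x k)) + (h k x * \<xi> k (x k))^2" for x
  by (simp add: power2_sum algebra_simps)
 show ?case
 proof (rule L2_leI_integral)
  show "(\<lambda>x. \<Sum>j<Suc k. h j x * \<xi> j (x j)) \<in> borel_measurable rows" using L2_leD(1)[OF IH] L2_leD(1)[OF sq] by simp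
  show "integrable rows (\<lambda>x. (\<Sum>j<Suc k. h j x * \<xi> j (x j))^2)"
   unfolding eq using i1 i2 i3 by (intro Bochner_Integration.integrable_add) auto
  have "(\<integral>x. (\<Sum>j<Suc k. h j x * \<xi> j (x j))^2 \<partial>rows) = (\<integral>x. (?S x)^2 \<partial>rows) + (\<integral>x. (h k x * \<xi> k (x k))^2 \<partial>rows)"
   unfolding eq using i1 i2 i3 zero by (subst Bochner_Integration.integral_add | simp)+
  also have "... \<le> (\<Sum>j<k. a j * b j) + a k * b k"
   using L1_le_integral[OF L1_le_square[OF IH]] L1_le_integral[OF L1_le_square[OF sq]] by simp
  finally show "(\<integral>x. (\<Sum>j<Suc k. h j x * \<xi> j (x j))^2 \<partial>rows) \<le> (\<Sum>j<Suc k. a j * b j)" by simp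
 qed
qed simp

end

subsection \<open>Linearisation of the chain\<close>

text \<open>These constants are produced by the estimates below: \<open>K1\<close> and
  \<open>K2\<close> bound the first two moments of the chain, \<open>K3\<close> its distance from
  the deterministic path, \<open>K4\<close> the remainder of the linearisation. The exponentials are
  Gronwall factors (1 + c / n)^j.\<close>

definition K1 :: "real => real" where "K1 C = 2 * C * exp (2 * C)"
definition K2 :: "real => real" where "K2 C = 16 * K1 C * C * exp (8 * C)"
definition K3 :: "real => real" where
 "K3 C = (2 * C + 4 * sqrt (K1 C * C) + sqrt (8 * K2 C * C) + 4 * K1 C * C) * exp C"
definition K4 :: "real => real" where
 "K4 C = 6 * C + 2 * sqrt (2 * K3 C * C) + sqrt (8 * K2 C * C) + 4 * K1 C * C + 2 * C * K3 C"
definition chain_const :: "real => real" where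
 "chain_const C = sqrt (8 * C) + 8 * K4 C + 320 * C ^ 2"

text \<open>The induction step of a discrete Gronwall inequality: d j (1 + p)^j is a supersolution
  of the recursion x \<rightarrow> (1 + p) x + d.\<close>

lemma growth_step:
 fixes d p :: real
 assumes "0 \<le> d" "0 \<le> p"
 shows "d * real j * (1 + p) ^ j * (1 + p) + d \<le> d * real (Suc j) * (1 + p) ^ Suc j"
proof -
 have "d * 1 \<le> d * (1 + p) ^ Suc j" using assms by (intro mult_left_mono one_le_power) auto
 then show ?thesis by (simp add: algebra_simps)
qed

lemma one_plus_power_le_exp:
 fixes p :: real assumes "0 \<le> p" "real j * p \<le> q" shows "(1 + p) ^ j \<le> exp q"
proof -
 have "(1 + p) ^ j \<le> exp p ^ j" using assms(1) by (intro power_mono) auto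
 also have "... = exp (real j * p)" by (rule exp_of_nat_mult[symmetric])
 finally show ?thesis using assms(2) by (auto intro: order_trans)
qed

text \<open>An abstract chain with small random coefficients. In the application \<open>s\<close> is
  the coordinate along the dual vector, \<open>\<iota>\<close> the inverse squared length of the
  remaining coordinates, \<open>\<alpha>\<close> the increment from q = 0 and \<open>\<beta>\<close>
  the geometric mean of \<open>\<alpha>\<close> and \<open>\<iota>\<close>. Both
  \<open>\<alpha>\<close> and \<open>\<iota>\<close> are close to 1 / (n - j); \<open>u\<close> is
  the centred part of s^2 \<iota>. The logarithm of a factor of p is lin + \<zeta> up to constants,
  with \<zeta> of second order.\<close>

locale row_chain = row_product Q "Suc r" for Q :: "'a measure" and r :: nat +
 fixes n :: nat and C :: real
  and s lin \<alpha> \<beta> \<iota> u \<zeta> :: "nat => 'a => real"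
 assumes r1: "1 \<le> r" and rn: "r < n" and C1: "1 \<le> C" and nr: "real n \<le> C * (real n - real r)"
  and \<alpha>_nonneg: "\<And>j y. 0 \<le> \<alpha> j y" and \<iota>_nonneg: "\<And>j y. 0 \<le> \<iota> j y"
  and \<beta>_sq: "\<And>j y. (\<beta> j y)^2 = \<alpha> j y * \<iota> j y"
  and u_eq: "\<And>j y. 1 \<le> j ==> (s j y)^2 * \<iota> j y = u j y + \<iota> j y"
  and s\<beta>: "\<And>j. j \<le> r ==> L2_le Q (\<lambda>y. s j y * \<beta> j y) (C / real n ^ 2)" "\<And>j. j \<le> r ==> (\<integral>y. s j y * \<beta> j y \<partial>Q) = 0"
  and \<alpha>2: "\<And>j. j \<le> r ==> L2_le Q (\<alpha> j) (C / real n ^ 2)"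
  and s\<iota>2: "\<And>j. j \<le> r ==> L2_le Q (\<lambda>y. (s j y)^2 * \<iota> j y) (C / real n ^ 2)"
  and u2: "\<And>j. j \<le> r ==> L2_le Q (u j) (C / real n ^ 2)" "\<And>j. j \<le> r ==> (\<integral>y. u j y \<partial>Q) = 0"
  and \<iota>1: "\<And>j. j \<le> r ==> L1_le Q (\<lambda>y. \<iota> j y - 1 / (real n - real j)) (C / (real n * sqrt n))"
  and \<alpha>1: "\<And>j. j \<le> r ==> L1_le Q (\<lambda>y. \<alpha> j y - 1 / (real n - real j)) (C / (real n * sqrt n))"
  and \<alpha>_lin: "\<And>j. j \<le> r ==> L1_le Q (\<lambda>y. \<alpha> j y - 1 / (real n - real j) + lin j y / (real n - real j)) (C / real n ^ 2)"
  and s\<beta>_diff: "\<And>j. j \<le> r ==> L2_le Q (\<lambda>y. s j y * (\<beta> j y - 1 / (real n - real j))) (C / real n ^ 3)"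
  and lin2: "\<And>j. j \<le> r ==> L2_le Q (lin j) (C / real n)" "\<And>j. j \<le> r ==> (\<integral>y. lin j y \<partial>Q) = 0"
  and s2: "\<And>j. j \<le> r ==> L2_le Q (s j) C" "\<And>j. j \<le> r ==> (\<integral>y. s j y \<partial>Q) = 0"
  and \<zeta>2: "\<And>j. j \<le> r ==> L2_le Q (\<zeta> j) (C / real n ^ 2)"
begin

section \<open>Moments of the chain\<close>

lemma n0: "real n > 0" using rn by simp

lemma sqrt_n0: "sqrt (real n) > 0" using n0 by simp

lemma m0: "j \<le> r ==> real n - real j > 0" using rn by simp

lemma inv_m: "j \<le> r ==> 1 / (real n - real j) \<le> C / real n"
proof -
 assume j: "j \<le> r"
 have "real n \<le> C * (real n - real r)" by (rule nr)
 also have "... \<le> C * (real n - real j)" using j C1 by (intro mult_left_mono) auto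
 finally show ?thesis using m0[OF j] n0 by (simp add: divide_simps mult.commute)
qed

lemma r_le_n: "real r \<le> real n" and Suc_r: "real (Suc r) \<le> 2 * real r" using rn r1 by auto

primrec q :: "nat => (nat => 'a) => real" where
 "q 0 x = 0"
| "q (Suc j) x = q j x + (\<alpha> j (x j) - 2 * (s j (x j) * \<beta> j (x j)) * sqrt (q j x) + (s j (x j))^2 * \<iota> j (x j) * q j x)"

text \<open>The increment is a - 2 t + b with t^2 = a b, so |2 t| \<le> a + b by the inequality of
  the means. Hence the chain is increasing, and the cross term can be absorbed at the price of a
  factor 2.\<close>

lemma increment_bounds:
 assumes "0 \<le> (Q0::real)"
 shows "0 \<le> \<alpha> j y - 2 * (s j y * \<beta> j y) * sqrt Q0 + (s j y)^2 * \<iota> j y * Q0"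
  and "\<alpha> j y - 2 * (s j y * \<beta> j y) * sqrt Q0 + (s j y)^2 * \<iota> j y * Q0 \<le> 2 * \<alpha> j y + 2 * ((s j y)^2 * \<iota> j y) * Q0"
proof -
 define a where "a = \<alpha> j y"
 define b where "b = (s j y)^2 * \<iota> j y * Q0"
 define t where "t = s j y * \<beta> j y * sqrt Q0"
 have ab: "0 \<le> a" "0 \<le> b" using assms by (auto simp: a_def b_def \<alpha>_nonneg \<iota>_nonneg)
 have "t^2 = a * b" using assms by (simp add: t_def a_def b_def power_mult_distrib \<beta>_sq mult_ac)
 also have "4 * (a * b) \<le> (a + b)^2" using zero_le_power2[of "a - b"] by (simp add: power2_eq_square algebra_simps)
 finally have "(2 * t)^2 \<le> (a + b)^2" by (simp add: power_mult_distrib)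
 then have "\<bar>2 * t\<bar> \<le> a + b" using ab by (metis abs_le_square_iff abs_of_nonneg add_nonneg_nonneg)
 then have "0 \<le> a - 2 * t + b" "a - 2 * t + b \<le> 2 * a + 2 * b" by linarith+
 then show "0 \<le> \<alpha> j y - 2 * (s j y * \<beta> j y) * sqrt Q0 + (s j y)^2 * \<iota> j y * Q0"
  "\<alpha> j y - 2 * (s j y * \<beta> j y) * sqrt Q0 + (s j y)^2 * \<iota> j y * Q0 \<le> 2 * \<alpha> j y + 2 * ((s j y)^2 * \<iota> j y) * Q0"
  unfolding a_def b_def t_def by (simp_all add: mult.assoc)
qed

lemma q_nonneg: "0 \<le> q j x"
proof (induction j)
 case (Suc j)
 then show ?case using increment_bounds(1)[OF Suc, of j "x j"] by simp
qed simp

lemma q_Suc_le: "q (Suc j) x \<le> q j x + 2 * \<alpha> j (x j) + 2 * (q j x * ((s j (x j))^2 * \<iota> j (x j)))"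
 using increment_bounds(2)[OF q_nonneg, of j "x j" j x] by (simp add: mult_ac)

lemma past_q: "past j (q j)"
proof (induction j)
 case (Suc j)
 then have "q j (x(i := y)) = q j x" if "Suc j \<le> i" for i x y using that by (auto intro: pastD)
 then show ?case unfolding past_def by auto
qed (simp add: past_def)

lemma row_meas: "j \<le> r ==> \<xi> \<in> borel_measurable Q ==> (\<lambda>x. \<xi> (x j)) \<in> borel_measurable rows" by (rule measurable_row_fun) auto

lemma q_meas: "j \<le> Suc r ==> q j \<in> borel_measurable rows"
proof (induction j)
 case (Suc j)
 then have j: "j \<le> r" and [measurable]: "q j \<in> borel_measurable rows" by auto
 have [measurable]: "(\<lambda>x. \<alpha> j (x j)) \<in> borel_measurable rows" "(\<lambda>x. s j (x j) * \<beta> j (x j)) \<in> borel_measurable rows"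
  "(\<lambda>x. (s j (x j))^2 * \<iota> j (x j)) \<in> borel_measurable rows"
  using row_meas[OF j L2_leD(1)[OF \<alpha>2[OF j]]] row_meas[OF j L2_leD(1)[OF s\<beta>(1)[OF j]]]
   row_meas[OF j L2_leD(1)[OF s\<iota>2[OF j]]] by simp_all
 show ?case unfolding q.simps[abs_def] by measurable
qed (simp add: q.simps(1)[abs_def])

lemma sqrt_C_le: "sqrt (C / real n ^ 2) \<le> C / real n"
proof -
 have "sqrt C \<le> C" using C1 by (metis abs_of_nonneg mult_left_mono mult.right_neutral order_trans
  real_sqrt_le_mono real_sqrt_mult_self zero_le_one abs_ge_self real_sqrt_mult)
 then show ?thesis using n0 by (simp add: real_sqrt_divide divide_right_mono)
qed

lemma \<alpha>_L1: "j \<le> r ==> L1_le Q (\<alpha> j) (C / real n)" using L1_le_weaken[OF Q.L2_le_imp_L1_le[OF \<alpha>2] sqrt_C_le] .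

lemma s\<iota>_L1: "j \<le> r ==> L1_le Q (\<lambda>y. (s j y)^2 * \<iota> j y) (C / real n)" using L1_le_weaken[OF Q.L2_le_imp_L1_le[OF s\<iota>2] sqrt_C_le] .

text \<open>Row j is independent of \<open>q j\<close>, so taking means in \<open>q_Suc_le\<close>
  gives the recursion x \<rightarrow> (1 + 2 C / n) x + 2 C / n.\<close>

lemma q_L1_aux: "j \<le> Suc r ==> L1_le rows (q j) (2 * C / real n * real j * (1 + 2 * C / real n) ^ j)"
proof (induction j)
 case 0
 then show ?case by (simp add: q.simps(1)[abs_def])
next
 case (Suc j)
 then have j: "j \<le> r" "j < Suc r" by auto
 let ?a = "2 * C / real n * real j * (1 + 2 * C / real n) ^ j"
 have IH: "L1_le rows (q j) ?a" using Suc by simp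
 have "L1_le rows (\<lambda>x. q j x + 2 * \<alpha> j (x j) + 2 * (q j x * ((s j (x j))^2 * \<iota> j (x j))))
   (?a + \<bar>2\<bar> * (C / real n) + \<bar>2\<bar> * (?a * (C / real n)))"
  by (intro L1_le_add L1_le_cmult IH L1_le_row[OF j(2)] \<alpha>_L1[OF j(1)] L1_le_past_mult(1)[OF j(2) IH past_q s\<iota>_L1[OF j(1)]])
 then show ?case
 proof (rule L1_le_mono)
  show "q (Suc j) \<in> borel_measurable rows" using Suc.prems by (rule q_meas)
  show "AE x in rows. \<bar>q (Suc j) x\<bar> \<le> \<bar>q j x + 2 * \<alpha> j (x j) + 2 * (q j x * ((s j (x j))^2 * \<iota> j (x j)))\<bar>"
   using q_Suc_le q_nonneg[of "Suc j"] by (intro AE_I2) (auto simp del: q.simps intro: order_trans[OF _ abs_ge_self])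
  have "A + \<bar>2\<bar> * (C / real n) + \<bar>2\<bar> * (A * (C / real n)) = A * (1 + 2 * C / real n) + 2 * C / real n" for A
   by (simp add: algebra_simps)
  then have "?a + \<bar>2\<bar> * (C / real n) + \<bar>2\<bar> * (?a * (C / real n)) = ?a * (1 + 2 * C / real n) + 2 * C / real n" .
  also have "... \<le> 2 * C / real n * real (Suc j) * (1 + 2 * C / real n) ^ Suc j" using C1 n0 by (intro growth_step) auto
  finally show "?a + \<bar>2\<bar> * (C / real n) + \<bar>2\<bar> * (?a * (C / real n)) \<le> 2 * C / real n * real (Suc j) * (1 + 2 * C / real n) ^ Suc j" .
 qed
qed

lemma K_pos: "K1 C \<ge> 1" "K2 C \<ge> 1" "K3 C \<ge> 0"
proof -
 have e: "exp (2 * C) \<ge> 1" "exp (8 * C) \<ge> 1" using C1 by simp_all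
 have "1 * 1 \<le> (2 * C) * exp (2 * C)" using C1 e by (intro mult_mono) auto
 then show 1: "K1 C \<ge> 1" by (simp add: K1_def)
 have "1 * 1 * 1 \<le> (16 * K1 C) * C * exp (8 * C)" using C1 e 1 by (intro mult_mono) auto
 then show "K2 C \<ge> 1" by (simp add: K2_def)
 then show "K3 C \<ge> 0" unfolding K3_def using C1 1 by (intro mult_nonneg_nonneg add_nonneg_nonneg) auto
qed

lemma q_L1: "j \<le> Suc r ==> L1_le rows (q j) (2 * K1 C * real r / real n)"
proof -
 assume j: "j \<le> Suc r"
 have "(1 + 2 * C / real n) ^ j \<le> exp (2 * C)" using C1 n0 j rn by (intro one_plus_power_le_exp) (auto simp: field_simps)
 moreover have "real j \<le> 2 * real r" using j Suc_r by linarith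
 ultimately have "2 * C / real n * real j * (1 + 2 * C / real n) ^ j \<le> 2 * C / real n * (2 * real r) * exp (2 * C)"
  using C1 n0 by (intro mult_mono) auto
 also have "... = 2 * K1 C * real r / real n" by (simp add: K1_def)
 finally show ?thesis using q_L1_aux[OF j] by (rule L1_le_weaken[rotated])
qed

lemma q_L2_aux: "j \<le> Suc r ==>
 L2_le rows (q j) (32 * K1 C * C * real r / real n ^ 2 * real j * (1 + 8 * C / real n) ^ j)"
proof (induction j)
 case 0
 then show ?case by (simp add: q.simps(1)[abs_def])
next
 case (Suc j)
 then have j: "j \<le> r" "j < Suc r" by auto
 \<comment> \<open>16 times the first-moment bound of q times C / n. The terms of the squared step
   that are not proportional to the second moment add up to 14 / 16 of it, and those that are give
   the factor 1 + p.\<close>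
 define d where "d = 32 * K1 C * C * real r / real n ^ 2"
 define p where "p = 8 * C / real n"
 let ?b = "d * real j * (1 + p) ^ j"
 have d0: "d \<ge> 0" and p0: "p \<ge> 0" using C1 n0 K_pos by (auto simp: d_def p_def)
 have IH: "L2_le rows (q j) ?b" using Suc by (simp add: d_def p_def)
 let ?w = "\<lambda>y. (s j y)^2 * \<iota> j y"
 let ?a = "2 * K1 C * real r / real n"
 have q1: "L1_le rows (q j) ?a" using Suc.prems by (intro q_L1) simp
 have q2: "L1_le rows (\<lambda>x. (q j x)^2) ?b" by (rule L1_le_square[OF IH])
 have pq2: "past j (\<lambda>x. (q j x)^2)" using past_q[of j] by (simp add: past_def)
 have w1: "L1_le Q ?w (C / real n)" by (rule s\<iota>_L1[OF j(1)])
 have w2: "L1_le Q (\<lambda>y. (?w y)^2) (C / real n ^ 2)" by (rule L1_le_square[OF s\<iota>2[OF j(1)]])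
 have \<alpha>w: "L1_le Q (\<lambda>y. \<alpha> j y * ?w y) (C / real n ^ 2)"
 proof -
  have "sqrt (C / real n ^ 2 * (C / real n ^ 2)) = C / real n ^ 2" using C1 by (subst real_sqrt_abs2) simp
  then show ?thesis using L1_le_mult[OF \<alpha>2[OF j(1)] s\<iota>2[OF j(1)]] by (simp only:)
 qed
 have \<alpha>sq: "L1_le Q (\<lambda>y. (\<alpha> j y)^2) (C / real n ^ 2)" by (rule L1_le_square[OF \<alpha>2[OF j(1)]])
 let ?F = "\<lambda>x. (q j x)^2 + 4 * ((q j x)^2 * ?w (x j)) + 4 * ((q j x)^2 * (?w (x j))^2)
   + 4 * (q j x * \<alpha> j (x j)) + 8 * (q j x * (\<alpha> j (x j) * ?w (x j))) + 4 * (\<alpha> j (x j))^2"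
 let ?c = "?b + \<bar>4\<bar> * (?b * (C / real n)) + \<bar>4\<bar> * (?b * (C / real n ^ 2))
   + \<bar>4\<bar> * (?a * (C / real n)) + \<bar>8\<bar> * (?a * (C / real n ^ 2)) + \<bar>4\<bar> * (C / real n ^ 2)"
 have "L1_le rows ?F ?c"
  by (intro L1_le_add L1_le_cmult q2 L1_le_past_mult(1)[OF j(2) q2 pq2 w1] L1_le_past_mult(1)[OF j(2) q2 pq2 w2]
   L1_le_past_mult(1)[OF j(2) q1 past_q \<alpha>_L1[OF j(1)]] L1_le_past_mult(1)[OF j(2) q1 past_q \<alpha>w] L1_le_row[OF j(2) \<alpha>sq])
 then have "L1_le rows (\<lambda>x. (q (Suc j) x)^2) (d * real (Suc j) * (1 + p) ^ Suc j)"
 proof (rule L1_le_mono)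
  show "(\<lambda>x. (q (Suc j) x)^2) \<in> borel_measurable rows" using q_meas[OF Suc.prems] by measurable
  have "(q (Suc j) x)^2 \<le> ?F x" for x
  proof -
   have "(q (Suc j) x)^2 \<le> (q j x + 2 * \<alpha> j (x j) + 2 * (q j x * ?w (x j)))^2"
    using q_Suc_le[of j x] q_nonneg[of "Suc j" x] by (intro power_mono)
   also have "... = ?F x" by (simp add: power2_eq_square algebra_simps)
   finally show ?thesis .
  qed
  then show "AE x in rows. \<bar>(q (Suc j) x)\<^sup>2\<bar> \<le> \<bar>?F x\<bar>" by (intro AE_I2) (auto simp del: q.simps intro: order_trans[OF _ abs_ge_self])
  have n1: "1 \<le> real n" using rn by simp
  have sq: "C / real n ^ 2 \<le> C / real n" using n1 C1 by (intro divide_left_mono) (auto simp: power2_eq_square)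
  have b0: "?b \<ge> 0" using d0 p0 by simp
  have r1': "1 \<le> real r" using r1 by simp
  have "?a * (C / real n ^ 2) \<le> ?a * (C / real n)" using K_pos sq by (intro mult_left_mono) auto
  moreover have "C / real n ^ 2 \<le> ?a * (C / real n) / 2"
  proof -
   have "1 * 1 \<le> K1 C * real r" using K_pos r1' by (intro mult_mono) auto
   then have "1 * (C / real n ^ 2) \<le> (K1 C * real r) * (C / real n ^ 2)" using C1 by (intro mult_right_mono) auto
   then show ?thesis by (simp add: power2_eq_square)
  qed
  moreover have "?b * (C / real n ^ 2) \<le> ?b * (C / real n)" using b0 sq by (intro mult_left_mono)
  moreover have "?a * (C / real n) = d / 16" by (simp add: d_def power2_eq_square)
  moreover have "B + \<bar>4\<bar> * B1 + \<bar>4\<bar> * B2 + \<bar>4\<bar> * A1 + \<bar>8\<bar> * A2 + \<bar>4\<bar> * Cn \<le> B + 8 * B1 + (4 * (d / 16) + 8 * (d / 16) + 2 * (d / 16))"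
   if "A2 \<le> A1" "Cn \<le> A1 / 2" "B2 \<le> B1" "A1 = d / 16" for A1 A2 B B1 B2 Cn :: real using that by simp
  ultimately have "?c \<le> ?b + 8 * (?b * (C / real n)) + (4 * (d / 16) + 8 * (d / 16) + 2 * (d / 16))" by blast
  also have "... \<le> ?b * (1 + p) + d" using d0 by (simp add: p_def algebra_simps)
  also have "... \<le> d * real (Suc j) * (1 + p) ^ Suc j" using d0 p0 by (rule growth_step)
  finally show "?c \<le> d * real (Suc j) * (1 + p) ^ Suc j" .
 qed
 then show ?case using q_meas[OF Suc.prems] by (simp only: L2_le_iff_L1 d_def p_def)
qed

lemma q_L2: "j \<le> Suc r ==> L2_le rows (q j) (4 * K2 C * (real r / real n)^2)"
proof -
 assume j: "j \<le> Suc r"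
 have "(1 + 8 * C / real n) ^ j \<le> exp (8 * C)" using C1 n0 j rn by (intro one_plus_power_le_exp) (auto simp: field_simps)
 moreover have "real j \<le> 2 * real r" using j Suc_r by linarith
 ultimately have "32 * K1 C * C * real r / real n ^ 2 * real j * (1 + 8 * C / real n) ^ j
   \<le> 32 * K1 C * C * real r / real n ^ 2 * (2 * real r) * exp (8 * C)" using C1 n0 K_pos by (intro mult_mono) auto
 also have "... = 4 * K2 C * (real r / real n)^2" by (simp add: K2_def power2_eq_square)
 finally show ?thesis using q_L2_aux[OF j] by (rule L2_le_weaken[rotated])
qed

text \<open>The deterministic path: the solution from 0 of the mean recursion x \<rightarrow> x + (1
  + x) / (n - j), see \<open>qb_Suc\<close>, in which \<open>\<alpha>\<close> and s^2 \<iota> are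
  replaced by 1 / (n - j) and the cross term by 0.\<close>

definition qb :: "nat => real" where "qb j = real j / (real n - real j + 1)"

lemma qb_Suc: "j \<le> r ==> qb (Suc j) = qb j + (1 + qb j) / (real n - real j)"
 using rn by (simp add: qb_def divide_simps) (simp add: algebra_simps)

lemma qb_nonneg: "j \<le> Suc r ==> 0 \<le> qb j" using rn by (simp add: qb_def)

lemma qb_le: "j \<le> r ==> qb j \<le> C * real r / real n"
proof -
 assume j: "j \<le> r"
 have "qb j \<le> real r * (1 / (real n - real j))" unfolding qb_def using j rn by (simp add: frac_le)
 also have "... \<le> real r * (C / real n)" by (intro mult_left_mono inv_m j) simp
 finally show ?thesis by (simp add: mult.commute)
qed

text \<open>The order of the deviation of the chain from \<open>qb\<close>: a relative error 1 /
  sqrt n of a quantity of order r / n.\<close>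

definition \<eta>0 :: real where "\<eta>0 = real r / (real n * sqrt n)"

lemma \<eta>0_nonneg: "0 \<le> \<eta>0" by (simp add: \<eta>0_def)

definition e :: "nat => (nat => 'a) => real" where "e j x = q j x - qb j"

section \<open>Deviation from the deterministic path\<close>

definition m1 :: "nat => (nat => 'a) => real" where
 "m1 k x = (\<Sum>j<k. sqrt (q j x) * (s j (x j) * \<beta> j (x j)))"
definition m2 :: "nat => (nat => 'a) => real" where
 "m2 k x = (\<Sum>j<k. q j x * u j (x j))"
definition d1 :: "nat => (nat => 'a) => real" where
 "d1 k x = (\<Sum>j<k. \<alpha> j (x j) - 1 / (real n - real j))"
definition d2 :: "nat => (nat => 'a) => real" where
 "d2 k x = (\<Sum>j<k. q j x * (\<iota> j (x j) - 1 / (real n - real j)))"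

text \<open>The steps of the chain minus those of \<open>qb\<close>, summed. Splitting s^2 \<iota>
  into u + \<iota> separates the martingale parts \<open>m1\<close>, \<open>m2\<close> from the
  drift errors \<open>d1\<close>, \<open>d2\<close>; the last sum feeds the deviation back.\<close>

lemma e_expansion:
 "k \<le> Suc r ==> e k x = d1 k x - 2 * m1 k x + m2 k x + d2 k x + (\<Sum>j<k. e j x * (1 / (real n - real j)))"
proof (induction k)
 case 0
 then show ?case by (simp add: e_def qb_def d1_def m1_def m2_def d2_def)
next
 case (Suc k)
 then have k: "k \<le> r" by simp
 \<comment> \<open>\<open>u_eq\<close> speaks of rows from 1 on; in row 0 both sides vanish because
   the chain starts at 0.\<close>
 have "(s k (x k))^2 * \<iota> k (x k) * q k x = (u k (x k) + \<iota> k (x k)) * q k x"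
 proof (cases "k = 0")
  case False
  then show ?thesis using u_eq[of k "x k"] by simp
 qed simp
 then have qS: "q (Suc k) x = q k x + (\<alpha> k (x k) - 2 * (s k (x k) * \<beta> k (x k)) * sqrt (q k x) + (u k (x k) + \<iota> k (x k)) * q k x)"
  by simp
 then have "e (Suc k) x = e k x + (\<alpha> k (x k) - 1 / (real n - real k)) - 2 * (sqrt (q k x) * (s k (x k) * \<beta> k (x k)))
   + q k x * u k (x k) + q k x * (\<iota> k (x k) - 1 / (real n - real k)) + e k x * (1 / (real n - real k))"
 proof -
  define M where "M = 1 / (real n - real k)"
  have "qb (Suc k) = qb k + (1 + qb k) * M" using qb_Suc[OF k] by (simp add: M_def)
  then show ?thesis unfolding e_def M_def[symmetric] qS by (simp add: algebra_simps)
 qed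
 then show ?case using Suc by (simp add: d1_def m1_def m2_def d2_def)
qed

lemma sqrt_q_L2: "j \<le> Suc r ==> L2_le rows (\<lambda>x. sqrt (q j x)) (2 * K1 C * real r / real n)"
 using q_L1[of j] q_meas[of j] by (simp add: L2_le_iff_L1 q_nonneg)

lemma past_sqrt_q: "past j (\<lambda>x. sqrt (q j x))" using past_q[of j] by (simp add: past_def)

lemma sum_le_2r:
 assumes "k \<le> Suc r" "0 \<le> c" "\<And>j. j < k ==> f j \<le> (c::real)"
 shows "(\<Sum>j<k. f j) \<le> 2 * real r * c"
proof -
 have "(\<Sum>j<k. f j) \<le> real k * c" by (rule sum_bound_const[OF assms(3)])
 also have "... \<le> (2 * real r) * c" using assms(1,2) Suc_r by (intro mult_right_mono) linarith+
 finally show ?thesis .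
qed

lemma d1_L1: "k \<le> Suc r ==> L1_le rows (d1 k) (2 * C * \<eta>0)"
proof -
 assume k: "k \<le> Suc r"
 have "L1_le rows (d1 k) (\<Sum>j<k. C / (real n * sqrt n))" unfolding d1_def[abs_def] using k by (intro L1_le_sum L1_le_row \<alpha>1) auto
 moreover have "(\<Sum>j<k. C / (real n * sqrt n)) \<le> 2 * C * \<eta>0"
  using sum_le_2r[OF k, of "C / (real n * sqrt n)" "\<lambda>_. C / (real n * sqrt n)"] C1 by (simp add: \<eta>0_def mult_ac)
 ultimately show ?thesis by (rule L1_le_weaken)
qed

lemma m1_L2: "k \<le> Suc r ==> L2_le rows (m1 k) (4 * K1 C * C * (real r)^2 / real n ^ 3)"
proof -
 assume k: "k \<le> Suc r"
 have "L2_le rows (m1 k) (\<Sum>j<k. (2 * K1 C * real r / real n) * (C / real n ^ 2))" unfolding m1_def[abs_def] using k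
  by (intro martingale_L2_le sqrt_q_L2 past_sqrt_q s\<beta>) auto
 moreover have "(\<Sum>j<k. (2 * K1 C * real r / real n) * (C / real n ^ 2)) \<le> 4 * K1 C * C * (real r)^2 / real n ^ 3"
  using sum_le_2r[OF k, of "(2 * K1 C * real r / real n) * (C / real n ^ 2)" "\<lambda>_. (2 * K1 C * real r / real n) * (C / real n ^ 2)"] C1 K_pos
  by (simp add: power2_eq_square power3_eq_cube mult_ac)
 ultimately show ?thesis by (rule L2_le_weaken)
qed

lemma sqrt_n_cube: "sqrt (real n ^ 3) = real n * sqrt n" using n0 by (simp add: power3_eq_cube real_sqrt_mult)

lemma m1_L1: "k \<le> Suc r ==> L1_le rows (m1 k) (2 * sqrt (K1 C * C) * \<eta>0)"
proof -
 assume k: "k \<le> Suc r"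
 have "sqrt (4 * K1 C * C * (real r)^2 / real n ^ 3) = 2 * sqrt (K1 C * C) * \<eta>0"
  using n0 by (simp add: \<eta>0_def real_sqrt_mult real_sqrt_divide sqrt_n_cube)
 with P.L2_le_imp_L1_le[OF m1_L2[OF k]] show ?thesis by simp
qed

lemma m2_L2: "k \<le> Suc r ==> L2_le rows (m2 k) (8 * K2 C * C * real r ^ 3 / real n ^ 4)"
proof -
 assume k: "k \<le> Suc r"
 let ?c = "(4 * K2 C * (real r / real n)^2) * (C / real n ^ 2)"
 have "L2_le rows (m2 k) (\<Sum>j<k. ?c)" unfolding m2_def[abs_def] using k by (intro martingale_L2_le q_L2 past_q u2) auto
 moreover have "(\<Sum>j<k. ?c) \<le> 8 * K2 C * C * real r ^ 3 / real n ^ 4" using sum_le_2r[OF k, of ?c "\<lambda>_. ?c"] C1 K_pos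
  by (simp add: power2_eq_square power3_eq_cube power4_eq_xxxx mult_ac)
 ultimately show ?thesis by (rule L2_le_weaken)
qed

lemma m2_L1: "k \<le> Suc r ==> L1_le rows (m2 k) (sqrt (8 * K2 C * C) * (real r * sqrt r / real n ^ 2))"
proof -
 assume k: "k \<le> Suc r"
 have "sqrt (real r ^ 3) = real r * sqrt r" by (simp add: power3_eq_cube real_sqrt_mult)
 moreover have "sqrt (real n ^ 4) = real n ^ 2" by (simp add: real_sqrt_unique power2_eq_square power4_eq_xxxx mult.assoc)
 ultimately have "sqrt (8 * K2 C * C * real r ^ 3 / real n ^ 4) = sqrt (8 * K2 C * C) * (real r * sqrt r / real n ^ 2)"
  by (simp only: real_sqrt_mult real_sqrt_divide times_divide_eq_right)
 with P.L2_le_imp_L1_le[OF m2_L2[OF k]] show ?thesis by simp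
qed

lemma r_sqrt_r: "real r * sqrt r / real n ^ 2 \<le> \<eta>0"
proof -
 have "sqrt r * sqrt n \<le> sqrt n * sqrt n" using r_le_n by (intro mult_right_mono) auto
 then have "sqrt r * sqrt n \<le> real n" by simp
 then have "real r * (sqrt r * sqrt n) \<le> real r * real n" by (intro mult_left_mono) auto
 then show ?thesis using n0 sqrt_n0 by (simp add: \<eta>0_def divide_simps power2_eq_square mult_ac)
qed

lemma d2_L1: "k \<le> Suc r ==> L1_le rows (d2 k) (4 * K1 C * C * (\<eta>0 * (real r / real n)))"
proof -
 assume k: "k \<le> Suc r"
 let ?c = "(2 * K1 C * real r / real n) * (C / (real n * sqrt n))"
 have "L1_le rows (d2 k) (\<Sum>j<k. ?c)" unfolding d2_def[abs_def] using k by (intro L1_le_sum L1_le_past_mult(1) q_L1 past_q \<iota>1) auto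
 moreover have "(\<Sum>j<k. ?c) \<le> 2 * real r * ?c" using C1 K_pos by (intro sum_le_2r[OF k]) auto
 moreover have "2 * real r * ?c = 4 * K1 C * C * (\<eta>0 * (real r / real n))" by (simp add: \<eta>0_def mult_ac)
 ultimately show ?thesis by (auto intro: L1_le_weaken)
qed

text \<open>All terms of \<open>e_expansion\<close> but the feedback are of order
  \<open>\<eta>0\<close>, and the feedback has coefficients at most C / n, so a geometric sum closes
  the induction with a factor at most exp C.\<close>

lemma e_L1: "k \<le> Suc r ==> L1_le rows (e k) (K3 C * \<eta>0)"
proof -
 define \<epsilon> where "\<epsilon> = (2 * C + 4 * sqrt (K1 C * C) + sqrt (8 * K2 C * C) + 4 * K1 C * C) * \<eta>0"
 have \<epsilon>0: "\<epsilon> \<ge> 0" unfolding \<epsilon>_def using C1 K_pos \<eta>0_nonneg by (intro mult_nonneg_nonneg add_nonneg_nonneg) auto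
 define p where "p = C / real n"
 have p0: "p > 0" using C1 n0 by (simp add: p_def)
 have base: "L1_le rows (\<lambda>x. d1 k x - 2 * m1 k x + m2 k x + d2 k x) \<epsilon>" if k: "k \<le> Suc r" for k
 proof -
  have "L1_le rows (\<lambda>x. d1 k x + (-2) * m1 k x + m2 k x + d2 k x)
   (2 * C * \<eta>0 + \<bar>-2\<bar> * (2 * sqrt (K1 C * C) * \<eta>0) + sqrt (8 * K2 C * C) * (real r * sqrt r / real n ^ 2) + 4 * K1 C * C * (\<eta>0 * (real r / real n)))"
   by (intro L1_le_add L1_le_cmult d1_L1 m1_L1 m2_L1 d2_L1 k)
  moreover have "2 * C * \<eta>0 + \<bar>-2\<bar> * (2 * sqrt (K1 C * C) * \<eta>0) + sqrt (8 * K2 C * C) * (real r * sqrt r / real n ^ 2) + 4 * K1 C * C * (\<eta>0 * (real r / real n)) \<le> \<epsilon>"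
  proof -
   have "sqrt (8 * K2 C * C) * (real r * sqrt r / real n ^ 2) \<le> sqrt (8 * K2 C * C) * \<eta>0"
    using C1 K_pos by (intro mult_left_mono r_sqrt_r) auto
   moreover have "4 * K1 C * C * (\<eta>0 * (real r / real n)) \<le> 4 * K1 C * C * (\<eta>0 * 1)"
    using r_le_n n0 C1 K_pos \<eta>0_nonneg by (intro mult_left_mono) auto
   ultimately show ?thesis unfolding \<epsilon>_def distrib_right by simp
  qed
  ultimately have "L1_le rows (\<lambda>x. d1 k x + (-2) * m1 k x + m2 k x + d2 k x) \<epsilon>" by (rule L1_le_weaken)
  then show ?thesis by simp
 qed
 have main: "k \<le> Suc r ==> L1_le rows (e k) (\<epsilon> * (1 + p) ^ k)" for k
 proof (induction k rule: less_induct)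
  case (less k)
  have "L1_le rows (\<lambda>x. (d1 k x - 2 * m1 k x + m2 k x + d2 k x) + (\<Sum>j<k. 1 / (real n - real j) * e j x))
    (\<epsilon> + (\<Sum>j<k. \<bar>1 / (real n - real j)\<bar> * (\<epsilon> * (1 + p) ^ j)))" using less by (intro L1_le_add base L1_le_sum L1_le_cmult) auto
  moreover have "\<epsilon> + (\<Sum>j<k. \<bar>1 / (real n - real j)\<bar> * (\<epsilon> * (1 + p) ^ j)) \<le> \<epsilon> * (1 + p) ^ k"
  proof -
   have "(\<Sum>j<k. \<bar>1 / (real n - real j)\<bar> * (\<epsilon> * (1 + p) ^ j)) \<le> (\<Sum>j<k. p * (\<epsilon> * (1 + p) ^ j))"
   proof (intro sum_mono mult_right_mono)
    fix j assume "j \<in> {..<k}"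
    then have "j \<le> r" using less.prems by simp
    then show "\<bar>1 / (real n - real j)\<bar> \<le> p" using inv_m[of j] m0[of j] by (simp add: p_def)
   qed (use \<epsilon>0 p0 in auto)
   also have "... = \<epsilon> * (1 + p) ^ k - \<epsilon>"
   proof -
    have "(\<Sum>j<i. p * (\<epsilon> * (1 + p) ^ j)) = \<epsilon> * (1 + p) ^ i - \<epsilon>" for i by (induction i) (auto simp: algebra_simps)
    then show ?thesis .
   qed
   finally show ?thesis by simp
  qed
  ultimately have "L1_le rows (\<lambda>x. (d1 k x - 2 * m1 k x + m2 k x + d2 k x) + (\<Sum>j<k. 1 / (real n - real j) * e j x)) (\<epsilon> * (1 + p) ^ k)"
   by (rule L1_le_weaken)
  moreover have "(\<lambda>x. (d1 k x - 2 * m1 k x + m2 k x + d2 k x) + (\<Sum>j<k. 1 / (real n - real j) * e j x)) = e k"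
  proof
   fix x
   have "(\<Sum>j<k. 1 / (real n - real j) * e j x) = (\<Sum>j<k. e j x * (1 / (real n - real j)))" by (simp only: mult.commute)
   then show "(d1 k x - 2 * m1 k x + m2 k x + d2 k x) + (\<Sum>j<k. 1 / (real n - real j) * e j x) = e k x"
    using e_expansion[OF less.prems, of x] by linarith
  qed
  ultimately show ?case by (simp only:)
 qed
 assume k: "k \<le> Suc r"
 have "(1 + p) ^ k \<le> exp C"
 proof (rule one_plus_power_le_exp)
  have "real k * p \<le> real n * p" using k rn p0 by (intro mult_right_mono) auto
  then show "real k * p \<le> C" using n0 by (simp add: p_def)
 qed (use p0 in simp)
 then have "\<epsilon> * (1 + p) ^ k \<le> \<epsilon> * exp C" using \<epsilon>0 by (rule mult_left_mono)
 also have "... = K3 C * \<eta>0" by (simp add: \<epsilon>_def K3_def)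
 finally show "L1_le rows (e k) (K3 C * \<eta>0)" using main[OF k] by (auto intro: L1_le_weaken)
qed

text \<open>The inverse of \<open>qb (Suc r)\<close>; it converts the absolute deviation at the end
  of the chain into the relative deviation \<open>z\<close>. Then \<open>w\<close> and
  \<open>b\<close> are the coefficients of \<open>lin\<close> and \<open>s\<close> in the linear
  part \<open>A\<close> of \<open>z\<close>.\<close>

definition lam :: real where "lam = (real n - real r) / (real r + 1)"
definition w :: "nat => real" where "w j = lam / (real n - real j)"
definition b :: "nat => real" where "b j = 2 * w j * sqrt (qb j)"
definition z :: "(nat => 'a) => real" where "z x = q (Suc r) x / qb (Suc r) - 1"
definition A :: "(nat => 'a) => real" where "A x = - (\<Sum>j<Suc r. w j * lin j (x j) + b j * s j (x j))"
text \<open>The scale against which errors are measured; up to a constant it is a lower bound for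
  the standard deviation, see \<open>\<kappa>_le_V\<close>. The first summand is due to q, the
  second to p.\<close>

definition \<kappa> :: real where "\<kappa> = 1 / sqrt n + real r / real n"

lemma lam_qb: "qb (Suc r) = 1 / lam" "0 < lam" "lam \<le> real n / real r"
proof -
 show "qb (Suc r) = 1 / lam" by (simp add: qb_def lam_def)
 show "0 < lam" using rn by (simp add: lam_def)
 show "lam \<le> real n / real r" unfolding lam_def using r1 rn by (intro frac_le) auto
qed

lemma w_bounds: "j \<le> r ==> 0 < w j" "j \<le> r ==> w j \<le> 1 / (real r + 1)"
proof -
 show "j \<le> r ==> 0 < w j" using lam_qb(2) m0[of j] by (simp add: w_def)
 assume j: "j \<le> r"
 have "w j = (1 / (real r + 1)) * ((real n - real r) / (real n - real j))" by (simp add: w_def lam_def)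
 also have "... \<le> (1 / (real r + 1)) * 1" using j m0[OF j] by (intro mult_left_mono) auto
 finally show "w j \<le> 1 / (real r + 1)" by simp
qed

lemma b_sq: "j \<le> r ==> (b j)^2 \<le> 4 * C / (real r * real n)"
proof -
 assume j: "j \<le> r"
 have r0: "real r > 0" using r1 by simp
 have "(b j)^2 = 4 * ((w j)^2 * qb j)" using qb_nonneg[of j] j by (simp add: b_def power_mult_distrib)
 also have "(w j)^2 * qb j \<le> (1 / real r)^2 * (C * real r / real n)"
 proof (intro mult_mono power_mono qb_le j)
  show "w j \<le> 1 / real r" using w_bounds(2)[OF j] r0 by (auto intro: order_trans simp: frac_le)
 qed (use w_bounds(1)[OF j] qb_nonneg[of j] j in auto)
 also have "(1 / real r)^2 * (C * real r / real n) = C / (real r * real n)" using r0 by (simp add: power2_eq_square)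
 finally show ?thesis by simp
qed

lemma weighted_sum_L2:
 assumes "k \<le> Suc r" "\<And>j. j < k ==> L2_le Q (f j) c" "\<And>j. j < k ==> (\<integral>y. f j y \<partial>Q) = 0"
 shows "L2_le rows (\<lambda>x. \<Sum>j<k. a j * f j (x j)) (\<Sum>j<k. (a j)^2 * c)"
 using assms by (intro martingale_L2_le P.L2_le_const) (auto simp: past_def)

lemma A_L2: "L2_le rows A (20 * C ^ 2 / real n)"
proof -
 have r0: "real r > 0" using r1 by simp
 have "L2_le rows (\<lambda>x. \<Sum>j<Suc r. w j * lin j (x j)) (\<Sum>j<Suc r. (w j)^2 * (C / real n))" by (rule weighted_sum_L2) (simp_all add: lin2)
 moreover have "(\<Sum>j<Suc r. (w j)^2 * (C / real n)) \<le> 2 * C / real n"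
 proof -
  have "(w j)^2 * (C / real n) \<le> (1 / real r) * (C / real n)" if "j < Suc r" for j
  proof -
   have j: "j \<le> r" using that by simp
   have "w j \<le> 1 / real r" using w_bounds(2)[OF j] r0 by (auto intro: order_trans simp: frac_le)
   moreover have "w j \<le> 1" using w_bounds(2)[OF j] by (auto intro: order_trans)
   ultimately have "w j * w j \<le> 1 * (1 / real r)" using w_bounds(1)[OF j] by (intro mult_mono) auto
   then show ?thesis unfolding power2_eq_square using C1 by (intro mult_right_mono) auto
  qed
  from sum_le_2r[OF order.refl _ this] C1 r0 show ?thesis by simp
 qed
 ultimately have 1: "L2_le rows (\<lambda>x. \<Sum>j<Suc r. w j * lin j (x j)) (2 * C / real n)" by (rule L2_le_weaken)
 have "L2_le rows (\<lambda>x. \<Sum>j<Suc r. b j * s j (x j)) (\<Sum>j<Suc r. (b j)^2 * C)" by (rule weighted_sum_L2) (simp_all add: s2)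
 moreover have "(\<Sum>j<Suc r. (b j)^2 * C) \<le> 8 * C ^ 2 / real n"
 proof -
  have "(b j)^2 * C \<le> 4 * C / (real r * real n) * C" if "j < Suc r" for j using that C1 by (intro mult_right_mono b_sq) auto
  from sum_le_2r[OF order.refl _ this] C1 r0 show ?thesis by (simp add: power2_eq_square)
 qed
 ultimately have 2: "L2_le rows (\<lambda>x. \<Sum>j<Suc r. b j * s j (x j)) (8 * C ^ 2 / real n)" by (rule L2_le_weaken)
 have "A = (\<lambda>x. (-1) * ((\<Sum>j<Suc r. w j * lin j (x j)) + (\<Sum>j<Suc r. b j * s j (x j))))"
  by (simp add: A_def[abs_def] sum.distrib algebra_simps)
 then have "L2_le rows A ((-1)^2 * (2 * (2 * C / real n) + 2 * (8 * C ^ 2 / real n)))"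
  using L2_le_cmult[OF L2_le_add[OF 1 2], of "-1"] by simp
 moreover have "(-1)^2 * (2 * (2 * C / real n) + 2 * (8 * C ^ 2 / real n)) \<le> 20 * C ^ 2 / real n"
 proof -
  have "C * 1 \<le> C * C" using C1 by (intro mult_left_mono) auto
  then have "C / real n \<le> C ^ 2 / real n" using n0 by (intro divide_right_mono) (auto simp: power2_eq_square)
  then show ?thesis by simp
 qed
 ultimately show ?thesis by (rule L2_le_weaken)
qed

definition R :: "(nat => 'a) => real" where "R x = z x - A x"

text \<open>The linear part of ln (q * p), collected row by row: the sum of \<open>lin\<close> from
  p plus \<open>A\<close> from q.\<close>

definition main :: "(nat => 'a) => real" where
 "main x = (\<Sum>j<Suc r. (1 - w j) * lin j (x j) - b j * s j (x j))"

text \<open>\<open>lam\<close> times \<open>e_expansion\<close>, with \<open>A\<close> removed. In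
  \<open>m1\<close> the product sqrt q * s \<beta> is replaced by sqrt qb * s / (n - j) in two
  moves, first in the square root and then in \<open>\<beta>\<close>, which leaves the second and
  third sums.\<close>

lemma R_expansion:
 "R x = lam * ((\<Sum>j<Suc r. \<alpha> j (x j) - 1 / (real n - real j) + lin j (x j) / (real n - real j))
  + (-2) * (\<Sum>j<Suc r. (sqrt (q j x) - sqrt (qb j)) * (s j (x j) * \<beta> j (x j)))
  + (-2) * (\<Sum>j<Suc r. sqrt (qb j) * (s j (x j) * (\<beta> j (x j) - 1 / (real n - real j))))
  + m2 (Suc r) x + d2 (Suc r) x + (\<Sum>j<Suc r. 1 / (real n - real j) * e j x))"
proof -
 have "z x = lam * e (Suc r) x" using lam_qb(1,2) by (simp add: z_def e_def right_diff_distrib del: q.simps)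
 moreover have "A x = - (lam * (\<Sum>j<Suc r. lin j (x j) / (real n - real j)) + lam * (2 * (\<Sum>j<Suc r. sqrt (qb j) * (s j (x j) * (1 / (real n - real j))))))"
  unfolding A_def b_def w_def sum.distrib sum_distrib_left by (simp add: sum_distrib_left mult_ac)
 moreover have "(\<Sum>j<Suc r. \<alpha> j (x j) - 1 / (real n - real j) + lin j (x j) / (real n - real j)) = d1 (Suc r) x + (\<Sum>j<Suc r. lin j (x j) / (real n - real j))"
  unfolding d1_def sum.distrib by (rule refl)
 moreover have "(\<Sum>j<Suc r. (sqrt (q j x) - sqrt (qb j)) * (s j (x j) * \<beta> j (x j))) = m1 (Suc r) x - (\<Sum>j<Suc r. sqrt (qb j) * (s j (x j) * \<beta> j (x j)))"
  unfolding m1_def left_diff_distrib sum_subtractf by (rule refl)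
 moreover have "(\<Sum>j<Suc r. sqrt (qb j) * (s j (x j) * (\<beta> j (x j) - 1 / (real n - real j)))) =
  (\<Sum>j<Suc r. sqrt (qb j) * (s j (x j) * \<beta> j (x j))) - (\<Sum>j<Suc r. sqrt (qb j) * (s j (x j) * (1 / (real n - real j))))"
  unfolding right_diff_distrib sum_subtractf by (rule refl)
 moreover have "(\<Sum>j<Suc r. 1 / (real n - real j) * e j x) = (\<Sum>j<Suc r. e j x * (1 / (real n - real j)))" by (simp only: mult.commute)
 ultimately show ?thesis unfolding R_def using e_expansion[OF order.refl, of x] by (simp only: ring_distribs)
qed

text \<open>The rate n^(-1/4) by which the remainder is smaller than \<open>\<kappa>\<close>. It
  comes from the martingale with sqrt q - sqrt qb, where the deviation of order
  \<open>\<eta>0\<close> passes to the square roots by |sqrt a - sqrt b|^2 \<le> |a - b|.\<close>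

definition \<eta> :: real where "\<eta> = 1 / sqrt (sqrt n)"

lemma \<eta>_pos: "0 < \<eta>" and \<kappa>_pos: "0 < \<kappa>" and \<kappa>_le: "\<kappa> \<le> 2" and \<eta>_le: "\<eta> \<le> 1"
proof -
 have n1: "1 \<le> real n" using rn by simp
 show "0 < \<eta>" using n0 by (simp add: \<eta>_def)
 show "0 < \<kappa>" using n0 by (simp add: \<kappa>_def add_pos_nonneg)
 have "1 / sqrt n \<le> 1" using n1 by simp
 moreover have "real r / real n \<le> 1" using r_le_n n0 by simp
 ultimately show "\<kappa> \<le> 2" by (simp add: \<kappa>_def)
 show "\<eta> \<le> 1" using n1 by (simp add: \<eta>_def)
qed

lemma \<eta>_sq: "\<eta> * \<eta> = 1 / sqrt n" using n0 by (simp add: \<eta>_def)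

text \<open>The left sides are the orders of the error terms that occur in the
  linearisation.\<close>

lemma rate_bounds:
 shows "1 / real n \<le> \<kappa> * \<eta>" "1 / sqrt n * \<eta> \<le> \<kappa> * \<eta>" "sqrt r / real n \<le> \<kappa> * \<eta>" "real r / (real n * sqrt n) \<le> \<kappa> * \<eta>"
  "1 / real n \<le> \<eta>"
proof -
 have \<eta>2: "\<eta> * \<eta> \<le> \<eta>" using \<eta>_pos \<eta>_le mult_left_mono[of \<eta> 1 \<eta>] by simp
 have sn: "1 / sqrt n \<le> \<kappa>" "real r / real n \<le> \<kappa>" by (auto simp: \<kappa>_def)
 have "1 / real n = 1 / sqrt n * (1 / sqrt n)" by simp
 also have "... = 1 / sqrt n * (\<eta> * \<eta>)" by (simp only: \<eta>_sq)
 also have "... \<le> \<kappa> * \<eta>" using \<eta>2 sn \<kappa>_pos \<eta>_pos by (intro mult_mono) auto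
 finally show "1 / real n \<le> \<kappa> * \<eta>" .
 show "1 / sqrt n * \<eta> \<le> \<kappa> * \<eta>" using sn \<eta>_pos by (intro mult_right_mono) auto
 show "real r / (real n * sqrt n) \<le> \<kappa> * \<eta>"
 proof -
  have "real r / (real n * sqrt n) = real r / real n * (\<eta> * \<eta>)" by (simp add: \<eta>_sq)
  also have "... \<le> \<kappa> * \<eta>" using \<eta>2 sn \<kappa>_pos \<eta>_pos by (intro mult_mono) auto
  finally show ?thesis .
 qed
 show "sqrt r / real n \<le> \<kappa> * \<eta>"
 proof -
  define a where "a = sqrt (real r / real n)"
  have a: "0 \<le> a" "a * a = real r / real n" by (auto simp: a_def)
  have "sqrt r / real n = a * (1 / sqrt n)" using n0 by (simp add: a_def real_sqrt_divide)
  also have "... = (a * \<eta>) * \<eta>" by (simp only: \<eta>_sq[symmetric] mult.assoc)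
  also have "... \<le> \<kappa> * \<eta>"
  proof (rule mult_right_mono)
   \<comment> \<open>The inequality of the means: a^2 and \<eta>^2 are exactly the two summands of
     \<open>\<kappa>\<close>.\<close>
   have "2 * (a * \<eta>) \<le> a * a + \<eta> * \<eta>" using zero_le_power2[of "a - \<eta>"] by (simp add: power2_eq_square algebra_simps)
   also have "... = \<kappa>" by (simp add: a \<eta>_sq \<kappa>_def)
   finally show "a * \<eta> \<le> \<kappa>" using a \<eta>_pos mult_nonneg_nonneg[of a \<eta>] by linarith
  qed (use \<eta>_pos in simp)
  finally show ?thesis .
 qed
 have "1 / real n = (\<eta> * \<eta>) * (\<eta> * \<eta>)" unfolding \<eta>_sq by simp
 also have "... \<le> \<eta> * 1"
 proof (rule mult_mono[OF \<eta>2])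
  show "\<eta> * \<eta> \<le> 1" using \<eta>2 \<eta>_le by linarith
 qed (use \<eta>_pos in auto)
 finally show "1 / real n \<le> \<eta>" by simp
qed

lemma lam_mult_le: "0 \<le> c ==> lam * (c * real r) \<le> c * real n"
proof -
 assume c: "0 \<le> c"
 have "lam * (c * real r) \<le> (real n / real r) * (c * real r)" using lam_qb(3) c by (intro mult_right_mono) auto
 then show ?thesis using r1 by (simp add: mult.commute)
qed

lemma R_L1: "L1_le rows R (K4 C * (\<kappa> * \<eta>))"
proof -
 have l0: "0 \<le> lam" using lam_qb(2) by simp
 let ?T1 = "\<lambda>x. \<Sum>j<Suc r. \<alpha> j (x j) - 1 / (real n - real j) + lin j (x j) / (real n - real j)"
 let ?T2 = "\<lambda>x. \<Sum>j<Suc r. (sqrt (q j x) - sqrt (qb j)) * (s j (x j) * \<beta> j (x j))"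
 let ?T3 = "\<lambda>x. \<Sum>j<Suc r. sqrt (qb j) * (s j (x j) * (\<beta> j (x j) - 1 / (real n - real j)))"
 let ?T6 = "\<lambda>x. \<Sum>j<Suc r. 1 / (real n - real j) * e j x"
 have T1: "L1_le rows ?T1 (2 * real r * (C / real n ^ 2))"
 proof -
  have "L1_le rows ?T1 (\<Sum>j<Suc r. C / real n ^ 2)" by (intro L1_le_sum L1_le_row \<alpha>_lin) auto
  then show ?thesis using sum_le_2r[OF order.refl, of "C / real n ^ 2" "\<lambda>_. C / real n ^ 2"] C1 by (auto intro: L1_le_weaken)
 qed
 have T2: "L1_le rows ?T2 (sqrt (2 * K3 C * C) * (real r / (real n * sqrt n)) * (1 / (sqrt n * sqrt (sqrt n)) * sqrt n))"
 proof -
  have h: "L2_le rows (\<lambda>x. sqrt (q j x) - sqrt (qb j)) (K3 C * \<eta>0)" if j: "j < Suc r" for j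
  proof -
   have m: "(\<lambda>x. sqrt (q j x) - sqrt (qb j)) \<in> borel_measurable rows"
   proof -
    have [measurable]: "q j \<in> borel_measurable rows" using q_meas[of j] j by simp
    show ?thesis by measurable
   qed
   have "(sqrt a - sqrt b)^2 \<le> \<bar>a - b\<bar>" if "0 \<le> a" "0 \<le> b" for a b :: real
   proof -
    have "(sqrt a - sqrt b)^2 = \<bar>sqrt a - sqrt b\<bar> * \<bar>sqrt a - sqrt b\<bar>" by (simp add: power2_eq_square)
    also have "... \<le> \<bar>sqrt a - sqrt b\<bar> * (sqrt a + sqrt b)" using that by (intro mult_left_mono) (auto simp: abs_if)
    also have "... = \<bar>(sqrt a - sqrt b) * (sqrt a + sqrt b)\<bar>" using that by (simp add: abs_mult)
    also have "(sqrt a - sqrt b) * (sqrt a + sqrt b) = a - b" using that by (simp add: algebra_simps)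
    finally show ?thesis .
   qed
   then have "(sqrt (q j x) - sqrt (qb j))^2 \<le> \<bar>e j x\<bar>" for x unfolding e_def using q_nonneg[of j x] qb_nonneg[of j] j by simp
   then have "L1_le rows (\<lambda>x. (sqrt (q j x) - sqrt (qb j))^2) (K3 C * \<eta>0)" using m j by (intro L1_le_mono[OF e_L1[of j]]) auto
   then show ?thesis using m by (simp add: L2_le_iff_L1)
  qed
  have ph: "past j (\<lambda>x. sqrt (q j x) - sqrt (qb j))" for j using past_q[of j] by (simp add: past_def)
  let ?c = "(K3 C * \<eta>0) * (C / real n ^ 2)"
  have "L2_le rows ?T2 (\<Sum>j<Suc r. ?c)" by (intro martingale_L2_le h ph s\<beta>) auto
  moreover have "(\<Sum>j<Suc r. ?c) \<le> 2 * real r * ?c" using K_pos C1 \<eta>0_nonneg by (intro sum_le_2r) auto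
  ultimately have "L2_le rows ?T2 (2 * real r * ?c)" by (rule L2_le_weaken)
  note L1 = P.L2_le_imp_L1_le[OF this]
  have "sqrt (2 * real r * ?c) = sqrt (2 * K3 C * C) * (real r / (real n * sqrt n)) * (1 / (sqrt n * sqrt (sqrt n)) * sqrt n)"
  proof (rule real_sqrt_unique)
   show "(sqrt (2 * K3 C * C) * (real r / (real n * sqrt n)) * (1 / (sqrt n * sqrt (sqrt n)) * sqrt n))^2 = 2 * real r * ?c"
   proof -
    define z where "z = sqrt (sqrt (real n))"
    have z: "z > 0" "sqrt n = z ^ 2" "real n = z ^ 4"
     using n0 by (auto simp: z_def power_mult[of "sqrt (sqrt (real n))" 2 2, simplified])
    have "(sqrt (2 * K3 C * C) * (real r / (z ^ 4 * z ^ 2)) * (1 / (z ^ 2 * z) * z ^ 2))^2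
      = (2 * K3 C * C) * ((real r / (z ^ 4 * z ^ 2)) * (1 / (z ^ 2 * z) * z ^ 2))^2"
     using K_pos C1 by (simp only: mult.assoc[of "sqrt _"] power_mult_distrib[of "sqrt _"]) simp
    also have "... = 2 * real r * (K3 C * (real r / (z ^ 4 * z ^ 2)) * (C / (z ^ 4) ^ 2))"
     using z(1) by (simp add: field_simps eval_nat_numeral)
    finally show ?thesis using z(1) unfolding \<eta>0_def z(2) unfolding z(3) by simp
   qed
  qed (use K_pos C1 in auto)
  with L1 show ?thesis by (simp only:)
 qed
 have T3: "L1_le rows ?T3 (2 * C * (real r / real n ^ 2))"
 proof -
  let ?c = "(C * real r / real n) * (C / real n ^ 3)"
  have "L2_le rows ?T3 (\<Sum>j<Suc r. (sqrt (qb j))^2 * (C / real n ^ 3))"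
  proof (rule weighted_sum_L2)
   fix j assume "j < Suc r"
   then have j: "j \<le> r" by simp
   show "L2_le Q (\<lambda>y. s j y * (\<beta> j y - 1 / (real n - real j))) (C / real n ^ 3)" by (rule s\<beta>_diff[OF j])
   have "integrable Q (\<lambda>y. s j y * \<beta> j y)" "integrable Q (s j)"
    using L1_le_integrable[OF Q.L2_le_imp_L1_le] s\<beta>(1)[OF j] s2(1)[OF j] by blast+
   then show "(\<integral>y. s j y * (\<beta> j y - 1 / (real n - real j)) \<partial>Q) = 0" using s\<beta>(2)[OF j] s2(2)[OF j] by (simp add: right_diff_distrib)
  qed simp
  moreover have "(sqrt (qb j))^2 * (C / real n ^ 3) \<le> ?c" if "j < Suc r" for j
   using qb_nonneg[of j] qb_le[of j] that C1 by (intro mult_right_mono) auto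
  then have "(\<Sum>j<Suc r. (sqrt (qb j))^2 * (C / real n ^ 3)) \<le> 2 * real r * ?c" using C1 by (intro sum_le_2r) auto
  ultimately have "L2_le rows ?T3 (2 * real r * ?c)" by (rule L2_le_weaken)
  then have "L1_le rows ?T3 (sqrt (2 * real r * ?c))" by (rule P.L2_le_imp_L1_le)
  moreover have "sqrt (2 * real r * ?c) \<le> 2 * C * (real r / real n ^ 2)"
  proof (rule real_le_lsqrt)
   have "2 * real r * ?c = 2 * (C * (real r / real n ^ 2))^2" by (simp add: power2_eq_square power3_eq_cube mult_ac)
   also have "... \<le> 4 * (C * (real r / real n ^ 2))^2" by (intro mult_right_mono) auto
   also have "... = (2 * C * (real r / real n ^ 2))^2" by (simp add: power_mult_distrib power_divide)
   finally show "2 * real r * ?c \<le> (2 * C * (real r / real n ^ 2))^2" .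
  qed (use C1 in auto)
  ultimately show ?thesis by (rule L1_le_weaken)
 qed
 have T6: "L1_le rows ?T6 (2 * real r * (C / real n * (K3 C * \<eta>0)))"
 proof -
  have "L1_le rows ?T6 (\<Sum>j<Suc r. \<bar>1 / (real n - real j)\<bar> * (K3 C * \<eta>0))" by (intro L1_le_sum L1_le_cmult e_L1) auto
  moreover have "\<bar>1 / (real n - real j)\<bar> * (K3 C * \<eta>0) \<le> C / real n * (K3 C * \<eta>0)" if "j < Suc r" for j
   using inv_m[of j] m0[of j] that K_pos \<eta>0_nonneg by (intro mult_right_mono) auto
  then have "(\<Sum>j<Suc r. \<bar>1 / (real n - real j)\<bar> * (K3 C * \<eta>0)) \<le> 2 * real r * (C / real n * (K3 C * \<eta>0))"
   using K_pos C1 \<eta>0_nonneg by (intro sum_le_2r) auto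
  ultimately show ?thesis by (rule L1_le_weaken)
 qed
 let ?B1 = "2 * real r * (C / real n ^ 2)"
 let ?B2 = "sqrt (2 * K3 C * C) * (real r / (real n * sqrt n)) * (1 / (sqrt n * sqrt (sqrt n)) * sqrt n)"
 let ?B3 = "2 * C * (real r / real n ^ 2)"
 let ?B4 = "sqrt (8 * K2 C * C) * (real r * sqrt r / real n ^ 2)"
 let ?B5 = "4 * K1 C * C * (\<eta>0 * (real r / real n))"
 let ?B6 = "2 * real r * (C / real n * (K3 C * \<eta>0))"
 have "L1_le rows R (\<bar>lam\<bar> * (?B1 + \<bar>-2\<bar> * ?B2 + \<bar>-2\<bar> * ?B3 + ?B4 + ?B5 + ?B6))" unfolding R_expansion[abs_def]
  by (intro L1_le_cmult L1_le_add T1 T2 T3 T6 m2_L1 d2_L1 order.refl)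
 moreover have "\<bar>lam\<bar> * (?B1 + \<bar>-2\<bar> * ?B2 + \<bar>-2\<bar> * ?B3 + ?B4 + ?B5 + ?B6) \<le> K4 C * (\<kappa> * \<eta>)"
 proof -
  have "lam * (?B1 + \<bar>-2\<bar> * ?B2 + \<bar>-2\<bar> * ?B3 + ?B4 + ?B5 + ?B6)
   = lam * ((2 * C / real n ^ 2 + 2 * sqrt (2 * K3 C * C) * (1 / (real n * sqrt n) * (1 / sqrt (sqrt n))) + 4 * C / real n ^ 2
    + sqrt (8 * K2 C * C) * (sqrt r / real n ^ 2) + 4 * K1 C * C * (real r / real n * (1 / (real n * sqrt n)))
    + 2 * C * K3 C * (real r / real n * (1 / (real n * sqrt n)))) * real r)" using n0 by (simp add: \<eta>0_def algebra_simps)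
  also have "... \<le> (2 * C / real n ^ 2 + 2 * sqrt (2 * K3 C * C) * (1 / (real n * sqrt n) * (1 / sqrt (sqrt n))) + 4 * C / real n ^ 2
    + sqrt (8 * K2 C * C) * (sqrt r / real n ^ 2) + 4 * K1 C * C * (real r / real n * (1 / (real n * sqrt n)))
    + 2 * C * K3 C * (real r / real n * (1 / (real n * sqrt n)))) * real n"
   using C1 K_pos by (intro lam_mult_le add_nonneg_nonneg mult_nonneg_nonneg) auto
  also have "... = 6 * C * (1 / real n) + 2 * sqrt (2 * K3 C * C) * (1 / sqrt n * \<eta>)
    + sqrt (8 * K2 C * C) * (sqrt r / real n) + 4 * K1 C * C * (real r / (real n * sqrt n)) + 2 * C * K3 C * (real r / (real n * sqrt n))"
   using n0 by (simp add: \<eta>_def algebra_simps power2_eq_square)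
  also have "... \<le> K4 C * (\<kappa> * \<eta>)"
  proof -
   have "6 * C * (1 / real n) \<le> 6 * C * (\<kappa> * \<eta>)" using C1 by (intro mult_left_mono rate_bounds) auto
   moreover have "2 * sqrt (2 * K3 C * C) * (1 / sqrt n * \<eta>) \<le> 2 * sqrt (2 * K3 C * C) * (\<kappa> * \<eta>)"
    using C1 K_pos by (intro mult_left_mono rate_bounds) auto
   moreover have "sqrt (8 * K2 C * C) * (sqrt r / real n) \<le> sqrt (8 * K2 C * C) * (\<kappa> * \<eta>)"
    using C1 K_pos by (intro mult_left_mono rate_bounds) auto
   moreover have "4 * K1 C * C * (real r / (real n * sqrt n)) \<le> 4 * K1 C * C * (\<kappa> * \<eta>)"
    using C1 K_pos by (intro mult_left_mono rate_bounds) auto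
   moreover have "2 * C * K3 C * (real r / (real n * sqrt n)) \<le> 2 * C * K3 C * (\<kappa> * \<eta>)"
    using C1 K_pos by (intro mult_left_mono rate_bounds) auto
   ultimately show ?thesis unfolding K4_def distrib_right by linarith
  qed
  finally show ?thesis using l0 by simp
 qed
 ultimately show ?thesis by (rule L1_le_weaken)
qed

text \<open>Outside events where the linear part or the remainder of \<open>z\<close> reaches 1/4,
  |z| \<le> 1/2 and ln (1 + z) = z + O(z^2). Here z^2 is bounded by A^2, with mean O(1 / n), plus a
  multiple of |R|. All three exceptional events are small by Markov's inequality.\<close>

theorem chain_deviation:
 assumes \<epsilon>: "\<epsilon> > 0"
 shows "P.prob {x \<in> space rows. \<epsilon> * \<kappa> \<le> \<bar>(\<Sum>j<Suc r. lin j (x j) + \<zeta> j (x j)) + ln (q (Suc r) x / qb (Suc r))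
   - (\<Sum>j<Suc r. \<integral>y. \<zeta> j y \<partial>Q) - main x\<bar>} \<le> chain_const C * \<eta> * (1 / \<epsilon> + 1)"
  and "0 \<le> chain_const C"
proof -
 define R1 where "R1 x = (\<Sum>j<Suc r. 1 * (\<zeta> j (x j) - (\<integral>y. \<zeta> j y \<partial>Q)))" for x
 have R1_L1: "L1_le rows R1 (sqrt (8 * C) * (\<kappa> * \<eta>))"
 proof -
  have "L2_le rows R1 (\<Sum>j<Suc r. 1^2 * (4 * C / real n ^ 2))" unfolding R1_def[abs_def]
  proof (rule weighted_sum_L2)
   fix j assume "j < Suc r"
   then have z: "L2_le Q (\<zeta> j) (C / real n ^ 2)" using \<zeta>2 by simp
   have int: "integrable Q (\<zeta> j)" by (rule L1_le_integrable[OF Q.L2_le_imp_L1_le[OF z]])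
   show "(\<integral>y. \<zeta> j y - (\<integral>y. \<zeta> j y \<partial>Q) \<partial>Q) = 0" using int by (simp add: Q.prob_space)
   have "\<bar>\<integral>y. \<zeta> j y \<partial>Q\<bar> \<le> sqrt (C / real n ^ 2)" by (rule L1_le_integral[OF Q.L2_le_imp_L1_le[OF z]])
   then have "(- (\<integral>y. \<zeta> j y \<partial>Q))^2 \<le> C / real n ^ 2"
   proof -
    assume "\<bar>\<integral>y. \<zeta> j y \<partial>Q\<bar> \<le> sqrt (C / real n ^ 2)"
    then have "\<bar>\<integral>y. \<zeta> j y \<partial>Q\<bar>\<^sup>2 \<le> (sqrt (C / real n ^ 2))^2" by (intro power_mono) auto
    also have "... = C / real n ^ 2" using C1 by (intro real_sqrt_pow2) auto
    finally show ?thesis by simp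
   qed
   then have "L2_le Q (\<lambda>y. - (\<integral>y. \<zeta> j y \<partial>Q)) (C / real n ^ 2)" by (rule L2_le_weaken[OF Q.L2_le_const])
   from L2_le_add[OF z this] show "L2_le Q (\<lambda>y. \<zeta> j y - (\<integral>y. \<zeta> j y \<partial>Q)) (4 * C / real n ^ 2)" by simp
  qed simp
  moreover have "(\<Sum>j<Suc r. 1^2 * (4 * C / real n ^ 2)) \<le> 2 * real r * (4 * C / real n ^ 2)" using C1 by (intro sum_le_2r) auto
  ultimately have "L2_le rows R1 (2 * real r * (4 * C / real n ^ 2))" by (rule L2_le_weaken)
  from P.L2_le_imp_L1_le[OF this] have "L1_le rows R1 (sqrt (8 * C) * (sqrt r / real n))"
   by (simp add: real_sqrt_mult real_sqrt_divide mult_ac)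
  then show ?thesis using C1 by (elim L1_le_weaken) (intro mult_left_mono rate_bounds, auto)
 qed
 have K4: "0 \<le> K4 C" unfolding K4_def using C1 K_pos by (intro add_nonneg_nonneg mult_nonneg_nonneg) auto
 show cc: "0 \<le> chain_const C" unfolding chain_const_def using K4 C1 by (intro add_nonneg_nonneg) auto
 have \<kappa>\<eta>: "0 < \<kappa> * \<eta>" using \<kappa>_pos \<eta>_pos by simp
 have C2: "0 \<le> C ^ 2" by simp
 \<comment> \<open>Dominates |R1| + |R| + 2 z^2 when z^2 \<le> A^2 + 3/2 |R|, whence the
   coefficients 4 = 1 + 2 * 3/2 and 2.\<close>
 define D where "D x = \<bar>R1 x\<bar> + 4 * \<bar>R x\<bar> + 2 * (A x)^2" for x
 have abs_L1: "L1_le rows (\<lambda>x. \<bar>f x\<bar>) c" if "L1_le rows f c" for f c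
  using that unfolding L1_le_def by (auto intro: borel_measurable_abs)
 have A1: "L1_le rows (\<lambda>x. (A x)^2) (20 * C ^ 2 / real n)" by (rule L1_le_square[OF A_L2])
 have D_L1: "L1_le rows D ((sqrt (8 * C) + 4 * K4 C + 40 * C ^ 2) * (\<kappa> * \<eta>))"
 proof -
  have "L1_le rows D (sqrt (8 * C) * (\<kappa> * \<eta>) + \<bar>4\<bar> * (K4 C * (\<kappa> * \<eta>)) + \<bar>2\<bar> * (20 * C ^ 2 / real n))"
   unfolding D_def[abs_def] by (intro L1_le_add L1_le_cmult abs_L1 R1_L1 R_L1 A1)
  moreover have "40 * C ^ 2 * (1 / real n) \<le> 40 * C ^ 2 * (\<kappa> * \<eta>)" by (intro mult_left_mono rate_bounds) auto
  ultimately show ?thesis by (elim L1_le_weaken) (simp add: algebra_simps)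
 qed
 have [measurable]: "D \<in> borel_measurable rows" "R \<in> borel_measurable rows" "A \<in> borel_measurable rows"
  using D_L1 R_L1 A_L2 by (auto simp: L1_le_def L2_le_def)
 let ?B1 = "{x \<in> space rows. 1 / 4 \<le> \<bar>R x\<bar>}"
 let ?B2 = "{x \<in> space rows. 1 / 16 \<le> \<bar>(A x)\<^sup>2\<bar>}"
 let ?B3 = "{x \<in> space rows. \<epsilon> * \<kappa> \<le> \<bar>D x\<bar>}"
 let ?S = "{x \<in> space rows. \<epsilon> * \<kappa> \<le> \<bar>(\<Sum>j<Suc r. lin j (x j) + \<zeta> j (x j)) + ln (q (Suc r) x / qb (Suc r))
   - (\<Sum>j<Suc r. \<integral>y. \<zeta> j y \<partial>Q) - main x\<bar>}"
 have sub: "?S \<subseteq> ?B1 \<union> (?B2 \<union> ?B3)"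
 proof
  fix x assume x: "x \<in> ?S"
  show "x \<in> ?B1 \<union> (?B2 \<union> ?B3)"
  proof (rule ccontr)
   assume "\<not> ?thesis"
   with x have R: "\<bar>R x\<bar> < 1 / 4" and A: "(A x)^2 < 1 / 16" and Dx: "\<bar>D x\<bar> < \<epsilon> * \<kappa>" by auto
   have "\<bar>A x\<bar>\<^sup>2 < (1 / 4)^2" using A by (simp add: power2_eq_square)
   then have A': "\<bar>A x\<bar> < 1 / 4" by (rule power2_less_imp_less) simp
   have zz: "z x = A x + R x" by (simp add: R_def)
   then have z: "\<bar>z x\<bar> \<le> 1 / 2" using R A' by linarith
   have q: "q (Suc r) x / qb (Suc r) = 1 + z x" by (simp add: z_def)
   have eq: "(\<Sum>j<Suc r. lin j (x j) + \<zeta> j (x j)) + ln (q (Suc r) x / qb (Suc r)) - (\<Sum>j<Suc r. \<integral>y. \<zeta> j y \<partial>Q) - main x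
     = R1 x + (ln (1 + z x) - z x) + R x" unfolding q R1_def main_def zz A_def
    by (simp add: sum.distrib sum_subtractf left_diff_distrib del: sum.lessThan_Suc)
   have "\<bar>ln (1 + z x) - z x\<bar> \<le> 2 * (z x)^2" using z by (rule abs_ln_one_plus_x_minus_x_bound)
   moreover have "(z x)^2 \<le> (A x)^2 + 3 / 2 * \<bar>R x\<bar>"
   proof -
    have "(z x)^2 = (A x)^2 + R x * (2 * A x + R x)" by (simp add: zz power2_eq_square algebra_simps)
    moreover have "R x * (2 * A x + R x) \<le> \<bar>R x\<bar> * \<bar>2 * A x + R x\<bar>" by (metis abs_ge_self abs_mult)
    moreover have "\<bar>R x\<bar> * \<bar>2 * A x + R x\<bar> \<le> \<bar>R x\<bar> * (3 / 2)" using A' R by (intro mult_left_mono) linarith+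
    ultimately show ?thesis by linarith
   qed
   ultimately have "\<bar>R1 x + (ln (1 + z x) - z x) + R x\<bar> \<le> D x" unfolding D_def by linarith
   then have "\<bar>(\<Sum>j<Suc r. lin j (x j) + \<zeta> j (x j)) + ln (q (Suc r) x / qb (Suc r)) - (\<Sum>j<Suc r. \<integral>y. \<zeta> j y \<partial>Q) - main x\<bar> < \<epsilon> * \<kappa>"
    unfolding eq using Dx by linarith
   with x show False by auto
  qed
 qed
 have "P.prob ?S \<le> P.prob (?B1 \<union> (?B2 \<union> ?B3))" by (rule P.finite_measure_mono[OF sub]) measurable
 also have "... \<le> P.prob ?B1 + (P.prob ?B2 + P.prob ?B3)" by (rule order_trans[OF measure_Un_le]) (auto intro!: measure_Un_le)
 also have "... \<le> 8 * K4 C * \<eta> + (320 * C ^ 2 * \<eta> + (sqrt (8 * C) + 4 * K4 C + 40 * C ^ 2) * \<eta> / \<epsilon>)"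
 proof (intro add_mono)
  have "P.prob ?B1 \<le> K4 C * (\<kappa> * \<eta>) / (1 / 4)" by (rule P.L1_le_Markov[OF R_L1]) simp
  also have "... = 4 * K4 C * \<eta> * \<kappa>" by simp
  also have "... \<le> 4 * K4 C * \<eta> * 2" using K4 \<eta>_pos \<kappa>_le by (intro mult_left_mono) auto
  finally show "P.prob ?B1 \<le> 8 * K4 C * \<eta>" by simp
  have "P.prob ?B2 \<le> 20 * C ^ 2 / real n / (1 / 16)" by (rule P.L1_le_Markov[OF A1]) simp
  also have "... = 320 * C ^ 2 * (1 / real n)" by simp
  also have "... \<le> 320 * C ^ 2 * \<eta>" by (intro mult_left_mono rate_bounds) auto
  finally show "P.prob ?B2 \<le> 320 * C ^ 2 * \<eta>" .
  have "P.prob ?B3 \<le> (sqrt (8 * C) + 4 * K4 C + 40 * C ^ 2) * (\<kappa> * \<eta>) / (\<epsilon> * \<kappa>)"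
   by (rule P.L1_le_Markov[OF D_L1]) (use \<epsilon> \<kappa>_pos in simp)
  also have "... = (sqrt (8 * C) + 4 * K4 C + 40 * C ^ 2) * \<eta> / \<epsilon>" using \<kappa>_pos by simp
  finally show "P.prob ?B3 \<le> (sqrt (8 * C) + 4 * K4 C + 40 * C ^ 2) * \<eta> / \<epsilon>" .
 qed
 also have "... \<le> chain_const C * \<eta> + chain_const C * \<eta> / \<epsilon>"
 proof -
  have "(8 * K4 C + 320 * C ^ 2) * \<eta> \<le> chain_const C * \<eta>" unfolding chain_const_def using \<eta>_pos C1 by (intro mult_right_mono) auto
  moreover have "(sqrt (8 * C) + 4 * K4 C + 40 * C ^ 2) * \<eta> / \<epsilon> \<le> chain_const C * \<eta> / \<epsilon>"
   unfolding chain_const_def using \<eta>_pos K4 \<epsilon> C2 by (intro divide_right_mono mult_right_mono) auto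
  ultimately show ?thesis by (simp add: distrib_right)
 qed
 also have "... = chain_const C * \<eta> * (1 / \<epsilon> + 1)" by (simp add: distrib_left)
 finally show "P.prob ?S \<le> chain_const C * \<eta> * (1 / \<epsilon> + 1)" .
qed

end

subsection \<open>Gaussian rows\<close>

lemma std_normal_moments:
 "(\<integral>x. x ^ 2 \<partial>std_normal_distribution) = 1" "(\<integral>x. x ^ 4 \<partial>std_normal_distribution) = 3"
 "(\<integral>x. x ^ 6 \<partial>std_normal_distribution) = 15" "(\<integral>x. x ^ 8 \<partial>std_normal_distribution) = 105"
 "(\<integral>x. x \<partial>std_normal_distribution) = 0"
 using std_normal_distribution_even_moments(1)[of 1] std_normal_distribution_even_moments(1)[of 2]
  std_normal_distribution_even_moments(1)[of 3] std_normal_distribution_even_moments(1)[of 4]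
  integral_std_normal_distribution_moment_odd[of 1] by (simp_all add: fact_numeral)

interpretation std_normal: prob_space std_normal_distribution by (rule prob_space_normal_density) simp

definition sq1 :: "real => real" where "sq1 x = x^2 - 1"

lemma sq1_moments:
 shows "integrable std_normal_distribution (\<lambda>x. sq1 x ^ p)"
  "(\<integral>x. sq1 x \<partial>std_normal_distribution) = 0" "(\<integral>x. sq1 x ^ 2 \<partial>std_normal_distribution) = 2"
  "(\<integral>x. sq1 x ^ 3 \<partial>std_normal_distribution) = 8" "(\<integral>x. sq1 x ^ 4 \<partial>std_normal_distribution) = 60"
proof -
 note I = integrable_std_normal_distribution_moment
 have pu: "measure std_normal_distribution UNIV = 1" using std_normal.prob_space by simp
 have e: "sq1 x ^ p = (\<Sum>i\<le>p. of_nat (p choose i) * x ^ (2 * i) * (- 1) ^ (p - i))" for x p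
  unfolding sq1_def diff_conv_add_uminus binomial_ring by (simp add: power_mult)
 show "integrable std_normal_distribution (\<lambda>x. sq1 x ^ p)"
  unfolding e by (intro Bochner_Integration.integrable_sum integrable_mult_left integrable_mult_right I)
 have e2: "sq1 x ^ 2 = x ^ 4 - 2 * x ^ 2 + 1" "sq1 x ^ 3 = x ^ 6 - 3 * x ^ 4 + 3 * x ^ 2 - 1"
   "sq1 x ^ 4 = x ^ 8 - 4 * x ^ 6 + 6 * x ^ 4 - 4 * x ^ 2 + 1" for x by (simp_all add: sq1_def eval_nat_numeral algebra_simps)
 show "(\<integral>x. sq1 x \<partial>std_normal_distribution) = 0" using I[of 2] std_normal_moments by (simp add: sq1_def pu)
 show "(\<integral>x. sq1 x ^ 2 \<partial>std_normal_distribution) = 2" unfolding e2 using I[of 2] I[of 4] std_normal_moments by (simp add: pu)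
 show "(\<integral>x. sq1 x ^ 3 \<partial>std_normal_distribution) = 8" unfolding e2 using I[of 2] I[of 4] I[of 6] std_normal_moments by (simp add: pu)
 show "(\<integral>x. sq1 x ^ 4 \<partial>std_normal_distribution) = 60"
  unfolding e2 using I[of 2] I[of 4] I[of 6] I[of 8] std_normal_moments by (simp add: pu)
qed

lemma std_normal_L1:
 "L2_le std_normal_distribution sq1 2" "L1_le std_normal_distribution (\<lambda>x. sq1 x ^ 4) 60"
 "L1_le std_normal_distribution (\<lambda>x. sq1 x ^ 2) 2" "\<exists>c. L1_le std_normal_distribution (\<lambda>x. sq1 x ^ 3) c"
 "L1_le std_normal_distribution sq1 (sqrt 2)"
 "L2_le std_normal_distribution (\<lambda>x. x) 1" "L2_le std_normal_distribution (\<lambda>x. x^2) 3"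
proof -
 have m: "sq1 \<in> borel_measurable std_normal_distribution" using borel_measurable_integrable[OF sq1_moments(1)[of 1]] by simp
 show 1: "L2_le std_normal_distribution sq1 2" using sq1_moments(3) by (intro L2_leI_integral m sq1_moments(1)) simp
 show "L1_le std_normal_distribution (\<lambda>x. sq1 x ^ 4) 60" "L1_le std_normal_distribution (\<lambda>x. sq1 x ^ 2) 2"
  using sq1_moments(3,5) by (auto intro!: L1_leI_integral sq1_moments(1))
 show "\<exists>c. L1_le std_normal_distribution (\<lambda>x. sq1 x ^ 3) c" using L1_leI_integral[OF sq1_moments(1)[of 3] order_refl] by blast
 show "L1_le std_normal_distribution sq1 (sqrt 2)" by (rule std_normal.L2_le_imp_L1_le[OF 1])
 show "L2_le std_normal_distribution (\<lambda>x. x) 1" "L2_le std_normal_distribution (\<lambda>x. x^2) 3"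
  using std_normal_moments integrable_std_normal_distribution_moment[of 2] integrable_std_normal_distribution_moment[of 4]
  by (auto intro!: L2_leI_integral simp: power_mult[symmetric])
qed

text \<open>The coordinates of one Gaussian vector are themselves independent rows, so the product
  lemmas are used on two levels: for coordinates within a point and for the points.\<close>

locale gaussian_vector = fixes n :: nat
begin

sublocale row_product std_normal_distribution n by unfold_locales

lemma rows_eq: "rows = gaussian_law n" by (simp add: gaussian_law_eq_PiM)

definition csum :: "nat => nat => (nat => real) => real" where
 "csum j k x = (\<Sum>i\<in>{j..<k}. sq1 (x i))"

lemma past_csum: "past k (csum j k)" by (auto simp: past_def csum_def intro!: sum.cong)

text \<open>In the fourth power, the term with S^3 vanishes because \<open>sq1\<close> is centred
  and the term with S because the sum is, which is why the mean is part of the induction. The rest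
  is at most 60 m^2 + 12 * 2 m + 60 \<le> 60 (m + 1)^2, where 60 is the fourth moment of
  \<open>sq1\<close>.\<close>

lemma csum_moments:
 assumes "j \<le> k" "k \<le> n"
 shows "L2_le rows (csum j k) (2 * (real k - real j)) \<and> L1_le rows (\<lambda>x. csum j k x ^ 4) (60 * (real k - real j) ^ 2)
  \<and> (\<integral>x. csum j k x \<partial>rows) = 0" using assms
proof (induction k rule: dec_induct)
 case base
 then show ?case by (simp add: csum_def)
next
 case (step k)
 let ?S = "csum j k"
 let ?m = "real k - real j"
 have k: "k < n" using step.prems by simp
 have m0: "?m \<ge> 0" using step.hyps by simp
 have IH: "L2_le rows ?S (2 * ?m)" "L1_le rows (\<lambda>x. ?S x ^ 4) (60 * ?m ^ 2)" "(\<integral>x. ?S x \<partial>rows) = 0" using step by auto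
 have Sm [measurable]: "?S \<in> borel_measurable rows" using IH(1) by (simp add: L2_le_def)
 have S1: "L1_le rows ?S (sqrt (2 * ?m))" by (rule P.L2_le_imp_L1_le[OF IH(1)])
 have S2: "L1_le rows (\<lambda>x. ?S x ^ 2) (2 * ?m)" by (rule L1_le_square[OF IH(1)])
 \<comment> \<open>Finiteness is what matters: the third moment is multiplied by the mean 0 of
   \<open>sq1\<close>.\<close>
 have S3: "L1_le rows (\<lambda>x. ?S x ^ 3) (2 * ?m + 60 * ?m ^ 2)"
 proof (rule L1_le_mono[OF L1_le_add[OF S2 IH(2)]])
  show "AE x in rows. \<bar>?S x ^ 3\<bar> \<le> \<bar>?S x ^ 2 + ?S x ^ 4\<bar>"
  proof (rule AE_I2)
   fix x
   define a where "a = \<bar>?S x\<bar>"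
   have "a ^ 3 \<le> a ^ 2 + a ^ 4"
   proof (cases "a \<le> 1")
    case True
    then have "a ^ 3 \<le> a ^ 2" by (intro power_decreasing) (auto simp: a_def)
    then show ?thesis by (simp add: a_def add_increasing2)
   next
    case False
    then have "a ^ 3 \<le> a ^ 4" by (intro power_increasing) auto
    then show ?thesis by (simp add: a_def add_increasing)
   qed
   then show "\<bar>?S x ^ 3\<bar> \<le> \<bar>?S x ^ 2 + ?S x ^ 4\<bar>" by (simp add: a_def power_abs abs_of_nonneg add_nonneg_nonneg)
  qed
 qed auto
 have pp: "past k (\<lambda>x. ?S x ^ p)" for p using past_csum[of k j] by (simp add: past_def)
 obtain c3 where c3: "L1_le std_normal_distribution (\<lambda>x. sq1 x ^ 3) c3" using std_normal_L1(4) by blast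
 note M31 = L1_le_past_mult[OF k S3 pp std_normal_L1(5)]
 note M22 = L1_le_past_mult[OF k S2 pp std_normal_L1(3)]
 note M13 = L1_le_past_mult[OF k S1 past_csum c3]
 note M11 = L1_le_past_mult[OF k S1 past_csum std_normal_L1(5)]
 note M04 = L1_le_row[OF k std_normal_L1(2)]
 note M02 = L1_le_row[OF k std_normal_L1(3)]
 note M01 = L1_le_row[OF k std_normal_L1(5)]
 have row_int: "(\<integral>x. \<xi> (x k) \<partial>rows) = (\<integral>y. \<xi> y \<partial>std_normal_distribution)"
  if "L1_le std_normal_distribution \<xi> c" for \<xi> c
  using L1_le_past_mult(2)[OF k P.L1_le_const[of 1] _ that] by (simp add: past_def P.prob_space)
 have Suc: "csum j (Suc k) x = ?S x + sq1 (x k)" for x using step.hyps by (simp add: csum_def)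
 have int1: "integrable rows (\<lambda>x. ?S x)" "integrable rows (\<lambda>x. sq1 (x k))" using L1_le_integrable[OF S1] L1_le_integrable[OF M01] .
 have mean: "(\<integral>x. csum j (Suc k) x \<partial>rows) = 0" unfolding Suc using int1 IH(3) row_int[OF std_normal_L1(5)] sq1_moments by simp
 have sqe: "(csum j (Suc k) x)^2 = ?S x ^ 2 + 2 * (?S x * sq1 (x k)) + sq1 (x k) ^ 2" for x
  unfolding Suc by (simp add: power2_eq_square algebra_simps)
 have L2: "L2_le rows (csum j (Suc k)) (2 * (real (Suc k) - real j))"
 proof (rule L2_leI_integral)
  show "csum j (Suc k) \<in> borel_measurable rows" unfolding Suc[abs_def] using L1_leD(1)[OF M01] by measurable
  show "integrable rows (\<lambda>x. (csum j (Suc k) x)^2)" unfolding sqe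
   using L1_le_integrable[OF S2] L1_le_integrable[OF M11(1)] L1_le_integrable[OF M02] by simp
  have "(\<integral>x. (csum j (Suc k) x)^2 \<partial>rows) = (\<integral>x. ?S x ^ 2 \<partial>rows) + 2"
   unfolding sqe using L1_le_integrable[OF S2] L1_le_integrable[OF M11(1)] L1_le_integrable[OF M02]
    M11(2) row_int[OF std_normal_L1(3)] sq1_moments by simp
  also have "... \<le> 2 * ?m + 2" using L1_le_integral[OF S2] by simp
  finally show "(\<integral>x. (csum j (Suc k) x)^2 \<partial>rows) \<le> 2 * (real (Suc k) - real j)" by simp
 qed
 have qe: "(csum j (Suc k) x) ^ 4 = ?S x ^ 4 + 4 * (?S x ^ 3 * sq1 (x k)) + 6 * (?S x ^ 2 * sq1 (x k) ^ 2) + 4 * (?S x * sq1 (x k) ^ 3) + sq1 (x k) ^ 4" for x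
  unfolding Suc by (simp add: eval_nat_numeral algebra_simps)
 have L4: "L1_le rows (\<lambda>x. csum j (Suc k) x ^ 4) (60 * (real (Suc k) - real j) ^ 2)"
 proof (rule L1_leI_integral)
  show "integrable rows (\<lambda>x. csum j (Suc k) x ^ 4)" unfolding qe
   using L1_le_integrable[OF IH(2)] L1_le_integrable[OF M31(1)] L1_le_integrable[OF M22(1)] L1_le_integrable[OF M13(1)] L1_le_integrable[OF M04] by simp
  have "(\<integral>x. \<bar>csum j (Suc k) x ^ 4\<bar> \<partial>rows) = (\<integral>x. csum j (Suc k) x ^ 4 \<partial>rows)" by simp
  also have "... = (\<integral>x. ?S x ^ 4 \<partial>rows) + 12 * (\<integral>x. ?S x ^ 2 \<partial>rows) + 60"
   unfolding qe using L1_le_integrable[OF IH(2)] L1_le_integrable[OF M31(1)] L1_le_integrable[OF M22(1)] L1_le_integrable[OF M13(1)] L1_le_integrable[OF M04]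
    M31(2) M22(2) M13(2) row_int[OF std_normal_L1(2)] sq1_moments IH(3) by simp
  also have "... \<le> 60 * ?m ^ 2 + 12 * (2 * ?m) + 60" using L1_le_integral[OF IH(2)] L1_le_integral[OF S2] by simp
  also have "... \<le> 60 * (real (Suc k) - real j) ^ 2" using m0 by (simp add: power2_eq_square algebra_simps)
  finally show "(\<integral>x. \<bar>csum j (Suc k) x ^ 4\<bar> \<partial>rows) \<le> 60 * (real (Suc k) - real j) ^ 2" .
 qed
 show ?case using L2 L4 mean by simp
qed

end

lemma (in prob_space) pair_L1:
 assumes "prob_space N" and f: "L1_le M f a" and g: "L1_le N g b"
 shows "L1_le (M \<Otimes>\<^sub>M N) (\<lambda>y. f (fst y) * g (snd y)) (a * b)"
proof -
 interpret N: prob_space N by fact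
 have [measurable]: "f \<in> borel_measurable M" "g \<in> borel_measurable N" using f g by (auto simp: L1_le_def)
 have "(\<integral>\<^sup>+y. ennreal \<bar>f (fst y) * g (snd y)\<bar> \<partial>(M \<Otimes>\<^sub>M N)) = (\<integral>\<^sup>+x. \<integral>\<^sup>+y. ennreal \<bar>f x\<bar> * ennreal \<bar>g y\<bar> \<partial>N \<partial>M)"
  by (subst N.nn_integral_fst[symmetric]) (auto simp: abs_mult ennreal_mult)
 also have "... = (\<integral>\<^sup>+x. ennreal \<bar>f x\<bar> \<partial>M) * (\<integral>\<^sup>+y. ennreal \<bar>g y\<bar> \<partial>N)" by (simp add: nn_integral_cmult nn_integral_multc)
 also have "... \<le> ennreal a * ennreal b" using f g by (intro mult_mono) (auto simp: L1_le_def)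
 finally show ?thesis using f g by (simp add: L1_le_def ennreal_mult)
qed

text \<open>Truncation at 1/2 costs nothing to first order: it acts only for d < -1/2, where the
  left sides are bounded and |d| and d^2 are bounded below.\<close>

lemma max_half_bounds:
 fixes d :: real
 assumes "-1 \<le> d"
 shows "\<bar>1 / max (1 + d) (1 / 2) - 1\<bar> \<le> 2 * \<bar>d\<bar>" "\<bar>1 / max (1 + d) (1 / 2) - 1 + d\<bar> \<le> 2 * d^2"
  "\<bar>ln (max (1 + d) (1 / 2)) - d\<bar> \<le> 2 * d^2"
proof -
 have A: "\<bar>1 / max (1 + d) (1 / 2) - 1\<bar> \<le> 2 * \<bar>d\<bar> \<and> \<bar>1 / max (1 + d) (1 / 2) - 1 + d\<bar> \<le> 2 * d^2
   \<and> \<bar>ln (max (1 + d) (1 / 2)) - d\<bar> \<le> 2 * d^2"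
 proof (cases "d \<ge> -1/2")
  case True
  then have p: "1 + d > 0" "1 + d \<ge> 1 / 2" by auto
  have "\<bar>1 / (1 + d) - 1\<bar> = \<bar>d\<bar> / (1 + d)" using p by (simp add: divide_simps abs_if)
  also have "... \<le> \<bar>d\<bar> / (1 / 2)" using p by (intro divide_left_mono) auto
  finally have 1: "\<bar>1 / (1 + d) - 1\<bar> \<le> 2 * \<bar>d\<bar>" by simp
  have "1 / (1 + d) - 1 + d = d^2 / (1 + d)" using p by (simp add: field_simps power2_eq_square)
  then have "\<bar>1 / (1 + d) - 1 + d\<bar> = d^2 / (1 + d)" using p by simp
  also have "... \<le> d^2 / (1 / 2)" using p by (intro divide_left_mono) auto
  finally have 2: "\<bar>1 / (1 + d) - 1 + d\<bar> \<le> 2 * d^2" by simp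
  have 3: "\<bar>ln (1 + d) - d\<bar> \<le> 2 * d^2"
  proof (cases "\<bar>d\<bar> \<le> 1 / 2")
   case True
   then show ?thesis by (rule abs_ln_one_plus_x_minus_x_bound)
  next
   case False
   then have d: "d > 1 / 2" using \<open>d \<ge> -1/2\<close> by auto
   have "0 \<le> ln (1 + d)" "ln (1 + d) \<le> d" using d by (auto intro: ln_add_one_self_le_self)
   then have "\<bar>ln (1 + d) - d\<bar> \<le> d" by auto
   also have "... \<le> 2 * d^2" using d by (simp add: power2_eq_square)
   finally show ?thesis .
  qed
  have "max (1 + d) (1 / 2) = 1 + d" using p by simp
  then show ?thesis using 1 2 3 by simp
 next
  case False
  then have d: "-1 \<le> d" "d < -1/2" using assms by auto
  then have "(1/2)^2 \<le> (-d)^2" by (intro power_mono) auto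
  then have d2: "1 / 2 \<le> 2 * d^2" by (simp add: power2_eq_square)
  have l: "-1 \<le> ln (1 / 2 :: real)" "ln (1 / 2 :: real) \<le> -1/2" using ln_2_less_1 ln2_ge_two_thirds by (auto simp: ln_div)
  have "\<bar>ln (1 / 2) - d\<bar> \<le> 1 / 2" using l d by linarith
  then show ?thesis using d d2 by (auto simp: max_def)
 qed
 then show "\<bar>1 / max (1 + d) (1 / 2) - 1\<bar> \<le> 2 * \<bar>d\<bar>" "\<bar>1 / max (1 + d) (1 / 2) - 1 + d\<bar> \<le> 2 * d^2"
  "\<bar>ln (max (1 + d) (1 / 2)) - d\<bar> \<le> 2 * d^2" by blast+
qed

lemma L1_le_abs: "L1_le M f c ==> L1_le M (\<lambda>x. \<bar>f x\<bar>) c" unfolding L1_le_def by (auto intro: borel_measurable_abs)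

lemma L1_leI:
 assumes "f \<in> borel_measurable M" "L1_le M g c" "\<And>x. \<bar>f x\<bar> \<le> g x" "c \<le> c'"
 shows "L1_le M f c'" using assms(3) by (intro L1_le_mono[OF assms(2,1) _ assms(4)] AE_I2) (meson abs_ge_self order_trans)

lemma L2_leI:
 assumes "f \<in> borel_measurable M" "L1_le M g c" "\<And>x. (f x)^2 \<le> g x" "c \<le> c'"
 shows "L2_le M f c'"
proof -
 have "(\<lambda>x. (f x)^2) \<in> borel_measurable M" using assms(1) by measurable
 from L1_leI[OF this assms(2) _ assms(4)] assms(3) show ?thesis by (simp add: L2_le_iff_L1[OF assms(1)])
qed

lemma square_sum_le:
 fixes a b c :: real
 shows "(a + b)^2 \<le> 2 * a^2 + 2 * b^2" "(a + b + c)^2 \<le> 3 * a^2 + 3 * b^2 + 3 * c^2"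
  "2 * a * b \<le> a^2 + b^2"
proof -
 show "(a + b)^2 \<le> 2 * a^2 + 2 * b^2" "2 * a * b \<le> a^2 + b^2"
  using zero_le_power2[of "a - b"] by (simp_all add: power2_eq_square algebra_simps)
 show "(a + b + c)^2 \<le> 3 * a^2 + 3 * b^2 + 3 * c^2"
  using zero_le_power2[of "a - b"] zero_le_power2[of "a - c"] zero_le_power2[of "b - c"]
  by (simp add: power2_eq_square algebra_simps)
qed

lemma inverse_max_half: "0 \<le> 1 / max x (1 / 2)" "1 / max x (1 / 2) \<le> (2 :: real)"
proof -
 show "0 \<le> 1 / max x (1 / 2)" by (simp add: le_max_iff_disj)
 have "1 / max x (1 / 2) \<le> 1 / (1 / 2)" by (rule divide_left_mono) (auto simp: less_max_iff_disj)
 then show "1 / max x (1 / 2) \<le> 2" by simp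
qed

lemma abs_sqrt_diff_le: "0 \<le> x ==> \<bar>sqrt x - 1\<bar> \<le> \<bar>x - 1\<bar>"
proof -
 assume x: "0 \<le> x"
 have "\<bar>sqrt x - 1\<bar> * 1 \<le> \<bar>sqrt x - 1\<bar> * (sqrt x + 1)" using x by (intro mult_left_mono) auto
 also have "... = \<bar>(sqrt x - 1) * (sqrt x + 1)\<bar>" using x by (simp add: abs_mult)
 finally show ?thesis using x by (simp add: algebra_simps)
qed

context gaussian_vector
begin

text \<open>Reflecting a coordinate is an instance of the rotation invariance of the Gaussian law.\<close>

lemma reflect_coordinate:
 assumes i: "i < n"
 obtains f where "f \<in> rows \<rightarrow>\<^sub>M rows" "distr rows rows f = rows"
  "\<And>x k. k < n ==> f x k = (if k = i then - x k else x k)"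
proof
 let ?b = "\<lambda>k l. if l = k then (if k = i then - 1 else 1 :: real) else 0"
 interpret R: radial_law "gaussian_law n" n "\<lambda>t. ennreal ((2 * pi) powr (- real n / 2) * exp (- t\<^sup>2 / 2))"
  by (rule radial_gaussian_law)
 interpret I: rotation_invariant_law "gaussian_law n" n by (rule R.rotation_invariant)
 have ons: "orthonormal_system n n ?b" unfolding orthonormal_system_def by (auto simp: if_distrib[of "\<lambda>x. x * _"] cong: if_cong)
 have sets: "sets rows = sets (lebesgue_Rn n)" by (simp add: rows_eq)
 show "rot n ?b \<in> rows \<rightarrow>\<^sub>M rows" using measurable_rot[of n ?b] measurable_cong_sets[OF sets sets] by simp
 have "distr rows rows (rot n ?b) = distr rows (lebesgue_Rn n) (rot n ?b)" by (rule distr_cong) (simp_all add: sets)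
 then show "distr rows rows (rot n ?b) = rows" using I.rot_invariant[OF ons] by (simp add: rows_eq)
 fix x k assume "k < n"
 then show "rot n ?b x k = (if k = i then - x k else x k)" by (simp add: rot_def ip_def if_distrib[of "\<lambda>x. x * _"] cong: if_cong)
qed

end

text \<open>A row is a Gaussian vector together with an independent second component.
  \<open>\<gamma>\<close> is 0 in the Gaussian model and 1 if the vector is normalised to its
  direction; \<open>t\<close> is then the defect 1 - |x|^2 of the length, with second moment of
  order 1 / n^2.\<close>

locale gaussian_rows =
 fixes n r :: nat and D K \<gamma> :: real and M2 :: "'a measure" and t :: "'a => real"
 assumes r1: "1 \<le> r" and rn: "r < n" and D1: "1 \<le> D" and nD: "real n \<le> D * (real n - real r)"
  and K0: "0 \<le> K" and \<gamma>: "\<gamma> = 0 \<or> \<gamma> = 1" and M2: "prob_space M2"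
  and t: "L2_le M2 t (K / real n ^ 2)" and t01: "\<And>y. 0 \<le> t y" "\<And>y. t y \<le> 1"
begin

sublocale G: gaussian_vector n .
sublocale M2: prob_space M2 by (rule M2)
abbreviation Q where "Q \<equiv> G.rows \<Otimes>\<^sub>M M2"
sublocale GM: pair_prob_space G.rows M2 by unfold_locales

text \<open>For row 0 the chain is still at 0; the value 0 keeps the mean of \<open>S\<close> at 0
  there.\<close>

definition S :: "nat => (nat => real) \<times> 'a => real" where "S j p = (if j = 0 then 0 else fst p (j - 1))"
definition im :: "nat => real" where "im j = 1 / (real n - real j)"
text \<open>\<open>1 + d j p\<close> is the mean square of the coordinates from j on.\<close>

definition d :: "nat => (nat => real) \<times> 'a => real" where "d j p = im j * G.csum j n (fst p)"
definition e :: "(nat => real) \<times> 'a => real" where "e p = \<gamma> * d 0 p"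
definition h :: "nat => (nat => real) \<times> 'a => real" where "h j p = 1 / max (1 + d j p) (1 / 2)"
definition rho :: "(nat => real) \<times> 'a => real" where "rho p = 1 / max (1 - t (snd p)) (1 / 2)"
text \<open>When no truncation is active this is the inverse squared ratio between the model point
  and the Gaussian vector, up to a constant; see \<open>good_row_facts\<close>.\<close>

definition \<pi> :: "(nat => real) \<times> 'a => real" where "\<pi> p = (1 + e p) * rho p"
text \<open>Cut off beyond r, where n - j may be 0 or negative, because \<open>row_chain\<close>
  asks for nonnegativity at all indices.\<close>

definition \<iota> :: "nat => (nat => real) \<times> 'a => real" where
 "\<iota> j p = (if j \<le> r then h j p * im j else 0)"
definition \<alpha> :: "nat => (nat => real) \<times> 'a => real" where "\<alpha> j p = \<pi> p * \<iota> j p"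
definition \<beta> :: "nat => (nat => real) \<times> 'a => real" where "\<beta> j p = sqrt (\<pi> p) * \<iota> j p"
definition u :: "nat => (nat => real) \<times> 'a => real" where
 "u j p = (if j = 0 then 0 else ((S j p)^2 - 1) * \<iota> j p)"
definition lin :: "nat => (nat => real) \<times> 'a => real" where "lin j p = d j p - e p"
text \<open>What \<open>lin\<close> leaves of the logarithm of a factor of p: the second-order
  remainders of two logarithms and the whole contribution of the length defect.\<close>

definition \<zeta> :: "nat => (nat => real) \<times> 'a => real" where
 "\<zeta> j p = ln (max (1 + d j p) (1 / 2)) - d j p - (ln (max (1 + e p) (1 / 2)) - e p)
  + ln (max (1 - t (snd p)) (1 / 2))"
text \<open>One constant, with room to spare, for all moment bounds required by
  \<open>row_chain\<close>; each of them has the form covered by \<open>Cc_ge\<close>.\<close>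

definition Cc :: real where "Cc = 4000 * D ^ 4 * (K + 1)"

section \<open>Moment bounds for the coefficients of a row\<close>

lemma n0: "real n > 0" and n1: "1 \<le> real n" using rn by simp_all

lemma im_pos: "j \<le> r ==> 0 < im j" using rn by (simp add: im_def)

lemma im_le: "j \<le> r ==> im j \<le> D / real n"
proof -
 assume j: "j \<le> r"
 have "D * (real n - real r) \<le> D * (real n - real j)" using j D1 by (intro mult_left_mono) auto
 with nD have "real n \<le> D * (real n - real j)" by simp
 then show ?thesis using j rn by (simp add: im_def divide_simps mult.commute)
qed

lemma im_sq_le: "j \<le> r ==> (im j)^2 \<le> D^2 / real n ^ 2" using im_le[of j] im_pos[of j] by (metis less_imp_le power_divide power_mono)

lemma Cc_ge:
 assumes "i \<le> 4" "0 \<le> a" "a \<le> 4000"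
 shows "a * D ^ i * (K + 1) \<le> Cc" "a * D ^ i \<le> Cc"
proof -
 have p: "a * D ^ i \<le> 4000 * D ^ 4" using assms D1 by (intro mult_mono power_increasing) auto
 then show "a * D ^ i * (K + 1) \<le> Cc" unfolding Cc_def using K0 by (intro mult_right_mono) auto
 have "4000 * D ^ 4 * 1 \<le> 4000 * D ^ 4 * (K + 1)" using D1 K0 by (intro mult_left_mono) auto
 with p show "a * D ^ i \<le> Cc" unfolding Cc_def by linarith
qed

lemma Cc1: "1 \<le> Cc" using Cc_ge(2)[of 0 1] by simp

lemma L1_fst: "L1_le G.rows f c ==> L1_le Q (\<lambda>p. f (fst p)) c" using G.P.pair_L1[OF M2 _ M2.L1_le_const[of 1], of f c] by simp

lemma L2_fst: "L2_le G.rows f c ==> L2_le Q (\<lambda>p. f (fst p)) c"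
 using L1_fst[OF L1_le_square] measurable_compose[OF measurable_fst L2_leD(1)] L2_le_iff_L1 by blast

lemma L2_snd: "L2_le M2 f c ==> L2_le Q (\<lambda>p. f (snd p)) c"
proof -
 assume f: "L2_le M2 f c"
 have "L1_le Q (\<lambda>p. (f (snd p))^2) c" using G.P.pair_L1[OF M2 G.P.L1_le_const[of 1] L1_le_square[OF f]] by simp
 moreover have "(\<lambda>p. f (snd p)) \<in> borel_measurable Q" using L2_leD(1)[OF f] by measurable
 ultimately show ?thesis by (simp add: L2_le_iff_L1)
qed

lemma integral_fst_Q: "L1_le G.rows f c ==> (\<integral>p. f (fst p) \<partial>Q) = (\<integral>x. f x \<partial>G.rows)"
 using GM.integral_fst'[OF L1_le_integrable[OF L1_fst], of f c] by (simp add: M2.prob_space)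

lemma S_mom:
 assumes j: "j \<le> r"
 shows "L2_le Q (S j) 1" "L2_le Q (\<lambda>p. (S j p)^2) 3" "(\<integral>p. S j p \<partial>Q) = 0"
proof -
 have "L2_le Q (S j) 1 \<and> L2_le Q (\<lambda>p. (S j p)^2) 3 \<and> (\<integral>p. S j p \<partial>Q) = 0"
 proof (cases "j = 0")
  case True
  then show ?thesis by (auto simp: S_def[abs_def] intro: L2_le_weaken[OF L2_le_0])
 next
  case False
  then have k: "j - 1 < n" using j rn by simp
  have S: "S j = (\<lambda>p. fst p (j - 1))" using False by (simp add: S_def fun_eq_iff)
  have "(\<integral>x. x (j - 1) \<partial>G.rows) = 0"
   using G.L1_le_past_mult(2)[OF k G.P.L1_le_const[of 1] _ std_normal.L2_le_imp_L1_le[OF std_normal_L1(6)]]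
   by (simp add: past_def std_normal_moments)
  then show ?thesis unfolding S using L2_fst[OF G.L2_le_row[OF k std_normal_L1(6)]] L2_fst[OF G.L2_le_row[OF k std_normal_L1(7)]]
    integral_fst_Q[OF G.P.L2_le_imp_L1_le[OF G.L2_le_row[OF k std_normal_L1(6)]]] by simp
 qed
 then show "L2_le Q (S j) 1" "L2_le Q (\<lambda>p. (S j p)^2) 3" "(\<integral>p. S j p \<partial>Q) = 0" by auto
qed

lemma d_mom:
 assumes j: "j \<le> r"
 shows "L2_le Q (d j) (2 * D / real n)" "L2_le Q (\<lambda>p. (d j p)^2) (60 * D^2 / real n ^ 2)" "(\<integral>p. d j p \<partial>Q) = 0"
proof -
 note m = G.csum_moments[of j n]
 have m1: "L2_le G.rows (G.csum j n) (2 * (real n - real j))" and m2: "L1_le G.rows (\<lambda>x. G.csum j n x ^ 4) (60 * (real n - real j)^2)"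
  and m3: "(\<integral>x. G.csum j n x \<partial>G.rows) = 0" using m j rn by auto
 have m0: "real n - real j > 0" using j rn by simp
 have "(im j)^2 * (2 * (real n - real j)) = 2 * im j" using m0 by (simp add: im_def power2_eq_square divide_simps)
 also have "... \<le> 2 * D / real n" using im_le[OF j] by simp
 finally show d2: "L2_le Q (d j) (2 * D / real n)" unfolding d_def[abs_def] by (rule L2_le_weaken[OF L2_le_cmult[OF L2_fst[OF m1]]])
 have "L1_le Q (\<lambda>p. im j ^ 4 * G.csum j n (fst p) ^ 4) (\<bar>im j ^ 4\<bar> * (60 * (real n - real j)^2))"
  by (rule L1_le_cmult[OF L1_fst[OF m2]])
 moreover have "\<bar>im j ^ 4\<bar> * (60 * (real n - real j)^2) = 60 * (im j)^2"
 proof -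
  have "\<bar>(1 / m) ^ 4\<bar> * (60 * m^2) = 60 * (1 / m)^2" if "m > 0" for m :: real using that by (simp add: field_simps eval_nat_numeral)
  then show ?thesis unfolding im_def using m0 by blast
 qed
 moreover have "60 * (im j)^2 \<le> 60 * D^2 / real n ^ 2" using im_sq_le[OF j] by simp
 ultimately have "L1_le Q (\<lambda>p. im j ^ 4 * G.csum j n (fst p) ^ 4) (60 * D^2 / real n ^ 2)" by (auto elim: L1_le_weaken)
 then have "L1_le Q (\<lambda>p. ((d j p)^2)^2) (60 * D^2 / real n ^ 2)" by (simp add: d_def power_mult_distrib flip: power_mult)
 moreover have "(\<lambda>p. (d j p)^2) \<in> borel_measurable Q" using L2_leD(1)[OF d2] by measurable
 ultimately show "L2_le Q (\<lambda>p. (d j p)^2) (60 * D^2 / real n ^ 2)" by (simp add: L2_le_iff_L1)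
 show "(\<integral>p. d j p \<partial>Q) = 0" unfolding d_def using integral_fst_Q[OF G.P.L2_le_imp_L1_le[OF m1]] m3 by simp
qed

lemma abs_e_le: "\<bar>e p\<bar> \<le> \<bar>d 0 p\<bar>" using \<gamma> by (auto simp: e_def)

lemma e_mom: "L2_le Q e (2 * D / real n)" "L2_le Q (\<lambda>p. (e p)^2) (60 * D^2 / real n ^ 2)" "(\<integral>p. e p \<partial>Q) = 0"
proof -
 have m [measurable]: "e \<in> borel_measurable Q" unfolding e_def[abs_def] using L2_leD(1)[OF d_mom(1)[of 0]] by simp
 show "L2_le Q e (2 * D / real n)" by (rule L2_le_mono[OF d_mom(1)[of 0] m]) (auto simp: abs_e_le)
 show "L2_le Q (\<lambda>p. (e p)^2) (60 * D^2 / real n ^ 2)"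
  by (rule L2_le_mono[OF d_mom(2)[of 0]]) (auto simp: abs_le_square_iff[symmetric] abs_e_le)
 show "(\<integral>p. e p \<partial>Q) = 0" using d_mom(3)[of 0] by (simp add: e_def)
qed

lemma t_mom: "L2_le Q (\<lambda>p. t (snd p)) (K / real n ^ 2)" "L2_le Q (\<lambda>p. (t (snd p))^2) (K / real n ^ 2)"
 "L1_le Q (\<lambda>p. t (snd p)) ((K + 1) / real n)"
proof -
 show 1: "L2_le Q (\<lambda>p. t (snd p)) (K / real n ^ 2)" by (rule L2_snd[OF t])
 have [measurable]: "(\<lambda>p. t (snd p)) \<in> borel_measurable Q" by (rule L2_leD(1)[OF 1])
 have "(t y)^2 \<le> t y" for y using t01[of y] by (simp add: power2_eq_square mult_left_le)
 then show "L2_le Q (\<lambda>p. (t (snd p))^2) (K / real n ^ 2)" using t01 by (intro L2_le_mono[OF 1]) auto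
 have "K \<le> (K + 1)^2" using K0 by (simp add: power2_eq_square algebra_simps)
 then have "sqrt K \<le> K + 1" using K0 by (intro real_le_lsqrt) auto
 then have "sqrt (K / real n ^ 2) \<le> (K + 1) / real n" using n0 by (simp add: real_sqrt_divide divide_right_mono)
 then show "L1_le Q (\<lambda>p. t (snd p)) ((K + 1) / real n)" by (rule L1_le_weaken[OF GM.P.L2_le_imp_L1_le[OF 1]])
qed

lemma csum_ge: "j \<le> n ==> - (real n - real j) \<le> G.csum j n x"
proof -
 assume j: "j \<le> n"
 have "(\<Sum>i\<in>{j..<n}. - 1) \<le> G.csum j n x" unfolding G.csum_def sq1_def by (intro sum_mono) auto
 then show ?thesis using j by simp
qed

lemma d_ge: "j \<le> r ==> - 1 \<le> d j p"
proof -
 assume j: "j \<le> r"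
 have "im j * - (real n - real j) \<le> d j p"
  unfolding d_def using csum_ge[of j "fst p"] im_pos[OF j] j rn by (intro mult_left_mono) auto
 moreover have "im j * (real n - real j) = 1" using j rn by (simp add: im_def)
 ultimately show ?thesis unfolding mult_minus_right by simp
qed

lemma e_ge: "- 1 \<le> e p" using \<gamma> d_ge[of 0 p] by (auto simp: e_def)

lemma h_bounds:
 assumes "j \<le> r"
 shows "0 \<le> h j p" "h j p \<le> 2" "\<bar>h j p - 1\<bar> \<le> 2 * \<bar>d j p\<bar>" "\<bar>h j p - 1 + d j p\<bar> \<le> 2 * (d j p)^2"
 using max_half_bounds[OF d_ge[OF assms, of p]] inverse_max_half unfolding h_def by blast+

lemma rho_bounds: "0 \<le> rho p" "rho p \<le> 2" "\<bar>rho p - 1\<bar> \<le> 2 * t (snd p)"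
 "\<bar>ln (max (1 - t (snd p)) (1 / 2))\<bar> \<le> 3 * t (snd p)"
proof -
 note b = max_half_bounds[of "- t (snd p)"]
 show "0 \<le> rho p" "rho p \<le> 2" "\<bar>rho p - 1\<bar> \<le> 2 * t (snd p)"
  using b(1) t01[of "snd p"] inverse_max_half[of "1 - t (snd p)"] unfolding rho_def by simp_all
 have "(t (snd p))^2 \<le> t (snd p)" using t01[of "snd p"] by (simp add: power2_eq_square mult_left_le)
 then show "\<bar>ln (max (1 - t (snd p)) (1 / 2))\<bar> \<le> 3 * t (snd p)" using b(3) t01[of "snd p"] by simp
qed

lemma \<pi>_nonneg: "0 \<le> \<pi> p" using e_ge[of p] rho_bounds(1)[of p] by (simp add: \<pi>_def)

lemma \<pi>_le: "\<pi> p \<le> 2 * (1 + e p)" using mult_left_mono[OF rho_bounds(2)[of p], of "1 + e p"] e_ge[of p] by (simp add: \<pi>_def)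

lemma \<iota>_nonneg: "0 \<le> \<iota> j p" using mult_nonneg_nonneg[OF h_bounds(1)[of j p] less_imp_le[OF im_pos[of j]]] by (simp add: \<iota>_def)

lemma \<iota>_le: "\<iota> j p \<le> 2 * (D / real n)"
proof (cases "j \<le> r")
 case True
 then have "h j p * im j \<le> 2 * (D / real n)" using h_bounds(1,2)[OF True, of p] im_le[of j] im_pos[of j] by (intro mult_mono) auto
 with True show ?thesis by (simp add: \<iota>_def)
next
 case False
 then show ?thesis using D1 n0 by (simp add: \<iota>_def)
qed

lemma \<iota>_sq_le: "(\<iota> j p)^2 \<le> 4 * (D^2 / real n ^ 2)"
 using power_mono[OF \<iota>_le[of j p] \<iota>_nonneg, of 2] by (simp add: power_mult_distrib power_divide)

lemma meas:
 assumes "j \<le> r"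
 shows "S j \<in> borel_measurable Q" "d j \<in> borel_measurable Q" "e \<in> borel_measurable Q"
  "(\<lambda>p. t (snd p)) \<in> borel_measurable Q"
 using assms L2_leD(1)[OF S_mom(1)] L2_leD(1)[OF d_mom(1)] L2_leD(1)[OF e_mom(1)] L2_leD(1)[OF t_mom(1)] by blast+

lemma meas2:
 assumes j: "j \<le> r"
 shows "\<iota> j \<in> borel_measurable Q" "\<alpha> j \<in> borel_measurable Q" "\<beta> j \<in> borel_measurable Q" "u j \<in> borel_measurable Q"
  "lin j \<in> borel_measurable Q" "\<zeta> j \<in> borel_measurable Q"
proof -
 note [measurable] = meas[OF j]
 have [measurable]: "rho \<in> borel_measurable Q" "h j \<in> borel_measurable Q" unfolding rho_def[abs_def] h_def[abs_def] by measurable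
 show [measurable]: "\<iota> j \<in> borel_measurable Q" using j unfolding \<iota>_def[abs_def] by measurable
 have [measurable]: "\<pi> \<in> borel_measurable Q" unfolding \<pi>_def[abs_def] by measurable
 show "\<alpha> j \<in> borel_measurable Q" "\<beta> j \<in> borel_measurable Q"
  "lin j \<in> borel_measurable Q" "\<zeta> j \<in> borel_measurable Q"
  unfolding \<alpha>_def[abs_def] \<beta>_def[abs_def] lin_def[abs_def] \<zeta>_def[abs_def] by measurable
 show "u j \<in> borel_measurable Q" by (cases "j = 0") (simp_all add: u_def[abs_def])
qed

abbreviation i2 where "i2 \<equiv> D^2 / real n ^ 2"

lemma i2_nonneg: "0 \<le> i2" by simp

lemma \<alpha>_L2: "j \<le> r ==> L2_le Q (\<alpha> j) (Cc / real n ^ 2)"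
proof -
 assume j: "j \<le> r"
 note B = L1_le_add[OF GM.P.L1_le_const[of "32 * i2"] L1_le_cmult[OF L1_le_square[OF e_mom(1)], of "32 * i2"]]
 show ?thesis
 proof (rule L2_leI[OF meas2(2)[OF j] B])
  fix p
  have "(\<pi> p)^2 \<le> (2 * (1 + e p))^2" using \<pi>_nonneg[of p] \<pi>_le[of p] by (intro power_mono) auto
  then have "(\<alpha> j p)^2 \<le> (2 * (1 + e p))^2 * (4 * i2)" unfolding \<alpha>_def power_mult_distrib[of "\<pi> p"] by (intro mult_mono \<iota>_sq_le) auto
  also have "... = 16 * i2 * (1 + e p)^2" by (simp only: power_mult_distrib) simp
  also have "... \<le> 16 * i2 * (2 * 1^2 + 2 * (e p)^2)" by (intro mult_left_mono square_sum_le) auto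
  also have "... = 32 * i2 + 32 * i2 * (e p)^2"
  proof -
   have "16 * z * (2 * 1^2 + 2 * y) = 32 * z + 32 * z * y" for y z :: real by (simp add: algebra_simps)
   then show ?thesis by blast
  qed
  finally show "(\<alpha> j p)^2 \<le> 32 * i2 + 32 * i2 * (e p)^2" .
 next
  have "2 * D / real n \<le> 2 * D" using n1 D1 by (simp add: divide_simps)
  then have "\<bar>32 * i2\<bar> + \<bar>32 * i2\<bar> * (2 * D / real n) \<le> 32 * i2 + 32 * i2 * (2 * D)" using D1 by (intro add_mono mult_mono) auto
  also have "... \<le> 32 * i2 * D + 32 * i2 * (2 * D)" using mult_left_mono[OF D1, of "32 * i2"] by (intro add_mono) auto
  also have "... = 96 * D ^ 3 / real n ^ 2" by (simp add: power2_eq_square power3_eq_cube)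
  also have "... \<le> Cc / real n ^ 2" by (intro divide_right_mono Cc_ge) auto
  finally show "\<bar>32 * i2\<bar> + \<bar>32 * i2\<bar> * (2 * D / real n) \<le> Cc / real n ^ 2" .
 qed
qed

lemma S\<beta>_L2: "j \<le> r ==> L2_le Q (\<lambda>p. S j p * \<beta> j p) (Cc / real n ^ 2)"
proof -
 assume j: "j \<le> r"
 note [measurable] = meas[OF j] meas2[OF j]
 note B = L1_le_cmult[OF L1_le_add[OF L1_le_add[OF L1_le_cmult[OF L1_le_square[OF S_mom(1)[OF j]], of 8]
  L1_le_cmult[OF L1_le_square[OF S_mom(2)[OF j]], of 4]] L1_le_cmult[OF L1_le_square[OF e_mom(1)], of 4]], of i2]
 show ?thesis
 proof (rule L2_leI[OF _ B])
  fix p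
  have "(S j p * \<beta> j p)^2 = (S j p)^2 * (\<pi> p * (\<iota> j p)^2)" using \<pi>_nonneg[of p] by (simp add: \<beta>_def power_mult_distrib)
  also have "... \<le> (S j p)^2 * ((2 * (1 + e p)) * (4 * i2))"
   using \<pi>_nonneg[of p] \<pi>_le[of p] \<iota>_sq_le[of j p] by (intro mult_left_mono mult_mono) auto
  also have "... = i2 * (8 * (S j p)^2 + 4 * (2 * (S j p)^2 * e p))"
  proof -
   have "x * ((2 * (1 + y)) * (4 * z)) = z * (8 * x + 4 * (2 * x * y))" for x y z :: real by (simp add: algebra_simps)
   then show ?thesis by blast
  qed
  also have "... \<le> i2 * (8 * (S j p)^2 + 4 * (((S j p)^2)^2 + (e p)^2))" by (intro mult_left_mono add_mono square_sum_le) auto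
  finally show "(S j p * \<beta> j p)^2 \<le> i2 * (8 * (S j p)^2 + 4 * ((S j p)^2)^2 + 4 * (e p)^2)" by (simp only: distrib_left[of 4] add.assoc)
 next
  have "2 * D / real n \<le> 2 * D" using n1 D1 by (simp add: divide_simps)
  then have "\<bar>i2\<bar> * (\<bar>8\<bar> * 1 + \<bar>4\<bar> * 3 + \<bar>4\<bar> * (2 * D / real n)) \<le> i2 * (28 * D)" using D1 by (intro mult_mono) auto
  also have "... = 28 * D ^ 3 / real n ^ 2" by (simp add: power2_eq_square power3_eq_cube)
  also have "... \<le> Cc / real n ^ 2" by (intro divide_right_mono Cc_ge) auto
  finally show "\<bar>i2\<bar> * (\<bar>8\<bar> * 1 + \<bar>4\<bar> * 3 + \<bar>4\<bar> * (2 * D / real n)) \<le> Cc / real n ^ 2" .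
 qed measurable
qed

lemma S\<iota>_L2: "j \<le> r ==> L2_le Q (\<lambda>p. (S j p)^2 * \<iota> j p) (Cc / real n ^ 2)"
proof -
 assume j: "j \<le> r"
 note [measurable] = meas[OF j] meas2[OF j]
 show ?thesis
 proof (rule L2_leI[OF _ L1_le_cmult[OF L1_le_square[OF S_mom(2)[OF j]], of "4 * i2"]])
  fix p
  have "((S j p)^2)^2 * (\<iota> j p)^2 \<le> ((S j p)^2)^2 * (4 * i2)" by (intro mult_left_mono \<iota>_sq_le) auto
  then show "((S j p)^2 * \<iota> j p)^2 \<le> 4 * i2 * ((S j p)^2)^2" by (simp add: power_mult_distrib mult_ac)
  have "12 * D ^ 2 / real n ^ 2 \<le> Cc / real n ^ 2" by (intro divide_right_mono Cc_ge) auto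
  then show "\<bar>4 * i2\<bar> * 3 \<le> Cc / real n ^ 2" by simp
 qed measurable
qed

lemma u_L2: "j \<le> r ==> L2_le Q (u j) (Cc / real n ^ 2)"
proof -
 assume j: "j \<le> r"
 show ?thesis
 proof (rule L2_leI[OF meas2(4)[OF j] L1_le_cmult[OF L1_le_add[OF L1_le_square[OF S_mom(2)[OF j]] GM.P.L1_le_const[of 1]], of "4 * i2"]])
  fix p
  have "((S j p)^2 - 1)^2 \<le> ((S j p)^2)^2 + 1" by (simp add: power2_diff)
  then have "((S j p)^2 - 1)^2 * (\<iota> j p)^2 \<le> (((S j p)^2)^2 + 1) * (4 * i2)" by (intro mult_mono \<iota>_sq_le) auto
  moreover have "(u j p)^2 \<le> ((S j p)^2 - 1)^2 * (\<iota> j p)^2" by (simp add: u_def power_mult_distrib)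
  ultimately show "(u j p)^2 \<le> 4 * i2 * (((S j p)^2)^2 + 1)" by (simp add: mult_ac)
  have "16 * D ^ 2 / real n ^ 2 \<le> Cc / real n ^ 2" by (intro divide_right_mono Cc_ge) auto
  then show "\<bar>4 * i2\<bar> * (3 + \<bar>1\<bar>) \<le> Cc / real n ^ 2" by simp
 qed
qed

lemma sqrt_2D: "sqrt (2 * D / real n) \<le> 2 * D / sqrt n"
proof -
 have "2 * D * 1 \<le> 2 * D * (2 * D)" using D1 by (intro mult_left_mono) auto
 then have "sqrt (2 * D) \<le> 2 * D" using D1 by (intro real_le_lsqrt) (auto simp: power2_eq_square)
 then show ?thesis using n0 by (simp add: real_sqrt_divide divide_right_mono)
qed

lemma d_L1: "j \<le> r ==> L1_le Q (d j) (2 * D / sqrt n)" and e_L1: "L1_le Q e (2 * D / sqrt n)"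
 using L1_le_weaken[OF GM.P.L2_le_imp_L1_le sqrt_2D] d_mom(1) e_mom(1) by blast+

lemma \<iota>_L1: "j \<le> r ==> L1_le Q (\<lambda>p. \<iota> j p - 1 / (real n - real j)) (Cc / (real n * sqrt n))"
proof -
 assume j: "j \<le> r"
 note [measurable] = meas2[OF j]
 show ?thesis
 proof (rule L1_leI[OF _ L1_le_cmult[OF L1_le_abs[OF d_L1[OF j]], of "2 * (D / real n)"]])
  fix p
  have "\<iota> j p - 1 / (real n - real j) = (h j p - 1) * im j" using j by (simp add: \<iota>_def left_diff_distrib flip: im_def)
  then have "\<bar>\<iota> j p - 1 / (real n - real j)\<bar> = \<bar>h j p - 1\<bar> * im j" using im_pos[OF j] by (simp add: abs_mult)
  also have "... \<le> (2 * \<bar>d j p\<bar>) * (D / real n)" using h_bounds(3)[OF j, of p] im_le[OF j] im_pos[OF j] by (intro mult_mono) auto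
  finally show "\<bar>\<iota> j p - 1 / (real n - real j)\<bar> \<le> 2 * (D / real n) * \<bar>d j p\<bar>" by (simp add: mult_ac)
  have "4 * D ^ 2 / (real n * sqrt n) \<le> Cc / (real n * sqrt n)" by (intro divide_right_mono Cc_ge) auto
  then show "\<bar>2 * (D / real n)\<bar> * (2 * D / sqrt n) \<le> Cc / (real n * sqrt n)" using D1 n0 by (simp add: power2_eq_square)
 qed measurable
qed

lemma \<alpha>_L1: "j \<le> r ==> L1_le Q (\<lambda>p. \<alpha> j p - 1 / (real n - real j)) (Cc / (real n * sqrt n))"
proof -
 assume j: "j \<le> r"
 note [measurable] = meas2[OF j]
 show ?thesis
 proof (rule L1_leI[OF _ L1_le_cmult[OF L1_le_add[OF L1_le_add[OF L1_le_cmult[OF L1_le_abs[OF e_L1], of 4]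
   L1_le_cmult[OF t_mom(3), of 4]] L1_le_cmult[OF L1_le_abs[OF d_L1[OF j]], of 2]], of "D / real n"]])
  fix p
  have eq: "\<alpha> j p - 1 / (real n - real j) = (e p * (rho p * h j p) + (rho p - 1) * h j p + (h j p - 1)) * im j"
   using j by (simp add: \<alpha>_def \<pi>_def \<iota>_def im_def algebra_simps)
  have "\<bar>e p * (rho p * h j p)\<bar> \<le> \<bar>e p\<bar> * (2 * 2)"
   using rho_bounds[of p] h_bounds[OF j, of p] unfolding abs_mult by (intro mult_left_mono mult_mono) auto
  moreover have "\<bar>(rho p - 1) * h j p\<bar> \<le> (2 * t (snd p)) * 2"
   using rho_bounds[of p] h_bounds[OF j, of p] unfolding abs_mult by (intro mult_mono) auto
  ultimately have "\<bar>e p * (rho p * h j p) + (rho p - 1) * h j p + (h j p - 1)\<bar> \<le> 4 * \<bar>e p\<bar> + 4 * t (snd p) + 2 * \<bar>d j p\<bar>"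
   using h_bounds(3)[OF j, of p] by linarith
  then have "\<bar>\<alpha> j p - 1 / (real n - real j)\<bar> \<le> (4 * \<bar>e p\<bar> + 4 * t (snd p) + 2 * \<bar>d j p\<bar>) * (D / real n)"
   unfolding eq abs_mult using im_le[OF j] im_pos[OF j] by (intro mult_mono) auto
  then show "\<bar>\<alpha> j p - 1 / (real n - real j)\<bar> \<le> D / real n * (4 * \<bar>e p\<bar> + 4 * t (snd p) + 2 * \<bar>d j p\<bar>)" by (simp add: mult_ac)
 next
  have "sqrt n * 1 \<le> sqrt n * sqrt n" using n1 by (intro mult_left_mono) auto
  then have "(K + 1) / real n \<le> (K + 1) / sqrt n" using K0 n0 by (intro divide_left_mono) auto
  also have "... = 1 * (K + 1) / sqrt n" by simp
  also have "... \<le> D * (K + 1) / sqrt n" using D1 K0 by (intro divide_right_mono mult_right_mono) auto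
  finally have 1: "(K + 1) / real n \<le> D * (K + 1) / sqrt n" .
  have 2: "2 * D / sqrt n \<le> 2 * (D * (K + 1) / sqrt n)" using D1 K0 by (simp add: divide_right_mono)
  have "\<bar>D / real n\<bar> * (\<bar>4\<bar> * (2 * D / sqrt n) + \<bar>4\<bar> * ((K + 1) / real n) + \<bar>2\<bar> * (2 * D / sqrt n))
    = (D / real n) * (4 * (2 * D / sqrt n) + 4 * ((K + 1) / real n) + 2 * (2 * D / sqrt n))" using D1 by simp
  also have "... \<le> (D / real n) * (16 * (D * (K + 1) / sqrt n))" by (intro mult_left_mono) (use 1 2 in linarith, use D1 in simp)
  also have "... = 16 * D ^ 2 * (K + 1) / (real n * sqrt n)" by (simp add: power2_eq_square)
  also have "... \<le> Cc / (real n * sqrt n)" by (intro divide_right_mono Cc_ge) auto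
  finally show "\<bar>D / real n\<bar> * (\<bar>4\<bar> * (2 * D / sqrt n) + \<bar>4\<bar> * ((K + 1) / real n) + \<bar>2\<bar> * (2 * D / sqrt n)) \<le> Cc / (real n * sqrt n)" .
 qed measurable
qed

text \<open>Up to the factor \<open>im j\<close>, \<open>\<alpha> j\<close> is (1 + e) h rho with h
  close to 1 - d and rho close to 1. So its first-order part is 1 - lin with lin = d - e; the error
  is quadratic in d and e and linear in t, and all of these have mean O(1 / n).\<close>

lemma \<alpha>_lin_L1: "j \<le> r ==> L1_le Q (\<lambda>p. \<alpha> j p - 1 / (real n - real j) + lin j p / (real n - real j)) (Cc / real n ^ 2)"
proof -
 assume j: "j \<le> r"
 note [measurable] = meas2[OF j]
 show ?thesis
 proof (rule L1_leI[OF _ L1_le_cmult[OF L1_le_add[OF L1_le_add[OF L1_le_cmult[OF L1_le_square[OF d_mom(1)[OF j]], of 3]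
   L1_le_cmult[OF L1_le_square[OF e_mom(1)], of 3]] L1_le_cmult[OF t_mom(3), of 6]], of "D / real n"]])
  fix p
  let ?E = "e p" and ?d = "d j p" and ?h = "h j p" and ?t = "t (snd p)"
  have eq: "\<alpha> j p - 1 / (real n - real j) + lin j p / (real n - real j)
    = ((?h - 1 + ?d) + ?E * (?h - 1) + (rho p - 1) * ((1 + ?E) * ?h)) * im j"
   using j by (simp add: \<alpha>_def \<pi>_def \<iota>_def im_def lin_def algebra_simps add_divide_distrib diff_divide_distrib)
  have "\<bar>?E * (?h - 1)\<bar> \<le> \<bar>?E\<bar> * (2 * \<bar>?d\<bar>)" unfolding abs_mult by (intro mult_left_mono h_bounds j) auto
  also have "... \<le> ?E^2 + ?d^2" using square_sum_le(3)[of "\<bar>?E\<bar>" "\<bar>?d\<bar>"] by simp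
  finally have 1: "\<bar>?E * (?h - 1)\<bar> \<le> ?E^2 + ?d^2" .
  have "\<bar>(rho p - 1) * ((1 + ?E) * ?h)\<bar> \<le> (2 * ?t) * ((1 + \<bar>?E\<bar>) * 2)"
   unfolding abs_mult using rho_bounds[of p] h_bounds[OF j, of p] t01 by (intro mult_mono) auto
  also have "... = 4 * ?t + 2 * (2 * ?t * \<bar>?E\<bar>)" by (simp add: algebra_simps)
  also have "... \<le> 4 * ?t + 2 * (?t^2 + \<bar>?E\<bar>\<^sup>2)" by (intro add_mono mult_left_mono square_sum_le) auto
  also have "?t^2 \<le> ?t" using t01[of "snd p"] by (simp add: power2_eq_square mult_left_le)
  finally have 2: "\<bar>(rho p - 1) * ((1 + ?E) * ?h)\<bar> \<le> 6 * ?t + 2 * ?E^2" by simp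
  have "\<bar>(?h - 1 + ?d) + ?E * (?h - 1) + (rho p - 1) * ((1 + ?E) * ?h)\<bar> \<le> 3 * ?d^2 + 3 * ?E^2 + 6 * ?t"
   using 1 2 h_bounds(4)[OF j, of p] by linarith
  then have "\<bar>\<alpha> j p - 1 / (real n - real j) + lin j p / (real n - real j)\<bar> \<le> (3 * ?d^2 + 3 * ?E^2 + 6 * ?t) * (D / real n)"
   unfolding eq abs_mult using im_le[OF j] im_pos[OF j] t01 by (intro mult_mono) auto
  then show "\<bar>\<alpha> j p - 1 / (real n - real j) + lin j p / (real n - real j)\<bar> \<le> D / real n * (3 * ?d^2 + 3 * ?E^2 + 6 * ?t)" by (simp add: mult_ac)
 next
  have 1: "2 * D / real n \<le> 2 * (D * (K + 1) / real n)" using D1 K0 by (simp add: divide_right_mono)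
  have 2: "(K + 1) / real n \<le> D * (K + 1) / real n" using D1 K0 mult_right_mono[of 1 D "K + 1"] by (intro divide_right_mono) auto
  have "\<bar>D / real n\<bar> * (\<bar>3\<bar> * (2 * D / real n) + \<bar>3\<bar> * (2 * D / real n) + \<bar>6\<bar> * ((K + 1) / real n))
    = (D / real n) * (3 * (2 * D / real n) + 3 * (2 * D / real n) + 6 * ((K + 1) / real n))" using D1 by simp
  also have "... \<le> (D / real n) * (18 * (D * (K + 1) / real n))" by (intro mult_left_mono) (use 1 2 in linarith, use D1 in simp)
  also have "... = 18 * D ^ 2 * (K + 1) / real n ^ 2" by (simp add: power2_eq_square)
  also have "... \<le> Cc / real n ^ 2" by (intro divide_right_mono Cc_ge) auto
  finally show "\<bar>D / real n\<bar> * (\<bar>3\<bar> * (2 * D / real n) + \<bar>3\<bar> * (2 * D / real n) + \<bar>6\<bar> * ((K + 1) / real n)) \<le> Cc / real n ^ 2" .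
 qed measurable
qed

lemma lin_L2: "j \<le> r ==> L2_le Q (lin j) (Cc / real n)"
proof -
 assume j: "j \<le> r"
 show ?thesis
 proof (rule L2_leI[OF meas2(5)[OF j] L1_le_add[OF L1_le_cmult[OF L1_le_square[OF d_mom(1)[OF j]], of 2] L1_le_cmult[OF L1_le_square[OF e_mom(1)], of 2]]])
  show "(lin j p)^2 \<le> 2 * (d j p)^2 + 2 * (e p)^2" for p using square_sum_le(1)[of "d j p" "- e p"] by (simp add: lin_def)
  have "8 * D ^ 1 / real n \<le> Cc / real n" by (intro divide_right_mono Cc_ge) auto
  then show "\<bar>2\<bar> * (2 * D / real n) + \<bar>2\<bar> * (2 * D / real n) \<le> Cc / real n" by simp
 qed
qed

lemma lin_mean: "j \<le> r ==> (\<integral>p. lin j p \<partial>Q) = 0"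
 using L1_le_integrable[OF d_L1] L1_le_integrable[OF e_L1] d_mom(3) e_mom(3) by (simp add: lin_def)

lemma \<zeta>_L2: "j \<le> r ==> L2_le Q (\<zeta> j) (Cc / real n ^ 2)"
proof -
 assume j: "j \<le> r"
 show ?thesis
 proof (rule L2_leI[OF meas2(6)[OF j] L1_le_add[OF L1_le_add[OF L1_le_cmult[OF L1_le_square[OF d_mom(2)[OF j]], of 12]
   L1_le_cmult[OF L1_le_square[OF e_mom(2)], of 12]] L1_le_cmult[OF L1_le_square[OF t_mom(1)], of 27]]])
  fix p
  have tri: "\<bar>a - b + c\<bar> \<le> a' + b' + c'" if "\<bar>a\<bar> \<le> a'" "\<bar>b\<bar> \<le> b'" "\<bar>c\<bar> \<le> c'" for a b c a' b' c' :: real using that by linarith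
  have "\<bar>\<zeta> j p\<bar> \<le> 2 * (d j p)^2 + 2 * (e p)^2 + 3 * t (snd p)"
   unfolding \<zeta>_def by (rule tri[OF max_half_bounds(3)[OF d_ge[OF j]] max_half_bounds(3)[OF e_ge] rho_bounds(4)])
  then have "\<bar>\<zeta> j p\<bar>\<^sup>2 \<le> (2 * (d j p)^2 + 2 * (e p)^2 + 3 * t (snd p))^2" by (rule power_mono) simp
  also have "... \<le> 3 * (2 * (d j p)^2)^2 + 3 * (2 * (e p)^2)^2 + 3 * (3 * t (snd p))^2" by (rule square_sum_le)
  finally show "(\<zeta> j p)^2 \<le> 12 * ((d j p)^2)^2 + 12 * ((e p)^2)^2 + 27 * (t (snd p))^2" by (simp add: power_mult_distrib)
 next
  have a: "60 * D^2 / real n ^ 2 \<le> 60 * D^2 * (K + 1) / real n ^ 2" using D1 K0 by (simp add: divide_right_mono)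
  have "K \<le> D^2 * (K + 1)"
  proof -
   have "K \<le> 1 * (K + 1)" by simp
   also have "... \<le> D^2 * (K + 1)" using K0 by (intro mult_right_mono one_le_power D1) auto
   finally show ?thesis .
  qed
  then have b: "K / real n ^ 2 \<le> D^2 * (K + 1) / real n ^ 2" by (rule divide_right_mono) simp
  have "\<bar>12\<bar> * p + \<bar>12\<bar> * p + \<bar>27\<bar> * k \<le> 1467 * X" if "p \<le> 60 * X" "k \<le> X" for p k X :: real using that by simp
  from this[of "60 * D^2 / real n ^ 2" "D^2 * (K + 1) / real n ^ 2", OF _ b]
  have "\<bar>12\<bar> * (60 * D^2 / real n ^ 2) + \<bar>12\<bar> * (60 * D^2 / real n ^ 2) + \<bar>27\<bar> * (K / real n ^ 2)
    \<le> 1467 * (D^2 * (K + 1) / real n ^ 2)" using a by (simp only: times_divide_eq_right mult.assoc)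
  also have "... = 1467 * D^2 * (K + 1) / real n ^ 2" by (simp only: times_divide_eq_right mult.assoc)
  also have "... \<le> Cc / real n ^ 2" by (intro divide_right_mono Cc_ge) auto
  finally show "\<bar>12\<bar> * (60 * D^2 / real n ^ 2) + \<bar>12\<bar> * (60 * D^2 / real n ^ 2) + \<bar>27\<bar> * (K / real n ^ 2) \<le> Cc / real n ^ 2" .
 qed
qed

text \<open>The difference is of first order in d, e and t; its square times S^2 is bounded by
  Cauchy-Schwarz with fourth moments.\<close>

lemma S\<beta>_diff_L2: "j \<le> r ==> L2_le Q (\<lambda>p. S j p * (\<beta> j p - 1 / (real n - real j))) (Cc / real n ^ 3)"
proof -
 assume j: "j \<le> r"
 note [measurable] = meas[OF j] meas2[OF j]
 note B = L1_le_cmult[OF L1_le_add[OF L1_le_add[OF L1_le_cmult[OF L1_le_mult[OF S_mom(2)[OF j] t_mom(2)], of 48]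
  L1_le_cmult[OF L1_le_mult[OF S_mom(2)[OF j] e_mom(2)], of 48]] L1_le_cmult[OF L1_le_mult[OF S_mom(2)[OF j] d_mom(2)[OF j]], of 12]], of i2]
 show ?thesis
 proof (rule L2_leI[OF _ B])
  fix p
  let ?E = "e p" and ?d = "d j p" and ?h = "h j p" and ?t = "t (snd p)"
  have eq: "\<beta> j p - 1 / (real n - real j) = ((sqrt (\<pi> p) - 1) * ?h + (?h - 1)) * im j"
   using j by (simp add: \<beta>_def \<iota>_def im_def algebra_simps)
  have "\<bar>sqrt (\<pi> p) - 1\<bar> \<le> \<bar>\<pi> p - 1\<bar>" by (rule abs_sqrt_diff_le[OF \<pi>_nonneg])
  also have "\<pi> p - 1 = (rho p - 1) + ?E * rho p" by (simp add: \<pi>_def algebra_simps)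
  also have "\<bar>(rho p - 1) + ?E * rho p\<bar> \<le> 2 * ?t + \<bar>?E\<bar> * 2" using rho_bounds[of p] mult_left_mono[of "rho p" 2 "\<bar>?E\<bar>"]
   by (intro order_trans[OF abs_triangle_ineq] add_mono) (auto simp: abs_mult)
  finally have "\<bar>(sqrt (\<pi> p) - 1) * ?h\<bar> \<le> (2 * ?t + \<bar>?E\<bar> * 2) * 2"
   unfolding abs_mult using h_bounds[OF j, of p] t01 by (intro mult_mono) auto
  from order_trans[OF abs_triangle_ineq add_mono[OF this h_bounds(3)[OF j]]]
  have "\<bar>(sqrt (\<pi> p) - 1) * ?h + (?h - 1)\<bar> \<le> 4 * ?t + 4 * \<bar>?E\<bar> + 2 * \<bar>?d\<bar>" by simp
  then have "\<bar>(sqrt (\<pi> p) - 1) * ?h + (?h - 1)\<bar>\<^sup>2 \<le> (4 * ?t + 4 * \<bar>?E\<bar> + 2 * \<bar>?d\<bar>)^2" by (rule power_mono) simp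
  also have "... \<le> 3 * (4 * ?t)^2 + 3 * (4 * \<bar>?E\<bar>)^2 + 3 * (2 * \<bar>?d\<bar>)^2" by (rule square_sum_le)
  finally have "\<bar>(sqrt (\<pi> p) - 1) * ?h + (?h - 1)\<bar>\<^sup>2 \<le> 48 * ?t^2 + 48 * ?E^2 + 12 * ?d^2" by (simp add: power_mult_distrib)
  then have "(\<beta> j p - 1 / (real n - real j))^2 \<le> (48 * ?t^2 + 48 * ?E^2 + 12 * ?d^2) * i2"
   unfolding eq power_mult_distrib using im_sq_le[OF j] by (intro mult_mono) auto
  then have "(S j p)^2 * (\<beta> j p - 1 / (real n - real j))^2 \<le> (S j p)^2 * ((48 * ?t^2 + 48 * ?E^2 + 12 * ?d^2) * i2)"
   by (rule mult_left_mono) simp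
  also have "... = i2 * (48 * ((S j p)^2 * ?t^2) + 48 * ((S j p)^2 * ?E^2) + 12 * ((S j p)^2 * ?d^2))" by (simp only: algebra_simps)
  finally show "(S j p * (\<beta> j p - 1 / (real n - real j)))^2
    \<le> i2 * (48 * ((S j p)^2 * ?t^2) + 48 * ((S j p)^2 * ?E^2) + 12 * ((S j p)^2 * ?d^2))" by (simp only: power_mult_distrib)
 next
  have dk: "D * 1 \<le> D * (K + 1)" "1 * (K + 1) \<le> D * (K + 1)" using D1 K0 by (intro mult_left_mono mult_right_mono; simp)+
  have "3 * K \<le> (2 * (K + 1))^2" using K0 by (simp add: power2_eq_square algebra_simps)
  then have "sqrt (3 * K) \<le> 2 * (K + 1)" using K0 by (intro real_le_lsqrt) auto
  then have "sqrt (3 * (K / real n ^ 2)) \<le> 2 * (K + 1) / real n" using n0 by (simp add: real_sqrt_divide real_sqrt_mult divide_right_mono)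
  also have "... \<le> 2 * (D * (K + 1)) / real n" using dk by (intro divide_right_mono) auto
  finally have 1: "sqrt (3 * (K / real n ^ 2)) \<le> 2 * (D * (K + 1) / real n)" by simp
  have "sqrt (3 * (60 * D^2 / real n ^ 2)) \<le> 14 * (D / real n)"
   using D1 by (intro real_le_lsqrt) (auto simp: power_mult_distrib power_divide divide_right_mono)
  also have "... \<le> 14 * (D * (K + 1) / real n)" using dk by (intro mult_left_mono divide_right_mono) auto
  finally have 2: "sqrt (3 * (60 * D^2 / real n ^ 2)) \<le> 14 * (D * (K + 1) / real n)" .
  have "\<bar>i2\<bar> * (\<bar>48\<bar> * sqrt (3 * (K / real n ^ 2)) + \<bar>48\<bar> * sqrt (3 * (60 * D^2 / real n ^ 2)) + \<bar>12\<bar> * sqrt (3 * (60 * D^2 / real n ^ 2)))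
    \<le> i2 * (936 * (D * (K + 1) / real n))" using 1 2 by (simp only: abs_of_nonneg[OF i2_nonneg]) (intro mult_left_mono, auto)
  also have "... = 936 * D ^ 3 * (K + 1) / real n ^ 3" by (simp add: power2_eq_square power3_eq_cube)
  also have "... \<le> Cc / real n ^ 3" by (intro divide_right_mono Cc_ge) auto
  finally show "\<bar>i2\<bar> * (\<bar>48\<bar> * sqrt (3 * (K / real n ^ 2)) + \<bar>48\<bar> * sqrt (3 * (60 * D^2 / real n ^ 2)) + \<bar>12\<bar> * sqrt (3 * (60 * D^2 / real n ^ 2)))
    \<le> Cc / real n ^ 3" .
 qed measurable
qed

text \<open>Reflecting the coordinate \<open>j - 1\<close> changes the sign of \<open>S j\<close> and of nothing else.\<close>

lemma S\<beta>_mean: assumes j: "j \<le> r" shows "(\<integral>p. S j p * \<beta> j p \<partial>Q) = 0"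
proof (cases "j = 0")
 case False
 then have k: "j - 1 < n" using j rn by simp
 obtain f where f: "f \<in> G.rows \<rightarrow>\<^sub>M G.rows" "distr G.rows G.rows f = G.rows"
  "\<And>x k. k < n ==> f x k = (if k = j - 1 then - x k else x k)" using G.reflect_coordinate[OF k] by blast
 define F where "F x y = S j (x, y) * \<beta> j (x, y)" for x y
 have eqF: "(\<lambda>(x, y). F x y) = (\<lambda>p. S j p * \<beta> j p)" by (auto simp: F_def fun_eq_iff)
 then have int: "integrable Q (\<lambda>(x, y). F x y)" using L1_le_integrable[OF GM.P.L2_le_imp_L1_le[OF S\<beta>_L2[OF j]]] by simp
 have Fm: "(\<lambda>(x, y). F x y) \<in> borel_measurable Q" using int by simp
 have c: "G.csum i n (f x) = G.csum i n x" for i x unfolding G.csum_def sq1_def using f(3) by (intro sum.cong) auto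
 have odd: "F (f x) y = - F x y" for x y
 proof -
  have "S j (f x, y) = - S j (x, y)" using f(3)[OF k, of x] False by (simp add: S_def)
  moreover have "\<beta> j (f x, y) = \<beta> j (x, y)" by (simp add: \<beta>_def \<pi>_def rho_def \<iota>_def h_def e_def d_def c)
  ultimately show ?thesis by (simp add: F_def)
 qed
 have "(\<integral>x. F x y \<partial>G.rows) = 0" if y: "y \<in> space M2" for y
 proof -
  have "(\<lambda>x. F x y) \<in> borel_measurable G.rows" using measurable_compose[OF measurable_Pair2'[OF y] Fm] by simp
  then have "(\<integral>x. F x y \<partial>distr G.rows G.rows f) = (\<integral>x. F (f x) y \<partial>G.rows)" using f(1) by (intro integral_distr)
  then show ?thesis unfolding f(2) odd by simp
 qed
 then have "(\<integral>y. (\<integral>x. F x y \<partial>G.rows) \<partial>M2) = (\<integral>y. 0 \<partial>M2)" by (intro Bochner_Integration.integral_cong) auto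
 then show ?thesis using GM.integral_snd[OF int] unfolding eqF by simp
qed (simp add: S_def)

text \<open>\<open>\<iota> j\<close> is a function of the coordinates from j on, hence independent
  of coordinate j - 1, whose \<open>sq1\<close> is centred. No reflection is involved, as the full
  norm does not enter \<open>u\<close>.\<close>

lemma u_mean: assumes j: "j \<le> r" shows "(\<integral>p. u j p \<partial>Q) = 0"
proof (cases "j = 0")
 case False
 then have k: "j - 1 < n" using j rn by simp
 define H where "H x = im j / max (1 + im j * G.csum j n x) (1 / 2)" for x
 have u: "u j p = H (fst p) * sq1 (fst p (j - 1))" for p
  using False j by (simp add: u_def \<iota>_def h_def d_def H_def S_def sq1_def mult_ac)
 have [measurable]: "G.csum j n \<in> borel_measurable G.rows" using G.csum_moments[of j n] j rn by (auto simp: L2_le_def)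
 have Hm: "H \<in> borel_measurable G.rows" unfolding H_def[abs_def] by measurable
 have "\<bar>H x\<bar> \<le> 2 * im j" for x using mult_left_mono[OF inverse_max_half(2), of "im j" "1 + im j * G.csum j n x"]
   mult_left_mono[OF inverse_max_half(1), of "im j" "1 + im j * G.csum j n x"] im_pos[OF j] by (simp add: H_def mult.commute)
 then have HL: "L1_le G.rows H \<bar>2 * im j\<bar>" by (intro L1_leI[OF Hm G.P.L1_le_const[of "2 * im j"]]) auto
 have "G.csum j n (x(j - 1 := y)) = G.csum j n x" for x y unfolding G.csum_def
 proof (rule sum.cong)
  fix i assume "i \<in> {j..<n}"
  then have "i \<noteq> j - 1" using False by auto
  then show "sq1 ((x(j - 1 := y)) i) = sq1 (x i)" by simp
 qed simp
 then have "H (x(j - 1 := y)) = H x" for x y by (simp add: H_def)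
 note M = G.L1_le_indep_mult[OF k HL this std_normal_L1(5)]
 have "(\<integral>p. u j p \<partial>Q) = (\<integral>x. H x * sq1 (x (j - 1)) \<partial>G.rows)" unfolding u by (rule integral_fst_Q[OF M(1)])
 then show ?thesis using M(2) sq1_moments(2) by simp
qed (simp add: u_def)

sublocale chain: row_chain Q r n Cc S lin \<alpha> \<beta> \<iota> u \<zeta>
proof
 have "D * (real n - real r) \<le> Cc * (real n - real r)" using Cc_ge(2)[of 1 1] rn by (intro mult_right_mono) auto
 then show "real n \<le> Cc * (real n - real r)" using nD by simp
 show "(\<beta> j y)^2 = \<alpha> j y * \<iota> j y" for j y using \<pi>_nonneg[of y] by (simp add: \<beta>_def \<alpha>_def power_mult_distrib power2_eq_square)
 show "(S j y)^2 * \<iota> j y = u j y + \<iota> j y" if "1 \<le> j" for j y using that by (simp add: u_def algebra_simps)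
 show "0 \<le> \<alpha> j y" for j y by (simp add: \<alpha>_def \<pi>_nonneg \<iota>_nonneg)
 show "L2_le Q (S j) Cc" if "j \<le> r" for j using S_mom(1)[OF that] Cc1 by (rule L2_le_weaken)
qed (use r1 rn Cc1 in \<open>auto intro: \<iota>_nonneg S\<beta>_L2 S\<beta>_mean \<alpha>_L2 S\<iota>_L2 u_L2 u_mean \<iota>_L1 \<alpha>_L1 \<alpha>_lin_L1
 S\<beta>_diff_L2 lin_L2 lin_mean S_mom(3) \<zeta>_L2\<close>)

end

subsection \<open>Central limit theorem for the linearised chain\<close>

lemma exp_minus_approx: "0 \<le> z ==> \<bar>exp (- z) - (1 - z)\<bar> \<le> (z :: real)^2"
proof -
 assume z: "0 \<le> z"
 have "exp (- z) = 1 / exp z" by (simp add: exp_minus divide_inverse)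
 also have "... \<le> 1 / (1 + z)" using z by (intro divide_left_mono) (auto intro: mult_pos_pos)
 also have "... \<le> 1 - z + z^2"
 proof -
  have "(1 - z + z^2) * (1 + z) = 1 + z ^ 3" by (simp add: eval_nat_numeral algebra_simps)
  then show ?thesis using z by (simp add: pos_divide_le_eq)
 qed
 finally show ?thesis using exp_ge_add_one_self[of "- z"] by simp
qed

text \<open>\<open>sq1\<close> has mean 0 and variance 2, so its characteristic function is 1 - x^2
  up to a third-moment term, at most 11 / 6 |x|^3. Replacing 1 - x^2 by exp (- x^2) costs at most
  |x|^3 more.\<close>

lemma char_sq1:
 assumes x: "\<bar>x\<bar> \<le> 1"
 shows "cmod ((\<integral>y. iexp (x * sq1 y) \<partial>std_normal_distribution) - of_real (exp (- x\<^sup>2))) \<le> 3 * \<bar>x\<bar> ^ 3"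
proof -
 let ?N = "std_normal_distribution"
 note I = sq1_moments(1)
 have m: "sq1 \<in> borel_measurable ?N" using borel_measurable_integrable[OF I[of 1]] by simp
 have L2: "L2_le ?N (\<lambda>y. (sq1 y)^2) 60" using std_normal_L1(2) m by (subst L2_le_iff_L1) (auto simp flip: power_mult)
 have L: "L1_le ?N (\<lambda>y. \<bar>sq1 y * (sq1 y)^2\<bar>) (sqrt (2 * 60))" by (intro L1_le_abs L1_le_mult std_normal_L1(1) L2)
 have eq: "\<bar>sq1 y * (sq1 y)^2\<bar> = \<bar>sq1 y\<bar> ^ 3" for y by (simp add: abs_mult power3_eq_cube power2_eq_square)
 \<comment> \<open>2 and 60 are the moments of order 2 and 4 of \<open>sq1\<close>; Cauchy-Schwarz
   bounds the third absolute moment by the root of their product.\<close>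
 have "sqrt (2 * 60 :: real) \<le> 11" by (rule real_le_lsqrt) auto
 with L1_le_integral[OF L] have E3: "(\<integral>y. \<bar>sq1 y\<bar> ^ 3 \<partial>?N) \<le> 11" unfolding eq by linarith
 have I3: "integrable ?N (\<lambda>y. \<bar>x\<bar> * \<bar>sq1 y\<bar> ^ 3)" using L1_le_integrable[OF L] unfolding eq by simp
 have Im: "integrable ?N (\<lambda>y. min (6 * (sq1 y)^2) (\<bar>x\<bar> * \<bar>sq1 y\<bar> ^ 3))" using I[of 2] I3 by (intro integrable_min) auto
 have "cmod (char (distr ?N borel sq1) x - (1 - x\<^sup>2 * 2 / 2))
   \<le> (x^2 / 6) * (\<integral>y. min (6 * (sq1 y)^2) (\<bar>x\<bar> * \<bar>sq1 y\<bar> ^ 3) \<partial>?N)"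
  using I[of 1] I[of 2] sq1_moments(2,3) m by (intro std_normal.char_approx3') simp_all
 also have "... \<le> (x^2 / 6) * (\<bar>x\<bar> * 11)"
 proof (rule mult_left_mono)
  have "(\<integral>y. min (6 * (sq1 y)^2) (\<bar>x\<bar> * \<bar>sq1 y\<bar> ^ 3) \<partial>?N) \<le> (\<integral>y. \<bar>x\<bar> * \<bar>sq1 y\<bar> ^ 3 \<partial>?N)" by (rule integral_mono[OF Im I3]) simp
  also have "... \<le> \<bar>x\<bar> * 11" using E3 by (simp add: mult_left_mono)
  finally show "(\<integral>y. min (6 * (sq1 y)^2) (\<bar>x\<bar> * \<bar>sq1 y\<bar> ^ 3) \<partial>?N) \<le> \<bar>x\<bar> * 11" .
 qed simp
 also have "... \<le> 2 * \<bar>x\<bar> ^ 3"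
 proof -
  have "x^2 * \<bar>x\<bar> = \<bar>x\<bar> ^ 3" by (simp add: power3_eq_cube power2_eq_square abs_mult_self_eq)
  moreover have "x^2 / 6 * (\<bar>x\<bar> * 11) = 11 / 6 * (x^2 * \<bar>x\<bar>)" by simp
  moreover have "0 \<le> \<bar>x\<bar> ^ 3" by simp
  ultimately show ?thesis by linarith
 qed
 finally have 1: "cmod (char (distr ?N borel sq1) x - of_real (1 - x\<^sup>2)) \<le> 2 * \<bar>x\<bar> ^ 3" by simp
 have "\<bar>exp (- x\<^sup>2) - (1 - x\<^sup>2)\<bar> \<le> (x^2)^2" by (rule exp_minus_approx) simp
 also have "... = \<bar>x\<bar> ^ 4" by (simp flip: power_mult)
 also have "... \<le> \<bar>x\<bar> ^ 3" using x by (intro power_decreasing) auto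
 finally have 2: "cmod (of_real (exp (- x\<^sup>2)) - of_real (1 - x\<^sup>2)) \<le> \<bar>x\<bar> ^ 3" unfolding of_real_diff[symmetric] norm_of_real .
 then have 2: "cmod (of_real (1 - x\<^sup>2) - of_real (exp (- x\<^sup>2))) \<le> \<bar>x\<bar> ^ 3" by (subst norm_minus_commute)
 have c: "char (distr ?N borel sq1) x = (\<integral>y. iexp (x * sq1 y) \<partial>?N)" unfolding char_def using m by (subst integral_distr) auto
 have "cmod (char (distr ?N borel sq1) x - of_real (exp (- x\<^sup>2))) \<le> 2 * \<bar>x\<bar> ^ 3 + \<bar>x\<bar> ^ 3" by (rule norm_diff_triangle_le[OF 1 2])
 then show ?thesis unfolding c by simp
qed

section \<open>The characteristic function of the linear part\<close>

context gaussian_rows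
begin

lemma char_product:
 fixes \<phi> :: "nat => nat => real => real"
 assumes \<phi> [measurable]: "\<And>j k. \<phi> j k \<in> borel_measurable borel"
 shows "(\<integral>x. iexp (\<Sum>j<Suc r. \<Sum>k<n. \<phi> j k (fst (x j) k)) \<partial>chain.rows)
   = (\<Prod>j<Suc r. \<Prod>k<n. \<integral>y. iexp (\<phi> j k y) \<partial>std_normal_distribution)"
proof -
 interpret PQ: product_sigma_finite "\<lambda>_::nat. Q" by standard
 interpret PN: product_sigma_finite "\<lambda>_::nat. std_normal_distribution" by standard
 define f where "f j p = (\<Prod>k<n. iexp (\<phi> j k (fst p k)))" for j and p :: "(nat => real) \<times> 'a"
 have mk: "(\<lambda>x. iexp (\<phi> j k (x k))) \<in> borel_measurable G.rows" if "k < n" for j k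
 proof (rule G.measurable_row_fun[OF that])
  have "(\<lambda>y::real. iexp y) \<in> borel_measurable borel" by (intro borel_measurable_continuous_onI continuous_intros)
  then show "(\<lambda>y. iexp (\<phi> j k y)) \<in> borel_measurable std_normal_distribution" using measurable_compose[OF \<phi>] by simp
 qed
 have fm: "f j \<in> borel_measurable Q" for j
  unfolding f_def[abs_def] by (intro borel_measurable_prod measurable_compose[OF measurable_fst mk]) auto
 have f1: "norm (f j p) = 1" for j p
 proof -
  have "norm (f j p) = (\<Prod>k<n. norm (iexp (\<phi> j k (fst p k))))" unfolding f_def by (rule prod_norm[symmetric])
  also have "... = (\<Prod>k<n. 1)" by (rule prod.cong) (auto simp only: norm_exp_i_times)
  finally show ?thesis by (simp only: prod.neutral_const)
 qed
 have fi: "integrable Q (f j)" for j by (rule GM.P.integrable_const_bound[OF _ fm, of _ 1]) (simp only: f1 order_refl AE_I2)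
 have "iexp (\<Sum>j<Suc r. \<Sum>k<n. \<phi> j k (fst (x j) k)) = (\<Prod>j<Suc r. f j (x j))" for x
  unfolding f_def by (simp add: exp_sum sum_distrib_left del: prod.lessThan_Suc sum.lessThan_Suc)
 then have "(\<integral>x. iexp (\<Sum>j<Suc r. \<Sum>k<n. \<phi> j k (fst (x j) k)) \<partial>chain.rows) = (\<integral>x. (\<Prod>j<Suc r. f j (x j)) \<partial>chain.rows)" by presburger
 also have "... = (\<Prod>j<Suc r. integral\<^sup>L Q (f j))" by (rule PQ.product_integral_prod) (simp_all add: fi)
 also have "... = (\<Prod>j<Suc r. \<Prod>k<n. \<integral>y. iexp (\<phi> j k y) \<partial>std_normal_distribution)"
 proof (rule prod.cong)
  fix j
  have "integral\<^sup>L Q (f j) = (\<integral>x. \<integral>y. f j (x, y) \<partial>M2 \<partial>G.rows)" by (rule GM.integral_fst'[OF fi, symmetric])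
  also have "... = (\<integral>x. (\<Prod>k<n. iexp (\<phi> j k (x k))) \<partial>G.rows)" by (simp add: f_def M2.prob_space)
  also have "... = (\<Prod>k<n. \<integral>y. iexp (\<phi> j k y) \<partial>std_normal_distribution)"
   by (rule PN.product_integral_prod) (auto intro!: std_normal.integrable_const_bound[of _ 1])
  finally show "integral\<^sup>L Q (f j) = (\<Prod>k<n. \<integral>y. iexp (\<phi> j k y) \<partial>std_normal_distribution)" .
 qed simp
 finally show ?thesis .
qed

definition a :: "nat => nat => real" where
 "a j k = (1 - chain.w j) * ((if j \<le> k then im j else 0) - \<gamma> / real n)"

text \<open>One summand per row and coordinate, each a function of one normal variable. Coordinate j
  - 1 of row j occurs linearly through \<open>S\<close> and, for \<open>\<gamma>\<close> = 1, also
  quadratically through the norm; its quadratic term is moved to \<open>dropped\<close>, so that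
  every summand is purely linear or purely quadratic. \<open>v\<close> lists the variances.\<close>

definition \<phi> :: "nat => nat => real => real" where
 "\<phi> j k y = (if 1 \<le> j \<and> k = j - 1 then - chain.b j * y else a j k * sq1 y)"

definition v :: "nat => nat => real" where
 "v j k = (if 1 \<le> j \<and> k = j - 1 then (chain.b j)^2 else 2 * (a j k)^2)"

definition V :: real where "V = (\<Sum>j<Suc r. \<Sum>k<n. v j k)"

definition main' :: "(nat => (nat => real) \<times> 'a) => real" where
 "main' x = (\<Sum>j<Suc r. \<Sum>k<n. \<phi> j k (fst (x j) k))"

lemma abs_a_le: "j \<le> r ==> \<bar>a j k\<bar> \<le> D / real n"
proof -
 assume j: "j \<le> r"
 have w: "0 < chain.w j" "chain.w j \<le> 1" using chain.w_bounds[OF j] order_trans[of "chain.w j" "1 / (real r + 1)" 1] by auto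
 have "1 / real n \<le> im j" using j rn by (simp add: im_def divide_simps)
 moreover have "1 / real n \<le> D / real n" using D1 by (simp add: divide_right_mono)
 ultimately have "\<bar>(if j \<le> k then im j else 0) - \<gamma> / real n\<bar> \<le> D / real n"
 proof -
  have "\<bar>x - g\<bar> \<le> D / real n" if "x = 0 \<or> x = im j" "g = 0 \<or> g = 1 / real n" for x g
  proof -
   have "0 \<le> 1 / real n" by simp
   with that \<open>1 / real n \<le> im j\<close> \<open>1 / real n \<le> D / real n\<close> im_le[OF j] show ?thesis by (elim disjE) linarith+
  qed
  moreover have "\<gamma> / real n = 0 \<or> \<gamma> / real n = 1 / real n" using \<gamma> by auto
  ultimately show ?thesis by presburger
 qed
 then have "\<bar>1 - chain.w j\<bar> * \<bar>(if j \<le> k then im j else 0) - \<gamma> / real n\<bar> \<le> 1 * (D / real n)" using w by (intro mult_mono) auto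
 then show ?thesis by (simp add: a_def abs_mult)
qed

lemma v_nonneg: "0 \<le> v j k" by (simp add: v_def)

text \<open>The linear summands are exactly normal. Each quadratic one is replaced by a normal
  factor with a cubic error from \<open>char_sq1\<close>, and |a| \<le> D / n turns the sum of the
  cubes into D / n times the variance.\<close>

lemma char_main':
 assumes \<tau>: "\<bar>\<tau>\<bar> * (D / real n) \<le> 1"
 shows "cmod ((\<integral>x. iexp (\<tau> * main' x) \<partial>chain.rows) - of_real (exp (- \<tau>\<^sup>2 * V / 2))) \<le> 3 / 2 * \<bar>\<tau>\<bar> ^ 3 * (D / real n) * V"
proof -
 let ?N = "std_normal_distribution"
 let ?I = "{..<Suc r} \<times> {..<n} :: (nat \<times> nat) set"
 define z where "z = (\<lambda>(j :: nat, k :: nat). \<integral>y. iexp (\<tau> * \<phi> j k y) \<partial>?N)"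
 define w where "w = (\<lambda>(j :: nat, k :: nat). complex_of_real (exp (- \<tau>\<^sup>2 * v j k / 2)))"
 have \<phi>m: "\<phi> j k \<in> borel_measurable borel" for j k unfolding \<phi>_def[abs_def] sq1_def[abs_def] by (cases "1 \<le> j \<and> k = j - 1") simp_all
 have "(\<integral>x. iexp (\<tau> * main' x) \<partial>chain.rows) = (\<integral>x. iexp (\<Sum>j<Suc r. \<Sum>k<n. \<tau> * \<phi> j k (fst (x j) k)) \<partial>chain.rows)"
  by (simp only: main'_def sum_distrib_left)
 also have "... = (\<Prod>j<Suc r. \<Prod>k<n. z (j, k))" unfolding z_def prod.case using \<phi>m by (intro char_product) simp
 also have "... = (\<Prod>p\<in>?I. z p)" by (simp add: prod.cartesian_product split_beta)
 finally have 1: "(\<integral>x. iexp (\<tau> * main' x) \<partial>chain.rows) = (\<Prod>p\<in>?I. z p)" .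
 have "- \<tau>\<^sup>2 * V / 2 = (\<Sum>p\<in>?I. - \<tau>\<^sup>2 * v (fst p) (snd p) / 2)"
  unfolding V_def by (simp add: sum.cartesian_product split_beta sum_distrib_left sum_divide_distrib sum_negf)
 then have 2: "complex_of_real (exp (- \<tau>\<^sup>2 * V / 2)) = (\<Prod>p\<in>?I. w p)" by (simp add: exp_sum w_def split_beta)
 have zw: "cmod (z (j, k) - w (j, k)) \<le> 3 / 2 * \<bar>\<tau>\<bar> ^ 3 * (D / real n) * v j k" if j: "j \<le> r" for j k
 proof (cases "1 \<le> j \<and> k = j - 1")
  case True
  have "z (j, k) = char ?N (- \<tau> * chain.b j)" using True by (simp add: z_def \<phi>_def char_def mult_ac)
  also have "... = w (j, k)" using True unfolding char_std_normal_distribution by (simp add: w_def v_def power_mult_distrib)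
  finally show ?thesis using v_nonneg[of j k] D1 by simp
 next
  case False
  have aD: "\<bar>a j k\<bar> \<le> D / real n" by (rule abs_a_le[OF j])
  have "\<bar>\<tau> * a j k\<bar> \<le> 1" using \<tau> mult_left_mono[OF aD, of "\<bar>\<tau>\<bar>"] by (simp add: abs_mult)
  from char_sq1[OF this] have "cmod (z (j, k) - w (j, k)) \<le> 3 * \<bar>\<tau> * a j k\<bar> ^ 3"
   using False by (auto simp: z_def w_def v_def \<phi>_def power_mult_distrib mult.assoc)
  also have "... = 3 * \<bar>\<tau>\<bar> ^ 3 * (a j k)^2 * \<bar>a j k\<bar>"
  proof -
   have "\<bar>y\<bar> ^ 3 = y^2 * \<bar>y\<bar>" for y :: real by (simp add: power3_eq_cube power2_eq_square)
   then show ?thesis by (simp only: abs_mult power_mult_distrib mult.assoc)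
  qed
  also have "... \<le> 3 * \<bar>\<tau>\<bar> ^ 3 * (a j k)^2 * (D / real n)" by (intro mult_left_mono aD) auto
  also have "... = 3 / 2 * \<bar>\<tau>\<bar> ^ 3 * (D / real n) * v j k" using False by (auto simp: v_def)
  finally show ?thesis .
 qed
 have "cmod ((\<Prod>p\<in>?I. z p) - (\<Prod>p\<in>?I. w p)) \<le> (\<Sum>p\<in>?I. cmod (z p - w p))"
 proof (rule norm_prod_diff)
  fix p :: "nat \<times> nat"
  obtain j k where p: "p = (j, k)" by (cases p)
  have "cmod (z p) \<le> (\<integral>y. cmod (iexp (\<tau> * \<phi> j k y)) \<partial>?N)" unfolding p z_def prod.case by (rule integral_norm_bound)
  then show "cmod (z p) \<le> 1" using std_normal.prob_space by simp
  show "cmod (w p) \<le> 1" using v_nonneg[of j k] by (simp add: p w_def)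
 qed
 also have "... \<le> (\<Sum>p\<in>?I. 3 / 2 * \<bar>\<tau>\<bar> ^ 3 * (D / real n) * v (fst p) (snd p))" using zw by (intro sum_mono) auto
 also have "... = 3 / 2 * \<bar>\<tau>\<bar> ^ 3 * (D / real n) * V" unfolding V_def by (simp add: sum.cartesian_product split_beta sum_distrib_left)
 finally show ?thesis unfolding 1 2 .
qed

definition dropped :: "(nat => (nat => real) \<times> 'a) => real" where
 "dropped x = (\<Sum>j<Suc r. ((1 - chain.w j) * (- \<gamma> / real n)) * (if 1 \<le> j then sq1 (S j (x j)) else 0))"

lemma lin_eq: "j \<le> r ==> lin j p = (\<Sum>k<n. ((if j \<le> k then im j else 0) - \<gamma> / real n) * sq1 (fst p k))"
proof -
 assume j: "j \<le> r"
 have "(\<Sum>k<n. (if j \<le> k then im j else 0) * sq1 (fst p k)) = (\<Sum>k\<in>{j..<n}. im j * sq1 (fst p k))"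
  by (rule sum.mono_neutral_cong_right) auto
 moreover have "(\<Sum>k<n. ((if j \<le> k then im j else 0) - \<gamma> / real n) * sq1 (fst p k))
   = (\<Sum>k<n. (if j \<le> k then im j else 0) * sq1 (fst p k)) - \<gamma> / real n * (\<Sum>k<n. sq1 (fst p k))"
  by (simp only: left_diff_distrib sum_subtractf sum_distrib_left)
 moreover have "(\<Sum>k<n. sq1 (fst p k)) = G.csum 0 n (fst p)" by (simp add: G.csum_def atLeast0LessThan)
 moreover have "(\<Sum>k\<in>{j..<n}. im j * sq1 (fst p k)) = im j * G.csum j n (fst p)" by (simp add: G.csum_def sum_distrib_left)
 ultimately show ?thesis by (simp add: lin_def d_def e_def im_def[of 0])
qed

lemma main_eq: "chain.main x = main' x + dropped x"
proof -
 have "(1 - chain.w j) * lin j (x j) - chain.b j * S j (x j)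
   = (\<Sum>k<n. \<phi> j k (fst (x j) k)) + ((1 - chain.w j) * (- \<gamma> / real n)) * (if 1 \<le> j then sq1 (S j (x j)) else 0)"
  if j: "j \<le> r" for j
 proof -
  let ?y = "fst (x j)"
  have l: "(1 - chain.w j) * lin j (x j) = (\<Sum>k<n. a j k * sq1 (?y k))"
   unfolding lin_eq[OF j] a_def by (simp add: sum_distrib_left mult.assoc)
  show ?thesis
  proof (cases "j = 0")
   case True
   then show ?thesis using l by (simp add: S_def \<phi>_def)
  next
   case False
   then have k: "j - 1 \<in> {..<n}" using j rn by simp
   have r: "(\<Sum>k\<in>{..<n} - {j - 1}. \<phi> j k (?y k)) = (\<Sum>k\<in>{..<n} - {j - 1}. a j k * sq1 (?y k))" by (intro sum.cong) (auto simp: \<phi>_def)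
   have "a j (j - 1) = (1 - chain.w j) * (- \<gamma> / real n)"
   proof -
    have "\<not> j \<le> j - 1" using False by arith
    then show ?thesis by (simp only: a_def if_False) simp
   qed
   then show ?thesis unfolding l sum.remove[OF finite_lessThan k] r using False by (simp add: \<phi>_def S_def)
  qed
 qed
 then show ?thesis unfolding chain.main_def main'_def dropped_def sum.distrib[symmetric] by (intro sum.cong) auto
qed

text \<open>A centred sum of r + 1 independent terms of size 1 / n, hence of order sqrt r / n, which
  \<open>rate_bounds\<close> places below the scale of the fluctuations.\<close>

lemma dropped_L1: "L1_le chain.rows dropped (2 * (chain.\<kappa> * chain.\<eta>))"
proof -
 let ?f = "\<lambda>j p. if 1 \<le> j then sq1 (S j p) else 0"
 let ?a = "\<lambda>j. (1 - chain.w j) * (- \<gamma> / real n)"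
 have f: "L2_le Q (?f j) 2 \<and> (\<integral>p. ?f j p \<partial>Q) = 0" if j: "j < Suc r" for j
 proof (cases "j = 0")
  case False
  then have k: "j - 1 < n" using j rn by simp
  have e: "?f j = (\<lambda>p. sq1 (fst p (j - 1)))" using False by (simp add: S_def fun_eq_iff)
  have "(\<integral>x. sq1 (x (j - 1)) \<partial>G.rows) = 0"
   using G.L1_le_past_mult(2)[OF k G.P.L1_le_const[of 1] _ std_normal_L1(5)] sq1_moments(2) by (simp add: past_def)
  then show ?thesis unfolding e using L2_fst[OF G.L2_le_row[OF k std_normal_L1(1)]]
   integral_fst_Q[OF G.L1_le_row[OF k std_normal_L1(5)]] by simp
 qed (auto intro: L2_le_weaken[OF L2_le_0])
 have "L2_le chain.rows (\<lambda>x. \<Sum>j<Suc r. ?a j * ?f j (x j)) (\<Sum>j<Suc r. (?a j)^2 * 2)" using f by (intro chain.weighted_sum_L2) auto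
 moreover have "(\<Sum>j<Suc r. (?a j)^2 * 2) \<le> 2 * real r * ((1 / real n)^2 * 2)"
 proof (rule chain.sum_le_2r)
  fix j assume "j < Suc r"
  then have j: "j \<le> r" by simp
  have w: "0 < chain.w j" "chain.w j \<le> 1" using chain.w_bounds[OF j] order_trans[of "chain.w j" "1 / (real r + 1)" 1] by auto
  have "\<bar>?a j\<bar> \<le> 1 * (1 / real n)" unfolding abs_mult using w \<gamma> by (intro mult_mono) auto
  then have "\<bar>?a j\<bar>\<^sup>2 \<le> (1 / real n)^2" by (intro power_mono) auto
  then show "(?a j)^2 * 2 \<le> (1 / real n)^2 * 2" unfolding power2_abs by (rule mult_right_mono) simp
 qed auto
 ultimately have "L2_le chain.rows dropped (2 * real r * ((1 / real n)^2 * 2))" unfolding dropped_def[abs_def] by (rule L2_le_weaken)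
 from chain.P.L2_le_imp_L1_le[OF this] have "L1_le chain.rows dropped (sqrt (2 * real r * ((1 / real n)^2 * 2)))" .
 moreover have "sqrt (2 * real r * ((1 / real n)^2 * 2)) = 2 * (sqrt r / real n)"
  by (rule real_sqrt_unique) (auto simp: power_mult_distrib power_divide)
 ultimately show ?thesis using chain.rate_bounds(3) by (elim L1_le_weaken) simp
qed

section \<open>The variance of the linear part\<close>

lemma row_square_sum: "j \<le> r ==> (\<Sum>k<n. ((if j \<le> k then im j else 0) - \<gamma> / real n)^2) = im j - \<gamma> / real n"
proof -
 assume j: "j \<le> r"
 let ?f = "\<lambda>k. ((if j \<le> k then im j else 0) - \<gamma> / real n)^2"
 have "{..<n} = {..<j} \<union> {j..<n}" using j rn by auto
 then have "(\<Sum>k<n. ?f k) = (\<Sum>k<j. ?f k) + (\<Sum>k\<in>{j..<n}. ?f k)" by (simp add: sum.union_disjoint ivl_disj_int)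
 also have "(\<Sum>k<j. ?f k) = real j * (\<gamma> / real n)^2" by simp
 also have "(\<Sum>k\<in>{j..<n}. ?f k) = (real n - real j) * (im j - \<gamma> / real n)^2" using j rn by (simp add: of_nat_diff)
 also have "real j * (\<gamma> / real n)^2 + (real n - real j) * (im j - \<gamma> / real n)^2 = im j - \<gamma> / real n"
 proof -
  have g: "\<gamma>^2 = \<gamma>" using \<gamma> by auto
  have m: "(real n - real j) * im j = 1" using j rn by (simp add: im_def)
  have "real j * (\<gamma> / real n)^2 + (real n - real j) * (im j - \<gamma> / real n)^2
    = ((real n - real j) * im j) * im j - 2 * ((real n - real j) * im j) * (\<gamma> / real n) + real n * (\<gamma> / real n)^2"
  proof -
   have "J * g^2 + (N - J) * (i - g)^2 = ((N - J) * i) * i - 2 * ((N - J) * i) * g + N * g^2" for J N i g :: real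
    by (simp add: power2_eq_square algebra_simps)
   then show ?thesis by blast
  qed
  also have "real n * (\<gamma> / real n)^2 = \<gamma> / real n" using n0 g by (simp add: power_divide power2_eq_square)
  finally show ?thesis unfolding m by simp
 qed
 finally show ?thesis .
qed

lemma v_row: "j \<le> r ==> (\<Sum>k<n. v j k) =
 (if j = 0 then 0 else (chain.b j)^2) + 2 * (1 - chain.w j)^2 * (im j - \<gamma> / real n - (if j = 0 then 0 else \<gamma> / (real n)^2))"
proof -
 assume j: "j \<le> r"
 let ?f = "\<lambda>k. ((if j \<le> k then im j else 0) - \<gamma> / real n)^2"
 have va: "2 * (a j k)^2 = 2 * (1 - chain.w j)^2 * ?f k" for k by (simp add: a_def power_mult_distrib)
 show ?thesis
 proof (cases "j = 0")
  case True
  have "(\<Sum>k<n. v j k) = 2 * (1 - chain.w j)^2 * (\<Sum>k<n. ?f k)" using True va unfolding v_def sum_distrib_left by simp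
  then show ?thesis using row_square_sum[OF j] True by simp
 next
  case False
  then have k: "j - 1 \<in> {..<n}" using j rn by simp
  have "(\<Sum>k\<in>{..<n} - {j - 1}. v j k) = 2 * (1 - chain.w j)^2 * (\<Sum>k\<in>{..<n} - {j - 1}. ?f k)"
   unfolding sum_distrib_left by (intro sum.cong) (auto simp: v_def va)
  also have "(\<Sum>k\<in>{..<n} - {j - 1}. ?f k) = (\<Sum>k<n. ?f k) - ?f (j - 1)" using sum.remove[OF finite_lessThan k, of ?f] by simp
  also have "?f (j - 1) = \<gamma> / (real n)^2" using False \<gamma> by (auto simp: power_divide)
  finally have "(\<Sum>k\<in>{..<n} - {j - 1}. v j k) = 2 * (1 - chain.w j)^2 * (im j - \<gamma> / real n - \<gamma> / (real n)^2)"
   unfolding row_square_sum[OF j] .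
  then show ?thesis unfolding sum.remove[OF finite_lessThan k, of "v j"] using False by (simp add: v_def)
 qed
qed

text \<open>What is neglected adds up to O(1 / n) over the r + 1 rows: (b j)^2 is of order 1 / (r
  n), the dropped coordinate contributes 1 / n^2, and the factor (1 - w j)^2 differs from 1 by at
  most 2 / (r + 1) against entries of order 1 / n.\<close>

lemma V_approx: "\<bar>V - (2 * (\<Sum>j<Suc r. im j) - 2 * \<gamma> * (real r + 1) / real n)\<bar> \<le> 16 * Cc / real n"
proof -
 have "\<bar>(\<Sum>k<n. v j k) - (2 * im j - 2 * \<gamma> / real n)\<bar> \<le> 4 * Cc / (real r * real n) + 2 / (real n)^2 + 4 / (real r + 1) * (D / real n)"
  if j: "j < Suc r" for j
 proof -
  have jr: "j \<le> r" using j by simp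
  have w: "0 < chain.w j" "chain.w j \<le> 1 / (real r + 1)" using chain.w_bounds[OF jr] by auto
  have w1: "chain.w j \<le> 1" using w(2) order_trans[of "chain.w j" "1 / (real r + 1)" 1] by auto
  let ?z = "if j = 0 then 0 else \<gamma> / (real n)^2"
  let ?b = "if j = 0 then 0 else (chain.b j)^2"
  let ?W = "(1 - chain.w j)^2"
  have eq: "(\<Sum>k<n. v j k) - (2 * im j - 2 * \<gamma> / real n) = ?b - 2 * ?W * ?z - 2 * (1 - ?W) * (im j - \<gamma> / real n)"
   unfolding v_row[OF jr] by (simp add: algebra_simps)
  have 1: "0 \<le> ?b" "?b \<le> 4 * Cc / (real r * real n)" using chain.b_sq[OF jr] Cc1 by auto
  have W: "0 \<le> ?W" "?W \<le> 1" using w(1) w1 by (auto simp: power_le_one)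
  have "2 * ?W * ?z \<le> 2 * 1 * (1 / (real n)^2)" using W \<gamma> by (intro mult_mono) auto
  moreover have "0 \<le> 2 * ?W * ?z" using W \<gamma> by auto
  ultimately have 2: "0 \<le> 2 * ?W * ?z" "2 * ?W * ?z \<le> 2 / (real n)^2" by auto
  have "1 - ?W \<le> 2 * chain.w j" by (simp add: power2_eq_square algebra_simps)
  then have W2: "1 - ?W \<le> 2 / (real r + 1)" using w(2) by simp
  have "1 / real n \<le> im j" using jr rn by (simp add: im_def divide_simps)
  then have "0 \<le> im j - \<gamma> / real n" "im j - \<gamma> / real n \<le> D / real n" using \<gamma> im_le[OF jr] im_pos[OF jr] n0
   by (auto intro: order_trans[OF _ im_le[OF jr]])
  moreover from this have "2 * (1 - ?W) * (im j - \<gamma> / real n) \<le> 2 * (2 / (real r + 1)) * (D / real n)"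
   using W W2 by (intro mult_mono) simp_all
  ultimately have "2 * (1 - ?W) * (im j - \<gamma> / real n) \<le> 2 * (2 / (real r + 1)) * (D / real n)" "0 \<le> 2 * (1 - ?W) * (im j - \<gamma> / real n)"
   using W(2) by (auto intro!: mult_nonneg_nonneg)
  then have 3: "0 \<le> 2 * (1 - ?W) * (im j - \<gamma> / real n)" "2 * (1 - ?W) * (im j - \<gamma> / real n) \<le> 4 / (real r + 1) * (D / real n)" by auto
  show ?thesis unfolding eq using 1 2 3 by linarith
 qed
 then have "\<bar>\<Sum>j<Suc r. (\<Sum>k<n. v j k) - (2 * im j - 2 * \<gamma> / real n)\<bar>
   \<le> (\<Sum>j<Suc r. 4 * Cc / (real r * real n) + 2 / (real n)^2 + 4 / (real r + 1) * (D / real n))"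
  by (intro order_trans[OF sum_abs] sum_mono) auto
 also have "... = (real r + 1) * (4 * Cc / (real r * real n)) + (real r + 1) * (2 / (real n)^2) + (real r + 1) * (4 / (real r + 1) * (D / real n))"
  by (simp only: sum_constant card_lessThan of_nat_Suc distrib_left) (simp only: add.commute)
 also have "... \<le> 8 * Cc / real n + 2 / real n + 4 * D / real n"
 proof (intro add_mono)
  have "(real r + 1) * (4 * Cc / (real r * real n)) \<le> (2 * real r) * (4 * Cc / (real r * real n))"
   using r1 Cc1 by (intro mult_right_mono) auto
  then show "(real r + 1) * (4 * Cc / (real r * real n)) \<le> 8 * Cc / real n" using r1 by simp
  have "(real r + 1) * (2 / (real n)^2) \<le> real n * (2 / (real n)^2)" using rn by (intro mult_right_mono) auto
  then show "(real r + 1) * (2 / (real n)^2) \<le> 2 / real n" using n0 by (simp add: power2_eq_square)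
  show "(real r + 1) * (4 / (real r + 1) * (D / real n)) \<le> 4 * D / real n" by simp
 qed
 also have "... = (8 * Cc + 2 + 4 * D) / real n" by (simp add: add_divide_distrib)
 also have "... \<le> 16 * Cc / real n" using Cc1 Cc_ge(2)[of 1 1] n0 by (intro divide_right_mono) auto
 finally have "\<bar>\<Sum>j<Suc r. (\<Sum>k<n. v j k) - (2 * im j - 2 * \<gamma> / real n)\<bar> \<le> 16 * Cc / real n" .
 moreover have "(\<Sum>j<Suc r. (\<Sum>k<n. v j k) - (2 * im j - 2 * \<gamma> / real n)) = V - (2 * (\<Sum>j<Suc r. im j) - 2 * \<gamma> * (real r + 1) / real n)"
  unfolding sum_subtractf V_def sum_distrib_left[symmetric] by (simp add: algebra_simps del: sum.lessThan_Suc)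
 ultimately show ?thesis by simp
qed

text \<open>For bounded r the error in \<open>V_approx\<close> is of the order of the variance
  itself, so a lower bound is needed separately. The part 1 / n comes from the linear terms, the
  part r^2 / n^2 from the quadratic ones, where even for \<open>\<gamma>\<close> = 1 row j retains
  about j / n^2.\<close>

lemma V_lower: "1 / (D^2 * real n) + real r * (real r - 1) / (4 * (real n)^2) \<le> V"
proof -
 \<comment> \<open>The first term bounds (b j)^2 from below through w j \<ge> 1 / (D (r + 1)) and qb
   j \<ge> j / n; the second bounds the quadratic part, using 1 - w j \<ge> 1/2 and allowing for the
   dropped coordinate.\<close>
 define g where "g j = 4 / (D^2 * (real r + 1)^2 * real n) * real j + (if j = 0 then 0 else (real j - 1) / (2 * (real n)^2))" for j
 have row: "g j \<le> (\<Sum>k<n. v j k)" if j: "j < Suc r" for j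
 proof (cases "j = 0")
  case True
  then show ?thesis by (simp add: g_def sum_nonneg v_nonneg)
 next
  case False
  have jr: "j \<le> r" using j by simp
  have w: "0 < chain.w j" "chain.w j \<le> 1 / (real r + 1)" using chain.w_bounds[OF jr] by auto
  have "1 / (real r + 1) \<le> 1 / 2" using r1 by (intro divide_left_mono) auto
  then have "1 / 2 \<le> 1 - chain.w j" using w by linarith
  then have "(1 / 2)^2 \<le> (1 - chain.w j)^2" by (intro power_mono) auto
  then have W: "1 / 2 \<le> 2 * (1 - chain.w j)^2" by (simp add: power2_eq_square)
  have "1 / (D * (real r + 1)) \<le> chain.w j"
  proof -
   have "real n - real j \<le> D * (real n - real r)" using nD by simp
   then show ?thesis using jr rn D1 by (simp add: chain.w_def chain.lam_def divide_simps mult_ac)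
  qed
  then have "(1 / (D * (real r + 1)))^2 \<le> (chain.w j)^2" using D1 by (intro power_mono) auto
  moreover have "real j / real n \<le> chain.qb j" unfolding chain.qb_def using False jr rn by (intro divide_left_mono) auto
  ultimately have "4 * ((1 / (D * (real r + 1)))^2 * (real j / real n)) \<le> 4 * ((chain.w j)^2 * chain.qb j)"
   by (intro mult_left_mono mult_mono) auto
  then have b: "4 / (D^2 * (real r + 1)^2 * real n) * real j \<le> (chain.b j)^2"
   using chain.qb_nonneg[of j] j by (simp add: chain.b_def power_mult_distrib power_divide)
  have s: "(real j - 1) / (real n)^2 \<le> im j - \<gamma> / real n - \<gamma> / (real n)^2"
  proof -
   have "real j / (real n)^2 \<le> im j - 1 / real n"
   proof -
    have "im j - 1 / real n = real j / (real n * (real n - real j))" using jr rn by (simp add: im_def divide_simps)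
    moreover have "real j / (real n)^2 \<le> real j / (real n * (real n - real j))"
     using jr rn by (intro divide_left_mono) (auto simp: power2_eq_square)
    ultimately show ?thesis by simp
   qed
   note jm = this
   from \<gamma> show ?thesis
   proof (elim disjE)
    assume g: "\<gamma> = 0"
    have "real j / (real n)^2 - 1 / (real n)^2 \<le> real j / (real n)^2" by simp
    also note jm
    also have "im j - 1 / real n \<le> im j" by simp
    finally show ?thesis using g by (simp add: diff_divide_distrib)
   qed (use jm in \<open>simp add: diff_divide_distrib\<close>)
  qed
  have s0: "0 \<le> (real j - 1) / (real n)^2" using False by simp
  have "1 / 2 * ((real j - 1) / (real n)^2) \<le> 2 * (1 - chain.w j)^2 * (im j - \<gamma> / real n - \<gamma> / (real n)^2)"
   using W s s0 by (intro mult_mono) auto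
  then show ?thesis unfolding v_row[OF jr] g_def using b False by simp
 qed
 have gs: "(\<Sum>j<Suc m. g j) = 4 / (D^2 * (real r + 1)^2 * real n) * (real m * (real m + 1) / 2) + (real m * (real m - 1) / 2) / (2 * (real n)^2)" for m
 proof (induction m)
  case (Suc m)
  define p where "p = 4 / (D^2 * (real r + 1)^2 * real n)"
  define q where "q = 2 * (real n)^2"
  define y where "y = real m"
  have 1: "p * (y * (y + 1) / 2) + p * (y + 1) = p * ((y + 1) * (y + 1 + 1) / 2)" by (simp add: field_simps)
  have "y * (y - 1) / 2 + y = (y + 1) * (y + 1 - 1) / 2" by (simp add: field_simps)
  then have 2: "(y * (y - 1) / 2) / q + y / q = ((y + 1) * (y + 1 - 1) / 2) / q" by (simp only: add_divide_distrib[symmetric])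
  have gm: "g (Suc m) = p * (y + 1) + y / q" by (simp add: g_def p_def q_def y_def add.commute)
  have "(\<Sum>j<Suc (Suc m). g j) = (p * (y * (y + 1) / 2) + (y * (y - 1) / 2) / q) + (p * (y + 1) + y / q)"
   unfolding sum.lessThan_Suc[of g "Suc m"] gm Suc.IH p_def q_def y_def ..
  also have "... = p * ((y + 1) * (y + 1 + 1) / 2) + ((y + 1) * (y + 1 - 1) / 2) / q" using 1 2 by linarith
  also have "y + 1 = real (Suc m)" by (simp add: y_def)
  finally show ?case unfolding p_def q_def .
 qed (simp add: g_def)
 have "1 / (D^2 * real n) \<le> 4 / (D^2 * (real r + 1)^2 * real n) * (real r * (real r + 1) / 2)"
 proof -
  have "4 / (D^2 * (real r + 1)^2 * real n) * (real r * (real r + 1) / 2) = (2 * real r / (real r + 1)) * (1 / (D^2 * real n))"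
   by (simp add: divide_simps power2_eq_square)
  moreover have "1 * (1 / (D^2 * real n)) \<le> (2 * real r / (real r + 1)) * (1 / (D^2 * real n))"
   using r1 by (intro mult_right_mono) (simp add: pos_le_divide_eq, simp)
  ultimately show ?thesis by simp
 qed
 then have "1 / (D^2 * real n) + real r * (real r - 1) / (4 * (real n)^2) \<le> (\<Sum>j<Suc r. g j)" unfolding gs by simp
 also have "... \<le> V" unfolding V_def using row by (intro sum_mono) auto
 finally show ?thesis .
qed

lemma V_pos: "0 < V"
proof -
 have "0 < 1 / (D^2 * real n)" using D1 n0 by simp
 moreover have "0 \<le> real r * (real r - 1) / (4 * (real n)^2)" using r1 by simp
 ultimately show ?thesis using V_lower by linarith
qed

lemma \<kappa>_le_V: "chain.\<kappa> \<le> 4 * D * sqrt V"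
proof (rule power2_le_imp_le)
 have "(chain.\<kappa>)^2 \<le> 2 * (1 / sqrt n)^2 + 2 * (real r / real n)^2" unfolding chain.\<kappa>_def by (rule square_sum_le)
 also have "... = 2 * (1 / real n) + 2 * ((real r)^2 / (real n)^2)" using n0 by (simp add: power_divide)
 also have "(real r)^2 \<le> 2 * (real r * (real r - 1)) + 1"
  using zero_le_power2[of "real r - 1"] by (simp add: power2_eq_square algebra_simps)
 then have "(real r)^2 / (real n)^2 \<le> (2 * (real r * (real r - 1)) + 1) / (real n)^2" by (rule divide_right_mono) simp
 also have "... = 2 * (real r * (real r - 1) / (real n)^2) + 1 / (real n)^2" by (simp add: add_divide_distrib)
 finally have 1: "(chain.\<kappa>)^2 \<le> 2 * (1 / real n) + 2 * (2 * (real r * (real r - 1) / (real n)^2) + 1 / (real n)^2)" by simp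
 have 2: "1 / (real n)^2 \<le> 1 / real n" using n1 by (simp add: power2_eq_square divide_simps)
 let ?x = "real r * (real r - 1) / (real n)^2"
 have x: "0 \<le> ?x" using r1 by simp
 have "16 * D^2 * (1 / (D^2 * real n) + real r * (real r - 1) / (4 * (real n)^2)) = 16 * (1 / real n) + 4 * (D^2 * ?x)"
  using D1 n0 by (simp add: distrib_left)
 then have 3: "16 * (1 / real n) + 4 * (D^2 * ?x) \<le> 16 * D^2 * V" using mult_left_mono[OF V_lower, of "16 * D^2"] by simp
 have 4: "?x \<le> D^2 * ?x" using mult_right_mono[OF one_le_power[OF D1, of 2] x] by simp
 have "2 * (1 / real n) + 2 * (2 * ?x + 1 / (real n)^2) \<le> 2 * (1 / real n) + 2 * (2 * (D^2 * ?x) + 1 / real n)"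
  by (intro add_mono mult_left_mono 2 4) auto
 also have "... = 4 * (1 / real n) + 4 * (D^2 * ?x)" by (simp add: distrib_left)
 also have "... \<le> 16 * (1 / real n) + 4 * (D^2 * ?x)" by (intro add_right_mono mult_right_mono) auto
 finally have "(chain.\<kappa>)^2 \<le> 16 * D^2 * V" by (intro order_trans[OF 1] order_trans[OF _ 3])
 then show "(chain.\<kappa>)^2 \<le> (4 * D * sqrt V)^2" using V_pos by (simp add: power_mult_distrib)
qed (use D1 V_pos in auto)

text \<open>Up to an additive constant, the logarithm of the squared volume when no truncation is
  active, see \<open>good_vol\<close>. \<open>shift\<close> is the mean of its nonlinear
  part.\<close>

definition logvol :: "(nat => (nat => real) \<times> 'a) => real" where
 "logvol x = (\<Sum>j<Suc r. lin j (x j) + \<zeta> j (x j)) + ln (chain.q (Suc r) x / chain.qb (Suc r))"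

definition shift :: real where "shift = (\<Sum>j<Suc r. \<integral>y. \<zeta> j y \<partial>Q)"

lemma row_comp: "k < n ==> j \<le> r ==> (\<lambda>x. fst (x j) k) \<in> borel_measurable chain.rows" by (rule chain.row_meas[where \<xi>="\<lambda>p. fst p k"])
   (auto intro!: measurable_compose[OF measurable_fst] G.measurable_row_fun[of k "\<lambda>y. y"])

lemma main'_meas: "main' \<in> borel_measurable chain.rows"
proof -
 have "\<phi> j k \<in> borel_measurable borel" for j k unfolding \<phi>_def[abs_def] sq1_def[abs_def] by (cases "1 \<le> j \<and> k = j - 1") simp_all
 then show ?thesis unfolding main'_def[abs_def] by (intro borel_measurable_sum measurable_compose[OF row_comp]) auto
qed

lemma logvol_meas: "logvol \<in> borel_measurable chain.rows"
proof -
 have [measurable]: "chain.q (Suc r) \<in> borel_measurable chain.rows" by (rule chain.q_meas) simp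
 have s: "(\<lambda>x. \<Sum>j<Suc r. lin j (x j) + \<zeta> j (x j)) \<in> borel_measurable chain.rows"
  by (intro borel_measurable_sum borel_measurable_add chain.row_meas meas2) auto
 have "(\<lambda>x. ln (chain.q (Suc r) x / chain.qb (Suc r))) \<in> borel_measurable chain.rows" by measurable
 from borel_measurable_add[OF s this] show ?thesis unfolding logvol_def[abs_def] .
qed

lemma logvol_deviation:
 assumes \<delta>: "\<delta> > 0"
 shows "chain.P.prob {x \<in> space chain.rows. \<delta> * sqrt V \<le> \<bar>logvol x - shift - main' x\<bar>}
  \<le> (chain_const Cc + 2) * chain.\<eta> * (8 * D / \<delta> + 1)"
proof -
 define \<epsilon> where "\<epsilon> = \<delta> / (8 * D)"
 have \<epsilon>: "\<epsilon> > 0" using \<delta> D1 by (simp add: \<epsilon>_def)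
 have [measurable]: "main' \<in> borel_measurable chain.rows" "logvol \<in> borel_measurable chain.rows" "dropped \<in> borel_measurable chain.rows"
  by (rule main'_meas logvol_meas L1_leD(1)[OF dropped_L1])+
 have mm: "chain.main = (\<lambda>x. main' x + dropped x)" using main_eq by auto
 let ?A = "{x \<in> space chain.rows. \<epsilon> * chain.\<kappa> \<le> \<bar>logvol x - shift - chain.main x\<bar>}"
 let ?B = "{x \<in> space chain.rows. \<epsilon> * chain.\<kappa> \<le> \<bar>dropped x\<bar>}"
 have "\<epsilon> * chain.\<kappa> \<le> \<epsilon> * (4 * D * sqrt V)" using \<epsilon> by (intro mult_left_mono \<kappa>_le_V) auto
 also have "... = \<delta> * sqrt V / 2" using D1 by (simp add: \<epsilon>_def)
 finally have le: "2 * (\<epsilon> * chain.\<kappa>) \<le> \<delta> * sqrt V" by simp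
 have "{x \<in> space chain.rows. \<delta> * sqrt V \<le> \<bar>logvol x - shift - main' x\<bar>} \<subseteq> ?A \<union> ?B" unfolding mm using le by auto
 then have "chain.P.prob {x \<in> space chain.rows. \<delta> * sqrt V \<le> \<bar>logvol x - shift - main' x\<bar>} \<le> chain.P.prob (?A \<union> ?B)"
  unfolding mm by (intro chain.P.finite_measure_mono) measurable
 also have "... \<le> chain.P.prob ?A + chain.P.prob ?B" unfolding mm by (rule measure_Un_le) measurable
 also have "... \<le> chain_const Cc * chain.\<eta> * (1 / \<epsilon> + 1) + 2 * (chain.\<kappa> * chain.\<eta>) / (\<epsilon> * chain.\<kappa>)"
 proof (rule add_mono)
  show "chain.P.prob ?A \<le> chain_const Cc * chain.\<eta> * (1 / \<epsilon> + 1)"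
   using chain.chain_deviation(1)[OF \<epsilon>] unfolding logvol_def shift_def .
  show "chain.P.prob ?B \<le> 2 * (chain.\<kappa> * chain.\<eta>) / (\<epsilon> * chain.\<kappa>)"
   using \<epsilon> chain.\<kappa>_pos by (intro chain.P.L1_le_Markov[OF dropped_L1]) simp
 qed
 also have "2 * (chain.\<kappa> * chain.\<eta>) / (\<epsilon> * chain.\<kappa>) = 2 * chain.\<eta> * (1 / \<epsilon>)" using chain.\<kappa>_pos by simp
 also have "2 * chain.\<eta> * (1 / \<epsilon>) \<le> 2 * chain.\<eta> * (1 / \<epsilon> + 1)" using chain.\<eta>_pos by (intro mult_left_mono) auto
 finally show ?thesis by (simp add: \<epsilon>_def algebra_simps)
qed

end

subsection \<open>Approximation of the volume\<close>

text \<open>\<open>c p\<close> is the factor taking the Gaussian vector \<open>fst p\<close> to a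
  point of the model. The condition \<open>scale\<close> identifies L0 c^2 times the squared
  Gaussian norm (normalised by n, or replaced by 1 when \<open>\<gamma>\<close> = 0) with 1 - t;
  \<open>L0\<close> is 1 in the Gaussian model and n in the others.\<close>

locale volume_rows = gaussian_rows n r D K \<gamma> M2 t
 for n r :: nat and D K \<gamma> :: real and M2 :: "(nat => real) measure" and t :: "(nat => real) => real" +
 fixes \<mu> :: "(nat => real) measure" and c :: "(nat => real) \<times> (nat => real) => real" and L0 :: real
 assumes \<mu>: "rotation_invariant_law \<mu> n" and L0: "0 < L0"
  and scaled_meas: "(\<lambda>p. vscale n (c p) (fst p)) \<in> Q \<rightarrow>\<^sub>M lebesgue_Rn n"
  and scaled_law: "distr Q (lebesgue_Rn n) (\<lambda>p. vscale n (c p) (fst p)) = \<mu>"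
  and scale: "AE p in Q. 1 / 2 \<le> 1 + e p \<longrightarrow> t (snd p) \<le> 1 / 2 \<longrightarrow> 0 < c p \<and> L0 * (c p)^2 * (1 + e p) = 1 - t (snd p)"
begin

sublocale \<mu>: rotation_invariant_law \<mu> n by (rule \<mu>)

definition vv :: "(nat => (nat => real) \<times> (nat => real)) => nat => nat => real" where
 "vv x j = vscale n (c (x j)) (fst (x j))"

text \<open>None of the truncations at 1/2 is active in this row.\<close>

definition good_row :: "nat => (nat => real) \<times> (nat => real) => bool" where
 "good_row j p \<longleftrightarrow> 1 / 2 \<le> 1 + d j p \<and> 1 / 2 \<le> 1 + e p \<and> t (snd p) \<le> 1 / 2"

definition good :: "(nat => (nat => real) \<times> (nat => real)) => bool" where
 "good x \<longleftrightarrow> (\<forall>j<Suc r. good_row j (x j))"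

definition scaled :: "(nat => real) \<times> (nat => real) => bool" where
 "scaled p \<longleftrightarrow> 0 < c p \<and> L0 * (c p)^2 * (1 + e p) = 1 - t (snd p)"

lemma AE_scaled: "AE x in chain.rows. good x \<longrightarrow> (\<forall>j<Suc r. scaled (x j))"
proof -
 have "AE x in chain.rows. good_row j (x j) \<longrightarrow> scaled (x j)" if "j < Suc r" for j
 proof (rule AE_PiM_component[where M="\<lambda>_. Q" and I="{..<Suc r}"])
  show "AE p in Q. good_row j p \<longrightarrow> scaled p" using scale by eventually_elim (auto simp: good_row_def scaled_def)
 qed (use that in \<open>auto intro: GM.P.prob_space_axioms\<close>)
 then have "AE x in chain.rows. \<forall>j\<in>{..<Suc r}. good_row j (x j) \<longrightarrow> scaled (x j)" by (intro AE_finite_allI) auto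
 then show ?thesis by eventually_elim (auto simp: good_def)
qed

lemma good_row_facts:
 assumes j: "j < Suc r" and g: "good_row j p" and sc: "scaled p"
 shows "tail_sq n j (vscale n (c p) (fst p)) = (c p)^2 * (1 + d j p) / im j" "0 < 1 + d j p" "0 < im j"
  "\<iota> j p = im j / (1 + d j p)" "\<pi> p = 1 / (L0 * (c p)^2)" "0 < c p"
  "ln ((c p)^2 * (1 + d j p) / im j) = lin j p + \<zeta> j p - ln L0 - ln (im j)"
proof -
 have jr: "j \<le> r" and jn: "j < n" using j rn by auto
 have b: "1 / 2 \<le> 1 + d j p" "1 / 2 \<le> 1 + e p" "t (snd p) \<le> 1 / 2" using g by (auto simp: good_row_def)
 have cp: "0 < c p" and eqn: "L0 * (c p)^2 * (1 + e p) = 1 - t (snd p)" using sc by (auto simp: scaled_def)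
 show "0 < c p" by (rule cp)
 show d0: "0 < 1 + d j p" using b by linarith
 have e0: "0 < 1 + e p" using b by linarith
 have t0: "0 < 1 - t (snd p)" using b by linarith
 show im0: "0 < im j" by (rule im_pos[OF jr])
 have "G.csum j n (fst p) = tail_sq n j (fst p) - (real n - real j)"
  using jn by (simp add: G.csum_def tail_sq_def sq1_def sum_subtractf of_nat_diff)
 moreover have "im j * (real n - real j) = 1" using jn by (simp add: im_def)
 ultimately have "1 + d j p = im j * tail_sq n j (fst p)" by (simp add: d_def right_diff_distrib)
 then have T: "tail_sq n j (fst p) = (1 + d j p) / im j" using im0 by simp
 have "tail_sq n j (vscale n (c p) (fst p)) = (c p)^2 * tail_sq n j (fst p)"
  by (simp add: tail_sq_def vscale_def power_mult_distrib sum_distrib_left)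
 then show "tail_sq n j (vscale n (c p) (fst p)) = (c p)^2 * (1 + d j p) / im j" unfolding T by simp
 have m: "max (1 + d j p) (1 / 2) = 1 + d j p" "max (1 + e p) (1 / 2) = 1 + e p" "max (1 - t (snd p)) (1 / 2) = 1 - t (snd p)"
  using b by auto
 show "\<iota> j p = im j / (1 + d j p)" using jr by (simp add: \<iota>_def h_def m)
 show "\<pi> p = 1 / (L0 * (c p)^2)" unfolding \<pi>_def rho_def m unfolding eqn[symmetric] using e0 L0 cp by simp
 have "ln (L0 * (c p)^2 * (1 + e p)) = ln L0 + ln ((c p)^2) + ln (1 + e p)" using L0 cp e0 by (simp add: ln_mult)
 then have "ln ((c p)^2) = ln (1 - t (snd p)) - ln L0 - ln (1 + e p)" unfolding eqn by simp
 moreover have "ln ((c p)^2 * (1 + d j p) / im j) = ln ((c p)^2) + ln (1 + d j p) - ln (im j)"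
  using cp d0 im0 by (simp add: ln_mult ln_div)
 ultimately show "ln ((c p)^2 * (1 + d j p) / im j) = lin j p + \<zeta> j p - ln L0 - ln (im j)" unfolding lin_def \<zeta>_def m by simp
qed

text \<open>With l^2 = \<open>L0\<close>, w^2 the normalised chain and c' the scaling factor of the
  row, the step of \<open>chain_dual\<close> is \<open>L0\<close> times the step of
  \<open>chain.q\<close>.\<close>

lemma dual_step:
 fixes l w s' \<iota>' c' :: real
 assumes "0 < l" "0 < c'" "0 < T"
 shows "l^2 * (w^2 + ((1 / (l^2 * c'^2)) * (1 / T) - 2 * (s' * (1 / (l * c') * (1 / T))) * w + s'^2 * (1 / T) * w^2))
  = l^2 * w^2 + (1 - l * w * (c' * s'))^2 / (c'^2 * T)"
 using assms by (simp add: divide_simps power2_eq_square) (simp add: algebra_simps)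

lemma good_dual:
 assumes g: "good x" and sc: "\<forall>j<Suc r. scaled (x j)"
 shows "j \<le> Suc r ==> chain_dual n (vv x) j = L0 * chain.q j x"
proof (induction j)
 case (Suc j)
 then have j: "j < Suc r" and jn: "j - 1 < n" using rn by auto
 have gr: "good_row j (x j)" "scaled (x j)" using g sc j by (auto simp: good_def)
 note f = good_row_facts[OF j gr]
 let ?p = "x j"
 define l where "l = sqrt L0"
 define w where "w = sqrt (chain.q j x)"
 define T where "T = (1 + d j ?p) / im j"
 have l: "0 < l" "L0 = l^2" using L0 by (auto simp: l_def)
 have w: "chain.q j x = w^2" "0 \<le> w" using chain.q_nonneg[of j x] by (auto simp: w_def)
 have T: "0 < T" using f(2,3) by (simp add: T_def)
 have i: "\<iota> j ?p = 1 / T" unfolding f(4) T_def by simp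
 have p: "\<pi> ?p = 1 / (l^2 * (c ?p)^2)" unfolding f(5) l(2) by simp
 have sp: "sqrt (\<pi> ?p) = 1 / (l * c ?p)" unfolding p using l f(6) by (simp add: real_sqrt_divide real_sqrt_mult)
 \<comment> \<open>In row 0 the coordinate and \<open>S\<close> differ, but the chain is at 0 and w
   = 0.\<close>
 have Sw: "S j ?p * w = fst ?p (j - 1) * w" by (cases "j = 0") (auto simp: S_def w_def)
 have v: "vv x j (j - 1) = c ?p * fst ?p (j - 1)" using jn by (simp add: vv_def vscale_def)
 have t: "tail_sq n j (vv x j) = (c ?p)^2 * T" unfolding vv_def f(1) T_def by simp
 have IH: "chain_dual n (vv x) j = l^2 * w^2" using Suc w l by simp
 have "sqrt (l^2 * w^2) = l * w" using l w by (simp add: real_sqrt_mult)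
 then have L: "chain_dual n (vv x) (Suc j) = l^2 * w^2 + (1 - l * w * (c ?p * fst ?p (j - 1)))^2 / ((c ?p)^2 * T)"
  unfolding chain_dual.simps IH v t by simp
 have sk: "S j ?p * k * w = fst ?p (j - 1) * k * w" for k
 proof -
  have "S j ?p * k * w = (S j ?p * w) * k" by (simp only: mult_ac)
  also have "... = fst ?p (j - 1) * k * w" unfolding Sw by (simp only: mult_ac)
  finally show ?thesis .
 qed
 have e1: "S j ?p * (sqrt (\<pi> ?p) * \<iota> j ?p) * w = fst ?p (j - 1) * (1 / (l * c ?p) * (1 / T)) * w" unfolding sp i by (rule sk)
 have e2: "(S j ?p)^2 * \<iota> j ?p * w^2 = (fst ?p (j - 1))^2 * (1 / T) * w^2"
 proof -
  have "(S j ?p)^2 * (1 / T) * w^2 = (S j ?p * w)^2 * (1 / T)" by (simp only: power_mult_distrib mult_ac)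
  also have "... = (fst ?p (j - 1))^2 * (1 / T) * w^2" unfolding Sw by (simp only: power_mult_distrib mult_ac)
  finally show ?thesis unfolding i .
 qed
 have "chain.q (Suc j) x = w^2 + (\<pi> ?p * \<iota> j ?p - 2 * (S j ?p * (sqrt (\<pi> ?p) * \<iota> j ?p) * w) + (S j ?p)^2 * \<iota> j ?p * w^2)"
  unfolding chain.q.simps \<alpha>_def \<beta>_def w(1)[symmetric] w_def[symmetric] by simp
 then have "chain.q (Suc j) x = w^2 + ((1 / (l^2 * (c ?p)^2)) * (1 / T) - 2 * (fst ?p (j - 1) * (1 / (l * c ?p) * (1 / T))) * w + (fst ?p (j - 1))^2 * (1 / T) * w^2)"
  unfolding e1 e2 unfolding p i by (simp add: mult.assoc)
 then show ?case unfolding L l(2) using dual_step[OF l(1) f(6) T, of w "fst ?p (j - 1)"] by metis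
qed simp

lemma good_prod:
 assumes g: "good x" and sc: "\<forall>j<Suc r. scaled (x j)"
 shows "j \<le> Suc r ==> 0 < chain_prod n (vv x) j \<and>
  ln (chain_prod n (vv x) j) = (\<Sum>i<j. lin i (x i) + \<zeta> i (x i)) - (\<Sum>i<j. ln L0 + ln (im i))"
proof (induction j)
 case (Suc j)
 then have j: "j < Suc r" by simp
 have gr: "good_row j (x j)" "scaled (x j)" using g sc j by (auto simp: good_def)
 note f = good_row_facts[OF j gr]
 have T: "tail_sq n j (vv x j) = (c (x j))^2 * (1 + d j (x j)) / im j" unfolding vv_def by (rule f(1))
 have T0: "0 < (c (x j))^2 * (1 + d j (x j)) / im j" using f(2,3,6) by simp
 have IH: "0 < chain_prod n (vv x) j" "ln (chain_prod n (vv x) j) = (\<Sum>i<j. lin i (x i) + \<zeta> i (x i)) - (\<Sum>i<j. ln L0 + ln (im i))"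
  using Suc by auto
 have "ln (chain_prod n (vv x) (Suc j)) = ln (chain_prod n (vv x) j) + ln ((c (x j))^2 * (1 + d j (x j)) / im j)"
  unfolding chain_prod.simps T by (rule ln_mult_pos[OF IH(1) T0])
 moreover have "0 < chain_prod n (vv x) (Suc j)" unfolding chain_prod.simps T by (rule mult_pos_pos[OF IH(1) T0])
 ultimately show ?case unfolding f(7) IH(2) by simp
qed simp

text \<open>Row 0 contributes the positive \<alpha> 0, and later increments are nonnegative.\<close>

lemma good_q_pos:
 assumes g: "good x" and sc: "\<forall>j<Suc r. scaled (x j)"
 shows "0 < chain.q (Suc j) x"
proof (induction j)
 case 0
 have gr: "good_row 0 (x 0)" "scaled (x 0)" using g sc by (auto simp: good_def)
 note f = good_row_facts[OF zero_less_Suc gr]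
 have "chain.q (Suc 0) x = \<alpha> 0 (x 0)" unfolding chain.q.simps by simp
 moreover have "0 < \<alpha> 0 (x 0)" unfolding \<alpha>_def f(4,5) using f(2,3,6) L0 by simp
 ultimately show ?case by simp
next
 case (Suc j)
 have "chain.q (Suc j) x \<le> chain.q (Suc (Suc j)) x"
  using chain.increment_bounds(1)[OF chain.q_nonneg, of "Suc j" "x (Suc j)" "Suc j" x] by (simp only: chain.q.simps(2)[of "Suc j"])
 with Suc show ?case by linarith
qed

definition center :: real where
 "center = ln L0 + ln (chain.qb (Suc r)) - (\<Sum>i<Suc r. ln L0 + ln (im i)) + shift"

definition A :: real where "A = exp (center / 2) / fact r"

definition vol :: "(nat => nat => real) => real" where
 "vol y = sqrt (chain_dual n y (Suc r) * chain_prod n y (Suc r)) / fact r"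

lemma good_vol:
 assumes g: "good x" and sc: "\<forall>j<Suc r. scaled (x j)"
 shows "chain_prod n (vv x) (Suc r) \<noteq> 0" "vol (vv x) = A * exp ((logvol x - shift) / 2)"
proof -
 have P: "0 < chain_prod n (vv x) (Suc r)"
  "ln (chain_prod n (vv x) (Suc r)) = (\<Sum>i<Suc r. lin i (x i) + \<zeta> i (x i)) - (\<Sum>i<Suc r. ln L0 + ln (im i))"
  using good_prod[OF g sc order_refl] by auto
 show "chain_prod n (vv x) (Suc r) \<noteq> 0" by (rule P(1)[THEN less_imp_neq, THEN not_sym])
 have q: "0 < chain.q (Suc r) x" by (rule good_q_pos[OF g sc])
 have qb: "0 < chain.qb (Suc r)" using chain.lam_qb by simp
 have D: "chain_dual n (vv x) (Suc r) = L0 * chain.q (Suc r) x" by (rule good_dual[OF g sc order_refl])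
 have DP: "0 < chain_dual n (vv x) (Suc r) * chain_prod n (vv x) (Suc r)" unfolding D using L0 q P(1) by simp
 have "ln (chain_dual n (vv x) (Suc r) * chain_prod n (vv x) (Suc r)) = ln L0 + ln (chain.q (Suc r) x) + ln (chain_prod n (vv x) (Suc r))"
  by (simp only: D ln_mult_pos[OF mult_pos_pos[OF L0 q] P(1)] ln_mult_pos[OF L0 q])
 also have "... = center + (logvol x - shift)" unfolding P(2) center_def logvol_def using q qb by (simp add: ln_div)
 finally have "chain_dual n (vv x) (Suc r) * chain_prod n (vv x) (Suc r) = exp (center + (logvol x - shift))"
  using DP by (metis exp_ln)
 also have "... = (exp (center / 2) * exp ((logvol x - shift) / 2))^2"
  by (simp add: exp_add[symmetric] exp_double[symmetric] add_divide_distrib diff_divide_distrib distrib_left)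
 finally show "vol (vv x) = A * exp ((logvol x - shift) / 2)" by (simp add: vol_def A_def real_sqrt_abs)
qed

lemma good_row_meas: "j < Suc r ==> {x \<in> space chain.rows. \<not> good_row j (x j)} \<in> sets chain.rows"
proof -
 assume j: "j < Suc r"
 then have jr: "j \<le> r" by simp
 have [measurable]: "(\<lambda>x. d j (x j)) \<in> borel_measurable chain.rows" "(\<lambda>x. e (x j)) \<in> borel_measurable chain.rows"
  "(\<lambda>x. t (snd (x j))) \<in> borel_measurable chain.rows"
  using chain.row_meas[OF jr meas(2)[OF jr]] chain.row_meas[OF jr meas(3)[OF jr]] chain.row_meas[OF jr meas(4)[OF jr]] by simp_all
 show ?thesis unfolding good_row_def by measurable
qed

text \<open>A bad row has |d| or |e| or t above 1/2. Fourth moments of d and e and the second moment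
  of t make this O(1 / n^2) per row, which survives the union over r + 1 \<le> n rows; second
  moments of d and e would not.\<close>

lemma bad_prob: "chain.P.prob {x \<in> space chain.rows. \<not> good x} \<le> Cc / real n" "{x \<in> space chain.rows. \<not> good x} \<in> sets chain.rows"
proof -
 have row: "chain.P.prob {x \<in> space chain.rows. \<not> good_row j (x j)} \<le> Cc / (real n)^2" if j: "j < Suc r" for j
 proof -
  have jr: "j \<le> r" using j by simp
  let ?w = "\<lambda>p. ((d j p)^2)^2 + ((e p)^2)^2 + (t (snd p))^2"
  have "L1_le Q ?w (60 * D^2 / real n ^ 2 + 60 * D^2 / real n ^ 2 + K / real n ^ 2)"
   by (intro L1_le_add L1_le_square d_mom(2)[OF jr] e_mom(2) t_mom(1))
  then have L: "L1_le chain.rows (\<lambda>x. ?w (x j)) (60 * D^2 / real n ^ 2 + 60 * D^2 / real n ^ 2 + K / real n ^ 2)"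
   by (rule chain.L1_le_row[OF j])
  have sub: "{x \<in> space chain.rows. \<not> good_row j (x j)} \<subseteq> {x \<in> space chain.rows. 1 / 16 \<le> \<bar>?w (x j)\<bar>}"
  proof
   fix x assume "x \<in> {x \<in> space chain.rows. \<not> good_row j (x j)}"
   then have x: "x \<in> space chain.rows" and "d j (x j) < - 1 / 2 \<or> e (x j) < - 1 / 2 \<or> 1 / 2 < t (snd (x j))"
    by (auto simp: good_row_def not_le)
   moreover have "1 / 16 \<le> (y^2)^2" if "y < - 1 / 2" for y :: real
   proof -
    have "(1 / 2)^2 \<le> (- y)^2" using that by (intro power_mono) auto
    then have "((1 / 2)^2)^2 \<le> ((- y)^2)^2" by (rule power_mono) simp
    then show ?thesis by (simp add: power2_eq_square)
   qed
   moreover have "1 / 16 \<le> y^2" if "1 / 2 < y" for y :: real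
   proof -
    have "(1 / 2)^2 \<le> y^2" using that by (intro power_mono) auto
    moreover have "(1 / 2)^2 = (1 / 4 :: real)" by (simp add: power2_eq_square)
    ultimately show ?thesis by linarith
   qed
   ultimately have "1 / 16 \<le> ((d j (x j))^2)^2 \<or> 1 / 16 \<le> ((e (x j))^2)^2 \<or> 1 / 16 \<le> (t (snd (x j)))^2" by blast
   moreover have "0 \<le> ((d j (x j))^2)^2" "0 \<le> ((e (x j))^2)^2" "0 \<le> (t (snd (x j)))^2" by auto
   ultimately have "1 / 16 \<le> ?w (x j)" by linarith
   then show "x \<in> {x \<in> space chain.rows. 1 / 16 \<le> \<bar>?w (x j)\<bar>}" using x by simp
  qed
  have [measurable]: "(\<lambda>x. ?w (x j)) \<in> borel_measurable chain.rows" by (rule L1_leD(1)[OF L])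
  have "chain.P.prob {x \<in> space chain.rows. \<not> good_row j (x j)} \<le> chain.P.prob {x \<in> space chain.rows. 1 / 16 \<le> \<bar>?w (x j)\<bar>}"
   by (rule chain.P.finite_measure_mono[OF sub]) measurable
  also have "... \<le> (60 * D^2 / real n ^ 2 + 60 * D^2 / real n ^ 2 + K / real n ^ 2) / (1 / 16)"
   by (rule chain.P.L1_le_Markov[OF L]) simp
  also have "... = (1920 * D^2 + 16 * K) / (real n)^2" by (simp add: add_divide_distrib)
  also have "... \<le> Cc / (real n)^2"
  proof (rule divide_right_mono)
   have "K \<le> D^2 * K" using mult_right_mono[OF one_le_power[OF D1, of 2] K0] by simp
   moreover have "0 \<le> D^2 * K" using K0 by simp
   ultimately have "1920 * D^2 + 16 * K \<le> 1920 * D^2 + 1920 * (D^2 * K)" by linarith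
   also have "... = 1920 * D^2 * (K + 1)" by (simp add: distrib_left)
   also have "... \<le> Cc" by (rule Cc_ge) auto
   finally show "1920 * D^2 + 16 * K \<le> Cc" .
  qed simp
  finally show ?thesis .
 qed
 have eq: "{x \<in> space chain.rows. \<not> good x} = (\<Union>j\<in>{..<Suc r}. {x \<in> space chain.rows. \<not> good_row j (x j)})" by (auto simp: good_def)
 show "{x \<in> space chain.rows. \<not> good x} \<in> sets chain.rows" unfolding eq by (intro sets.finite_UN good_row_meas) auto
 have "chain.P.prob {x \<in> space chain.rows. \<not> good x} \<le> (\<Sum>j\<in>{..<Suc r}. chain.P.prob {x \<in> space chain.rows. \<not> good_row j (x j)})"
  unfolding eq using good_row_meas by (intro chain.P.finite_measure_subadditive_finite) auto
 also have "... \<le> (\<Sum>j\<in>{..<Suc r}. Cc / (real n)^2)" using row by (intro sum_mono) auto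
 also have "... = (real r + 1) * (Cc / (real n)^2)" by simp
 also have "... \<le> real n * (Cc / (real n)^2)" using rn Cc1 by (intro mult_right_mono) auto
 also have "... = Cc / real n" by (simp add: power2_eq_square)
 finally show "chain.P.prob {x \<in> space chain.rows. \<not> good x} \<le> Cc / real n" .
qed

text \<open>Applying the scaling to each row maps the product of \<open>Q\<close> to the product of
  \<open>\<mu>\<close>.\<close>

lemma transfer_rows:
 assumes B: "B \<in> sets borel"
 shows "measure (\<Pi>\<^sub>M i\<in>{..<Suc r}. \<mu>) {y \<in> space (\<Pi>\<^sub>M i\<in>{..<Suc r}. \<mu>). chain_prod n y (Suc r) \<noteq> 0 \<and>
   sqrt (chain_dual n y (Suc r) * chain_prod n y (Suc r)) / fact r \<in> B}
  = chain.P.prob {x \<in> space chain.rows. chain_prod n (vv x) (Suc r) \<noteq> 0 \<and> vol (vv x) \<in> B}"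
  and "{x \<in> space chain.rows. chain_prod n (vv x) (Suc r) \<noteq> 0 \<and> vol (vv x) \<in> B} \<in> sets chain.rows"
proof -
 let ?J = "{..<Suc r}"
 let ?f = "\<lambda>p. vscale n (c p) (fst p)"
 have f: "?f \<in> Q \<rightarrow>\<^sub>M \<mu>" using scaled_meas measurable_cong_sets[OF refl \<mu>.sets_\<mu>, of Q] by simp
 have df: "distr Q \<mu> ?f = \<mu>" using scaled_law distr_cong[OF refl \<mu>.sets_\<mu>, of Q ?f ?f] by simp
 have "distr chain.rows (PiM ?J (\<lambda>_. \<mu>)) (compose ?J ?f) = PiM ?J (\<lambda>_. distr Q \<mu> ?f)"
  by (intro distr_PiM_finite_prob_space' GM.P.prob_space_axioms \<mu>.prob_space_axioms f) auto
 then have law: "distr chain.rows (PiM ?J (\<lambda>_. \<mu>)) (compose ?J ?f) = PiM ?J (\<lambda>_. \<mu>)" unfolding df .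
 have cm: "compose ?J ?f \<in> chain.rows \<rightarrow>\<^sub>M PiM ?J (\<lambda>_. \<mu>)"
 proof (rule measurable_PiM_single')
  fix i assume i: "i \<in> ?J"
  then show "(\<lambda>x. compose ?J ?f x i) \<in> chain.rows \<rightarrow>\<^sub>M \<mu>"
   using measurable_compose[OF chain.measurable_row f, of i] by (simp add: compose_def)
 qed (use measurable_space[OF measurable_compose[OF chain.measurable_row f]] in \<open>auto simp: compose_def\<close>)
 have [measurable]: "(\<lambda>y. chain_prod n y (Suc r)) \<in> borel_measurable (PiM ?J (\<lambda>_. \<mu>))"
  by (rule measurable_chain_prod) (auto intro: \<mu>.PiM_row_measurable)
 have [measurable]: "(\<lambda>y. chain_dual n y (Suc r)) \<in> borel_measurable (PiM ?J (\<lambda>_. \<mu>))"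
  using rn by (intro measurable_chain_dual) (auto intro: \<mu>.PiM_row_measurable)
 let ?E = "{y \<in> space (PiM ?J (\<lambda>_. \<mu>)). chain_prod n y (Suc r) \<noteq> 0 \<and> sqrt (chain_dual n y (Suc r) * chain_prod n y (Suc r)) / fact r \<in> B}"
 have E: "?E \<in> sets (PiM ?J (\<lambda>_. \<mu>))" using B by measurable
 have vv: "compose ?J ?f x i = vv x i" if "i < Suc r" for x i using that by (simp add: compose_def vv_def)
 have cp: "chain_prod n (compose ?J ?f x) (Suc r) = chain_prod n (vv x) (Suc r)" for x by (rule chain_prod_cong) (rule vv)
 have cd: "chain_dual n (compose ?J ?f x) (Suc r) = chain_dual n (vv x) (Suc r)" for x by (rule chain_dual_cong) (rule vv)
 have pre: "compose ?J ?f -` ?E \<inter> space chain.rows = {x \<in> space chain.rows. chain_prod n (vv x) (Suc r) \<noteq> 0 \<and> vol (vv x) \<in> B}"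
  using measurable_space[OF cm] unfolding vol_def by (auto simp: cp cd simp del: chain_prod.simps chain_dual.simps)
 have "measure (PiM ?J (\<lambda>_. \<mu>)) ?E = measure (distr chain.rows (PiM ?J (\<lambda>_. \<mu>)) (compose ?J ?f)) ?E" unfolding law ..
 also have "... = chain.P.prob (compose ?J ?f -` ?E \<inter> space chain.rows)" by (rule measure_distr[OF cm E])
 finally show "measure (PiM ?J (\<lambda>_. \<mu>)) ?E = chain.P.prob {x \<in> space chain.rows. chain_prod n (vv x) (Suc r) \<noteq> 0 \<and> vol (vv x) \<in> B}"
  unfolding pre .
 show "{x \<in> space chain.rows. chain_prod n (vv x) (Suc r) \<noteq> 0 \<and> vol (vv x) \<in> B} \<in> sets chain.rows"
  using measurable_sets[OF cm E] unfolding pre .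
qed

definition err :: "real => real" where
 "err \<delta> = (chain_const Cc + 2) * chain.\<eta> * (8 * D / \<delta> + 1) + 2 * (Cc / real n)"

text \<open>The threshold A exp (sqrt V y / 2) corresponds on good rows to
  \<open>logvol x - shift \<le> sqrt V * y\<close>. Replacing \<open>logvol x - shift\<close> by
  \<open>main'\<close> moves y by \<delta>; \<open>err\<close> collects the deviation probability,
  the bad rows and the degenerate samples.\<close>

lemma cdf_sandwich:
 assumes M: "prob_space M" and ind: "prob_space.indep_vars M (\<lambda>_. lebesgue_Rn n) X {1..r+1}"
  and law: "\<And>i. i \<in> {1..r+1} ==> distr M (lebesgue_Rn n) (X i) = \<mu>" and \<delta>: "\<delta> > 0"
 shows "measure M {w \<in> space M. simplex_volume n r (\<lambda>i. X i w) \<le> A * exp (sqrt V * y / 2)}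
   \<le> chain.P.prob {x \<in> space chain.rows. main' x \<le> sqrt V * (y + \<delta>)} + err \<delta>" (is "?m \<le> _")
  and "chain.P.prob {x \<in> space chain.rows. main' x \<le> sqrt V * (y - \<delta>)} - err \<delta> \<le>
   measure M {w \<in> space M. simplex_volume n r (\<lambda>i. X i w) \<le> A * exp (sqrt V * y / 2)}"
proof -
 interpret M: prob_space M by fact
 let ?v = "\<lambda>w. simplex_volume n r (\<lambda>i. X i w)"
 let ?y = "A * exp (sqrt V * y / 2)"
 let ?R = "chain.rows"
 define E where "E w = (\<Prod>i<Suc r. gs_sq n (\<lambda>i. X (Suc i) w) i)" for w
 note L = \<mu>.simplex_volume_law[OF M rn ind law, folded E_def]
 have [measurable]: "E \<in> borel_measurable M" using L(2)[of UNIV] by (simp add: E_def[abs_def])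
 have X: "X i \<in> M \<rightarrow>\<^sub>M lebesgue_Rn n" if "i \<in> {1..r+1}" for i using ind that by (simp add: M.indep_vars_def2)
 have [measurable]: "?v \<in> borel_measurable M" using rn by (intro measurable_simplex_volume X) auto
 have [measurable]: "main' \<in> borel_measurable ?R" "logvol \<in> borel_measurable ?R" by (rule main'_meas logvol_meas)+
 let ?bad = "{x \<in> space ?R. \<not> good x}"
 let ?G = "{x \<in> space ?R. chain_prod n (vv x) (Suc r) \<noteq> 0 \<and> vol (vv x) \<in> {..?y}}"
 let ?U = "{x \<in> space ?R. chain_prod n (vv x) (Suc r) \<noteq> 0 \<and> vol (vv x) \<in> UNIV}"
 let ?L = "{x \<in> space ?R. logvol x - shift \<le> sqrt V * y}"
 have A0: "0 < A" by (simp add: A_def)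
 have iff: "A * exp ((logvol x - shift) / 2) \<le> ?y \<longleftrightarrow> logvol x - shift \<le> sqrt V * y" for x

 proof -
  have "a / 2 \<le> b / 2 \<longleftrightarrow> a \<le> b" for a b :: real by simp
  then show ?thesis by (simp only: mult_le_cancel_left_pos[OF A0] exp_le_cancel_iff)
 qed
 have Gs: "?G \<in> sets ?R" "?U \<in> sets ?R" by (rule transfer_rows(2), simp)+
 have bs: "?bad \<in> sets ?R" by (rule bad_prob(2))
 have mG: "measure M {w \<in> space M. E w \<noteq> 0 \<and> ?v w \<in> {..?y}} = chain.P.prob ?G"
  using L(1)[of "{..?y}"] transfer_rows(1)[of "{..?y}"] by simp
 have mU: "measure M {w \<in> space M. E w \<noteq> 0 \<and> ?v w \<in> UNIV} = chain.P.prob ?U" using L(1)[of UNIV] transfer_rows(1)[of UNIV] by simp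
 have G_le: "chain.P.prob ?G \<le> chain.P.prob (?L \<union> ?bad)"
 proof (rule chain.P.finite_measure_mono_AE)
  show "AE x in ?R. x \<in> ?G \<longrightarrow> x \<in> ?L \<union> ?bad" using AE_scaled by eventually_elim (use good_vol(2) iff in auto)
 qed (use bs in measurable)
 have G_ge: "chain.P.prob ?L \<le> chain.P.prob (?G \<union> ?bad)"
 proof (rule chain.P.finite_measure_mono_AE)
  show "AE x in ?R. x \<in> ?L \<longrightarrow> x \<in> ?G \<union> ?bad" using AE_scaled by eventually_elim (use good_vol iff in auto)
 qed (use bs Gs in measurable)
 have U_ge: "chain.P.prob (space ?R) \<le> chain.P.prob (?U \<union> ?bad)"
 proof (rule chain.P.finite_measure_mono_AE)
  show "AE x in ?R. x \<in> space ?R \<longrightarrow> x \<in> ?U \<union> ?bad" using AE_scaled by eventually_elim (use good_vol(1) in auto)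
 qed (use bs Gs in measurable)
 have b: "chain.P.prob ?bad \<le> Cc / real n" by (rule bad_prob(1))
 have Lm: "?L \<in> sets ?R" by measurable
 have G_le': "chain.P.prob ?G \<le> chain.P.prob ?L + Cc / real n" using G_le measure_Un_le[OF Lm bs] b by linarith
 have G_ge': "chain.P.prob ?L \<le> chain.P.prob ?G + Cc / real n" using G_ge measure_Un_le[OF Gs(1) bs] b by linarith
 have U_ge': "1 \<le> chain.P.prob ?U + Cc / real n" using U_ge measure_Un_le[OF Gs(2) bs] b chain.P.prob_space by linarith
 \<comment> \<open>Taking all of the reals as the target set, the law of the volume reduces to the
   probability of nondegeneracy, which is at least that of good rows.\<close>
 have E0: "measure M {w \<in> space M. \<not> E w \<noteq> 0} \<le> Cc / real n" using M.prob_neg[of "\<lambda>w. E w \<noteq> 0"] mU U_ge' by simp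
 have m1: "?m \<le> measure M ({w \<in> space M. E w \<noteq> 0 \<and> ?v w \<in> {..?y}} \<union> {w \<in> space M. \<not> E w \<noteq> 0})"
  by (rule M.finite_measure_mono) (auto intro: sets.Un)
 have m1': "?m \<le> chain.P.prob ?G + Cc / real n"
  using m1 measure_Un_le[of "{w \<in> space M. E w \<noteq> 0 \<and> ?v w \<in> {..?y}}" M "{w \<in> space M. \<not> E w \<noteq> 0}"] E0 mG by simp
 have m2: "chain.P.prob ?G \<le> ?m" unfolding mG[symmetric] by (rule M.finite_measure_mono) auto
 let ?D = "{x \<in> space ?R. \<delta> * sqrt V \<le> \<bar>logvol x - shift - main' x\<bar>}"
 have Ds: "?D \<in> sets ?R" by measurable
 note dev = logvol_deviation[OF \<delta>]
 let ?M1 = "{x \<in> space ?R. main' x \<le> sqrt V * (y + \<delta>)}" and ?M2 = "{x \<in> space ?R. main' x \<le> sqrt V * (y - \<delta>)}"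
 have Ms: "?M1 \<in> sets ?R" "?M2 \<in> sets ?R" by measurable
 have "chain.P.prob ?L \<le> chain.P.prob (?M1 \<union> ?D)" by (rule chain.P.finite_measure_mono) (use Ms Ds in \<open>auto simp: algebra_simps\<close>)
 then have u: "chain.P.prob ?L \<le> chain.P.prob ?M1 + chain.P.prob ?D" using measure_Un_le[OF Ms(1) Ds] by linarith
 have "chain.P.prob ?M2 \<le> chain.P.prob (?L \<union> ?D)" by (rule chain.P.finite_measure_mono) (use Lm Ds in \<open>auto simp: algebra_simps\<close>)
 then have l: "chain.P.prob ?M2 \<le> chain.P.prob ?L + chain.P.prob ?D" using measure_Un_le[OF Lm Ds] by linarith
 have c0: "0 \<le> Cc / real n" using Cc1 by simp
 show "?m \<le> chain.P.prob ?M1 + err \<delta>" unfolding err_def using m1' G_le' u dev by linarith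
 show "chain.P.prob ?M2 - err \<delta> \<le> ?m" unfolding err_def using m2 G_ge' l dev c0 by linarith
qed

text \<open>The auxiliary objects of the locale vary with n; here they disappear, and the errors
  depend only on \<open>D\<close>, \<open>K\<close> and n. Since V \<ge> 1 / (D^2 n), the normalised
  quadratic coefficients are at most D^2 / sqrt n, which makes the characteristic functions
  converge.\<close>

lemma volume_approximation:
 obtains A W :: real and L :: "real measure" where "0 < A" "0 < W" "real_distribution L"
  "\<bar>W - (2 * (\<Sum>j<Suc r. 1 / (real n - real j)) - 2 * \<gamma> * (real r + 1) / real n)\<bar> \<le> 16 * (4000 * D ^ 4 * (K + 1)) / real n"
  "\<And>\<tau>. \<bar>\<tau>\<bar> * D^2 \<le> sqrt n ==> cmod (char L \<tau> - of_real (exp (- \<tau>\<^sup>2 / 2))) \<le> 3 / 2 * \<bar>\<tau>\<bar> ^ 3 * D^2 / sqrt n"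
  "\<And>(M :: 'b measure) X \<delta> y. \<lbrakk>prob_space M; prob_space.indep_vars M (\<lambda>_. lebesgue_Rn n) X {1..r+1};
    \<And>i. i \<in> {1..r+1} ==> distr M (lebesgue_Rn n) (X i) = \<mu>; \<delta> > 0\<rbrakk> \<Longrightarrow>
   measure M {w \<in> space M. simplex_volume n r (\<lambda>i. X i w) \<le> A * exp (sqrt W * y / 2)} \<le> cdf L (y + \<delta>) +
     ((chain_const (4000 * D ^ 4 * (K + 1)) + 2) * (1 / sqrt (sqrt n)) * (8 * D / \<delta> + 1) + 2 * (4000 * D ^ 4 * (K + 1) / real n)) \<and>
   cdf L (y - \<delta>) - ((chain_const (4000 * D ^ 4 * (K + 1)) + 2) * (1 / sqrt (sqrt n)) * (8 * D / \<delta> + 1) + 2 * (4000 * D ^ 4 * (K + 1) / real n)) \<le> measure M {w \<in> space M. simplex_volume n r (\<lambda>i. X i w) \<le> A * exp (sqrt W * y / 2)}"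
proof
 let ?L = "distr chain.rows borel (\<lambda>x. main' x / sqrt V)"
 have [measurable]: "main' \<in> borel_measurable chain.rows" by (rule main'_meas)
 show "0 < A" by (simp add: A_def)
 show "0 < V" by (rule V_pos)
 have sV: "0 < sqrt V" using V_pos by simp
 show "real_distribution ?L" by (rule chain.P.real_distribution_distr) measurable
 show "\<bar>V - (2 * (\<Sum>j<Suc r. 1 / (real n - real j)) - 2 * \<gamma> * (real r + 1) / real n)\<bar> \<le> 16 * (4000 * D ^ 4 * (K + 1)) / real n"
  using V_approx unfolding im_def Cc_def .
 have cdfL: "cdf ?L y = chain.P.prob {x \<in> space chain.rows. main' x \<le> sqrt V * y}" for y
  unfolding cdf_def by (subst measure_distr) (auto intro!: arg_cong[where f=chain.P.prob] simp: pos_divide_le_eq[OF sV] mult.commute)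
 show "measure M {w \<in> space M. simplex_volume n r (\<lambda>i. X i w) \<le> A * exp (sqrt V * y / 2)} \<le> cdf ?L (y + \<delta>) +
     ((chain_const (4000 * D ^ 4 * (K + 1)) + 2) * (1 / sqrt (sqrt n)) * (8 * D / \<delta> + 1) + 2 * (4000 * D ^ 4 * (K + 1) / real n)) \<and>
   cdf ?L (y - \<delta>) - ((chain_const (4000 * D ^ 4 * (K + 1)) + 2) * (1 / sqrt (sqrt n)) * (8 * D / \<delta> + 1) + 2 * (4000 * D ^ 4 * (K + 1) / real n)) \<le> measure M {w \<in> space M. simplex_volume n r (\<lambda>i. X i w) \<le> A * exp (sqrt V * y / 2)}"
  if "prob_space M" "prob_space.indep_vars M (\<lambda>_. lebesgue_Rn n) X {1..r+1}"
   "\<And>i. i \<in> {1..r+1} ==> distr M (lebesgue_Rn n) (X i) = \<mu>" "\<delta> > 0" for M :: "'b measure" and X \<delta> y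
  unfolding cdfL using cdf_sandwich[OF that, of y] unfolding err_def chain.\<eta>_def Cc_def by blast
 fix \<tau> assume \<tau>: "\<bar>\<tau>\<bar> * D^2 \<le> sqrt n"
 have "1 / (D^2 * real n) \<le> V"
 proof -
  have "0 \<le> real r * (real r - 1) / (4 * (real n)^2)" using r1 by simp
  then show ?thesis using V_lower by linarith
 qed
 then have "sqrt (1 / (D^2 * real n)) \<le> sqrt V" by simp
 then have Vn: "1 / (D * sqrt n) \<le> sqrt V" using D1 by (simp add: real_sqrt_divide real_sqrt_mult)
 have inv: "1 / sqrt V \<le> D * sqrt n" using Vn sV D1 n0 by (simp add: divide_simps mult_ac)
 have nn: "real n = sqrt n * sqrt n" by simp
 have Dn: "(D / real n) / sqrt V \<le> D^2 / sqrt n"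
 proof -
  have "(D / real n) * (1 / sqrt V) \<le> (D / real n) * (D * sqrt n)" using D1 by (intro mult_left_mono inv) auto
  also have "... = D^2 / sqrt n" using n0 by (simp add: divide_simps power2_eq_square)
  finally show ?thesis by simp
 qed
 have "\<bar>\<tau> / sqrt V\<bar> * (D / real n) = \<bar>\<tau>\<bar> * ((D / real n) / sqrt V)" using sV by (simp add: abs_divide)
 also have "... \<le> \<bar>\<tau>\<bar> * (D^2 / sqrt n)" by (intro mult_left_mono Dn) auto
 also have "... \<le> 1" using \<tau> n0 by (simp add: divide_simps)
 finally have *: "\<bar>\<tau> / sqrt V\<bar> * (D / real n) \<le> 1" .
 have "char ?L \<tau> = (\<integral>x. iexp (\<tau> * (main' x / sqrt V)) \<partial>chain.rows)" unfolding char_def by (subst integral_distr) auto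
 also have "... = (\<integral>x. iexp ((\<tau> / sqrt V) * main' x) \<partial>chain.rows)" by (simp add: mult_ac)
 finally have c: "char ?L \<tau> = (\<integral>x. iexp ((\<tau> / sqrt V) * main' x) \<partial>chain.rows)" .
 have e: "- (\<tau> / sqrt V)\<^sup>2 * V / 2 = - \<tau>\<^sup>2 / 2" using V_pos by (simp add: power_divide)
 have "3 / 2 * \<bar>\<tau> / sqrt V\<bar> ^ 3 * (D / real n) * V = 3 / 2 * \<bar>\<tau>\<bar> ^ 3 * ((D / real n) / sqrt V)"
 proof -
  have "V = sqrt V * sqrt V" using V_pos by simp
  moreover have "3 / 2 * \<bar>\<tau> / s\<bar> ^ 3 * q * (s * s) = 3 / 2 * \<bar>\<tau>\<bar> ^ 3 * (q / s)" if "0 < s" for s q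
   using that by (simp add: abs_divide power_divide power3_eq_cube)
  ultimately show ?thesis using sV by metis
 qed
 also have "... \<le> 3 / 2 * \<bar>\<tau>\<bar> ^ 3 * (D^2 / sqrt n)" by (intro mult_left_mono Dn) auto
 finally show "cmod (char ?L \<tau> - of_real (exp (- \<tau>\<^sup>2 / 2))) \<le> 3 / 2 * \<bar>\<tau>\<bar> ^ 3 * D^2 / sqrt n"
  using char_main'[OF *] unfolding c e by simp
qed

end

subsection \<open>Limits of the volume\<close>

lemma volume_rows_gaussian:
 assumes "1 \<le> r" "r < n" "1 \<le> D" "real n \<le> D * (real n - real r)"
 shows "volume_rows n r D 0 0 (gaussian_law n) (\<lambda>_. 0) (gaussian_law n) (\<lambda>_. 1) 1"
proof -
 interpret G: gaussian_vector n .
 have gr: "gaussian_rows n r D 0 0 (gaussian_law n) (\<lambda>_. 0)"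
  using assms unfolding gaussian_rows_def by (auto intro: prob_space_gaussian_law)
 have [simp]: "vscale n 1 x = x" if "x \<in> space (lebesgue_Rn n)" for x
  using that by (auto simp: vscale_def space_lebesgue_Rn fun_eq_iff PiE_iff extensional_def)
 have sp: "space (gaussian_law n) = space (lebesgue_Rn n)" by (rule sets_eq_imp_space_eq) simp
 have m: "(\<lambda>p. vscale n 1 (fst p)) \<in> gaussian_law n \<Otimes>\<^sub>M gaussian_law n \<rightarrow>\<^sub>M lebesgue_Rn n" by measurable
 have "distr (gaussian_law n \<Otimes>\<^sub>M gaussian_law n) (lebesgue_Rn n) (\<lambda>p. vscale n 1 (fst p))
   = distr (gaussian_law n \<Otimes>\<^sub>M gaussian_law n) (gaussian_law n) fst" by (rule distr_cong) (auto simp: space_pair_measure sp)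
 also have "... = gaussian_law n" by (rule prob_space.distr_pair_fst[OF prob_space_gaussian_law])
 finally have law: "distr (gaussian_law n \<Otimes>\<^sub>M gaussian_law n) (lebesgue_Rn n) (\<lambda>p. vscale n 1 (fst p)) = gaussian_law n" .
 show ?thesis unfolding volume_rows_def volume_rows_axioms_def G.rows_eq
  using gr m law radial_law.rotation_invariant[OF radial_gaussian_law, of n] by (simp add: gaussian_rows.e_def[OF gr])
qed

lemma (in near_sphere_law) volume_rows_near_sphere:
 assumes "1 \<le> r" "r < n" "1 \<le> D" "real n \<le> D * (real n - real r)" "0 \<le> K"
 shows "volume_rows n r D K 1 \<mu> (\<lambda>y. max 0 (1 - (nrm n y)\<^sup>2)) \<mu> (\<lambda>p. nrm n (snd p) / nrm n (fst p)) (real n)"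
proof -
 interpret G: gaussian_vector n .
 \<comment> \<open>The norm is at most 1 only almost everywhere; the maximum with 0 gives the
   pointwise bounds that \<open>gaussian_rows\<close> asks for.\<close>
 let ?t = "\<lambda>y. max 0 (1 - (nrm n y)\<^sup>2)"
 have n0: "real n > 0" using assms by simp
 have tm: "?t \<in> borel_measurable \<mu>" by measurable
 have L2: "L2_le \<mu> ?t (K / real n ^ 2)"
 proof -
  have "(\<integral>\<^sup>+x. ennreal ((?t x)^2) \<partial>\<mu>) \<le> (\<integral>\<^sup>+x. ennreal ((1 - (nrm n x)\<^sup>2)^2) \<partial>\<mu>)"
   by (intro nn_integral_mono ennreal_leI) (auto simp: max_def)
  also have "... \<le> ennreal (K / real n ^ 2)" by (rule nrm_moment)
  finally show ?thesis using tm assms(5) by (simp add: L2_le_def)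
 qed
 have gr: "gaussian_rows n r D K 1 \<mu> ?t" using assms L2 prob_space_axioms unfolding gaussian_rows_def by auto
 have re: "redirect n p = vscale n (nrm n (snd p) / nrm n (fst p)) (fst p)" for p
  by (cases p) (simp add: redirect_def vscale_def direction_def fun_eq_iff restrict_def)
 have m: "(\<lambda>p. vscale n (nrm n (snd p) / nrm n (fst p)) (fst p)) \<in> gaussian_law n \<Otimes>\<^sub>M \<mu> \<rightarrow>\<^sub>M lebesgue_Rn n" by measurable
 have law: "distr (gaussian_law n \<Otimes>\<^sub>M \<mu>) (lebesgue_Rn n) (\<lambda>p. vscale n (nrm n (snd p) / nrm n (fst p)) (fst p)) = \<mu>"
  using redirect_eq unfolding re[symmetric] by (simp add: fun_eq_iff)
 interpret GG: prob_space "gaussian_law n" by (rule prob_space_gaussian_law)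
 interpret PP: pair_sigma_finite "gaussian_law n" \<mu> by unfold_locales
 have "AE p in gaussian_law n \<Otimes>\<^sub>M \<mu>. nrm n (snd p) \<le> 1"
 proof (rule PP.AE_pair_measure)
  show "{p \<in> space (gaussian_law n \<Otimes>\<^sub>M \<mu>). nrm n (snd p) \<le> 1} \<in> sets (gaussian_law n \<Otimes>\<^sub>M \<mu>)" by measurable
  show "AE x in gaussian_law n. AE y in \<mu>. nrm n (snd (x, y)) \<le> 1" using nrm_le_1 by simp
 qed
 then have sc: "AE p in gaussian_law n \<Otimes>\<^sub>M \<mu>. 1 / 2 \<le> 1 + gaussian_rows.e n 1 p \<longrightarrow> ?t (snd p) \<le> 1 / 2 \<longrightarrow>
   0 < nrm n (snd p) / nrm n (fst p) \<and> real n * (nrm n (snd p) / nrm n (fst p))^2 * (1 + gaussian_rows.e n 1 p) = 1 - ?t (snd p)"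
 proof eventually_elim
  case (elim p)
  show ?case
  proof (intro impI)
   assume e: "1 / 2 \<le> 1 + gaussian_rows.e n 1 p" and t: "?t (snd p) \<le> 1 / 2"
   have "(nrm n (fst p))^2 = (\<Sum>k<n. (fst p k)^2)" by (simp add: L2_set_def sum_nonneg)
   then have "G.csum 0 n (fst p) = (nrm n (fst p))^2 - real n" by (simp add: G.csum_def sq1_def sum_subtractf atLeast0LessThan)
   then have e': "1 + gaussian_rows.e n 1 p = (nrm n (fst p))^2 / real n"
    using n0 by (simp add: gaussian_rows.e_def[OF gr] gaussian_rows.d_def[OF gr] gaussian_rows.im_def[OF gr] field_simps)
   have fz: "nrm n (fst p) \<noteq> 0" using e unfolding e' by auto
   then have f0: "0 < nrm n (fst p)" by (simp add: less_le)
   have "(nrm n (snd p))^2 \<le> 1^2" using elim by (intro power_mono) auto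
   then have t': "?t (snd p) = 1 - (nrm n (snd p))\<^sup>2" by simp
   have "nrm n (snd p) \<noteq> 0" using t unfolding t' by auto
   then have "0 < nrm n (snd p)" by (simp add: less_le)
   then show "0 < nrm n (snd p) / nrm n (fst p) \<and> real n * (nrm n (snd p) / nrm n (fst p))^2 * (1 + gaussian_rows.e n 1 p) = 1 - ?t (snd p)"
    unfolding e' t' using f0 n0 by (simp add: power_divide)
  qed
 qed
 show ?thesis unfolding volume_rows_def volume_rows_axioms_def G.rows_eq using gr m law sc n0 rotation_invariant_law_axioms by auto
qed

text \<open>A bound for n^2 times the second moment of the length defect t.\<close>

fun model_K :: "point_model => real" where
 "model_K (Beta_model \<nu>) = \<nu> * (\<nu> + 2)"
| "model_K _ = 0"

fun model_\<gamma> :: "point_model => real" where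
 "model_\<gamma> Gaussian_model = 0"
| "model_\<gamma> _ = 1"

lemma volume_rows_model:
 assumes "model_parameter_ok model" "1 \<le> r" "r < n" "1 \<le> D" "real n \<le> D * (real n - real r)"
  and p: "prob_space (model_law model n)"
 shows "\<exists>t M2 c L0. volume_rows n r D (model_K model) (model_\<gamma> model) M2 t (model_law model n) c L0"
proof (cases model)
 case Gaussian_model
 then show ?thesis using volume_rows_gaussian[OF assms(2-5)] by auto
next
 case (Beta_model \<nu>)
 then have "near_sphere_law (beta_law \<nu> n) n (\<nu> * (\<nu> + 2))" using assms by (intro near_sphere_beta_law) auto
 from near_sphere_law.volume_rows_near_sphere[OF this assms(2-5)] show ?thesis using Beta_model assms(1) by auto
next
 case Spherical_model
 have "near_sphere_law (sphere_law n) n 0" using assms by (intro near_sphere_sphere_law) auto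
 from near_sphere_law.volume_rows_near_sphere[OF this assms(2-5)] show ?thesis using Spherical_model by auto
qed

text \<open>ln ((m + 1) / m) \<le> 1 / m \<le> ln (m / (m - 1)) for m = n - j, and both outer terms
  telescope.\<close>

lemma sum_inverse_bounds:
 assumes "k < n"
 shows "ln ((real n + 1) / (real n - real k + 1)) \<le> (\<Sum>j<k. 1 / (real n - real j))"
  "(\<Sum>j<k. 1 / (real n - real j)) \<le> ln (real n / (real n - real k))"
proof -
 have "ln ((real n + 1) / (real n - real k + 1)) \<le> (\<Sum>j<k. 1 / (real n - real j)) \<and>
  (\<Sum>j<k. 1 / (real n - real j)) \<le> ln (real n / (real n - real k))" using assms
 proof (induction k)
  case (Suc k)
  define m where "m = real n - real k"
  have m: "m > 1" using Suc.prems by (simp add: m_def)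
  have IH: "ln ((real n + 1) / (m + 1)) \<le> (\<Sum>j<k. 1 / (real n - real j))" "(\<Sum>j<k. 1 / (real n - real j)) \<le> ln (real n / m)"
   using Suc by (auto simp: m_def)
  have n: "real n > 0" using Suc.prems by simp
  have "ln ((m + 1) / m) = ln (1 + 1 / m)" using m by (simp add: add_divide_distrib)
  also have "... \<le> 1 / m" using m by (intro ln_add_one_self_le_self) auto
  finally have "ln ((m + 1) / m) \<le> 1 / m" .
  moreover have "ln ((real n + 1) / m) = ln ((real n + 1) / (m + 1)) + ln ((m + 1) / m)" using m n by (simp add: ln_div)
  ultimately have 1: "ln ((real n + 1) / m) \<le> (\<Sum>j<k. 1 / (real n - real j)) + 1 / m" using IH(1) by linarith
  have "ln ((m - 1) / m) \<le> (m - 1) / m - 1" using m by (intro ln_le_minus_one) auto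
  also have "... = - (1 / m)" using m by (simp add: field_simps)
  finally have "1 / m \<le> - ln ((m - 1) / m)" by simp
  moreover have "ln (real n / (m - 1)) = ln (real n / m) - ln ((m - 1) / m)" using m n by (simp add: ln_div)
  ultimately have 2: "(\<Sum>j<k. 1 / (real n - real j)) + 1 / m \<le> ln (real n / (m - 1))" using IH(2) by linarith
  have e: "real n - real (Suc k) + 1 = m" "real n - real (Suc k) = m - 1" "real n - real k = m" by (simp_all add: m_def)
  show ?case unfolding sum.lessThan_Suc e using 1 2 by simp
 qed simp
 then show "ln ((real n + 1) / (real n - real k + 1)) \<le> (\<Sum>j<k. 1 / (real n - real j))"
  "(\<Sum>j<k. 1 / (real n - real j)) \<le> ln (real n / (real n - real k))" by auto
qed

section \<open>Passage to the limit\<close>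

abbreviation \<Phi> :: "real => real" where "\<Phi> \<equiv> cdf std_normal_distribution"

lemma real_distribution_std_normal: "real_distribution std_normal_distribution"
 using std_normal.prob_space_axioms by (simp add: real_distribution_def real_distribution_axioms_def)

lemma isCont_\<Phi>: "isCont \<Phi> x"
proof -
 interpret R: real_distribution std_normal_distribution by (rule real_distribution_std_normal)
 have "emeasure std_normal_distribution {x} = (\<integral>\<^sup>+y. ennreal (std_normal_density y) * indicator {x} y \<partial>lborel)"
  by (simp add: emeasure_density)
 also have "... = integral\<^sup>N lborel (\<lambda>y::real. 0)"
  using AE_lborel_singleton[of x] by (intro nn_integral_cong_AE) (auto elim!: eventually_mono)
 finally have "measure std_normal_distribution {x} = 0" by (simp add: measure_def)
 then show ?thesis by (simp add: R.isCont_cdf)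
qed

text \<open>Monotonicity replaces the moving argument by a fixed one at distance \<delta>, the
  sandwich costs another \<delta>, and continuity of the limit lets \<delta> tend to 0.\<close>

lemma cdf_squeeze:
 fixes F G :: "nat => real => real"
 assumes mono: "\<And>n x y. x \<le> y ==> F n x \<le> F n y"
  and FG: "\<And>\<delta>. \<delta> > 0 ==> eventually (\<lambda>n. \<forall>x. F n x \<le> G n (x + \<delta>) + E n \<delta> \<and> G n (x - \<delta>) - E n \<delta> \<le> F n x) sequentially"
  and E: "\<And>\<delta>. \<delta> > 0 ==> (\<lambda>n. E n \<delta>) \<longlonglongrightarrow> 0"
  and G: "\<And>x. (\<lambda>n. G n x) \<longlonglongrightarrow> H x" and cont: "isCont H x" and ys: "ys \<longlonglongrightarrow> x"
 shows "(\<lambda>n. F n (ys n)) \<longlonglongrightarrow> H x"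
proof (rule order_tendstoI)
 fix u assume u: "H x < u"
 have "eventually (\<lambda>y. H y < u) (at x)" using cont u by (auto simp: isCont_def intro: order_tendstoD)
 then obtain d where d: "d > 0" "\<And>y. y \<noteq> x ==> dist y x < d ==> H y < u" by (auto simp: eventually_at)
 \<comment> \<open>A third of d, so that x + 2 \<delta> is still within distance d of x.\<close>
 define \<delta> where "\<delta> = d / 3"
 have \<delta>: "\<delta> > 0" using d by (simp add: \<delta>_def)
 have Hu: "H (x + 2 * \<delta>) < u" using d by (intro d(2)) (auto simp: \<delta>_def dist_real_def)
 have "(\<lambda>n. G n (x + 2 * \<delta>) + E n \<delta>) \<longlonglongrightarrow> H (x + 2 * \<delta>) + 0" by (intro tendsto_add G E \<delta>)
 then have "eventually (\<lambda>n. G n (x + 2 * \<delta>) + E n \<delta> < u) sequentially" using Hu by (auto intro: order_tendstoD)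
 moreover have "eventually (\<lambda>n. ys n < x + \<delta>) sequentially" using ys \<delta> by (auto intro: order_tendstoD)
 ultimately show "eventually (\<lambda>n. F n (ys n) < u) sequentially" using FG[OF \<delta>]
 proof eventually_elim
  case (elim n)
  have "F n (ys n) \<le> F n (x + \<delta>)" using elim by (intro mono) simp
  also have "... \<le> G n (x + \<delta> + \<delta>) + E n \<delta>" using elim by blast
  also have "x + \<delta> + \<delta> = x + 2 * \<delta>" by simp
  finally show ?case using elim by linarith
 qed
next
 fix u assume u: "u < H x"
 have "eventually (\<lambda>y. u < H y) (at x)" using cont u by (auto simp: isCont_def intro: order_tendstoD)
 then obtain d where d: "d > 0" "\<And>y. y \<noteq> x ==> dist y x < d ==> u < H y" by (auto simp: eventually_at)
 define \<delta> where "\<delta> = d / 3"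
 have \<delta>: "\<delta> > 0" using d by (simp add: \<delta>_def)
 have Hu: "u < H (x - 2 * \<delta>)" using d by (intro d(2)) (auto simp: \<delta>_def dist_real_def)
 have "(\<lambda>n. G n (x - 2 * \<delta>) - E n \<delta>) \<longlonglongrightarrow> H (x - 2 * \<delta>) - 0" by (intro tendsto_diff G E \<delta>)
 then have "eventually (\<lambda>n. u < G n (x - 2 * \<delta>) - E n \<delta>) sequentially" using Hu by (auto intro: order_tendstoD)
 moreover have "eventually (\<lambda>n. x - \<delta> < ys n) sequentially" using ys \<delta> by (auto intro: order_tendstoD)
 ultimately show "eventually (\<lambda>n. u < F n (ys n)) sequentially" using FG[OF \<delta>]
 proof eventually_elim
  case (elim n)
  have "G n (x - \<delta> - \<delta>) - E n \<delta> \<le> F n (x - \<delta>)" using elim by blast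
  also have "... \<le> F n (ys n)" using elim by (intro mono) simp
  also have "x - \<delta> - \<delta> = x - 2 * \<delta>" by simp
  finally show ?case using elim by linarith
 qed
qed

lemma inverse_sqrt_LIMSEQ: "(\<lambda>n. 1 / sqrt (real n)) \<longlonglongrightarrow> 0" "(\<lambda>n. 1 / sqrt (sqrt (real n))) \<longlonglongrightarrow> 0"
proof -
 have 1: "(\<lambda>n. sqrt (1 / real n)) \<longlonglongrightarrow> sqrt 0" by (intro tendsto_real_sqrt lim_1_over_n)
 have 2: "(\<lambda>n. sqrt (sqrt (1 / real n))) \<longlonglongrightarrow> sqrt (sqrt 0)" by (intro tendsto_real_sqrt lim_1_over_n)
 show "(\<lambda>n. 1 / sqrt (real n)) \<longlonglongrightarrow> 0" using 1 by (simp add: real_sqrt_divide)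
 show "(\<lambda>n. 1 / sqrt (sqrt (real n))) \<longlonglongrightarrow> 0" using 2 by (simp add: real_sqrt_divide)
qed

definition sample :: "nat => nat => (nat => real) measure => 'a measure => (nat => 'a => nat => real) => bool" where
 "sample n r \<mu> M X \<longleftrightarrow> prob_space M \<and> prob_space.indep_vars M (\<lambda>_. lebesgue_Rn n) X {1..r+1} \<and>
   (\<forall>i\<in>{1..r+1}. distr M (lebesgue_Rn n) (X i) = \<mu>)"

lemma volume_limit:
 fixes r :: "nat => nat" and M :: "nat => 'a measure" and X :: "nat => nat => 'a => nat => real"
 assumes vr: "eventually (\<lambda>n. \<exists>t M2 c L0. volume_rows n (r n) D K \<gamma> M2 t (\<mu> n) c L0) sequentially"
  and sm: "eventually (\<lambda>n. sample n (r n) (\<mu> n) (M n) (X n)) sequentially"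
 obtains A W :: "nat => real" where "\<And>n. 0 < A n" "\<And>n. 0 < W n"
  "eventually (\<lambda>n. \<bar>W n - (2 * (\<Sum>j<Suc (r n). 1 / (real n - real j)) - 2 * \<gamma> * (real (r n) + 1) / real n)\<bar>
   \<le> 16 * (4000 * D ^ 4 * (K + 1)) / real n) sequentially"
  "\<And>ys y. ys \<longlonglongrightarrow> y ==> (\<lambda>n. measure (M n) {w \<in> space (M n).
    simplex_volume n (r n) (\<lambda>i. X n i w) \<le> A n * exp (sqrt (W n) * ys n / 2)}) \<longlonglongrightarrow> \<Phi> y"
proof -
 define C where "C = 4000 * D ^ 4 * (K + 1)"
 define E where "E n \<delta> = (chain_const C + 2) * (1 / sqrt (sqrt (real n))) * (8 * D / \<delta> + 1) + 2 * (C / real n)" for n :: nat and \<delta>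
 define m where "m n A W y = measure (M n) {w \<in> space (M n). simplex_volume n (r n) (\<lambda>i. X n i w) \<le> A * exp (sqrt W * y / 2)}" for n A W y
 define Ok where "Ok n \<longleftrightarrow> (\<exists>t M2 c L0. volume_rows n (r n) D K \<gamma> M2 t (\<mu> n) c L0) \<and> sample n (r n) (\<mu> n) (M n) (X n)" for n
 define P where "P n A W L \<longleftrightarrow> 0 < A \<and> 0 < W \<and> real_distribution L \<and>
   \<bar>W - (2 * (\<Sum>j<Suc (r n). 1 / (real n - real j)) - 2 * \<gamma> * (real (r n) + 1) / real n)\<bar> \<le> 16 * C / real n \<and>
   (\<forall>\<tau>. \<bar>\<tau>\<bar> * D^2 \<le> sqrt n \<longrightarrow> cmod (char L \<tau> - of_real (exp (- \<tau>\<^sup>2 / 2))) \<le> 3 / 2 * \<bar>\<tau>\<bar> ^ 3 * D^2 / sqrt n) \<and>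
   (\<forall>\<delta>>0. \<forall>y. m n A W y \<le> cdf L (y + \<delta>) + E n \<delta> \<and> cdf L (y - \<delta>) - E n \<delta> \<le> m n A W y)" for n A W L
 have evOk: "eventually Ok sequentially" unfolding Ok_def[abs_def] using vr sm by (rule eventually_conj)
 have ex: "\<exists>A W L. P n A W L" if ok: "Ok n" for n
 proof -
  obtain t M2 c L0 where v: "volume_rows n (r n) D K \<gamma> M2 t (\<mu> n) c L0" using ok by (auto simp: Ok_def)
  from ok have s: "prob_space (M n)" "prob_space.indep_vars (M n) (\<lambda>_. lebesgue_Rn n) (X n) {1..r n+1}"
   "\<And>i. i \<in> {1..r n+1} ==> distr (M n) (lebesgue_Rn n) (X n i) = \<mu> n" by (auto simp: Ok_def sample_def)
  interpret v: volume_rows n "r n" D K \<gamma> M2 t "\<mu> n" c L0 by (rule v)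
  obtain A W :: real and L :: "real measure" where "0 < A" "0 < W" "real_distribution L"
   "\<bar>W - (2 * (\<Sum>j<Suc (r n). 1 / (real n - real j)) - 2 * \<gamma> * (real (r n) + 1) / real n)\<bar> \<le> 16 * (4000 * D ^ 4 * (K + 1)) / real n"
   "\<And>\<tau>. \<bar>\<tau>\<bar> * D^2 \<le> sqrt n ==> cmod (char L \<tau> - of_real (exp (- \<tau>\<^sup>2 / 2))) \<le> 3 / 2 * \<bar>\<tau>\<bar> ^ 3 * D^2 / sqrt n"
   and b: "\<And>(M :: 'a measure) X \<delta> y. \<lbrakk>prob_space M; prob_space.indep_vars M (\<lambda>_. lebesgue_Rn n) X {1..r n+1};
     \<And>i. i \<in> {1..r n+1} ==> distr M (lebesgue_Rn n) (X i) = \<mu> n; \<delta> > 0\<rbrakk> \<Longrightarrow>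
    measure M {w \<in> space M. simplex_volume n (r n) (\<lambda>i. X i w) \<le> A * exp (sqrt W * y / 2)} \<le> cdf L (y + \<delta>) +
     ((chain_const (4000 * D ^ 4 * (K + 1)) + 2) * (1 / sqrt (sqrt n)) * (8 * D / \<delta> + 1) + 2 * (4000 * D ^ 4 * (K + 1) / real n)) \<and>
    cdf L (y - \<delta>) - ((chain_const (4000 * D ^ 4 * (K + 1)) + 2) * (1 / sqrt (sqrt n)) * (8 * D / \<delta> + 1) + 2 * (4000 * D ^ 4 * (K + 1) / real n))
     \<le> measure M {w \<in> space M. simplex_volume n (r n) (\<lambda>i. X i w) \<le> A * exp (sqrt W * y / 2)}"
   by (rule v.volume_approximation) blast
  then have "P n A W L" unfolding P_def m_def E_def C_def using b[OF s] by blast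
  then show ?thesis by blast
 qed
 then have "\<forall>n. \<exists>p. Ok n \<longrightarrow> P n (fst p) (fst (snd p)) (snd (snd p))" by (metis fst_conv snd_conv)
 then obtain f where f: "\<And>n. Ok n ==> P n (fst (f n)) (fst (snd (f n))) (snd (snd (f n)))" by metis
 \<comment> \<open>For the finitely many n without an approximation, defaults keep \<open>A\<close>
   and \<open>W\<close> positive and \<open>L\<close> a distribution.\<close>
 define A where "A n = (if Ok n then fst (f n) else 1)" for n
 define W where "W n = (if Ok n then fst (snd (f n)) else 1)" for n
 define L where "L n = (if Ok n then snd (snd (f n)) else std_normal_distribution)" for n
 have PO: "P n (A n) (W n) (L n)" if "Ok n" for n using f[OF that] that by (simp add: A_def W_def L_def)
 have A0: "0 < A n" and W0: "0 < W n" and Ld: "real_distribution (L n)" for n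
  using PO[of n] real_distribution_std_normal by (cases "Ok n"; auto simp: P_def A_def W_def L_def)+
 have C0: "(\<lambda>n. c / real n) \<longlonglongrightarrow> 0" for c using tendsto_mult_right[OF lim_1_over_n, of c] by simp
 have "(\<lambda>n. char (L n) \<tau>) \<longlonglongrightarrow> char std_normal_distribution \<tau>" for \<tau>
 proof (rule LIM_zero_cancel, rule Lim_null_comparison)
  have "eventually (\<lambda>n. (\<bar>\<tau>\<bar> * D^2)^2 \<le> real n) sequentially" using filterlim_real_sequentially by (simp add: filterlim_at_top)
  then show "eventually (\<lambda>n. norm (char (L n) \<tau> - char std_normal_distribution \<tau>) \<le> 3 / 2 * \<bar>\<tau>\<bar> ^ 3 * D^2 * (1 / sqrt n)) sequentially"
   using evOk
  proof eventually_elim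
   case (elim n)
   have "\<bar>\<tau>\<bar> * D^2 \<le> sqrt n" by (rule real_le_rsqrt[OF elim(1)])
   then show ?case using PO[OF elim(2)] unfolding P_def char_std_normal_distribution by simp
  qed
  show "(\<lambda>n. 3 / 2 * \<bar>\<tau>\<bar> ^ 3 * D^2 * (1 / sqrt (real n))) \<longlonglongrightarrow> 0"
   using tendsto_mult_left[OF inverse_sqrt_LIMSEQ(1), of "3 / 2 * \<bar>\<tau>\<bar> ^ 3 * D^2"] by simp
 qed
 then have "weak_conv_m L std_normal_distribution" by (intro levy_continuity Ld real_distribution_std_normal)
 then have cdfL: "(\<lambda>n. cdf (L n) x) \<longlonglongrightarrow> \<Phi> x" for x using isCont_\<Phi> by (simp add: weak_conv_m_def weak_conv_def)
 have E0: "(\<lambda>n. E n \<delta>) \<longlonglongrightarrow> 0" for \<delta>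
 proof -
  have "(\<lambda>n. (chain_const C + 2) * (1 / sqrt (sqrt (real n))) * (8 * D / \<delta> + 1) + 2 * (C / real n))
    \<longlonglongrightarrow> (chain_const C + 2) * 0 * (8 * D / \<delta> + 1) + 2 * 0" by (intro tendsto_intros inverse_sqrt_LIMSEQ C0)
  then show ?thesis by (simp add: E_def)
 qed
 \<comment> \<open>Setting the value to 0 where \<open>Ok\<close> fails makes monotonicity in the
   threshold, which rests on measurability of the volume, available for every n.\<close>
 have mono: "m' n x \<le> m' n y" if "x \<le> y" and m': "m' = (\<lambda>n y. if Ok n then m n (A n) (W n) y else 0)" for m' n x y
 proof (cases "Ok n")
  case True
  then have rn: "r n \<le> n" and X: "\<And>i. i \<in> {1..r n+1} ==> X n i \<in> M n \<rightarrow>\<^sub>M lebesgue_Rn n" and p: "prob_space (M n)"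
   by (auto simp: Ok_def sample_def volume_rows_def gaussian_rows_def prob_space.indep_vars_def2)
  interpret p: prob_space "M n" by (rule p)
  have [measurable]: "(\<lambda>w. simplex_volume n (r n) (\<lambda>i. X n i w)) \<in> borel_measurable (M n)"
   by (rule measurable_simplex_volume[OF rn X])
  have "A n * exp (sqrt (W n) * x / 2) \<le> A n * exp (sqrt (W n) * y / 2)"
   using A0[of n] W0[of n] that(1) by (simp add: mult_left_mono)
  then show ?thesis using True unfolding m' m_def by (simp, intro p.finite_measure_mono) (auto intro: order_trans)
 qed (simp add: m')
 show thesis
 proof (rule that[of A W])
  show "0 < A n" "0 < W n" for n by (rule A0 W0)+
  show "eventually (\<lambda>n. \<bar>W n - (2 * (\<Sum>j<Suc (r n). 1 / (real n - real j)) - 2 * \<gamma> * (real (r n) + 1) / real n)\<bar>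
   \<le> 16 * (4000 * D ^ 4 * (K + 1)) / real n) sequentially" using evOk by eventually_elim (use PO in \<open>auto simp: P_def C_def\<close>)
  fix ys :: "nat => real" and y assume ys: "ys \<longlonglongrightarrow> y"
  let ?m = "\<lambda>n y. if Ok n then m n (A n) (W n) y else 0"
  have "(\<lambda>n. ?m n (ys n)) \<longlonglongrightarrow> \<Phi> y"
  proof (rule cdf_squeeze[where F="?m" and G="\<lambda>n. cdf (L n)" and E=E and H=\<Phi> and ys=ys and x=y])
   show "?m n x \<le> ?m n y" if "x \<le> y" for n x y using mono[OF that refl, of n] .
   show "eventually (\<lambda>n. \<forall>x. ?m n x \<le> cdf (L n) (x + \<delta>) + E n \<delta> \<and> cdf (L n) (x - \<delta>) - E n \<delta> \<le> ?m n x) sequentially" if "\<delta> > 0" for \<delta>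
    using evOk by eventually_elim (use PO that in \<open>auto simp: P_def\<close>)
  qed (auto intro: E0 cdfL isCont_\<Phi> ys)
  then show "(\<lambda>n. measure (M n) {w \<in> space (M n). simplex_volume n (r n) (\<lambda>i. X n i w) \<le> A n * exp (sqrt (W n) * ys n / 2)}) \<longlonglongrightarrow> \<Phi> y"
   by (rule Lim_transform_eventually) (use evOk in \<open>auto elim!: eventually_mono simp: m_def\<close>)
 qed
qed

lemma cdf_distr:
 assumes "f \<in> borel_measurable M" shows "cdf (distr M borel f) y = measure M {w \<in> space M. f w \<le> y}"
 unfolding cdf_def using assms by (subst measure_distr) (auto intro!: arg_cong[where f="measure M"])

theorem theorem3p8:
  fixes model :: point_model
    and r :: "nat \<Rightarrow> nat"
    and M :: "nat \<Rightarrow> 'a measure"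
    and X :: "nat \<Rightarrow> nat \<Rightarrow> 'a \<Rightarrow> (nat \<Rightarrow> real)"
    and V :: "nat \<Rightarrow> 'a \<Rightarrow> real"
    and N :: "'b measure" and Z :: "'b \<Rightarrow> real"
  assumes "model_parameter_ok model"
    and "\<And>n. n \<ge> model_min_dim model \<Longrightarrow> 1 \<le> r n \<and> r n \<le> n"
    and "\<And>n. n \<ge> model_min_dim model \<Longrightarrow> prob_space (M n)"
    and "\<And>n. n \<ge> model_min_dim model \<Longrightarrow>
           prob_space.indep_vars (M n) (\<lambda>_. lebesgue_Rn n) (X n) {1..r n + 1}"
    and "\<And>n i. n \<ge> model_min_dim model \<Longrightarrow> i \<in> {1..r n + 1} \<Longrightarrow>
           distr (M n) (lebesgue_Rn n) (X n i) = model_law model n"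
    and "\<And>n \<omega>. V n \<omega> = simplex_volume n (r n) (\<lambda>i. X n i \<omega>)"
    and "prob_space N"
    and "distributed N lborel Z std_normal_density"
  shows "((\<lambda>n. real (r n)) \<in> o(\<lambda>n. real n) \<longrightarrow>
            (\<exists>a b :: nat \<Rightarrow> real. (\<forall>n. b n > 0) \<and>
               weak_conv_m (\<lambda>n. distr (M n) borel (\<lambda>\<omega>. (V n \<omega> - a n) / b n))
                           (distr N borel Z)))
       \<and> (\<forall>\<alpha>::real. 0 < \<alpha> \<and> \<alpha> < 1 \<and> (\<lambda>n. real (r n) / (\<alpha> * real n)) \<longlonglongrightarrow> 1 \<longrightarrow>
            (\<exists>b :: nat \<Rightarrow> real. (\<forall>n. b n > 0) \<and>
               weak_conv_m (\<lambda>n. distr (M n) borel (\<lambda>\<omega>. V n \<omega> / b n))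
                 (distr N borel (\<lambda>\<omega>. case model of
                      Gaussian_model \<Rightarrow> exp (sqrt (1 / 2 * ln (1 / (1 - \<alpha>))) * Z \<omega>)
                    | Beta_model \<nu> \<Rightarrow> exp (sqrt (1 / 2 * ln (1 / (1 - \<alpha>)) - \<alpha> / 2) * Z \<omega>)
                    | Spherical_model \<Rightarrow> exp (sqrt (1 / 2 * ln (1 / (1 - \<alpha>)) - \<alpha> / 2) * Z \<omega>)))))"
proof -
 let ?\<mu> = "model_law model" and ?\<gamma> = "model_\<gamma> model" and ?K = "model_K model"
 \<comment> \<open>Limits are taken along n \<ge> 2, where every model is defined.\<close>
 have min2: "model_min_dim model \<le> 2" by (cases model) auto
 have X: "X n i \<in> M n \<rightarrow>\<^sub>M lebesgue_Rn n" if "2 \<le> n" "i \<in> {1..r n + 1}" for n i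
  using assms(3,4)[of n] min2 that by (auto simp: prob_space.indep_vars_def2)
 have sm: "sample n (r n) (?\<mu> n) (M n) (X n)" if "2 \<le> n" for n using assms(3-5)[of n] min2 that by (auto simp: sample_def)
 \<comment> \<open>That the model law has total mass 1 is read off from the law of the first
   vertex.\<close>
 have pl: "prob_space (?\<mu> n)" if n: "2 \<le> n" for n
 proof -
  have "1 \<in> {1..r n + 1}" by simp
  then have "prob_space (distr (M n) (lebesgue_Rn n) (X n 1))"
   using assms(3)[of n] X[OF n] min2 n by (intro prob_space.prob_space_distr) auto
  then show ?thesis using assms(5)[of n 1] min2 n by simp
 qed
 have V: "V n = (\<lambda>\<omega>. simplex_volume n (r n) (\<lambda>i. X n i \<omega>))" for n using assms(6) by blast
 have Vm: "V n \<in> borel_measurable (M n)" if n: "2 \<le> n" for n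
  unfolding V using assms(2)[of n] min2 n X[OF n] by (intro measurable_simplex_volume) auto
 have evsm: "eventually (\<lambda>n. sample n (r n) (?\<mu> n) (M n) (X n)) sequentially"
  using eventually_ge_at_top[of 2] by eventually_elim (rule sm)
 have vr: "eventually (\<lambda>n. \<exists>t M2 c L0. volume_rows n (r n) D ?K ?\<gamma> M2 t (?\<mu> n) c L0) sequentially"
  if D: "1 \<le> D" and ev: "eventually (\<lambda>n. real n \<le> D * (real n - real (r n))) sequentially" for D using ev eventually_ge_at_top[of 2]
 proof eventually_elim
  case (elim n)
  \<comment> \<open>For r n = n the bound in \<open>ev\<close> would read n \<le> 0.\<close>
  have "r n \<noteq> n" using elim by auto
  then have "1 \<le> r n" "r n < n" using assms(2)[of n] min2 elim by auto
  then show ?case using elim pl[of n] D by (intro volume_rows_model assms(1)) auto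
 qed
 have Zm: "Z \<in> borel_measurable N" using distributed_measurable[OF assms(8)] by simp
 have Zlaw: "distr N borel Z = std_normal_distribution"
  using distributed_distr_eq_density[OF assms(8)] distr_cong[of N N borel lborel Z Z] by simp
 have \<gamma>01: "0 \<le> ?\<gamma>" by (cases model) auto
 have C0: "(\<lambda>n. c / real n) \<longlonglongrightarrow> 0" for c :: real using tendsto_mult_right[OF lim_1_over_n, of c] by simp
 have part1: "\<exists>a b :: nat => real. (\<forall>n. b n > 0) \<and>
   weak_conv_m (\<lambda>n. distr (M n) borel (\<lambda>\<omega>. (V n \<omega> - a n) / b n)) (distr N borel Z)"
  if o: "(\<lambda>n. real (r n)) \<in> o(\<lambda>n. real n)"
 proof -
  have rlim: "(\<lambda>n. real (r n) / real n) \<longlonglongrightarrow> 0" using smalloD_tendsto[OF o] by simp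
  have half: "eventually (\<lambda>n. real n \<le> 2 * (real n - real (r n))) sequentially"
  proof -
   have "eventually (\<lambda>n. real (r n) / real n < 1 / 2) sequentially" by (rule order_tendstoD(2)[OF rlim]) simp
   then show ?thesis using eventually_gt_at_top[of 0]
   proof eventually_elim
    case (elim n)
    then have "real (r n) < 1 / 2 * real n" by (simp add: pos_divide_less_eq)
    then show ?case by simp
   qed
  qed
  obtain A W where A: "\<And>n. 0 < A n" and W: "\<And>n. 0 < W n"
   and Wap: "eventually (\<lambda>n. \<bar>W n - (2 * (\<Sum>j<Suc (r n). 1 / (real n - real j)) - 2 * ?\<gamma> * (real (r n) + 1) / real n)\<bar>
    \<le> 16 * (4000 * 2 ^ 4 * (?K + 1)) / real n) sequentially"
   and lim: "\<And>ys y. ys \<longlonglongrightarrow> y ==> (\<lambda>n. measure (M n) {w \<in> space (M n).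
     simplex_volume n (r n) (\<lambda>i. X n i w) \<le> A n * exp (sqrt (W n) * ys n / 2)}) \<longlonglongrightarrow> \<Phi> y"
   by (rule volume_limit[OF vr[OF _ half] evsm]) auto
  define C where "C = 16 * (4000 * 2 ^ 4 * (?K + 1))"
  have W0: "W \<longlonglongrightarrow> 0"
  proof (rule tendsto_sandwich[where f="\<lambda>_. 0" and h="\<lambda>n. 4 * (real (r n) / real n) + 4 / real n + C / real n"])
   show "eventually (\<lambda>n. W n \<le> 4 * (real (r n) / real n) + 4 / real n + C / real n) sequentially"
    using Wap half eventually_gt_at_top[of 0]
   proof eventually_elim
    case (elim n)
    have "1 / (real n - real j) \<le> 2 / real n" if "j < Suc (r n)" for j
    proof -
     have "real n \<le> 2 * (real n - real j)" using elim(2) that by simp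
     moreover have "real n > 0" using elim(3) by simp
     ultimately show ?thesis by (simp add: divide_simps)
    qed
    then have "(\<Sum>j<Suc (r n). 1 / (real n - real j)) \<le> (\<Sum>j<Suc (r n). 2 / real n)" by (intro sum_mono) auto
    also have "... = 2 * (real (r n) / real n) + 2 / real n" by (simp add: add_divide_distrib distrib_right)
    finally have "2 * (\<Sum>j<Suc (r n). 1 / (real n - real j)) \<le> 4 * (real (r n) / real n) + 4 / real n" by simp
    moreover have "0 \<le> 2 * ?\<gamma> * (real (r n) + 1) / real n" using \<gamma>01 by simp
    ultimately show ?case using elim(1) unfolding C_def by linarith
   qed
   have "(\<lambda>n. 4 * (real (r n) / real n) + 4 / real n + C / real n) \<longlonglongrightarrow> 4 * 0 + 0 + 0" by (intro tendsto_intros rlim C0)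
   then show "(\<lambda>n. 4 * (real (r n) / real n) + 4 / real n + C / real n) \<longlonglongrightarrow> 0" by simp
   show "eventually (\<lambda>n. 0 \<le> W n) sequentially" by (intro always_eventually allI less_imp_le W)
  qed simp
  define \<sigma> where "\<sigma> n = sqrt (W n)" for n
  have \<sigma>: "\<sigma> n > 0" for n using W by (simp add: \<sigma>_def)
  have \<sigma>0: "\<sigma> \<longlonglongrightarrow> 0" using tendsto_real_sqrt[OF W0] by (simp add: \<sigma>_def[abs_def])
  \<comment> \<open>The derivative at y = 0 of A exp (\<sigma> y / 2); as \<sigma> tends to 0 the
    exponential becomes linear.\<close>
  define b where "b n = A n * \<sigma> n / 2" for n
  have b: "b n > 0" for n using A \<sigma> by (simp add: b_def)
  have "weak_conv_m (\<lambda>n. distr (M n) borel (\<lambda>\<omega>. (V n \<omega> - A n) / b n)) (distr N borel Z)" unfolding weak_conv_m_def weak_conv_def Zlaw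
  proof (intro allI impI)
   fix y :: real
   define z where "z n = \<sigma> n * y / 2" for n
   \<comment> \<open>The solution of A exp (\<sigma> ys / 2) = A + b y; its difference from y is of
     order \<sigma>.\<close>
   define ys where "ys n = 2 / \<sigma> n * ln (1 + z n)" for n
   have z0: "z \<longlonglongrightarrow> 0" using tendsto_mult_right[OF \<sigma>0, of "y / 2"] by (simp add: z_def[abs_def])
   have zs: "eventually (\<lambda>n. \<bar>z n\<bar> < 1 / 2) sequentially" using tendstoD[OF z0, of "1/2"] by (simp add: dist_real_def)
   have "ys \<longlonglongrightarrow> y"
   proof (rule LIM_zero_cancel, rule Lim_null_comparison)
    show "eventually (\<lambda>n. norm (ys n - y) \<le> \<sigma> n * y^2) sequentially" using zs
    proof eventually_elim
     case (elim n)
     have "ys n - y = 2 / \<sigma> n * (ln (1 + z n) - z n)" using \<sigma>[of n] by (simp add: ys_def z_def field_simps)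
     then have "\<bar>ys n - y\<bar> = 2 / \<sigma> n * \<bar>ln (1 + z n) - z n\<bar>"
      by (simp only: abs_mult abs_of_pos[OF divide_pos_pos[OF zero_less_numeral \<sigma>]])
     also have "... \<le> 2 / \<sigma> n * (2 * (z n)^2)" using elim \<sigma>[of n] by (intro mult_left_mono abs_ln_one_plus_x_minus_x_bound) auto
     also have "... = \<sigma> n * y^2" using \<sigma>[of n] by (simp add: z_def power2_eq_square)
     finally show ?case by simp
    qed
    show "(\<lambda>n. \<sigma> n * y^2) \<longlonglongrightarrow> 0" using tendsto_mult_right[OF \<sigma>0, of "y^2"] by simp
   qed
   from lim[OF this] show "(\<lambda>n. cdf (distr (M n) borel (\<lambda>\<omega>. (V n \<omega> - A n) / b n)) y) \<longlonglongrightarrow> \<Phi> y"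
   proof (rule Lim_transform_eventually)
    show "eventually (\<lambda>n. measure (M n) {w \<in> space (M n). simplex_volume n (r n) (\<lambda>i. X n i w) \<le> A n * exp (sqrt (W n) * ys n / 2)}
      = cdf (distr (M n) borel (\<lambda>\<omega>. (V n \<omega> - A n) / b n)) y) sequentially" using zs eventually_ge_at_top[of 2]
    proof eventually_elim
     case (elim n)
     have "exp (sqrt (W n) * ys n / 2) = exp (ln (1 + z n))" using \<sigma>[of n] by (simp add: ys_def \<sigma>_def[symmetric])
     also have "... = 1 + z n" using elim by (intro exp_ln) linarith
     finally have e: "A n * exp (sqrt (W n) * ys n / 2) = b n * y + A n" by (simp add: b_def z_def algebra_simps)
     have "(V n w - A n) / b n \<le> y \<longleftrightarrow> V n w \<le> b n * y + A n" for w using b[of n] by (simp add: pos_divide_le_eq algebra_simps)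
     then show ?case unfolding e using Vm[OF elim(2)] by (subst cdf_distr) (simp_all add: V)
    qed
   qed
  qed
  then show ?thesis using b by blast
 qed
 have part2: "\<exists>b :: nat => real. (\<forall>n. b n > 0) \<and> weak_conv_m (\<lambda>n. distr (M n) borel (\<lambda>\<omega>. V n \<omega> / b n))
   (distr N borel (\<lambda>\<omega>. exp (sqrt (1 / 2 * ln (1 / (1 - \<alpha>)) - ?\<gamma> * \<alpha> / 2) * Z \<omega>)))"
  if \<alpha>: "0 < \<alpha>" "\<alpha> < 1" and ra: "(\<lambda>n. real (r n) / (\<alpha> * real n)) \<longlonglongrightarrow> 1" for \<alpha>
 proof -
  have rlim: "(\<lambda>n. real (r n) / real n) \<longlonglongrightarrow> \<alpha>" using tendsto_mult_left[OF ra, of \<alpha>] \<alpha> by simp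
  \<comment> \<open>Eventually r / n < (1 + \<alpha>) / 2, hence n - r > n (1 - \<alpha>) /
    2.\<close>
  define D where "D = 2 / (1 - \<alpha>)"
  have D1: "1 \<le> D" using \<alpha> by (simp add: D_def divide_simps)
  have frac: "eventually (\<lambda>n. real n \<le> D * (real n - real (r n))) sequentially"
  proof -
   have "eventually (\<lambda>n. real (r n) / real n < (1 + \<alpha>) / 2) sequentially" using \<alpha> by (intro order_tendstoD(2)[OF rlim]) simp
   then show ?thesis using eventually_gt_at_top[of 0]
  proof eventually_elim
   case (elim n)
   have "real (r n) \<le> (1 + \<alpha>) / 2 * real n" using elim \<alpha> by (simp add: pos_divide_less_eq less_imp_le)
   then have "(1 - \<alpha>) * real n \<le> 2 * (real n - real (r n))" by (simp add: algebra_simps)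
   then show ?case using \<alpha> by (simp add: D_def pos_le_divide_eq mult.commute)
  qed
  qed
  obtain A W where A: "\<And>n. 0 < A n" and W: "\<And>n. 0 < W n"
   and Wap: "eventually (\<lambda>n. \<bar>W n - (2 * (\<Sum>j<Suc (r n). 1 / (real n - real j)) - 2 * ?\<gamma> * (real (r n) + 1) / real n)\<bar>
    \<le> 16 * (4000 * D ^ 4 * (?K + 1)) / real n) sequentially"
   and lim: "\<And>ys y. ys \<longlonglongrightarrow> y ==> (\<lambda>n. measure (M n) {w \<in> space (M n).
     simplex_volume n (r n) (\<lambda>i. X n i w) \<le> A n * exp (sqrt (W n) * ys n / 2)}) \<longlonglongrightarrow> \<Phi> y"
   by (rule volume_limit[OF vr[OF D1 frac] evsm]) auto
  define S where "S n = (\<Sum>j<Suc (r n). 1 / (real n - real j))" for n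
  have Slim: "S \<longlonglongrightarrow> ln (1 / (1 - \<alpha>))"
  proof (rule tendsto_sandwich)
   have i0: "(\<lambda>n. 1 / real n) \<longlonglongrightarrow> 0" by (rule lim_1_over_n)
   have "(\<lambda>n. ln ((1 + 1 / real n) / (1 - real (r n) / real n))) \<longlonglongrightarrow> ln ((1 + 0) / (1 - \<alpha>))"
    using \<alpha> by (intro tendsto_intros i0 rlim) auto
   then show "(\<lambda>n. ln ((1 + 1 / real n) / (1 - real (r n) / real n))) \<longlonglongrightarrow> ln (1 / (1 - \<alpha>))" by simp
   have "(\<lambda>n. ln (1 / (1 - real (r n) / real n - 1 / real n))) \<longlonglongrightarrow> ln (1 / (1 - \<alpha> - 0))"
    using \<alpha> by (intro tendsto_intros i0 rlim) auto
   then show "(\<lambda>n. ln (1 / (1 - real (r n) / real n - 1 / real n))) \<longlonglongrightarrow> ln (1 / (1 - \<alpha>))" by simp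
   have "(\<lambda>n. real (r n) / real n + 1 / real n) \<longlonglongrightarrow> \<alpha> + 0" by (intro tendsto_add rlim i0)
   then have "eventually (\<lambda>n. real (r n) / real n + 1 / real n < 1) sequentially" using \<alpha> by (intro order_tendstoD) auto
   then have ev: "eventually (\<lambda>n. Suc (r n) < n \<and> 0 < n) sequentially" using eventually_gt_at_top[of 0]
   proof eventually_elim
    case (elim n)
    then have "(real (r n) + 1) / real n < 1" by (simp add: add_divide_distrib)
    then show ?case using elim by (simp add: divide_simps)
   qed
   show "eventually (\<lambda>n. ln ((1 + 1 / real n) / (1 - real (r n) / real n)) \<le> S n) sequentially" using ev
   proof eventually_elim
    case (elim n)
    have "(1 + 1 / real n) / (1 - real (r n) / real n) = (real n + 1) / (real n - real (Suc (r n)) + 1)"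
     using elim by (simp add: field_simps)
    then show ?case using sum_inverse_bounds(1)[of "Suc (r n)" n] elim unfolding S_def by simp
   qed
   show "eventually (\<lambda>n. S n \<le> ln (1 / (1 - real (r n) / real n - 1 / real n))) sequentially" using ev
   proof eventually_elim
    case (elim n)
    have "1 / (1 - real (r n) / real n - 1 / real n) = real n / (real n - real (Suc (r n)))"
    proof -
     have "1 - real (r n) / real n - 1 / real n = (real n - real (Suc (r n))) / real n"
      using elim by (simp add: diff_divide_distrib add_divide_distrib)
     then show ?thesis by simp
    qed
    then show ?case using sum_inverse_bounds(2)[of "Suc (r n)" n] elim unfolding S_def by simp
   qed
  qed
  define l where "l = ln (1 / (1 - \<alpha>))"
  define W1 where "W1 = 2 * l - 2 * ?\<gamma> * \<alpha>"
  have Wlim: "W \<longlonglongrightarrow> W1"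
  proof -
   have e: "(\<lambda>n. 2 * S n - (2 * ?\<gamma> * (real (r n) / real n) + 2 * ?\<gamma> * (1 / real n))) \<longlonglongrightarrow> 2 * l - (2 * ?\<gamma> * \<alpha> + 2 * ?\<gamma> * 0)"
    unfolding l_def by (intro tendsto_intros Slim rlim lim_1_over_n)
   have "(\<lambda>n. W n - (2 * S n - (2 * ?\<gamma> * (real (r n) / real n) + 2 * ?\<gamma> * (1 / real n)))) \<longlonglongrightarrow> 0"
   proof (rule Lim_null_comparison[OF _ C0])
    show "eventually (\<lambda>n. norm (W n - (2 * S n - (2 * ?\<gamma> * (real (r n) / real n) + 2 * ?\<gamma> * (1 / real n))))
      \<le> 16 * (4000 * D ^ 4 * (?K + 1)) / real n) sequentially"
     using Wap by eventually_elim (simp add: S_def add_divide_distrib distrib_left)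
   qed
   from tendsto_add[OF this e] show ?thesis by (simp add: W1_def)
  qed
  \<comment> \<open>Strictness of ln x < x - 1 for x different from 1 keeps the limiting variance
    positive even after \<alpha> is subtracted.\<close>
  have la: "\<alpha> < l"
  proof -
   have "ln (1 - \<alpha>) \<le> (1 - \<alpha>) - 1" using \<alpha> by (intro ln_le_minus_one) auto
   moreover have "ln (1 - \<alpha>) \<noteq> (1 - \<alpha>) - 1" using ln_eq_minus_one[of "1 - \<alpha>"] \<alpha> by auto
   ultimately show ?thesis using \<alpha> by (simp add: l_def ln_div)
  qed
  have "?\<gamma> * \<alpha> \<le> \<alpha>" using \<alpha> by (cases model) auto
  then have W1: "W1 > 0" using la by (simp add: W1_def)
  \<comment> \<open>\<open>W\<close> approximates the variance for the squared volume, so the volume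
    itself has half the limiting standard deviation.\<close>
  define s where "s = sqrt (1 / 2 * l - ?\<gamma> * \<alpha> / 2)"
  have "s = sqrt (W1 / 4)" by (simp add: s_def W1_def)
  then have s: "sqrt W1 = 2 * s" by (simp add: real_sqrt_divide)
  then have s0: "s > 0" using W1 by (metis mult_pos_pos real_sqrt_gt_zero zero_less_mult_pos zero_less_numeral)
  have sW: "(\<lambda>n. sqrt (W n)) \<longlonglongrightarrow> 2 * s" using tendsto_real_sqrt[OF Wlim] unfolding s .
  have target: "cdf (distr N borel (\<lambda>\<omega>. exp (s * Z \<omega>))) y = (if 0 < y then \<Phi> (ln y / s) else 0)" for y
  proof -
   have m: "(\<lambda>\<omega>. exp (s * Z \<omega>)) \<in> borel_measurable N" using Zm by measurable
   show ?thesis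
   proof (cases "0 < y")
    case True
    have "exp (s * z) \<le> y \<longleftrightarrow> z \<le> ln y / s" for z
     using ln_ge_iff[OF True, of "s * z"] s0 by (simp add: pos_le_divide_eq mult.commute)
    then have "cdf (distr N borel (\<lambda>\<omega>. exp (s * Z \<omega>))) y = cdf (distr N borel Z) (ln y / s)"
     unfolding cdf_distr[OF m] cdf_distr[OF Zm] by simp
    then show ?thesis using True by (simp add: Zlaw)
   next
    case False
    then have "\<not> exp (s * z) \<le> y" for z using exp_gt_zero[of "s * z"] by linarith
    then show ?thesis using False unfolding cdf_distr[OF m] by simp
   qed
  qed
  have "weak_conv_m (\<lambda>n. distr (M n) borel (\<lambda>\<omega>. V n \<omega> / A n)) (distr N borel (\<lambda>\<omega>. exp (s * Z \<omega>)))"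
   unfolding weak_conv_m_def weak_conv_def
  proof (intro allI impI)
   fix y :: real
   have cd: "cdf (distr (M n) borel (\<lambda>\<omega>. V n \<omega> / A n)) y = measure (M n) {w \<in> space (M n). V n w \<le> A n * y}" if "2 \<le> n" for n
    using Vm[OF that] A[of n] by (subst cdf_distr) (auto simp: pos_divide_le_eq mult.commute)
   show "(\<lambda>n. cdf (distr (M n) borel (\<lambda>\<omega>. V n \<omega> / A n)) y) \<longlonglongrightarrow> cdf (distr N borel (\<lambda>\<omega>. exp (s * Z \<omega>))) y"
   proof (cases "0 < y")
    case True
    have "(\<lambda>n. 2 * ln y / sqrt (W n)) \<longlonglongrightarrow> 2 * ln y / (2 * s)" using s0 by (intro tendsto_intros sW) auto
    then have "(\<lambda>n. 2 * ln y / sqrt (W n)) \<longlonglongrightarrow> ln y / s" by simp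
    from lim[OF this] have "(\<lambda>n. cdf (distr (M n) borel (\<lambda>\<omega>. V n \<omega> / A n)) y) \<longlonglongrightarrow> \<Phi> (ln y / s)"
    proof (rule Lim_transform_eventually)
     show "eventually (\<lambda>n. measure (M n) {w \<in> space (M n). simplex_volume n (r n) (\<lambda>i. X n i w) \<le> A n * exp (sqrt (W n) * (2 * ln y / sqrt (W n)) / 2)}
       = cdf (distr (M n) borel (\<lambda>\<omega>. V n \<omega> / A n)) y) sequentially" using eventually_ge_at_top[of 2]
     proof eventually_elim
      case (elim n)
      have "sqrt (W n) * (2 * ln y / sqrt (W n)) / 2 = ln y" using W[of n] by simp
      then have e: "exp (sqrt (W n) * (2 * ln y / sqrt (W n)) / 2) = y" using True by (simp only: exp_ln)
      show ?case unfolding e cd[OF elim] by (simp add: V)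
     qed
    qed
    then show ?thesis unfolding target using True by simp
   next
    case False
    interpret \<Phi>: real_distribution std_normal_distribution by (rule real_distribution_std_normal)
    \<comment> \<open>For y \<le> 0 compare with the positive thresholds A exp (sqrt W x / 2), whose
      limit \<Phi> x is as small as desired for x far to the left.\<close>
    have "(\<lambda>n. cdf (distr (M n) borel (\<lambda>\<omega>. V n \<omega> / A n)) y) \<longlonglongrightarrow> 0"
    proof (rule order_tendstoI)
     fix u :: real assume u: "0 < u"
     have "eventually (\<lambda>x. \<Phi> x < u) at_bot" by (rule order_tendstoD(2)[OF \<Phi>.cdf_lim_at_bot u])
     then obtain x where x: "\<Phi> x < u" by (auto simp: eventually_at_bot_linorder)
     from order_tendstoD(2)[OF lim[OF tendsto_const[of x]] x]
     show "eventually (\<lambda>n. cdf (distr (M n) borel (\<lambda>\<omega>. V n \<omega> / A n)) y < u) sequentially" using eventually_ge_at_top[of 2]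
     proof eventually_elim
      case (elim n)
      interpret p: prob_space "M n" using assms(3)[of n] min2 elim(2) by simp
      have "A n * y \<le> 0" using A[of n] False by (simp add: mult_nonneg_nonpos)
      also have "... \<le> A n * exp (sqrt (W n) * x / 2)" using A[of n] by simp
      finally have "cdf (distr (M n) borel (\<lambda>\<omega>. V n \<omega> / A n)) y \<le> measure (M n) {w \<in> space (M n). V n w \<le> A n * exp (sqrt (W n) * x / 2)}"
       unfolding cd[OF elim(2)] using Vm[OF elim(2)] by (intro p.finite_measure_mono) auto
      then show ?case using elim(1) by (simp add: V)
     qed
    next
     fix u :: real assume u: "u < 0"
     show "eventually (\<lambda>n. u < cdf (distr (M n) borel (\<lambda>\<omega>. V n \<omega> / A n)) y) sequentially"
      using eventually_ge_at_top[of 2] by eventually_elim (use u in \<open>simp add: cd less_le_trans[OF _ measure_nonneg]\<close>)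
    qed
    then show ?thesis unfolding target using False by simp
   qed
  qed
  then show ?thesis using A unfolding s_def l_def by blast
 qed
 have "(\<lambda>\<omega>. case model of Gaussian_model => exp (sqrt (1 / 2 * ln (1 / (1 - \<alpha>))) * Z \<omega>)
   | Beta_model \<nu> => exp (sqrt (1 / 2 * ln (1 / (1 - \<alpha>)) - \<alpha> / 2) * Z \<omega>)
   | Spherical_model => exp (sqrt (1 / 2 * ln (1 / (1 - \<alpha>)) - \<alpha> / 2) * Z \<omega>))
  = (\<lambda>\<omega>. exp (sqrt (1 / 2 * ln (1 / (1 - \<alpha>)) - ?\<gamma> * \<alpha> / 2) * Z \<omega>))" for \<alpha> by (cases model) simp_all
 then show ?thesis using part1 part2 by auto
qed

end
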